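(* Fix $n\ge 1$. Let $X^\bullet$ be an augmented cosimplicial space, equipped with a (continuous) map $$\langle f\rangle: X^{f^{-1}(1)}\times\cdots\times X^{f^{-1}(k)}\to X^T$$ for each $k\geq 1$, each finite totally ordered set $T$ and each function $f:T\to\{1,\ldots,k\}$ (not necessarily order-preserving or surjective) of complexity $\le n$, where $\langle f\rangle$ is the identity map when $k=1$. Suppose that the maps $\langle f\rangle$ are consistent with the cosimplicial operators, commutative, associative and unital (in the sense spelled out in the context). Then $\operatorname{Tot}(X^\bullet)$ is an $E_n$ space.
   Context: $\Delta_+$ is the category of finite totally ordered sets (including the empty set) and order-preserving maps. An augmented cosimplicial space is a functor $X^\bullet$ from $\Delta_+$ to spaces; its value at $T$ is written $X^T$, and the map induced by an order-preserving $\phi:T\to T'$ is written $\phi_*$. $\Delta^\bullet$ is the augmented cosimplicial space taking $T$ to $\Delta^T$, the simplex with vertex set $T$, with $\Delta^\emptyset=\emptyset$. $\operatorname{Tot}(X^\bullet)$ is the space $\operatorname{Hom}_{\Delta_+}(\Delta^\bullet,X^\bullet)$ of maps of augmented cosimplicial spaces (equivalently, the usual totalization of the restriction of $X^\bullet$ to nonempty finite totally ordered sets). Complexity. A function $f:T\to\{1,\ldots,k\}$ on a finite totally ordered set is the same as a finite sequence with values in $\{1,\ldots,k\}$. For a sequence with at most two distinct values its complexity is the number of times the sequence changes its value (e.g. $11222122112$ has complexity $5$). In general, the complexity of $f$ is the maximum, over all pairs $a\ne b$ in $\{1,\ldots,k\}$, of the complexity of the subsequence consisting of all entries equal to $a$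 or $b$ (and it is $0$ if $k=1$). Conditions on the maps $\langle f\rangle$. Consistent: for every order-preserving $\phi:T\to T'$ and functions $f:T\to\{1,\ldots,k\}$, $g:T'\to\{1,\ldots,k\}$ of complexity $\le n$ with $g\circ\phi=f$, one has $\phi_*\circ\langle f\rangle=\langle g\rangle\circ\big((\phi_1)_*\times\cdots\times(\phi_k)_*\big)$, where $\phi_i:f^{-1}(i)\to g^{-1}(i)$ is the restriction of $\phi$. Commutative: for every $f:T\to\{1,\ldots,k\}$ of complexity $\le n$ and every $\sigma\in\Sigma_k$, $\langle f\rangle(x_1,\ldots,x_k)=\langle\sigma\circ f\rangle(x_{\sigma^{-1}(1)},\ldots,x_{\sigma^{-1}(k)})$. Associative: let $\chi:\{1,\ldots,j\}\to\{1,\ldots,k\}$ be an order-preserving surjection, let $g:T\to\{1,\ldots,j\}$ be a function, and for $1\le i\le k$ let $g_i:(\chi\circ g)^{-1}(i)\to\chi^{-1}(i)\cong\{1,\ldots,j_i\}$ be the restriction of $g$ (the isomorphism being order-preserving). If $\chi\circ g$ and all the $g_i$ have complexity $\le n$ (in which case $g$ does too), then $\langle\chi\circ g\rangle\circ\big(\langle g_1\rangle\times\cdots\times\langle g_k\rangle\big)=\langle g\rangle$. Unital: there is an element $\varepsilon\in X^\emptyset$ such that, whenever $k\ge 2$, $1\le i\le k$, $f':T\to\{1,\ldots,k-1\}$ has complexity $\le n$, and $f=\lambda\circ f'$ where $\lambda:\{1,\ldots,k-1\}\to\{1,\ldots,k\}$ is the order-preserving injection whose image omits $i$, one has $\langle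 f\rangle(x_1,\ldots,x_{i-1},\varepsilon,x_{i+1},\ldots,x_k)=\langle f'\rangle(x_1,\ldots,x_{i-1},x_{i+1},\ldots,x_k)$. Operads. An operad is a (symmetric) operad in topological spaces in the sense of May (spaces $\mathcal O(k)$, $k\geq 0$, with right $\Sigma_k$-actions, unit $1\in\mathcal O(1)$ and associative, unital, equivariant composition maps $\gamma$; $\mathcal O(0)$ need not be a point). A morphism of operads is a weak equivalence if it is a weak equivalence of spaces for each $k$; two operads are weakly equivalent if they are connected by a zig-zag of weak equivalences of operads. The little $n$-cubes operad $\mathcal C_n$: a TD-map $I^n\to I^n$, $I=[0,1]$, is a map $(t_1,\ldots,t_n)\mapsto(a_1+bt_1,\ldots,a_n+bt_n)$ with $a_i\ge0$, $b>0$, $a_i+b\le1$; $\mathcal C_n(k)$ is the space of $k$-tuples of TD-maps whose images have disjoint interiors; $\Sigma_k$ permutes the entries, and $\gamma\big((\kappa_i),(\lambda_{1l}),\ldots,(\lambda_{kl})\big)=(\kappa_i\circ\lambda_{il})_{i,l}$. An $E_n$ operad is an operad weakly equivalent to $\mathcal C_n$. An $E_n$ space is a space with an action of an $E_n$ operad. *)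

theory Defs
  imports "HOL-Analysis.Analysis" "HOL-Combinatorics.Permutations"
begin

section \<open>Mapping spaces and weak equivalences\<close>

text \<open>Points of mapping spaces are continuous maps, made unique by extensionality.\<close>

definition compact_open :: "'a topology \<Rightarrow> 'b topology \<Rightarrow> ('a \<Rightarrow> 'b) topology" where
  "compact_open X Y = topology_generated_by
     {{f \<in> extensional (topspace X). continuous_map X Y f \<and> f ` K \<subseteq> U} | K U.
        compactin X K \<and> openin Y U}"

definition unit_cube :: "nat \<Rightarrow> (nat \<Rightarrow> real) topology" where
  "unit_cube q = product_topology (\<lambda>_. top_of_set {0..1}) {1..q}"

definition unit_cube_boundary :: "nat \<Rightarrow> (nat \<Rightarrow> real) set" where
  "unit_cube_boundary q = {t \<in> topspace (unit_cube q). \<exists>i\<in>{1..q}. t i = 0 \<or> t i = 1}"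

definition spheroids :: "nat \<Rightarrow> 'a topology \<Rightarrow> 'a \<Rightarrow> ((nat \<Rightarrow> real) \<Rightarrow> 'a) set" where
  "spheroids q X x = {g. continuous_map (unit_cube q) X g \<and> (\<forall>t\<in>unit_cube_boundary q. g t = x)}"

definition spheroid_homotopy ::
  "nat \<Rightarrow> 'a topology \<Rightarrow> 'a \<Rightarrow> ((nat \<Rightarrow> real) \<Rightarrow> 'a) rel" where
  "spheroid_homotopy q X x = {(g, h). g \<in> spheroids q X x \<and> h \<in> spheroids q X x \<and>
     homotopic_with (\<lambda>u. \<forall>t\<in>unit_cube_boundary q. u t = x) (unit_cube q) X g h}"

definition homotopy_group :: "nat \<Rightarrow> 'a topology \<Rightarrow> 'a \<Rightarrow> ((nat \<Rightarrow> real) \<Rightarrow> 'a) set set" where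
  "homotopy_group q X x = spheroids q X x // spheroid_homotopy q X x"

definition homotopy_group_map ::
  "nat \<Rightarrow> 'b topology \<Rightarrow> 'b \<Rightarrow> ('a \<Rightarrow> 'b) \<Rightarrow>
     ((nat \<Rightarrow> real) \<Rightarrow> 'a) set \<Rightarrow> ((nat \<Rightarrow> real) \<Rightarrow> 'b) set" where
  "homotopy_group_map q Y y f c = spheroid_homotopy q Y y `` ((\<lambda>g. f \<circ> g) ` c)"

text \<open>The map induced on homotopy groups is always a homomorphism, so being an isomorphism is
  being bijective; the group structure itself is not needed.\<close>

definition weak_homotopy_equivalence :: "'a topology \<Rightarrow> 'b topology \<Rightarrow> ('a \<Rightarrow> 'b) \<Rightarrow> bool" where
  "weak_homotopy_equivalence X Y f \<longleftrightarrow>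
     continuous_map X Y f \<and>
     bij_betw (\<lambda>C. \<Union>x\<in>C. path_component_of_set Y (f x))
       (path_components_of X) (path_components_of Y) \<and>
     (\<forall>q\<ge>1. \<forall>x\<in>topspace X.
        bij_betw (homotopy_group_map q Y (f x) f) (homotopy_group q X x) (homotopy_group q Y (f x)))"

section \<open>Operads in topological spaces\<close>

text \<open>For arities \<open>j 1, j 2, \<dots>\<close> the \<open>l\<close>-th letter of the \<open>i\<close>-th block has position
  \<open>block_index j i l\<close> in the concatenation of the blocks; \<open>block_num\<close> and \<open>block_pos\<close> recover
  \<open>i\<close> and \<open>l\<close> from a position. All positions are counted from 1.\<close>

definition block_index :: "(nat \<Rightarrow> nat) \<Rightarrow> nat \<Rightarrow> nat \<Rightarrow> nat" where
  "block_index j i l = sum j {1..<i} + l"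

definition block_num :: "(nat \<Rightarrow> nat) \<Rightarrow> nat \<Rightarrow> nat" where
  "block_num j t = (LEAST i. t \<le> sum j {1..i})"

definition block_pos :: "(nat \<Rightarrow> nat) \<Rightarrow> nat \<Rightarrow> nat" where
  "block_pos j t = t - sum j {1..<block_num j t}"

text \<open>The block permutation \<open>\<sigma>(j\<^sub>1,\<dots>,j\<^sub>k)\<close> and the direct sum \<open>\<tau>\<^sub>1 \<oplus> \<dots> \<oplus> \<tau>\<^sub>k\<close>.\<close>

definition block_perm :: "nat \<Rightarrow> (nat \<Rightarrow> nat) \<Rightarrow> (nat \<Rightarrow> nat) \<Rightarrow> nat \<Rightarrow> nat" where
  "block_perm k j \<sigma> t = (if t \<in> {1..sum j {1..k}}
     then block_index (j \<circ> inv \<sigma>) (\<sigma> (block_num j t)) (block_pos j t) else t)"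

definition block_sum :: "nat \<Rightarrow> (nat \<Rightarrow> nat) \<Rightarrow> (nat \<Rightarrow> nat \<Rightarrow> nat) \<Rightarrow> nat \<Rightarrow> nat" where
  "block_sum k j \<tau> t = (if t \<in> {1..sum j {1..k}}
     then block_index j (block_num j t) (\<tau> (block_num j t) (block_pos j t)) else t)"

text \<open>\<open>opd_act P k c \<sigma>\<close> is \<open>c\<sigma>\<close>, and \<open>opd_comp P k j c d\<close> is \<open>\<gamma>(c; d 1, \<dots>, d k)\<close> for
  \<open>c\<close> of arity \<open>k\<close> and \<open>d i\<close> of arity \<open>j i\<close>.\<close>

record 'o operad =
  opd_space :: "nat \<Rightarrow> 'o topology"
  opd_act :: "nat \<Rightarrow> 'o \<Rightarrow> (nat \<Rightarrow> nat) \<Rightarrow> 'o"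
  opd_unit :: 'o
  opd_comp :: "nat \<Rightarrow> (nat \<Rightarrow> nat) \<Rightarrow> 'o \<Rightarrow> (nat \<Rightarrow> 'o) \<Rightarrow> 'o"

definition opd_inputs :: "'o operad \<Rightarrow> nat \<Rightarrow> (nat \<Rightarrow> nat) \<Rightarrow> (nat \<Rightarrow> 'o) topology" where
  "opd_inputs P k j = product_topology (\<lambda>i. opd_space P (j i)) {1..k}"

definition topological_operad :: "'o operad \<Rightarrow> bool" where
  "topological_operad P \<longleftrightarrow>
     (\<forall>k \<sigma>. \<sigma> permutes {1..k} \<longrightarrow>
        continuous_map (opd_space P k) (opd_space P k) (\<lambda>c. opd_act P k c \<sigma>)) \<and>
     (\<forall>k. \<forall>c\<in>topspace (opd_space P k). opd_act P k c id = c) \<and>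
     (\<forall>k \<sigma> \<tau>. \<sigma> permutes {1..k} \<longrightarrow> \<tau> permutes {1..k} \<longrightarrow>
        (\<forall>c\<in>topspace (opd_space P k).
           opd_act P k (opd_act P k c \<sigma>) \<tau> = opd_act P k c (\<sigma> \<circ> \<tau>))) \<and>
     (\<forall>k j. continuous_map (prod_topology (opd_space P k) (opd_inputs P k j))
        (opd_space P (sum j {1..k})) (\<lambda>(c, d). opd_comp P k j c d)) \<and>
     \<comment> \<open>of \<open>j\<close>, only the values \<open>j 1, \<dots>, j k\<close> may matter\<close>
     (\<forall>k j j'. (\<forall>i\<in>{1..k}. j i = j' i) \<longrightarrow>
        (\<forall>c\<in>topspace (opd_space P k). \<forall>d\<in>topspace (opd_inputs P k j).
           opd_comp P k j c d = opd_comp P k j' c d)) \<and>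
     (\<forall>k j m. \<forall>c\<in>topspace (opd_space P k). \<forall>d\<in>topspace (opd_inputs P k j).
        \<forall>e\<in>topspace (opd_inputs P (sum j {1..k}) m).
          opd_comp P (sum j {1..k}) m (opd_comp P k j c d) e =
          opd_comp P k (\<lambda>s. \<Sum>l=1..j s. m (block_index j s l)) c
            (\<lambda>s\<in>{1..k}. opd_comp P (j s) (\<lambda>l. m (block_index j s l)) (d s)
               (\<lambda>l\<in>{1..j s}. e (block_index j s l)))) \<and>
     opd_unit P \<in> topspace (opd_space P 1) \<and>
     (\<forall>m. \<forall>d\<in>topspace (opd_space P m).
        opd_comp P 1 (\<lambda>_. m) (opd_unit P) (\<lambda>i\<in>{1}. d) = d) \<and>
     (\<forall>k. \<forall>c\<in>topspace (opd_space P k).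
        opd_comp P k (\<lambda>_. 1) c (\<lambda>i\<in>{1..k}. opd_unit P) = c) \<and>
     (\<forall>k j \<sigma>. \<sigma> permutes {1..k} \<longrightarrow>
        (\<forall>c\<in>topspace (opd_space P k). \<forall>d\<in>topspace (opd_inputs P k j).
           opd_comp P k j (opd_act P k c \<sigma>) d =
           opd_act P (sum j {1..k})
             (opd_comp P k (j \<circ> inv \<sigma>) c (\<lambda>i\<in>{1..k}. d (inv \<sigma> i))) (block_perm k j \<sigma>))) \<and>
     (\<forall>k j \<tau>. (\<forall>i\<in>{1..k}. \<tau> i permutes {1..j i}) \<longrightarrow>
        (\<forall>c\<in>topspace (opd_space P k). \<forall>d\<in>topspace (opd_inputs P k j).
           opd_comp P k j c (\<lambda>i\<in>{1..k}. opd_act P (j i) (d i) (\<tau> i)) =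
           opd_act P (sum j {1..k}) (opd_comp P k j c d) (block_sum k j \<tau>)))"

definition operad_morphism :: "'o operad \<Rightarrow> 'p operad \<Rightarrow> (nat \<Rightarrow> 'o \<Rightarrow> 'p) \<Rightarrow> bool" where
  "operad_morphism P Q F \<longleftrightarrow>
     (\<forall>k. continuous_map (opd_space P k) (opd_space Q k) (F k)) \<and>
     (\<forall>k \<sigma>. \<sigma> permutes {1..k} \<longrightarrow> (\<forall>c\<in>topspace (opd_space P k).
        F k (opd_act P k c \<sigma>) = opd_act Q k (F k c) \<sigma>)) \<and>
     F 1 (opd_unit P) = opd_unit Q \<and>
     (\<forall>k j. \<forall>c\<in>topspace (opd_space P k). \<forall>d\<in>topspace (opd_inputs P k j).
        F (sum j {1..k}) (opd_comp P k j c d) =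
        opd_comp Q k j (F k c) (\<lambda>i\<in>{1..k}. F (j i) (d i)))"

definition operad_weak_equivalence :: "'o operad \<Rightarrow> 'p operad \<Rightarrow> (nat \<Rightarrow> 'o \<Rightarrow> 'p) \<Rightarrow> bool" where
  "operad_weak_equivalence P Q F \<longleftrightarrow> operad_morphism P Q F \<and>
     (\<forall>k. weak_homotopy_equivalence (opd_space P k) (opd_space Q k) (F k))"

definition weakly_equivalent_operads :: "'o operad \<Rightarrow> 'o operad \<Rightarrow> bool" where
  "weakly_equivalent_operads = equivclp (\<lambda>P Q. topological_operad P \<and> topological_operad Q \<and>
     (\<exists>F. operad_weak_equivalence P Q F))"

text \<open>\<open>\<theta> k c y\<close> is \<open>\<theta>\<^sub>k(c; y 1, \<dots>, y k)\<close>.\<close>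

definition operad_action ::
  "'o operad \<Rightarrow> 'y topology \<Rightarrow> (nat \<Rightarrow> 'o \<Rightarrow> (nat \<Rightarrow> 'y) \<Rightarrow> 'y) \<Rightarrow> bool" where
  "operad_action P Y \<theta> \<longleftrightarrow>
     (\<forall>k. continuous_map (prod_topology (opd_space P k) (product_topology (\<lambda>_. Y) {1..k})) Y
        (\<lambda>(c, y). \<theta> k c y)) \<and>
     (\<forall>k j. \<forall>c\<in>topspace (opd_space P k). \<forall>d\<in>topspace (opd_inputs P k j).
        \<forall>y\<in>topspace (product_topology (\<lambda>_. Y) {1..sum j {1..k}}).
          \<theta> (sum j {1..k}) (opd_comp P k j c d) y =
          \<theta> k c (\<lambda>i\<in>{1..k}. \<theta> (j i) (d i) (\<lambda>l\<in>{1..j i}. y (block_index j i l)))) \<and>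
     (\<forall>y\<in>topspace Y. \<theta> 1 (opd_unit P) (\<lambda>i\<in>{1}. y) = y) \<and>
     (\<forall>k \<sigma>. \<sigma> permutes {1..k} \<longrightarrow> (\<forall>c\<in>topspace (opd_space P k).
        \<forall>y\<in>topspace (product_topology (\<lambda>_. Y) {1..k}).
          \<theta> k (opd_act P k c \<sigma>) y = \<theta> k c (\<lambda>i\<in>{1..k}. y (inv \<sigma> i))))"

section \<open>Little cubes and \<open>E\<^sub>n\<close> spaces\<close>

definition TD_map :: "nat \<Rightarrow> ((nat \<Rightarrow> real) \<Rightarrow> nat \<Rightarrow> real) \<Rightarrow> bool" where
  "TD_map n h \<longleftrightarrow> (\<exists>a b. b > 0 \<and> (\<forall>i\<in>{1..n}. 0 \<le> a i \<and> a i + b \<le> 1) \<and>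
     h = (\<lambda>t\<in>topspace (unit_cube n). \<lambda>i\<in>{1..n}. a i + b * t i))"

type_synonym cube_tuple = "nat \<Rightarrow> (nat \<Rightarrow> real) \<Rightarrow> nat \<Rightarrow> real"

definition little_cubes_space :: "nat \<Rightarrow> nat \<Rightarrow> cube_tuple topology" where
  "little_cubes_space n k =
     subtopology (product_topology (\<lambda>_. compact_open (unit_cube n) (unit_cube n)) {1..k})
       {c. (\<forall>i\<in>{1..k}. TD_map n (c i)) \<and>
           (\<forall>i\<in>{1..k}. \<forall>i'\<in>{1..k}. i \<noteq> i' \<longrightarrow>
              disjnt (product_topology (\<lambda>_. euclideanreal) {1..n} interior_of
                        (c i ` topspace (unit_cube n)))
                     (product_topology (\<lambda>_. euclideanreal) {1..n} interior_of
                        (c i' ` topspace (unit_cube n))))}"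

definition little_cubes :: "nat \<Rightarrow> cube_tuple operad" where
  "little_cubes n = \<lparr>
     opd_space = little_cubes_space n,
     opd_act = (\<lambda>k c \<sigma>. \<lambda>i\<in>{1..k}. c (\<sigma> i)),
     opd_unit = (\<lambda>i\<in>{1}. \<lambda>t\<in>topspace (unit_cube n). t),
     opd_comp = (\<lambda>k j c d. \<lambda>t\<in>{1..sum j {1..k}}.
        compose (topspace (unit_cube n)) (c (block_num j t)) (d (block_num j t) (block_pos j t)))\<rparr>"

text \<open>HOL has no quantification over types, so the operads in the definition of an \<open>E\<^sub>n\<close> space
  and in the zig-zags have their points in one fixed type, that of the points of the little cubes
  operads. It has \<open>2\<close> to the continuum many elements.\<close>

definition E_operad :: "nat \<Rightarrow> cube_tuple operad \<Rightarrow> bool" where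
  "E_operad n P \<longleftrightarrow> topological_operad P \<and> weakly_equivalent_operads P (little_cubes n)"

definition E_space :: "nat \<Rightarrow> 'y topology \<Rightarrow> bool" where
  "E_space n Y \<longleftrightarrow> (\<exists>P \<theta>. E_operad n P \<and> operad_action P Y \<theta>)"

section \<open>Augmented cosimplicial spaces\<close>

text \<open>The category of finite totally ordered sets is represented by its equivalent full
  subcategory of finite sets of natural numbers, which is closed under passing to subsets and so
  contains the fibres \<open>f\<^sup>-\<^sup>1(i)\<close> of functions on its objects.\<close>

definition ord_hom :: "nat set \<Rightarrow> nat set \<Rightarrow> (nat \<Rightarrow> nat) set" where
  "ord_hom T T' = {\<phi> \<in> T \<rightarrow>\<^sub>E T'. mono_on T \<phi>}"

record 'a cosimplicial =
  cos_space :: "nat set \<Rightarrow> 'a topology"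
  cos_map :: "nat set \<Rightarrow> nat set \<Rightarrow> (nat \<Rightarrow> nat) \<Rightarrow> 'a \<Rightarrow> 'a"

definition augmented_cosimplicial_space :: "'a cosimplicial \<Rightarrow> bool" where
  "augmented_cosimplicial_space X \<longleftrightarrow>
     (\<forall>T T' \<phi>. finite T \<longrightarrow> finite T' \<longrightarrow> \<phi> \<in> ord_hom T T' \<longrightarrow>
        continuous_map (cos_space X T) (cos_space X T') (cos_map X T T' \<phi>)) \<and>
     (\<forall>T. finite T \<longrightarrow> (\<forall>x\<in>topspace (cos_space X T). cos_map X T T (\<lambda>t\<in>T. t) x = x)) \<and>
     (\<forall>T T' T'' \<phi> \<psi>. finite T \<longrightarrow> finite T' \<longrightarrow> finite T'' \<longrightarrow>
        \<phi> \<in> ord_hom T T' \<longrightarrow> \<psi> \<in> ord_hom T' T'' \<longrightarrow>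
        (\<forall>x\<in>topspace (cos_space X T).
           cos_map X T T'' (compose T \<psi> \<phi>) x = cos_map X T' T'' \<psi> (cos_map X T T' \<phi> x)))"

text \<open>Barycentric coordinates, extended by zero outside the vertex set; in particular
  \<open>simplex_on {..p}\<close> has the points of the library's standard simplex of dimension \<open>p\<close>, and
  \<open>simplex_on {}\<close> is empty.\<close>

definition simplex_on :: "nat set \<Rightarrow> (nat \<Rightarrow> real) topology" where
  "simplex_on T = subtopology (powertop_real UNIV)
     {u. (\<forall>t. 0 \<le> u t) \<and> (\<forall>t. t \<notin> T \<longrightarrow> u t = 0) \<and> sum u T = 1}"

definition simplex_push :: "nat set \<Rightarrow> (nat \<Rightarrow> nat) \<Rightarrow> (nat \<Rightarrow> real) \<Rightarrow> nat \<Rightarrow> real" where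
  "simplex_push T \<phi> u s = sum u {t \<in> T. \<phi> t = s}"

definition Tot :: "'a cosimplicial \<Rightarrow> (nat set \<Rightarrow> (nat \<Rightarrow> real) \<Rightarrow> 'a) topology" where
  "Tot X = subtopology
     (product_topology (\<lambda>T. compact_open (simplex_on T) (cos_space X T)) {T. finite T})
     {\<alpha>. \<forall>T T' \<phi>. finite T \<longrightarrow> finite T' \<longrightarrow> \<phi> \<in> ord_hom T T' \<longrightarrow>
        (\<forall>u\<in>topspace (simplex_on T).
           \<alpha> T' (simplex_push T \<phi> u) = cos_map X T T' \<phi> (\<alpha> T u))}"

section \<open>Complexity and the structure maps\<close>

definition changes :: "nat list \<Rightarrow> nat" where
  "changes xs = card {p. Suc p < length xs \<and> xs ! p \<noteq> xs ! Suc p}"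

text \<open>The additional \<open>0\<close> only matters if there are no pairs \<open>a \<noteq> b\<close>.\<close>

definition complexity :: "nat \<Rightarrow> nat set \<Rightarrow> (nat \<Rightarrow> nat) \<Rightarrow> nat" where
  "complexity k T f = Max (insert 0
     {changes (filter (\<lambda>v. v = a \<or> v = b) (map f (sorted_list_of_set T))) | a b.
        a \<in> {1..k} \<and> b \<in> {1..k} \<and> a \<noteq> b})"

definition admissible :: "nat \<Rightarrow> nat \<Rightarrow> nat set \<Rightarrow> (nat \<Rightarrow> nat) \<Rightarrow> bool" where
  "admissible n k T f \<longleftrightarrow> finite T \<and> f \<in> T \<rightarrow>\<^sub>E {1..k} \<and> complexity k T f \<le> n"

definition fibre :: "nat set \<Rightarrow> (nat \<Rightarrow> nat) \<Rightarrow> nat \<Rightarrow> nat set" where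
  "fibre T f i = {t \<in> T. f t = i}"

definition fibre_product ::
  "'a cosimplicial \<Rightarrow> nat \<Rightarrow> nat set \<Rightarrow> (nat \<Rightarrow> nat) \<Rightarrow> (nat \<Rightarrow> 'a) topology" where
  "fibre_product X k T f = product_topology (\<lambda>i. cos_space X (fibre T f i)) {1..k}"

text \<open>A family \<open>B\<close> of structure maps: \<open>B k T f\<close> is \<open>\<langle>f\<rangle>\<close> for \<open>f : T \<rightarrow> {1,\<dots>,k}\<close>.\<close>

type_synonym 'a brackets = "nat \<Rightarrow> nat set \<Rightarrow> (nat \<Rightarrow> nat) \<Rightarrow> (nat \<Rightarrow> 'a) \<Rightarrow> 'a"

definition brackets_continuous :: "nat \<Rightarrow> 'a cosimplicial \<Rightarrow> 'a brackets \<Rightarrow> bool" where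
  "brackets_continuous n X B \<longleftrightarrow> (\<forall>k\<ge>1. \<forall>T f. admissible n k T f \<longrightarrow>
     continuous_map (fibre_product X k T f) (cos_space X T) (B k T f))"

definition brackets_identity :: "nat \<Rightarrow> 'a cosimplicial \<Rightarrow> 'a brackets \<Rightarrow> bool" where
  "brackets_identity n X B \<longleftrightarrow> (\<forall>T f. admissible n 1 T f \<longrightarrow>
     (\<forall>x\<in>topspace (fibre_product X 1 T f). B 1 T f x = x 1))"

definition brackets_consistent :: "nat \<Rightarrow> 'a cosimplicial \<Rightarrow> 'a brackets \<Rightarrow> bool" where
  "brackets_consistent n X B \<longleftrightarrow> (\<forall>k\<ge>1. \<forall>T T' f g. \<forall>\<phi>\<in>ord_hom T T'.
     admissible n k T f \<longrightarrow> admissible n k T' g \<longrightarrow> compose T g \<phi> = f \<longrightarrow>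
     (\<forall>x\<in>topspace (fibre_product X k T f).
        cos_map X T T' \<phi> (B k T f x) =
        B k T' g (\<lambda>i\<in>{1..k}.
          cos_map X (fibre T f i) (fibre T' g i) (restrict \<phi> (fibre T f i)) (x i))))"

definition brackets_commutative :: "nat \<Rightarrow> 'a cosimplicial \<Rightarrow> 'a brackets \<Rightarrow> bool" where
  "brackets_commutative n X B \<longleftrightarrow> (\<forall>k\<ge>1. \<forall>T f \<sigma>. admissible n k T f \<longrightarrow> \<sigma> permutes {1..k} \<longrightarrow>
     (\<forall>x\<in>topspace (fibre_product X k T f).
        B k T f x = B k T (compose T \<sigma> f) (\<lambda>i\<in>{1..k}. x (inv \<sigma> i))))"

text \<open>As \<open>\<xi>\<close> is monotone, its fibre over \<open>i\<close> is an interval, namely \<open>{1..card (fibre {1..j} \<xi> i)}\<close>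
  shifted by \<open>fibre_offset j \<xi> i\<close>. Hence subtracting the offset is the order isomorphism of this
  fibre with an initial segment.\<close>

definition fibre_offset :: "nat \<Rightarrow> (nat \<Rightarrow> nat) \<Rightarrow> nat \<Rightarrow> nat" where
  "fibre_offset j \<xi> i = card {m \<in> {1..j}. \<xi> m < i}"

definition fibre_restriction ::
  "nat \<Rightarrow> (nat \<Rightarrow> nat) \<Rightarrow> nat set \<Rightarrow> (nat \<Rightarrow> nat) \<Rightarrow> nat \<Rightarrow> nat \<Rightarrow> nat" where
  "fibre_restriction j \<xi> T g i =
     (\<lambda>t\<in>fibre T (compose T \<xi> g) i. g t - fibre_offset j \<xi> i)"

definition brackets_associative :: "nat \<Rightarrow> 'a cosimplicial \<Rightarrow> 'a brackets \<Rightarrow> bool" where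
  "brackets_associative n X B \<longleftrightarrow> (\<forall>k\<ge>1. \<forall>j T g. \<forall>\<xi>\<in>ord_hom {1..j} {1..k}.
     \<xi> ` {1..j} = {1..k} \<longrightarrow> g \<in> T \<rightarrow>\<^sub>E {1..j} \<longrightarrow>
     admissible n k T (compose T \<xi> g) \<longrightarrow>
     (\<forall>i\<in>{1..k}. admissible n (card (fibre {1..j} \<xi> i)) (fibre T (compose T \<xi> g) i)
        (fibre_restriction j \<xi> T g i)) \<longrightarrow>
     (\<forall>x\<in>topspace (fibre_product X j T g).
        B k T (compose T \<xi> g) (\<lambda>i\<in>{1..k}.
          B (card (fibre {1..j} \<xi> i)) (fibre T (compose T \<xi> g) i) (fibre_restriction j \<xi> T g i)
            (\<lambda>l\<in>{1..card (fibre {1..j} \<xi> i)}. x (fibre_offset j \<xi> i + l))) =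
        B j T g x))"

definition brackets_unital :: "nat \<Rightarrow> 'a cosimplicial \<Rightarrow> 'a brackets \<Rightarrow> bool" where
  "brackets_unital n X B \<longleftrightarrow> (\<exists>\<epsilon>\<in>topspace (cos_space X {}).
     \<forall>k\<ge>2. \<forall>i\<in>{1..k}. \<forall>T f'. admissible n (k - 1) T f' \<longrightarrow>
       (\<forall>x\<in>topspace (fibre_product X (k - 1) T f').
          B k T (compose T (\<lambda>m. if m < i then m else m + 1) f')
            (\<lambda>m\<in>{1..k}. if m < i then x m else if m = i then \<epsilon> else x (m - 1)) =
          B (k - 1) T f' x))"

end

theory Submission
  imports Defs
begin

text \<open>The acting operad consists of little cubes decorated with progress functions: monotone maps
  from the unit interval onto itself saying how much of each input has been consumed at a given
  time. Two cubes separated in the direction \<open>m\<close> must consume in at most \<open>m + 1\<close> alternating time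
  intervals. Such a tuple of progress functions, together with a point of a simplex read as a
  partition of the unit interval, is presented by a sequence of complexity at most \<open>n\<close> and a point
  in the simplex on each of its fibres; applying the map \<open>\<langle>f\<rangle>\<close> of that sequence gives the action on
  the totalization. Common refinement and consistency show that the value does not depend on the
  presentation, and compactness of the space of presentations gives continuity.

  Forgetting the progress functions is a weak equivalence: after shrinking the cubes by a factor
  \<open>\<delta>\<close> there is room, at a scale where no two coordinates differ by a critical amount, to consume all
  inputs one after the other in an order read off from the centres, and inserting this at the
  beginning of the time contracts the fibres relative to the boundary. Ranging over more scales than
  there are coordinate differences makes the choice of the scale continuous.\<close>


text \<open>Two cubes that are separated in direction 1 must be consumed strictly one after the
  other, and the directions separating different pairs can form a cycle: 1 before 2, 2 before 3, 3
  before 1. So no order of processing can simply be read off from the separations, which is the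
  obstacle to contracting the choices of progress functions. The way out is
  \<open>cell_mono\<close>: a bound \<open>m\<close> on alternation implies every strictly larger
  bound with either input first. It is therefore harmless to order a pair by a coordinate later than
  the one that separates it, and deciding by the last far coordinate imposes no condition that the
  separating direction does not already give. This deciding coordinate may separate the centres by
  far less than the size of the cubes, so the cubes must be shrunk before the order is used. Arity 0
  is part of the operad. It acts through the unit \<epsilon>, and composites with empty blocks are
  reduced to the associativity axiom by the unit axiom. The fixed type of operad points in
  \<open>E_operad\<close> is met by coding a cube and its progress function as one function.\<close>

declare One_nat_def [simp del]

section \<open>Blocks\<close>

lemma sum_split_at:
  fixes j :: "nat \<Rightarrow> nat"
  assumes "1 \<le> i"
  shows "sum j {1..i} = sum j {1..<i} + j i"
proof -
  have "{1..i} = insert i {1..<i}" using assms by auto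
  then show ?thesis by simp
qed

lemma sum_mono_upto:
  fixes j :: "nat \<Rightarrow> nat"
  assumes "i \<le> k"
  shows "sum j {1..i} \<le> sum j {1..k}"
  using assms by (intro sum_mono2) auto

lemma block_num_index:
  assumes "1 \<le> i" "1 \<le> l" "l \<le> j i"
  shows "block_num j (block_index j i l) = i"
  unfolding block_num_def
proof (rule Least_equality)
  show "block_index j i l \<le> sum j {1..i}"
    using assms sum_split_at[of i j] by (simp add: block_index_def)
next
  fix i' assume a: "block_index j i l \<le> sum j {1..i'}"
  show "i \<le> i'"
  proof (rule ccontr)
    assume "\<not> i \<le> i'"
    then have "sum j {1..i'} \<le> sum j {1..<i}" by (intro sum_mono2) auto
    with a assms show False by (simp add: block_index_def)
  qed
qed

lemma block_pos_index:
  assumes "1 \<le> i" "1 \<le> l" "l \<le> j i"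
  shows "block_pos j (block_index j i l) = l"
  using block_num_index[of i l j] assms by (simp add: block_pos_def block_index_def)

lemma block_index_bounds:
  assumes "i \<in> {1..k}" "l \<in> {1..j i}"
  shows "block_index j i l \<in> {1..sum j {1..k}}"
proof -
  have "sum j {1..<i} + l \<le> sum j {1..i}" using assms sum_split_at[of i j] by simp
  also have "\<dots> \<le> sum j {1..k}" using assms by (intro sum_mono_upto) auto
  finally show ?thesis using assms by (simp add: block_index_def)
qed

lemma block_cases:
  assumes "t \<in> {1..sum j {1..k}}"
  obtains i l where "i \<in> {1..k}" "l \<in> {1..j i}" "t = block_index j i l"
proof -
  define i where "i = (LEAST i. t \<le> sum j {1..i})"
  have le: "t \<le> sum j {1..i}" unfolding i_def by (rule LeastI[of _ k]) (use assms in auto)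
  have ik: "i \<le> k" unfolding i_def by (rule Least_le) (use assms in auto)
  have i1: "1 \<le> i" using le assms by (cases i) auto
  have "\<not> t \<le> sum j {1..i-1}" using i1 unfolding i_def by (intro not_less_Least) auto
  moreover have "{1..i-1} = {1..<i}" using i1 by auto
  ultimately have gt: "sum j {1..<i} < t" by simp
  show thesis
    by (rule that[of i "t - sum j {1..<i}"])
      (use gt le ik i1 sum_split_at[of i j] in \<open>auto simp: block_index_def\<close>)
qed

lemma block_index_inject:
  assumes "i \<in> {1..k}" "l \<in> {1..j i}" "i' \<in> {1..k}" "l' \<in> {1..j i'}"
    and "block_index j i l = block_index j i' l'"
  shows "i = i' \<and> l = l'"
  using assms by (metis atLeastAtMost_iff block_num_index block_pos_index)

lemma block_num_pos_bounds:
  assumes "t \<in> {1..sum j {1..k}}"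
  shows "block_num j t \<in> {1..k}" "block_pos j t \<in> {1..j (block_num j t)}"
    "block_index j (block_num j t) (block_pos j t) = t"
  using block_cases[OF assms] block_num_index block_pos_index by (metis atLeastAtMost_iff)+

lemma sum_block_index:
  fixes m :: "nat \<Rightarrow> nat"
  shows "(\<Sum>t=1..sum j {1..k}. m t) = (\<Sum>s=1..k. \<Sum>l=1..j s. m (block_index j s l))"
proof -
  have "(\<Sum>s=1..k. \<Sum>l=1..j s. m (block_index j s l)) =
    (\<Sum>(s,l)\<in>(SIGMA s:{1..k}. {1..j s}). m (block_index j s l))"
    by (rule sum.Sigma) auto
  also have "\<dots> = (\<Sum>t=1..sum j {1..k}. m t)"
    by (rule sum.reindex_bij_witness[of _ "\<lambda>t. (block_num j t, block_pos j t)"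
          "\<lambda>(s,l). block_index j s l"])
      (use block_num_pos_bounds[of _ j k] block_index_bounds[of _ k _ j]
        in \<open>auto simp: block_num_index block_pos_index\<close>)
  finally show ?thesis by simp
qed

text \<open>The letters before the \<open>l\<close>-th one of block \<open>s\<close> are those of
  the complete earlier blocks and the first \<open>l - 1\<close> letters of block \<open>s\<close>
  itself; summing \<open>m\<close> over the two groups gives the two-stage position. This is the
  bookkeeping behind associativity of operadic composition.\<close>

lemma block_index_assoc:
  assumes "s \<in> {1..k}" "l \<in> {1..j s}"
  shows "block_index m (block_index j s l) q =
    block_index (\<lambda>s. \<Sum>l=1..j s. m (block_index j s l)) s
      (block_index (\<lambda>l. m (block_index j s l)) l q)"
proof -
  have "{1..<block_index j s l} = {1..sum j {1..<s}} \<union> (\<lambda>l. block_index j s l) ` {1..<l}"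
  proof (intro set_eqI iffI)
    fix x assume x: "x \<in> {1..<block_index j s l}"
    show "x \<in> {1..sum j {1..<s}} \<union> (\<lambda>l. block_index j s l) ` {1..<l}"
    proof (cases "x \<le> sum j {1..<s}")
      case False
      then have "x = block_index j s (x - sum j {1..<s})" "x - sum j {1..<s} \<in> {1..<l}"
        using x by (auto simp: block_index_def)
      then show ?thesis by blast
    qed (use x in auto)
  qed (use assms in \<open>auto simp: block_index_def\<close>)
  then have "sum m {1..<block_index j s l} =
      sum m {1..sum j {1..<s}} + sum m ((\<lambda>l. block_index j s l) ` {1..<l})"
    by (simp, intro sum.union_disjoint) (auto simp: block_index_def)
  also have "sum m ((\<lambda>l. block_index j s l) ` {1..<l}) = (\<Sum>l=1..<l. m (block_index j s l))"
    by (subst sum.reindex) (auto simp: inj_on_def block_index_def)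
  also have "sum m {1..sum j {1..<s}} = (\<Sum>s'=1..s-1. \<Sum>l=1..j s'. m (block_index j s' l))"
  proof -
    have "{1..<s} = {1..s-1}" using assms by auto
    then show ?thesis using sum_block_index[of m j "s-1"] by simp
  qed
  also have "{1..s-1} = {1..<s}" using assms by auto
  finally show ?thesis by (simp add: block_index_def)
qed

lemma sum_permuted:
  fixes j :: "nat \<Rightarrow> nat"
  assumes "\<sigma> permutes {1..k}"
  shows "sum (j \<circ> inv \<sigma>) {1..k} = sum j {1..k}"
  using sum.permute[OF permutes_inv[OF assms], of j] by simp

text \<open>The \<open>i\<close>-th block goes to place \<open>\<sigma> i\<close>, so the block
  lengths after the permutation are listed by \<open>j \<circ> inv \<sigma>\<close>.\<close>

lemma block_perm_index:
  assumes "\<sigma> permutes {1..k}" "i \<in> {1..k}" "l \<in> {1..j i}"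
  shows "block_perm k j \<sigma> (block_index j i l) = block_index (j \<circ> inv \<sigma>) (\<sigma> i) l"
    "block_index (j \<circ> inv \<sigma>) (\<sigma> i) l \<in> {1..sum j {1..k}}"
proof -
  have \<sigma>i: "\<sigma> i \<in> {1..k}" using assms permutes_in_image by metis
  show "block_perm k j \<sigma> (block_index j i l) = block_index (j \<circ> inv \<sigma>) (\<sigma> i) l"
    using assms block_index_bounds[of i k l j] by (simp add: block_perm_def block_num_index block_pos_index)
  show "block_index (j \<circ> inv \<sigma>) (\<sigma> i) l \<in> {1..sum j {1..k}}"
    using block_index_bounds[OF \<sigma>i, of l "j \<circ> inv \<sigma>"] assms sum_permuted[OF assms(1), of j]
    by (simp add: permutes_inverses(2)[OF assms(1)])
qed

section \<open>Operads of tuples in a monoid\<close>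

text \<open>Little cubes and decorated cubes both have this shape, with \<open>R\<close> expressing
  which entries may occur together; the operad laws are proved once for both.\<close>

definition tuple_operad ::
  "'m topology \<Rightarrow> ('m \<Rightarrow> 'm \<Rightarrow> 'm) \<Rightarrow> 'm \<Rightarrow> ('m \<Rightarrow> 'm \<Rightarrow> bool) \<Rightarrow> (nat \<Rightarrow> 'm) operad" where
  "tuple_operad M mul e R = \<lparr>
     opd_space = (\<lambda>k. subtopology (product_topology (\<lambda>_. M) {1..k})
        {c. \<forall>i\<in>{1..k}. \<forall>i'\<in>{1..k}. i \<noteq> i' \<longrightarrow> R (c i) (c i')}),
     opd_act = (\<lambda>k c \<sigma>. \<lambda>i\<in>{1..k}. c (\<sigma> i)),
     opd_unit = (\<lambda>i\<in>{1}. e),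
     opd_comp = (\<lambda>k j c d. \<lambda>t\<in>{1..sum j {1..k}}.
        mul (c (block_num j t)) (d (block_num j t) (block_pos j t)))\<rparr>"

text \<open>\<open>R_right\<close> and \<open>R_left\<close> are what closure under composition asks
  for: entries of a composite in different blocks inherit their relation from the outer tuple,
  entries in the same block from the inner one.\<close>

locale operadic_monoid =
  fixes M :: "'m topology" and mul :: "'m \<Rightarrow> 'm \<Rightarrow> 'm" and e :: 'm and R :: "'m \<Rightarrow> 'm \<Rightarrow> bool"
  assumes mul_cont: "continuous_map (prod_topology M M) M (\<lambda>(x, y). mul x y)"
    and mul_assoc: "\<lbrakk>x \<in> topspace M; y \<in> topspace M; z \<in> topspace M\<rbrakk>
      \<Longrightarrow> mul (mul x y) z = mul x (mul y z)"
    and e_in: "e \<in> topspace M"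
    and mul_e_left: "x \<in> topspace M \<Longrightarrow> mul e x = x"
    and mul_e_right: "x \<in> topspace M \<Longrightarrow> mul x e = x"
    and R_sym: "\<lbrakk>x \<in> topspace M; y \<in> topspace M; R x y\<rbrakk> \<Longrightarrow> R y x"
    and R_right: "\<lbrakk>x \<in> topspace M; y \<in> topspace M; a \<in> topspace M; b \<in> topspace M; R x y\<rbrakk>
      \<Longrightarrow> R (mul x a) (mul y b)"
    and R_left: "\<lbrakk>x \<in> topspace M; a \<in> topspace M; b \<in> topspace M; R a b\<rbrakk>
      \<Longrightarrow> R (mul x a) (mul x b)"
begin

abbreviation "Opd \<equiv> tuple_operad M mul e R"

lemma mul_in: "\<lbrakk>x \<in> topspace M; y \<in> topspace M\<rbrakk> \<Longrightarrow> mul x y \<in> topspace M"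
  using mul_cont by (auto simp: continuous_map_def Pi_iff)

lemma in_space:
  "c \<in> topspace (opd_space Opd k) \<longleftrightarrow> c \<in> {1..k} \<rightarrow>\<^sub>E topspace M \<and>
     (\<forall>i\<in>{1..k}. \<forall>i'\<in>{1..k}. i \<noteq> i' \<longrightarrow> R (c i) (c i'))"
  by (simp add: tuple_operad_def)

lemma in_inputs:
  "d \<in> topspace (opd_inputs Opd k j) \<longleftrightarrow> d \<in> extensional {1..k} \<and>
     (\<forall>i\<in>{1..k}. d i \<in> topspace (opd_space Opd (j i)))"
  by (simp add: opd_inputs_def PiE_iff conj_commute)

lemma space_at: "\<lbrakk>c \<in> topspace (opd_space Opd k); i \<in> {1..k}\<rbrakk> \<Longrightarrow> c i \<in> topspace M"
  unfolding in_space by (meson PiE_mem)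

lemma inputs_at:
  "\<lbrakk>d \<in> topspace (opd_inputs Opd k j); i \<in> {1..k}; l \<in> {1..j i}\<rbrakk> \<Longrightarrow> d i l \<in> topspace M"
  unfolding in_inputs using space_at by blast

lemma act_in:
  assumes "\<sigma> permutes {1..k}" "c \<in> topspace (opd_space Opd k)"
  shows "opd_act Opd k c \<sigma> \<in> topspace (opd_space Opd k)"
proof -
  have "\<sigma> i \<in> {1..k}" if "i \<in> {1..k}" for i using assms(1) that permutes_in_image by metis
  moreover have "\<sigma> i \<noteq> \<sigma> i'" if "i \<noteq> i'" for i i' using assms(1) that permutes_inj injD by metis
  ultimately show ?thesis using assms(2) unfolding in_space
    by (auto simp: tuple_operad_def PiE_iff)
qed

lemma comp_in:
  assumes c: "c \<in> topspace (opd_space Opd k)" and d: "d \<in> topspace (opd_inputs Opd k j)"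
  shows "opd_comp Opd k j c d \<in> topspace (opd_space Opd (sum j {1..k}))"
proof -
  have cM: "c i \<in> topspace M" if "i \<in> {1..k}" for i using c that by (auto simp: in_space)
  have dM: "d i l \<in> topspace M" if "i \<in> {1..k}" "l \<in> {1..j i}" for i l
    using inputs_at[OF d] that by blast
  have R: "R (opd_comp Opd k j c d t) (opd_comp Opd k j c d t')"
    if t: "t \<in> {1..sum j {1..k}}" and t': "t' \<in> {1..sum j {1..k}}" and ne: "t \<noteq> t'" for t t'
  proof -
    obtain i l where il: "i \<in> {1..k}" "l \<in> {1..j i}" "t = block_index j i l" using block_cases[OF t] .
    obtain i' l' where il': "i' \<in> {1..k}" "l' \<in> {1..j i'}" "t' = block_index j i' l'"
      using block_cases[OF t'] .
    have "R (mul (c i) (d i l)) (mul (c i') (d i' l'))"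
    proof (cases "i = i'")
      case True
      then have "R (d i l) (d i l')" using d il il' ne unfolding in_inputs in_space by metis
      then show ?thesis using True R_left cM dM il il' by auto
    next
      case False
      then have "R (c i) (c i')" using c il il' by (auto simp: in_space)
      then show ?thesis using R_right cM dM il il' by auto
    qed
    then show ?thesis using il il' t t' by (simp add: tuple_operad_def block_num_index block_pos_index)
  qed
  have "opd_comp Opd k j c d \<in> {1..sum j {1..k}} \<rightarrow>\<^sub>E topspace M"
    using block_num_pos_bounds[of _ j k] by (auto simp: tuple_operad_def intro!: mul_in cM dM)
  then show ?thesis using R unfolding in_space by blast
qed

lemma comp_continuous:
  "continuous_map (prod_topology (opd_space Opd k) (opd_inputs Opd k j))
     (opd_space Opd (sum j {1..k})) (\<lambda>(c, d). opd_comp Opd k j c d)"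
proof -
  let ?X = "prod_topology (opd_space Opd k) (opd_inputs Opd k j)"
  have "continuous_map ?X (product_topology (\<lambda>_. M) {1..sum j {1..k}}) (\<lambda>(c, d). opd_comp Opd k j c d)"
  proof (subst continuous_map_componentwise, intro conjI ballI)
    show "(\<lambda>(c, d). opd_comp Opd k j c d) ` topspace ?X \<subseteq> extensional {1..sum j {1..k}}"
      by (auto simp: tuple_operad_def)
    fix t assume t: "t \<in> {1..sum j {1..k}}"
    let ?i = "block_num j t" and ?l = "block_pos j t"
    note b = block_num_pos_bounds[OF t]
    have 1: "continuous_map (opd_space Opd k) M (\<lambda>c. c ?i)"
      using b by (auto simp: tuple_operad_def intro!: continuous_map_from_subtopology
          continuous_map_product_projection)
    have 2: "continuous_map (opd_inputs Opd k j) (opd_space Opd (j ?i)) (\<lambda>d. d ?i)"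
      using b by (auto simp: opd_inputs_def intro!: continuous_map_product_projection)
    have 3: "continuous_map (opd_space Opd (j ?i)) M (\<lambda>c. c ?l)"
      using b by (auto simp: tuple_operad_def intro!: continuous_map_from_subtopology
          continuous_map_product_projection)
    have "continuous_map ?X (prod_topology M M) (\<lambda>x. (fst x ?i, snd x ?i ?l))"
      using continuous_map_compose[OF continuous_map_fst 1] 
        continuous_map_compose[OF continuous_map_snd continuous_map_compose[OF 2 3]]
      by (auto simp: continuous_map_pairwise o_def)
    from continuous_map_compose[OF this mul_cont]
    show "continuous_map ?X M (\<lambda>x. (case x of (c, d) \<Rightarrow> opd_comp Opd k j c d) t)"
      using t by (simp add: o_def tuple_operad_def case_prod_unfold)
  qed
  moreover have "(\<lambda>(c, d). opd_comp Opd k j c d) \<in> topspace ?X \<rightarrow> topspace (opd_space Opd (sum j {1..k}))"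
    using comp_in by auto
  ultimately show ?thesis
    by (subst (2) tuple_operad_def, simp add: continuous_map_in_subtopology Pi_iff) 
      (auto simp: in_space)
qed

lemma act_continuous:
  assumes "\<sigma> permutes {1..k}"
  shows "continuous_map (opd_space Opd k) (opd_space Opd k) (\<lambda>c. opd_act Opd k c \<sigma>)"
proof -
  have "continuous_map (opd_space Opd k) (product_topology (\<lambda>_. M) {1..k}) (\<lambda>c. opd_act Opd k c \<sigma>)"
  proof (subst continuous_map_componentwise, intro conjI ballI)
    show "(\<lambda>c. opd_act Opd k c \<sigma>) ` topspace (opd_space Opd k) \<subseteq> extensional {1..k}"
      by (auto simp: tuple_operad_def)
    fix i assume i: "i \<in> {1..k}"
    then have "\<sigma> i \<in> {1..k}" using assms permutes_in_image by metis
    then show "continuous_map (opd_space Opd k) M (\<lambda>c. opd_act Opd k c \<sigma> i)"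
      using i by (auto simp: tuple_operad_def intro!: continuous_map_from_subtopology
          continuous_map_product_projection)
  qed
  moreover have "(\<lambda>c. opd_act Opd k c \<sigma>) \<in> topspace (opd_space Opd k) \<rightarrow> topspace (opd_space Opd k)"
    using act_in[OF assms] by auto
  ultimately show ?thesis
    by (subst (2) tuple_operad_def, simp add: continuous_map_in_subtopology Pi_iff)
      (auto simp: in_space)
qed

lemma comp_at:
  assumes "i \<in> {1..k}" "l \<in> {1..j i}"
  shows "opd_comp Opd k j c d (block_index j i l) = mul (c i) (d i l)"
  using assms block_index_bounds[of i k l j] by (simp add: tuple_operad_def block_num_index block_pos_index)

lemma comp_extensional: "opd_comp Opd k j c d \<in> extensional {1..sum j {1..k}}"
  by (simp add: tuple_operad_def)

lemma act_extensional: "opd_act Opd k c \<sigma> \<in> extensional {1..k}"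
  by (simp add: tuple_operad_def)

lemma act_at: "i \<in> {1..k} \<Longrightarrow> opd_act Opd k c \<sigma> i = c (\<sigma> i)"
  by (simp add: tuple_operad_def)

lemma space_extensional: "c \<in> topspace (opd_space Opd k) \<Longrightarrow> c \<in> extensional {1..k}"
  by (auto simp: in_space PiE_iff)

text \<open>The laws that involve composition are verified in this form, since
  \<open>comp_at\<close> computes a composite at block positions.\<close>

lemma blockwise_eqI:
  assumes "x \<in> extensional {1..sum j {1..k}}" "y \<in> extensional {1..sum j {1..k}}"
    and "\<And>i l. \<lbrakk>i \<in> {1..k}; l \<in> {1..j i}\<rbrakk> \<Longrightarrow> x (block_index j i l) = y (block_index j i l)"
  shows "x = y"
  using assms(1,2) by (rule extensionalityI) (metis assms(3) block_cases)

lemma comp_assoc: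
  assumes c: "c \<in> topspace (opd_space Opd k)" and d: "d \<in> topspace (opd_inputs Opd k j)"
    and e: "f \<in> topspace (opd_inputs Opd (sum j {1..k}) m)"
  shows "opd_comp Opd (sum j {1..k}) m (opd_comp Opd k j c d) f =
          opd_comp Opd k (\<lambda>s. \<Sum>l=1..j s. m (block_index j s l)) c
            (\<lambda>s\<in>{1..k}. opd_comp Opd (j s) (\<lambda>l. m (block_index j s l)) (d s)
               (\<lambda>l\<in>{1..j s}. f (block_index j s l)))"
    (is "?L = opd_comp Opd k ?M c ?d")
proof (rule blockwise_eqI[where j = m and k = "sum j {1..k}"])
  show "?L \<in> extensional {1..sum m {1..sum j {1..k}}}" by (rule comp_extensional)
  show "opd_comp Opd k ?M c ?d \<in> extensional {1..sum m {1..sum j {1..k}}}"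
    using comp_extensional[of k ?M c ?d] sum_block_index[of m j k] by simp
  fix t q assume t: "t \<in> {1..sum j {1..k}}" and q: "q \<in> {1..m t}"
  obtain s l where sl: "s \<in> {1..k}" "l \<in> {1..j s}" "t = block_index j s l" using block_cases[OF t] .
  have cM: "c s \<in> topspace M" using c sl by (auto simp: in_space)
  have dM: "d s l \<in> topspace M" using inputs_at[OF d] sl by blast
  have fM: "f t q \<in> topspace M" using inputs_at[OF e] t q by blast
  let ?m = "\<lambda>l. m (block_index j s l)"
  have q': "block_index ?m l q \<in> {1..?M s}"
    using block_index_bounds[of l "j s" q ?m] sl q by simp
  have "?L (block_index m t q) = mul (mul (c s) (d s l)) (f t q)"
    using t q comp_at[of t _ q m] comp_at[of s k l j] sl by simp
  moreover have "opd_comp Opd k ?M c ?d (block_index m t q) = mul (c s) (mul (d s l) (f t q))"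
    using comp_at[of s k "block_index ?m l q" ?M c ?d] comp_at[of l "j s" q ?m] sl q q'
      block_index_assoc[of s k l j m q] by simp
  ultimately show "?L (block_index m t q) = opd_comp Opd k ?M c ?d (block_index m t q)"
    using mul_assoc[OF cM dM fM] by simp
qed

lemma comp_act_left:
  assumes \<sigma>: "\<sigma> permutes {1..k}"
  shows "opd_comp Opd k j (opd_act Opd k c \<sigma>) d =
           opd_act Opd (sum j {1..k})
             (opd_comp Opd k (j \<circ> inv \<sigma>) c (\<lambda>i\<in>{1..k}. d (inv \<sigma> i))) (block_perm k j \<sigma>)"
proof (rule blockwise_eqI[where j = j and k = k])
  fix i l assume i: "i \<in> {1..k}" and l: "l \<in> {1..j i}"
  have \<sigma>i: "\<sigma> i \<in> {1..k}" using i \<sigma> permutes_in_image by metis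
  show "opd_comp Opd k j (opd_act Opd k c \<sigma>) d (block_index j i l) =
      opd_act Opd (sum j {1..k}) (opd_comp Opd k (j \<circ> inv \<sigma>) c (\<lambda>i\<in>{1..k}. d (inv \<sigma> i)))
        (block_perm k j \<sigma>) (block_index j i l)"
    using i l \<sigma> comp_at[of i k l j] act_at[OF i] act_at[of "block_index j i l"] block_index_bounds[of i k l j]
      comp_at[of "\<sigma> i" k l "j \<circ> inv \<sigma>"] block_perm_index[of \<sigma> k i l j] \<sigma>i l
    by (simp add: permutes_inverses(2)[OF \<sigma>])
qed (rule comp_extensional act_extensional)+

lemma comp_act_right:
  assumes \<tau>: "\<And>i. i \<in> {1..k} \<Longrightarrow> \<tau> i permutes {1..j i}"
  shows "opd_comp Opd k j c (\<lambda>i\<in>{1..k}. opd_act Opd (j i) (d i) (\<tau> i)) =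
           opd_act Opd (sum j {1..k}) (opd_comp Opd k j c d) (block_sum k j \<tau>)"
proof (rule blockwise_eqI[where j = j and k = k])
  fix i l assume i: "i \<in> {1..k}" and l: "l \<in> {1..j i}"
  have \<tau>l: "\<tau> i l \<in> {1..j i}" using l \<tau>[OF i] permutes_in_image by metis
  have "block_sum k j \<tau> (block_index j i l) = block_index j i (\<tau> i l)"
    using i l block_index_bounds[of i k l j] by (simp add: block_sum_def block_num_index block_pos_index)
  then show "opd_comp Opd k j c (\<lambda>i\<in>{1..k}. opd_act Opd (j i) (d i) (\<tau> i)) (block_index j i l) =
      opd_act Opd (sum j {1..k}) (opd_comp Opd k j c d) (block_sum k j \<tau>) (block_index j i l)"
    using i l \<tau>l comp_at[of i k l j] act_at[OF l] act_at[of "block_index j i l"] block_index_bounds[of i k l j] comp_at[of i k "\<tau> i l" j] i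
    by simp
qed (rule comp_extensional act_extensional)+

lemma comp_cong:
  assumes "\<And>i. i \<in> {1..k} \<Longrightarrow> j i = j' i"
  shows "opd_comp Opd k j c d = opd_comp Opd k j' c d"
proof (rule blockwise_eqI[where j = j and k = k])
  have s: "sum j {1..k} = sum j' {1..k}" using assms by simp
  show "opd_comp Opd k j' c d \<in> extensional {1..sum j {1..k}}" unfolding s by (rule comp_extensional)
  fix i l assume i: "i \<in> {1..k}" and l: "l \<in> {1..j i}"
  have "block_index j i l = block_index j' i l" unfolding block_index_def using assms i by simp
  then show "opd_comp Opd k j c d (block_index j i l) = opd_comp Opd k j' c d (block_index j i l)"
    using comp_at[of i k l j c d] comp_at[of i k l j' c d] i l assms[OF i] by simp
qed (rule comp_extensional)

lemma topological_operad: "topological_operad Opd"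
proof -
  have unit_in: "opd_unit Opd \<in> topspace (opd_space Opd 1)"
    using e_in by (auto simp: in_space) (auto simp: tuple_operad_def)
  have unit_left: "opd_comp Opd 1 (\<lambda>_. m) (opd_unit Opd) (\<lambda>i\<in>{1}. d) = d"
    if d: "d \<in> topspace (opd_space Opd m)" for m d
  proof (rule blockwise_eqI[where j = "\<lambda>_. m" and k = 1])
    fix i l assume i: "i \<in> {1..1::nat}" and l: "l \<in> {1..m}"
    have "d l \<in> topspace M" using d l by (auto simp: in_space)
    then show "opd_comp Opd 1 (\<lambda>_. m) (opd_unit Opd) (\<lambda>i\<in>{1}. d) (block_index (\<lambda>_. m) i l) =
        d (block_index (\<lambda>_. m) i l)"
      using comp_at[of i _ l "\<lambda>_. m"] l i
      by (simp add: block_index_def mul_e_left) (simp add: tuple_operad_def mul_e_left)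
  next
    have one: "{1..1::nat} = {1}" by auto
    show "d \<in> extensional {1..\<Sum>_ = 1..1::nat. m}"
      using space_extensional[OF d] unfolding one by simp
  qed (rule comp_extensional)
  have unit_right: "opd_comp Opd k (\<lambda>_. 1) c (\<lambda>i\<in>{1..k}. opd_unit Opd) = c"
    if c: "c \<in> topspace (opd_space Opd k)" for k c
  proof (rule blockwise_eqI[where j = "\<lambda>_. 1" and k = k])
    fix i l assume i: "i \<in> {1..k}" and l: "l \<in> {1..1::nat}"
    have "c i \<in> topspace M" using c i by (auto simp: in_space)
    moreover have "opd_unit Opd 1 = e" by (simp add: tuple_operad_def)
    moreover have "block_index (\<lambda>_. 1) i l = i" using i l by (simp add: block_index_def)
    ultimately show "opd_comp Opd k (\<lambda>_. 1) c (\<lambda>i\<in>{1..k}. opd_unit Opd) (block_index (\<lambda>_. 1) i l) =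
        c (block_index (\<lambda>_. 1) i l)"
      using comp_at[of i _ l "\<lambda>_. 1" c "\<lambda>i\<in>{1..k}. opd_unit Opd"] l i by (simp add: mul_e_right)
  next
    show "c \<in> extensional {1..\<Sum>_ = 1..k. 1}" using space_extensional[OF c] by simp
  qed (rule comp_extensional)
  have act_id: "opd_act Opd k c id = c" if "c \<in> topspace (opd_space Opd k)" for k c
    by (rule extensionalityI[OF act_extensional space_extensional[OF that]]) (simp add: act_at)
  have act_act: "opd_act Opd k (opd_act Opd k c \<sigma>) \<tau> = opd_act Opd k c (\<sigma> \<circ> \<tau>)"
    if "\<tau> permutes {1..k}" for k c \<sigma> \<tau>
  proof (rule extensionalityI[OF act_extensional act_extensional])
    fix i assume i: "i \<in> {1..k}"
    then have "\<tau> i \<in> {1..k}" using that permutes_in_image by metis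
    then show "opd_act Opd k (opd_act Opd k c \<sigma>) \<tau> i = opd_act Opd k c (\<sigma> \<circ> \<tau>) i"
      using i by (simp add: act_at)
  qed
  show ?thesis
    unfolding topological_operad_def
    by (intro conjI allI impI ballI;
        (rule act_continuous act_id act_act comp_assoc comp_cong comp_continuous unit_in unit_left
          unit_right comp_act_left comp_act_right; (assumption | blast)))
qed

end

text \<open>Reduces the comparison of two such operads to single elements: a continuous monoid
  homomorphism that preserves the relation is applied entrywise.\<close>

lemma tuple_operad_morphism:
  assumes "operadic_monoid M mul e R" "operadic_monoid M' mul' e' R'"
    and h: "continuous_map M M' h"
    and mul: "\<And>x y. \<lbrakk>x \<in> topspace M; y \<in> topspace M\<rbrakk> \<Longrightarrow> h (mul x y) = mul' (h x) (h y)"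
    and e: "h e = e'"
    and R: "\<And>x y. \<lbrakk>x \<in> topspace M; y \<in> topspace M; R x y\<rbrakk> \<Longrightarrow> R' (h x) (h y)"
  shows "operad_morphism (tuple_operad M mul e R) (tuple_operad M' mul' e' R')
    (\<lambda>k c. \<lambda>i\<in>{1..k}. h (c i))"
proof -
  interpret A: operadic_monoid M mul e R by fact
  interpret B: operadic_monoid M' mul' e' R' by fact
  have hin: "h x \<in> topspace M'" if "x \<in> topspace M" for x
    using h that by (auto simp: continuous_map_def)
  have cont: "continuous_map (opd_space A.Opd k) (opd_space B.Opd k) (\<lambda>c. \<lambda>i\<in>{1..k}. h (c i))" for k
  proof -
    have "continuous_map (opd_space A.Opd k) (product_topology (\<lambda>_. M') {1..k}) (\<lambda>c. \<lambda>i\<in>{1..k}. h (c i))"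
    proof (subst continuous_map_componentwise, intro conjI ballI)
      fix i assume i: "i \<in> {1..k}"
      have "continuous_map (opd_space A.Opd k) M (\<lambda>c. c i)"
        using i by (auto simp: tuple_operad_def intro!: continuous_map_from_subtopology
          continuous_map_product_projection)
      from continuous_map_compose[OF this h] i
      show "continuous_map (opd_space A.Opd k) M' (\<lambda>c. (\<lambda>i\<in>{1..k}. h (c i)) i)" by (simp add: o_def)
    qed auto
    moreover have "(\<lambda>i\<in>{1..k}. h (c i)) \<in> topspace (opd_space B.Opd k)"
      if "c \<in> topspace (opd_space A.Opd k)" for c
      using that hin R by (auto simp: A.in_space B.in_space PiE_iff)
    ultimately show ?thesis
      by (subst (2) tuple_operad_def, simp add: continuous_map_in_subtopology Pi_iff)
        (auto simp: B.in_space)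
  qed
  have act: "(\<lambda>i\<in>{1..k}. h (opd_act A.Opd k c \<sigma> i)) = opd_act B.Opd k (\<lambda>i\<in>{1..k}. h (c i)) \<sigma>"
    if "\<sigma> permutes {1..k}" for k c \<sigma>
  proof (rule extensionalityI[OF restrict_extensional B.act_extensional])
    fix i assume i: "i \<in> {1..k}"
    then have "\<sigma> i \<in> {1..k}" using that permutes_in_image by metis
    then show "(\<lambda>i\<in>{1..k}. h (opd_act A.Opd k c \<sigma> i)) i = opd_act B.Opd k (\<lambda>i\<in>{1..k}. h (c i)) \<sigma> i"
      using i by (simp add: A.act_at B.act_at)
  qed
  have comp: "(\<lambda>i\<in>{1..sum j {1..k}}. h (opd_comp A.Opd k j c d i)) =
      opd_comp B.Opd k j (\<lambda>i\<in>{1..k}. h (c i)) (\<lambda>i\<in>{1..k}. \<lambda>l\<in>{1..j i}. h (d i l))"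
    if c: "c \<in> topspace (opd_space A.Opd k)" and d: "d \<in> topspace (opd_inputs A.Opd k j)" for k j c d
  proof (rule B.blockwise_eqI[where j = j and k = k])
    fix i l assume i: "i \<in> {1..k}" and l: "l \<in> {1..j i}"
    have "c i \<in> topspace M" "d i l \<in> topspace M"
      using A.space_at[OF c i] A.inputs_at[of d k j i l] d i l by auto
    then show "(\<lambda>i\<in>{1..sum j {1..k}}. h (opd_comp A.Opd k j c d i)) (block_index j i l) =
        opd_comp B.Opd k j (\<lambda>i\<in>{1..k}. h (c i)) (\<lambda>i\<in>{1..k}. \<lambda>l\<in>{1..j i}. h (d i l)) (block_index j i l)"
      using A.comp_at[of i k l j] B.comp_at[of i k l j] block_index_bounds[of i k l j] i l mul by simp
  qed (rule restrict_extensional B.comp_extensional)+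
  have unit: "(\<lambda>i\<in>{1..1}. h (opd_unit A.Opd i)) = opd_unit B.Opd"
    by (auto simp: tuple_operad_def fun_eq_iff e)
  show ?thesis unfolding operad_morphism_def using cont act comp unit by blast
qed

section \<open>The compact-open topology\<close>

lemma continuous_map_fst_comp:
  "continuous_map Z (prod_topology X Y) f \<Longrightarrow> continuous_map Z X (\<lambda>z. fst (f z))"
  using continuous_map_fst_of[of Z X Y f] by (simp add: o_def)

lemma continuous_map_snd_comp:
  "continuous_map Z (prod_topology X Y) f \<Longrightarrow> continuous_map Z Y (\<lambda>z. snd (f z))"
  using continuous_map_snd_of[of Z X Y f] by (simp add: o_def)

lemma continuous_map_Pair:
  "\<lbrakk>continuous_map Z X f; continuous_map Z Y g\<rbrakk> \<Longrightarrow> continuous_map Z (prod_topology X Y) (\<lambda>z. (f z, g z))"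
  by (simp add: continuous_map_pairwise o_def)

lemma continuous_map_ident: "continuous_map X X (\<lambda>x. x)"
  using continuous_map_id[of X] by (simp add: id_def)

lemma continuous_map_o:
  "\<lbrakk>continuous_map X Y g; continuous_map Y Z f\<rbrakk> \<Longrightarrow> continuous_map X Z (\<lambda>x. f (g x))"
  using continuous_map_compose[of X Y g Z f] by (simp add: o_def)

lemmas continuous_map_projections =
  continuous_map_fst_comp continuous_map_snd_comp continuous_map_Pair continuous_map_ident

lemma topspace_compact_open:
  "topspace (compact_open X Y) = {f \<in> extensional (topspace X). continuous_map X Y f}"
proof -
  have "topspace (compact_open X Y) = \<Union>{{f \<in> extensional (topspace X). continuous_map X Y f \<and> f ` K \<subseteq> U} | K U.
        compactin X K \<and> openin Y U}"
    unfolding compact_open_def by (rule topology_generated_by_topspace)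
  also have "\<dots> = {f \<in> extensional (topspace X). continuous_map X Y f}" (is "\<Union>?S = ?A")
  proof
    have "{f \<in> extensional (topspace X). continuous_map X Y f \<and> f ` {} \<subseteq> {}} \<in> ?S"
      using compactin_empty openin_empty by blast
    from Union_upper[OF this] show "?A \<subseteq> \<Union>?S" by simp
    show "\<Union>?S \<subseteq> ?A" by (rule Union_least) auto
  qed
  finally show ?thesis .
qed

lemma openin_compact_open:
  assumes "compactin X K" "openin Y U"
  shows "openin (compact_open X Y) {f \<in> extensional (topspace X). continuous_map X Y f \<and> f ` K \<subseteq> U}"
  unfolding compact_open_def by (rule topology_generated_by_Basis) (use assms in blast)

text \<open>Currying. The preimage of a subbasic set is the complement of the projection to
  \<open>Z\<close> of a closed subset of \<open>Z \<times> K\<close>, and projecting along the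
  compact \<open>K\<close> is a closed map.\<close>

lemma continuous_map_into_compact_open:
  assumes cont: "continuous_map (prod_topology Z X) Y (\<lambda>(z, x). F z x)"
    and ext: "\<And>z. z \<in> topspace Z \<Longrightarrow> F z \<in> extensional (topspace X)"
  shows "continuous_map Z (compact_open X Y) F"
proof -
  have Fz: "continuous_map X Y (F z)" if z: "z \<in> topspace Z" for z
  proof -
    have "continuous_map X (prod_topology Z X) (\<lambda>x. (z, x))" using z by (simp add: continuous_map_pairwise o_def)
    from continuous_map_compose[OF this cont] show ?thesis by (simp add: o_def)
  qed
  show ?thesis
    unfolding compact_open_def
  proof (rule continuous_on_generated_topo)
    fix W assume "W \<in> {{f \<in> extensional (topspace X). continuous_map X Y f \<and> f ` K \<subseteq> U} | K U.
        compactin X K \<and> openin Y U}"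
    then obtain K U where K: "compactin X K" and U: "openin Y U"
      and W: "W = {f \<in> extensional (topspace X). continuous_map X Y f \<and> f ` K \<subseteq> U}" by blast
    have KX: "K \<subseteq> topspace X" using K compactin_subset_topspace by blast
    let ?P = "prod_topology Z (subtopology X K)"
    have "continuous_map ?P Y (\<lambda>(z, x). F z x)"
      using continuous_map_from_subtopology[OF cont, of "topspace Z \<times> K"]
      by (simp add: prod_topology_subtopology subtopology_subtopology)
    then have "closedin ?P {p \<in> topspace ?P. (case p of (z, x) \<Rightarrow> F z x) \<in> topspace Y - U}"
      using U by (intro closedin_continuous_map_preimage) auto
    moreover have "compact_space (subtopology X K)" using K compact_space_subtopology by blast
    ultimately have cl: "closedin Z (fst ` {p \<in> topspace ?P. (case p of (z, x) \<Rightarrow> F z x) \<in> topspace Y - U})"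
      using Abstract_Topological_Spaces.closed_map_fst unfolding closed_map_def by blast
    have "F -` W \<inter> topspace Z =
        topspace Z - fst ` {p \<in> topspace ?P. (case p of (z, x) \<Rightarrow> F z x) \<in> topspace Y - U}"
    proof (intro set_eqI iffI)
      fix z assume "z \<in> F -` W \<inter> topspace Z"
      then show "z \<in> topspace Z - fst ` {p \<in> topspace ?P. (case p of (z, x) \<Rightarrow> F z x) \<in> topspace Y - U}"
        using W KX by auto
    next
      fix z assume z: "z \<in> topspace Z - fst ` {p \<in> topspace ?P. (case p of (z, x) \<Rightarrow> F z x) \<in> topspace Y - U}"
      have "F z x \<in> U" if "x \<in> K" for x
      proof (rule ccontr)
        assume "F z x \<notin> U"
        moreover have "F z x \<in> topspace Y" using Fz[of z] z that KX by (auto simp: continuous_map_def)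
        ultimately have "z \<in> fst ` {p \<in> topspace ?P. (case p of (z, x) \<Rightarrow> F z x) \<in> topspace Y - U}"
          using z that KX by (intro image_eqI[of _ _ "(z, x)"]) auto
        then show False using z by blast
      qed
      then show "z \<in> F -` W \<inter> topspace Z" using z W Fz ext by auto
    qed
    with cl show "openin Z (F -` W \<inter> topspace Z)" by (simp add: openin_diff)
  next
    have "F ` topspace Z \<subseteq> topspace (compact_open X Y)"
      using Fz ext by (auto simp: topspace_compact_open)
    then show "F ` topspace Z \<subseteq> \<Union>{{f \<in> extensional (topspace X). continuous_map X Y f \<and> f ` K \<subseteq> U} | K U.
        compactin X K \<and> openin Y U}"
      unfolding compact_open_def topology_generated_by_topspace .
  qed
qed

text \<open>In a compact Hausdorff space a point has arbitrarily small compact neighbourhoods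
  \<open>K\<close>. So \<open>f x \<in> U\<close> persists on the product of a subbasic set for
  \<open>K\<close> and \<open>U\<close> with an open set inside \<open>K\<close>.\<close>

lemma continuous_map_evaluation:
  assumes "compact_space X" "Hausdorff_space X"
  shows "continuous_map (prod_topology (compact_open X Y) X) Y (\<lambda>(f, x). f x)"
  unfolding continuous_map_def
proof (intro conjI allI impI)
  show "(\<lambda>(f, x). f x) \<in> topspace (prod_topology (compact_open X Y) X) \<rightarrow> topspace Y"
    by (auto simp: topspace_compact_open continuous_map_def)
  fix U assume U: "openin Y U"
  let ?S = "{p \<in> topspace (prod_topology (compact_open X Y) X). (case p of (f, x) \<Rightarrow> f x) \<in> U}"
  have nb: "neighbourhood_base_of (compactin X) X"
    using assms locally_compact_space_neighbourhood_base compact_imp_locally_compact_space by blast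
  show "openin (prod_topology (compact_open X Y) X) ?S"
  proof (subst openin_subopen, intro ballI)
    fix p assume "p \<in> ?S"
    then obtain f x where p: "p = (f, x)" and f: "f \<in> extensional (topspace X)" "continuous_map X Y f"
      and x: "x \<in> topspace X" and fx: "f x \<in> U" by (auto simp: topspace_compact_open)
    have "openin X {x \<in> topspace X. f x \<in> U}" using f U by (auto simp: continuous_map_def)
    then obtain V K where V: "openin X V" and K: "compactin X K" "x \<in> V" "V \<subseteq> K" "K \<subseteq> {x \<in> topspace X. f x \<in> U}"
      using nb x fx unfolding neighbourhood_base_of by (metis (mono_tags, lifting) mem_Collect_eq)
    let ?W = "{f \<in> extensional (topspace X). continuous_map X Y f \<and> f ` K \<subseteq> U}"
    have "openin (prod_topology (compact_open X Y) X) (?W \<times> V)"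
      using openin_compact_open[OF K(1) U] V by (simp add: openin_prod_Times_iff)
    moreover have "p \<in> ?W \<times> V" using p f K by auto
    moreover have "?W \<times> V \<subseteq> ?S" using K openin_subset[OF V] by (fastforce simp: topspace_compact_open)
    ultimately show "\<exists>T. openin (prod_topology (compact_open X Y) X) T \<and> p \<in> T \<and> T \<subseteq> ?S" by blast
  qed
qed

lemma continuous_map_evaluation_compose:
  assumes "compact_space X" "Hausdorff_space X"
    and "continuous_map Z (compact_open X Y) F" "continuous_map Z X h"
  shows "continuous_map Z Y (\<lambda>z. F z (h z))"
proof -
  have "continuous_map Z (prod_topology (compact_open X Y) X) (\<lambda>z. (F z, h z))"
    using assms(3,4) by (simp add: continuous_map_pairwise o_def)
  from continuous_map_compose[OF this continuous_map_evaluation[OF assms(1,2)]]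
  show ?thesis by (simp add: o_def)
qed

section \<open>The monoid of little cubes\<close>

abbreviation cube_set :: "nat \<Rightarrow> (nat \<Rightarrow> real) set" where
  "cube_set n \<equiv> topspace (unit_cube n)"

lemma cube_set_eq: "cube_set n = {1..n} \<rightarrow>\<^sub>E {0..1}"
  by (simp add: unit_cube_def)

lemma compact_Hausdorff_unit_cube: "compact_space (unit_cube n)" "Hausdorff_space (unit_cube n)"
proof -
  show "compact_space (unit_cube n)"
    unfolding unit_cube_def compact_space_product_topology
    by (simp add: compact_space_subtopology)
  show "Hausdorff_space (unit_cube n)"
    unfolding unit_cube_def Hausdorff_space_product_topology
    by (simp add: Hausdorff_space_subtopology)
qed

lemma continuous_map_into_unit_cube:
  assumes "\<And>z. z \<in> topspace Z \<Longrightarrow> F z \<in> cube_set n"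
    and "\<And>i. i \<in> {1..n} \<Longrightarrow> continuous_map Z euclideanreal (\<lambda>z. F z i)"
  shows "continuous_map Z (unit_cube n) F"
  unfolding unit_cube_def
proof (subst continuous_map_componentwise, intro conjI ballI)
  show "F ` topspace Z \<subseteq> extensional {1..n}" using assms(1) by (auto simp: cube_set_eq PiE_iff)
  fix i assume "i \<in> {1..n}"
  then show "continuous_map Z (top_of_set {0..1}) (\<lambda>z. F z i)"
    using assms by (auto simp: continuous_map_in_subtopology cube_set_eq PiE_iff Pi_iff)
qed

lemma continuous_map_cube_coord:
  assumes "continuous_map Z (unit_cube n) F" "i \<in> {1..n}"
  shows "continuous_map Z euclideanreal (\<lambda>z. F z i)"
  using assms unfolding unit_cube_def
  by (auto simp: continuous_map_componentwise continuous_map_in_subtopology)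

definition affine_cube :: "nat \<Rightarrow> (nat \<Rightarrow> real) \<Rightarrow> real \<Rightarrow> (nat \<Rightarrow> real) \<Rightarrow> nat \<Rightarrow> real" where
  "affine_cube n a b = (\<lambda>t\<in>cube_set n. \<lambda>i\<in>{1..n}. a i + b * t i)"

text \<open>Corner and edge length are read off from values of the map at two vertices, which makes
  them depend continuously on the map in the compact-open topology.\<close>

definition corner :: "nat \<Rightarrow> ((nat \<Rightarrow> real) \<Rightarrow> nat \<Rightarrow> real) \<Rightarrow> nat \<Rightarrow> real" where
  "corner n h = h (\<lambda>i\<in>{1..n}. 0)"

text \<open>A TD-map has the same factor in every coordinate; coordinate 1 is available when
  \<open>n \<ge> 1\<close>.\<close>

definition side :: "nat \<Rightarrow> ((nat \<Rightarrow> real) \<Rightarrow> nat \<Rightarrow> real) \<Rightarrow> real" where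
  "side n h = h (\<lambda>i\<in>{1..n}. 1) 1 - h (\<lambda>i\<in>{1..n}. 0) 1"

definition TD_space :: "nat \<Rightarrow> ((nat \<Rightarrow> real) \<Rightarrow> nat \<Rightarrow> real) topology" where
  "TD_space n = subtopology (compact_open (unit_cube n) (unit_cube n)) (Collect (TD_map n))"

lemma corners_in_cube: "(\<lambda>i\<in>{1..n}. 0) \<in> cube_set n" "(\<lambda>i\<in>{1..n}. 1) \<in> cube_set n"
  by (auto simp: cube_set_eq)

lemma corner_affine: "i \<in> {1..n} \<Longrightarrow> corner n (affine_cube n a b) i = a i"
  using corners_in_cube by (simp add: corner_def affine_cube_def)

lemma side_affine: "n \<ge> 1 \<Longrightarrow> side n (affine_cube n a b) = b"
  using corners_in_cube by (simp add: side_def affine_cube_def)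

lemma affine_cube_cong:
  "(\<And>i. i \<in> {1..n} \<Longrightarrow> a i = a' i) \<Longrightarrow> affine_cube n a b = affine_cube n a' b"
  by (auto simp: affine_cube_def fun_eq_iff restrict_def)

lemma TD_map_affine:
  assumes "n \<ge> 1" "TD_map n h"
  shows "h = affine_cube n (corner n h) (side n h)" "side n h > 0"
    "\<And>i. i \<in> {1..n} \<Longrightarrow> 0 \<le> corner n h i \<and> corner n h i + side n h \<le> 1"
proof -
  obtain a b where ab: "b > 0" "\<forall>i\<in>{1..n}. 0 \<le> a i \<and> a i + b \<le> 1" "h = affine_cube n a b"
    using assms(2) unfolding TD_map_def affine_cube_def by blast
  show "h = affine_cube n (corner n h) (side n h)"
    using ab assms(1) affine_cube_cong[of n a "corner n h" b] by (simp add: side_affine corner_affine)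
  show "side n h > 0" using ab assms side_affine by simp
  show "\<And>i. i \<in> {1..n} \<Longrightarrow> 0 \<le> corner n h i \<and> corner n h i + side n h \<le> 1"
    using ab assms by (simp add: side_affine corner_affine)
qed

lemma affine_cube_bounds:
  fixes a b x :: real
  assumes "0 \<le> b" "0 \<le> a" "a + b \<le> 1" "0 \<le> x" "x \<le> 1"
  shows "0 \<le> a + b * x" "a + b * x \<le> a + b" "a + b * x \<le> 1"
proof -
  have "b * x \<le> b" using assms mult_left_le by blast
  then show "a + b * x \<le> a + b" "a + b * x \<le> 1" using assms by linarith+
  show "0 \<le> a + b * x" using assms by simp
qed

lemma affine_cube_in:
  assumes "b \<ge> 0" "\<And>i. i \<in> {1..n} \<Longrightarrow> 0 \<le> a i \<and> a i + b \<le> 1" "t \<in> cube_set n"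
  shows "affine_cube n a b t \<in> cube_set n"
  using assms affine_cube_bounds[of b] by (auto simp: affine_cube_def cube_set_eq PiE_iff)

lemma TD_map_affine_cube:
  assumes "b > 0" "\<And>i. i \<in> {1..n} \<Longrightarrow> 0 \<le> a i \<and> a i + b \<le> 1"
  shows "TD_map n (affine_cube n a b)"
  using assms unfolding TD_map_def affine_cube_def by blast

lemma continuous_map_affine_cube:
  assumes "b \<ge> 0" "\<And>i. i \<in> {1..n} \<Longrightarrow> 0 \<le> a i \<and> a i + b \<le> 1"
  shows "continuous_map (unit_cube n) (unit_cube n) (affine_cube n a b)"
proof (rule continuous_map_into_unit_cube)
  fix i assume i: "i \<in> {1..n}"
  have "continuous_map (unit_cube n) euclideanreal (\<lambda>t. a i + b * t i)"
    using continuous_map_cube_coord[OF continuous_map_id i]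
    by (intro continuous_map_add continuous_map_real_mult) (simp_all add: o_def)
  then show "continuous_map (unit_cube n) euclideanreal (\<lambda>t. affine_cube n a b t i)"
    by (rule continuous_map_eq) (use i in \<open>simp add: affine_cube_def\<close>)
qed (rule affine_cube_in[OF assms])

lemma topspace_TD_space: "topspace (TD_space n) = Collect (TD_map n)"
proof -
  have "h \<in> topspace (compact_open (unit_cube n) (unit_cube n))" if TD: "TD_map n h" for h
  proof -
    obtain a b where ab: "b > 0" "\<forall>i\<in>{1..n}. 0 \<le> a i \<and> a i + b \<le> 1" "h = affine_cube n a b"
      using TD unfolding TD_map_def affine_cube_def by blast
    then show ?thesis
      using continuous_map_affine_cube[of b n a] by (simp add: topspace_compact_open affine_cube_def)
  qed
  then show ?thesis by (auto simp: TD_space_def)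
qed

lemma TD_in_cube: "TD_map n h \<Longrightarrow> t \<in> cube_set n \<Longrightarrow> h t \<in> cube_set n"
  using topspace_TD_space[of n] by (auto simp: TD_space_def topspace_compact_open continuous_map_def)

abbreviation cube_compose where
  "cube_compose n \<equiv> compose (cube_set n)"

lemma compose_affine:
  assumes "b' \<ge> 0" "\<And>i. i \<in> {1..n} \<Longrightarrow> 0 \<le> a' i \<and> a' i + b' \<le> 1"
  shows "cube_compose n (affine_cube n a b) (affine_cube n a' b') =
    affine_cube n (\<lambda>i. a i + b * a' i) (b * b')"
proof
  fix t
  show "cube_compose n (affine_cube n a b) (affine_cube n a' b') t =
    affine_cube n (\<lambda>i. a i + b * a' i) (b * b') t"
    using affine_cube_in[of b' n a' t] assms
    by (cases "t \<in> cube_set n") (auto simp: compose_def affine_cube_def fun_eq_iff algebra_simps restrict_def)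
qed

lemma cube_compose_TD:
  assumes n: "n \<ge> 1" and h: "TD_map n h" and h': "TD_map n h'"
  shows "TD_map n (cube_compose n h h')"
    "\<And>i. i \<in> {1..n} \<Longrightarrow> corner n (cube_compose n h h') i = corner n h i + side n h * corner n h' i"
    "side n (cube_compose n h h') = side n h * side n h'"
proof -
  note A = TD_map_affine[OF n h] and B = TD_map_affine[OF n h']
  have eq: "cube_compose n h h' = affine_cube n (\<lambda>i. corner n h i + side n h * corner n h' i) (side n h * side n h')"
    by (subst A(1), subst B(1), rule compose_affine) (use B in auto)
  show "\<And>i. i \<in> {1..n} \<Longrightarrow> corner n (cube_compose n h h') i = corner n h i + side n h * corner n h' i"
    unfolding eq by (simp add: corner_affine)
  show "side n (cube_compose n h h') = side n h * side n h'" unfolding eq using n by (simp add: side_affine)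
  show "TD_map n (cube_compose n h h')" unfolding eq
  proof (rule TD_map_affine_cube)
    fix i assume i: "i \<in> {1..n}"
    have "side n h * (corner n h' i + side n h') \<le> side n h"
      using A B i by (meson less_imp_le mult_left_le)
    then show "0 \<le> corner n h i + side n h * corner n h' i \<and>
        corner n h i + side n h * corner n h' i + side n h * side n h' \<le> 1"
      using A B i by (smt (verit, ccfv_SIG) distrib_left mult_nonneg_nonneg)
  qed (use A B in simp)
qed

lemma TD_eval_continuous: 
  assumes "continuous_map Z (TD_space n) F" "continuous_map Z (unit_cube n) h"
  shows "continuous_map Z (unit_cube n) (\<lambda>z. F z (h z))"
proof -
  have "continuous_map Z (compact_open (unit_cube n) (unit_cube n)) F"
    using assms(1) unfolding TD_space_def by (rule continuous_map_into_fulltopology)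
  then show ?thesis
    by (rule continuous_map_evaluation_compose[OF compact_Hausdorff_unit_cube _ assms(2)])
qed

lemma continuous_map_corner:
  assumes "continuous_map Z (TD_space n) F" "i \<in> {1..n}"
  shows "continuous_map Z euclideanreal (\<lambda>z. corner n (F z) i)"
  unfolding corner_def
  by (rule continuous_map_cube_coord[OF TD_eval_continuous[OF assms(1)] assms(2)])
    (simp add: corners_in_cube)

lemma continuous_map_side:
  assumes "continuous_map Z (TD_space n) F" "n \<ge> 1"
  shows "continuous_map Z euclideanreal (\<lambda>z. side n (F z))"
  unfolding side_def
  by (intro continuous_map_diff continuous_map_cube_coord[OF TD_eval_continuous[OF assms(1)]])
    (use assms(2) in \<open>simp_all add: corners_in_cube\<close>)

text \<open>The map adjoint to composition is an iterated evaluation, hence continuous.\<close>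

lemma TD_mul_continuous:
  assumes "n \<ge> 1"
  shows "continuous_map (prod_topology (TD_space n) (TD_space n)) (TD_space n) (\<lambda>(h, h'). cube_compose n h h')"
proof -
  let ?P = "prod_topology (TD_space n) (TD_space n)"
  have "continuous_map (prod_topology ?P (unit_cube n)) (unit_cube n) (\<lambda>z. fst (fst z) (snd (fst z) (snd z)))"
    by (rule TD_eval_continuous continuous_map_projections)+
  then have "continuous_map ?P (compact_open (unit_cube n) (unit_cube n)) (\<lambda>(h, h'). cube_compose n h h')"
    by (intro continuous_map_into_compact_open)
      (auto simp: case_prod_unfold compose_def elim!: continuous_map_eq)
  then show ?thesis
    using cube_compose_TD(1)[OF assms] topspace_TD_space[of n]
    by (auto simp: TD_space_def continuous_map_in_subtopology)
qed

section \<open>Separation of cubes by coordinate hyperplanes\<close>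

definition cube_before :: "nat \<Rightarrow> nat \<Rightarrow> ((nat \<Rightarrow> real) \<Rightarrow> nat \<Rightarrow> real) \<Rightarrow> ((nat \<Rightarrow> real) \<Rightarrow> nat \<Rightarrow> real) \<Rightarrow> bool" where
  "cube_before n m h h' \<longleftrightarrow> corner n h m + side n h \<le> corner n h' m"

definition cubes_disjoint :: "nat \<Rightarrow> ((nat \<Rightarrow> real) \<Rightarrow> nat \<Rightarrow> real) \<Rightarrow> ((nat \<Rightarrow> real) \<Rightarrow> nat \<Rightarrow> real) \<Rightarrow> bool" where
  "cubes_disjoint n h h' \<longleftrightarrow>
     disjnt (product_topology (\<lambda>_. euclideanreal) {1..n} interior_of (h ` cube_set n))
            (product_topology (\<lambda>_. euclideanreal) {1..n} interior_of (h' ` cube_set n))"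

lemma cube_before_mul_right:
  assumes "n \<ge> 1" "m \<in> {1..n}" "TD_map n x" "TD_map n y" "TD_map n a" "TD_map n b" "cube_before n m x y"
  shows "cube_before n m (cube_compose n x a) (cube_compose n y b)"
proof -
  note X = TD_map_affine[OF assms(1,3)] and Y = TD_map_affine[OF assms(1,4)]
   and A = TD_map_affine[OF assms(1,5)] and B = TD_map_affine[OF assms(1,6)]
  have "side n x * (corner n a m + side n a) \<le> side n x"
    using X A assms(2) by (meson less_imp_le mult_left_le)
  moreover have "0 \<le> side n y * corner n b m" using Y B assms(2) by (simp add: less_imp_le)
  ultimately show ?thesis using assms
    by (simp add: cube_before_def cube_compose_TD algebra_simps)
qed

lemma cube_before_mul_left:
  assumes "n \<ge> 1" "m \<in> {1..n}" "TD_map n x" "TD_map n a" "TD_map n b" "cube_before n m a b"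
  shows "cube_before n m (cube_compose n x a) (cube_compose n x b)"
proof -
  have "side n x * (corner n a m + side n a) \<le> side n x * corner n b m"
    using TD_map_affine[OF assms(1,3)] assms(6) by (simp add: cube_before_def)
  then show ?thesis using assms by (simp add: cube_before_def cube_compose_TD algebra_simps)
qed

text \<open>Two open boxes meet unless, in some coordinate, one edge ends before the other begins.
  The interior of an image is controlled from below by the open box and from above by the bounds of
  the closed one.\<close>

lemma cubes_disjoint_iff:
  assumes n: "n \<ge> 1" and h: "TD_map n h" and h': "TD_map n h'"
  shows "cubes_disjoint n h h' \<longleftrightarrow> (\<exists>m\<in>{1..n}. cube_before n m h h' \<or> cube_before n m h' h)"
proof -
  let ?E = "product_topology (\<lambda>_. euclideanreal) {1..n}"
  have open_box: "({1..n} \<rightarrow>\<^sub>E UNIV) \<inter> {x. \<forall>i\<in>{1..n}. corner n h i < x i \<and> x i < corner n h i + side n h}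
      \<subseteq> ?E interior_of (h ` cube_set n)" if h: "TD_map n h" for h
  proof (rule interior_of_maximal)
    note A = TD_map_affine[OF n h]
    show "({1..n} \<rightarrow>\<^sub>E UNIV) \<inter> {x. \<forall>i\<in>{1..n}. corner n h i < x i \<and> x i < corner n h i + side n h} \<subseteq> h ` cube_set n"
    proof
      fix x assume x: "x \<in> ({1..n} \<rightarrow>\<^sub>E UNIV) \<inter> {x. \<forall>i\<in>{1..n}. corner n h i < x i \<and> x i < corner n h i + side n h}"
      define t where "t = (\<lambda>i\<in>{1..n}. (x i - corner n h i) / side n h)"
      have "t i \<in> {0..1}" if "i \<in> {1..n}" for i
      proof -
        have "corner n h i < x i" "x i < corner n h i + side n h" using x that by auto
        then show ?thesis using A(2) that by (simp add: t_def divide_le_eq)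
      qed
      then have "t \<in> cube_set n" by (simp add: t_def cube_set_eq PiE_iff)
      moreover have "x = h t"
      proof (rule extensionalityI[of _ "{1..n}"])
        show "x \<in> extensional {1..n}" using x by (simp add: PiE_iff)
        show "h t \<in> extensional {1..n}" using \<open>t \<in> cube_set n\<close> by (subst A(1)) (simp add: affine_cube_def)
        show "x i = h t i" if "i \<in> {1..n}" for i
          using \<open>t \<in> cube_set n\<close> that A(2) by (subst A(1)) (simp add: affine_cube_def t_def)
      qed
      ultimately show "x \<in> h ` cube_set n" by blast
    qed
    have "({1..n} \<rightarrow>\<^sub>E UNIV) \<inter> {x. \<forall>i\<in>{1..n}. corner n h i < x i \<and> x i < corner n h i + side n h} =
       (\<Pi>\<^sub>E i\<in>{1..n}. {corner n h i<..<corner n h i + side n h})" by (auto simp: PiE_iff)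
    moreover have "openin ?E (\<Pi>\<^sub>E i\<in>{1..n}. {corner n h i<..<corner n h i + side n h})"
      by (subst openin_PiE) auto
    ultimately show "openin ?E (({1..n} \<rightarrow>\<^sub>E UNIV) \<inter> {x. \<forall>i\<in>{1..n}. corner n h i < x i \<and> x i < corner n h i + side n h})"
      by simp
  qed
  have image_bounds: "corner n h i \<le> x i \<and> x i \<le> corner n h i + side n h"
    if h: "TD_map n h" and x: "x \<in> h ` cube_set n" and i: "i \<in> {1..n}" for h x i
  proof -
    note A = TD_map_affine[OF n h]
    obtain t where t: "t \<in> cube_set n" "x = h t" using x by blast
    then have "x i = corner n h i + side n h * t i" using i by (subst (asm) A(1)) (simp add: affine_cube_def)
    moreover have "0 \<le> t i" "t i \<le> 1" using t i by (auto simp: cube_set_eq)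
    ultimately show ?thesis using A(2) by (simp add: mult_left_le)
  qed
  have before_disj: "disjnt (?E interior_of (h ` cube_set n)) (?E interior_of (h' ` cube_set n))"
    if h: "TD_map n h" and h': "TD_map n h'" and m: "m \<in> {1..n}" and b: "cube_before n m h h'" for h h' m
  proof (rule ccontr)
    assume "\<not> ?thesis"
    then obtain x where x: "x \<in> ?E interior_of (h ` cube_set n)" "x \<in> ?E interior_of (h' ` cube_set n)"
      by (auto simp: disjnt_iff)
    have xE: "x \<in> topspace ?E" using subsetD[OF interior_of_subset_topspace x(1)] .
    have bd: "x m = corner n h' m" "corner n h' m = corner n h m + side n h"
    proof -
      have "x \<in> h ` cube_set n" "x \<in> h' ` cube_set n" using x[THEN subsetD[OF interior_of_subset]] .
      then show "x m = corner n h' m" "corner n h' m = corner n h m + side n h"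
        using image_bounds[OF h _ m, of x] image_bounds[OF h' _ m, of x] b by (auto simp: cube_before_def)
    qed
    have "continuous_map euclideanreal ?E (\<lambda>s. x(m := s))"
      by (subst continuous_map_componentwise)
        (use xE m in \<open>auto simp: PiE_iff extensional_def fun_upd_def\<close>)
    then have "openin euclideanreal {s \<in> topspace euclideanreal. x(m := s) \<in> ?E interior_of (h ` cube_set n)}"
      by (rule openin_continuous_map_preimage) simp
    then have "open {s. x(m := s) \<in> ?E interior_of (h ` cube_set n)}" by simp
    moreover have "x m \<in> {s. x(m := s) \<in> ?E interior_of (h ` cube_set n)}" using x by simp
    ultimately obtain e where e: "e > 0" "ball (x m) e \<subseteq> {s. x(m := s) \<in> ?E interior_of (h ` cube_set n)}"
      using open_contains_ball by blast
    \<comment> \<open>A common interior point lies on the shared face. Moving it by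
      \<open>e / 2\<close> in direction \<open>m\<close> keeps it in the interior of the image of
      \<open>h\<close> and yet carries it beyond that face.\<close>
    have "x m + e / 2 \<in> ball (x m) e" using e by (simp add: dist_real_def)
    then have "x(m := x m + e / 2) \<in> h ` cube_set n" using e subsetD[OF interior_of_subset[of ?E "h ` cube_set n"]] by blast
    from image_bounds[OF h this m] bd e show False by simp
  qed
  show ?thesis
  proof
    assume d: "cubes_disjoint n h h'"
    show "\<exists>m\<in>{1..n}. cube_before n m h h' \<or> cube_before n m h' h"
    proof (rule ccontr)
      assume "\<not> ?thesis"
      then have no: "corner n h' m < corner n h m + side n h" "corner n h m < corner n h' m + side n h'" if "m \<in> {1..n}" for m
        using that by (auto simp: cube_before_def not_le)
      \<comment> \<open>If all edges overlap, the midpoints of the overlaps form a common interior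
        point.\<close>
      define x where "x = (\<lambda>m\<in>{1..n}. (max (corner n h m) (corner n h' m) +
        min (corner n h m + side n h) (corner n h' m + side n h')) / 2)"
      have "max (corner n h m) (corner n h' m) < x m \<and> x m < min (corner n h m + side n h) (corner n h' m + side n h')" if "m \<in> {1..n}" for m
      proof -
        have "max (corner n h m) (corner n h' m) < min (corner n h m + side n h) (corner n h' m + side n h')"
          using no[OF that] TD_map_affine(2)[OF n h] TD_map_affine(2)[OF n h'] by simp
        moreover have "A < (A + B) / 2 \<and> (A + B) / 2 < B" if "A < B" for A B :: real using that by simp
        ultimately show ?thesis using that unfolding x_def by (simp only: restrict_apply if_True)
      qed
      then have "corner n h m < x m \<and> x m < corner n h m + side n h"
          "corner n h' m < x m \<and> x m < corner n h' m + side n h'" if "m \<in> {1..n}" for m using that by fastforce+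
      moreover have "x \<in> {1..n} \<rightarrow>\<^sub>E UNIV" by (simp add: x_def)
      ultimately have "x \<in> ?E interior_of (h ` cube_set n)" "x \<in> ?E interior_of (h' ` cube_set n)"
        by (intro subsetD[OF open_box[OF h]] subsetD[OF open_box[OF h']], simp)+
      then show False using d by (auto simp: cubes_disjoint_def disjnt_iff)
    qed
  next
    assume "\<exists>m\<in>{1..n}. cube_before n m h h' \<or> cube_before n m h' h"
    then show "cubes_disjoint n h h'"
      unfolding cubes_disjoint_def using before_disj h h' disjnt_sym by metis
  qed
qed

definition cube_id :: "nat \<Rightarrow> (nat \<Rightarrow> real) \<Rightarrow> nat \<Rightarrow> real" where
  "cube_id n = (\<lambda>t\<in>cube_set n. t)"

lemma TD_cube_id: "TD_map n (cube_id n)"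
  by (auto simp: TD_map_def cube_id_def fun_eq_iff restrict_def cube_set_eq PiE_iff extensional_def
      intro!: exI[of _ "\<lambda>_. 0"] exI[of _ 1])

lemma TD_extensional: "TD_map n h \<Longrightarrow> h \<in> extensional (cube_set n)"
  by (auto simp: TD_map_def)

lemma cube_compose_id:
  assumes "TD_map n h"
  shows "cube_compose n (cube_id n) h = h" "cube_compose n h (cube_id n) = h"
proof -
  show "cube_compose n (cube_id n) h = h"
    using TD_in_cube[OF assms] TD_extensional[OF assms]
    by (intro extensionalityI[of _ "cube_set n"]) (auto simp: compose_def cube_id_def)
  show "cube_compose n h (cube_id n) = h"
    using TD_extensional[OF assms]
    by (intro extensionalityI[of _ "cube_set n"]) (auto simp: compose_def cube_id_def)
qed

lemma operadic_monoid_cubes: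
  assumes n: "n \<ge> 1"
  shows "operadic_monoid (TD_space n) (cube_compose n) (cube_id n) (cubes_disjoint n)"
proof
  show "continuous_map (prod_topology (TD_space n) (TD_space n)) (TD_space n) (\<lambda>(h, h'). cube_compose n h h')"
    by (rule TD_mul_continuous[OF n])
next
  fix x y z assume "x \<in> topspace (TD_space n)" "y \<in> topspace (TD_space n)" "z \<in> topspace (TD_space n)"
  then show "cube_compose n (cube_compose n x y) z = cube_compose n x (cube_compose n y z)"
    using compose_assoc[of z "cube_set n" "cube_set n" x y] TD_in_cube[of n] by (simp add: topspace_TD_space)
qed (use n in \<open>auto simp: topspace_TD_space TD_cube_id cube_compose_id cubes_disjoint_iff
  cube_compose_TD(1) intro: cube_before_mul_right cube_before_mul_left\<close>)

text \<open>One side is a subspace of a product, the other a subspace of a product of subspaces; the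
  topologies agree.\<close>

lemma little_cubes_eq:
  "little_cubes n = tuple_operad (TD_space n) (cube_compose n) (cube_id n) (cubes_disjoint n)"
proof -
  have "little_cubes_space n k = subtopology (product_topology (\<lambda>_. TD_space n) {1..k})
      {c. \<forall>i\<in>{1..k}. \<forall>i'\<in>{1..k}. i \<noteq> i' \<longrightarrow> cubes_disjoint n (c i) (c i')}" for k
  proof -
    let ?P = "product_topology (\<lambda>_. compact_open (unit_cube n) (unit_cube n)) {1..k}"
    let ?A = "{c. (\<forall>i\<in>{1..k}. TD_map n (c i)) \<and> (\<forall>i\<in>{1..k}. \<forall>i'\<in>{1..k}. i \<noteq> i' \<longrightarrow> cubes_disjoint n (c i) (c i'))}"
    let ?B = "{c. \<forall>i\<in>{1..k}. \<forall>i'\<in>{1..k}. i \<noteq> i' \<longrightarrow> cubes_disjoint n (c i) (c i')}"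
    have "product_topology (\<lambda>_. TD_space n) {1..k} = subtopology ?P ({1..k} \<rightarrow>\<^sub>E Collect (TD_map n))"
      unfolding TD_space_def by (simp add: subtopology_product_topology)
    then have "subtopology (product_topology (\<lambda>_. TD_space n) {1..k}) ?B =
        subtopology ?P (({1..k} \<rightarrow>\<^sub>E Collect (TD_map n)) \<inter> ?B)"
      by (simp add: subtopology_subtopology)
    have "topspace ?P \<inter> ({1..k} \<rightarrow>\<^sub>E Collect (TD_map n)) = topspace ?P \<inter> {c. \<forall>i\<in>{1..k}. TD_map n (c i)}"
      by (simp add: set_eq_iff PiE_iff conj_ac)
    then have "topspace ?P \<inter> (({1..k} \<rightarrow>\<^sub>E Collect (TD_map n)) \<inter> ?B) = topspace ?P \<inter> ?A"
      unfolding Int_assoc[symmetric] by (simp add: set_eq_iff)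
    with \<open>subtopology (product_topology (\<lambda>_. TD_space n) {1..k}) ?B = _\<close>
    have "subtopology (product_topology (\<lambda>_. TD_space n) {1..k}) ?B = subtopology ?P ?A"
      by (metis (no_types, lifting) subtopology_restrict)
    then show ?thesis unfolding little_cubes_space_def cubes_disjoint_def by simp
  qed
  then show ?thesis
    unfolding little_cubes_def tuple_operad_def cube_id_def by (simp add: fun_eq_iff)
qed

section \<open>Progress functions\<close>

text \<open>The functions live on the whole line and are constant outside the unit interval, so that
  composites and affine changes of time leave no domain conditions behind.\<close>

definition progress :: "(real \<Rightarrow> real) set" where
  "progress = {p. mono p \<and> continuous_on UNIV p \<and> (\<forall>t\<le>0. p t = 0) \<and> (\<forall>t\<ge>1. p t = 1)}"

definition progress_space :: "(real \<Rightarrow> real) topology" where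
  "progress_space = subtopology (powertop_real UNIV) progress"

text \<open>The unit for composition of progress functions. It also brings cut points into the unit
  interval without changing the values of progress functions there.\<close>

definition clamp01 :: "real \<Rightarrow> real" where
  "clamp01 t = max 0 (min 1 t)"

lemma topspace_progress [simp]: "topspace progress_space = progress"
  by (auto simp: progress_space_def)

lemma progressD:
  assumes "p \<in> progress"
  shows "mono p" "continuous_on UNIV p" "t \<le> 0 \<Longrightarrow> p t = 0" "t \<ge> 1 \<Longrightarrow> p t = 1" "x \<le> y \<Longrightarrow> p x \<le> p y"
  using assms by (auto simp: progress_def mono_def)

lemma progress_bounds:
  assumes "p \<in> progress"
  shows "0 \<le> p t" "p t \<le> 1"
proof -
  have "p (min t 0) \<le> p t" "p t \<le> p (max t 1)" using progressD(5)[OF assms] by simp_all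
  then show "0 \<le> p t" "p t \<le> 1" using progressD(3,4)[OF assms] by auto
qed

lemma progress_clamp: "p \<in> progress \<Longrightarrow> p (clamp01 t) = p t"
  using progressD(3,4)[of p] by (auto simp: clamp01_def max_def min_def)

lemma clamp01_id: "0 \<le> t \<Longrightarrow> t \<le> 1 \<Longrightarrow> clamp01 t = t"
  by (simp add: clamp01_def)

lemma clamp01_bounds: "0 \<le> clamp01 t" "clamp01 t \<le> 1"
  by (auto simp: clamp01_def)

lemma clamp01_progress: "clamp01 \<in> progress"
  unfolding progress_def clamp01_def mono_def by (auto intro!: continuous_intros)

lemma progress_compose:
  assumes "p \<in> progress" "q \<in> progress"
  shows "q \<circ> p \<in> progress"
proof -
  have "continuous_on UNIV (q \<circ> p)"
    using continuous_on_compose[of UNIV p q] progressD(2)[OF assms(1)] continuous_on_subset[OF progressD(2)[OF assms(2)]] by blast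
  then show ?thesis
    using progressD(3-5)[OF assms(1)] progressD(3-5)[OF assms(2)] by (auto simp: progress_def mono_def)
qed

lemma progress_surj:
  assumes "p \<in> progress" "0 \<le> v" "v \<le> 1"
  shows "\<exists>t\<in>{0..1}. p t = v"
  using IVT'[of p 0 v 1] assms progressD[OF assms(1)] continuous_on_subset[OF progressD(2)[OF assms(1)], of "{0..1}"]
  by auto

lemma progress_IVT:
  assumes "p \<in> progress" "x \<le> y" "p x \<le> v" "v \<le> p y"
  shows "\<exists>t\<in>{x..y}. p t = v"
  using IVT'[of p x v y] assms continuous_on_subset[OF progressD(2)[OF assms(1)], of "{x..y}"] by auto

lemma continuous_map_progress_at:
  assumes "continuous_map Z progress_space F"
  shows "continuous_map Z euclideanreal (\<lambda>z. F z t)"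
  using assms unfolding progress_space_def continuous_map_in_subtopology by (auto simp: continuous_map_componentwise_UNIV)

lemma continuous_map_into_progress:
  assumes "\<And>z. z \<in> topspace Z \<Longrightarrow> F z \<in> progress" "\<And>t. continuous_map Z euclideanreal (\<lambda>z. F z t)"
  shows "continuous_map Z progress_space F"
  using assms unfolding progress_space_def continuous_map_in_subtopology by (auto simp: continuous_map_componentwise_UNIV)

text \<open>Pointwise convergence of monotone functions to a continuous one is locally uniform, so the
  topology of pointwise convergence makes evaluation jointly continuous.\<close>

lemma continuous_map_progress_eval:
  assumes F: "continuous_map Z progress_space F" and h: "continuous_map Z euclideanreal h"
  shows "continuous_map Z euclideanreal (\<lambda>z. F z (h z))"
  unfolding continuous_map_def
proof (intro conjI allI impI)
  show "(\<lambda>z. F z (h z)) \<in> topspace Z \<rightarrow> topspace euclideanreal" by simp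
  fix U :: "real set" assume "openin euclideanreal U"
  then have U: "open U" by simp
  show "openin Z {z \<in> topspace Z. F z (h z) \<in> U}"
  proof (subst openin_subopen, intro ballI)
    fix z assume z: "z \<in> {z \<in> topspace Z. F z (h z) \<in> U}"
    then obtain e where e: "e > 0" "ball (F z (h z)) e \<subseteq> U" using U open_contains_ball by blast
    have Fp: "F w \<in> progress" if "w \<in> topspace Z" for w
      using F that by (auto simp: continuous_map_def)
    have "isCont (F z) (h z)" using progressD(2)[OF Fp] z by (simp add: continuous_on_eq_continuous_at)
    then obtain d where d: "d > 0" "\<And>x. dist x (h z) < d \<Longrightarrow> dist (F z x) (F z (h z)) < e"
      using e unfolding continuous_at_eps_delta by blast
    define l r where "l = h z - d / 2" and "r = h z + d / 2"
    have lr: "l < h z" "h z < r" "F z (h z) - e < F z l" "F z r < F z (h z) + e"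
      using d(1) d(2)[of l] d(2)[of r] unfolding l_def r_def by (auto simp: dist_real_def)
    let ?T = "{w \<in> topspace Z. h w \<in> {l<..<r}} \<inter> {w \<in> topspace Z. F w l \<in> {F z (h z) - e<..}}
       \<inter> {w \<in> topspace Z. F w r \<in> {..<F z (h z) + e}}"
    have "openin Z ?T"
      by (intro openin_Int openin_continuous_map_preimage[OF h]
          openin_continuous_map_preimage[OF continuous_map_progress_at[OF F]]) auto
    moreover have "z \<in> ?T" using z lr by auto
    moreover have "?T \<subseteq> {z \<in> topspace Z. F z (h z) \<in> U}"
    proof
      fix w assume w: "w \<in> ?T"
      then have "F w l \<le> F w (h w)" "F w (h w) \<le> F w r" using progressD(5)[OF Fp[of w]] by auto
      then have "F w (h w) \<in> ball (F z (h z)) e" using w by (auto simp: dist_real_def)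
      then show "w \<in> {z \<in> topspace Z. F z (h z) \<in> U}" using e w by blast
    qed
    ultimately show "\<exists>T. openin Z T \<and> z \<in> T \<and> T \<subseteq> {z \<in> topspace Z. F z (h z) \<in> U}" by blast
  qed
qed

section \<open>Cells\<close>

text \<open>The continuous counterpart of a sequence in two letters with at most \<open>m\<close> changes of value.\<close>

definition cell :: "nat \<Rightarrow> (real \<Rightarrow> real) \<Rightarrow> (real \<Rightarrow> real) \<Rightarrow> bool" where
  "cell m f g \<longleftrightarrow> (\<exists>t. t 0 \<le> 0 \<and> 1 \<le> t (Suc m) \<and> (\<forall>r\<le>m. t r \<le> t (Suc r) \<and>
     (if even r then g (t r) = g (t (Suc r)) else f (t r) = f (t (Suc r)))))"

lemma cell_compose_left: "cell m f g \<Longrightarrow> cell m (q \<circ> f) (q' \<circ> g)"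
  unfolding cell_def by (metis comp_apply)

text \<open>The new cut points are preimages of the old ones under \<open>h\<close>. They stay
  ordered because \<open>h\<close> is monotone and every value has one chosen preimage.\<close>

lemma cell_compose_right:
  assumes "cell m f g" and f: "f \<in> progress" and g: "g \<in> progress" and h: "h \<in> progress"
  shows "cell m (f \<circ> h) (g \<circ> h)"
proof -
  obtain t where t: "t 0 \<le> 0" "1 \<le> t (Suc m)"
    "\<And>r. r \<le> m \<Longrightarrow> t r \<le> t (Suc r) \<and>
      (if even r then g (t r) = g (t (Suc r)) else f (t r) = f (t (Suc r)))"
    using assms(1) unfolding cell_def by blast
  \<comment> \<open>A right inverse of \<open>h\<close> on the unit interval. Its values at 0 and 1
    are prescribed so that the first cut stays \<le> 0 and the last one \<ge> 1.\<close>
  define G where "G v = (if v = 0 then 0 else if v = 1 then 1 else SOME s. h s = v)" for v :: real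
  have hG: "h (G v) = v" if "0 \<le> v" "v \<le> 1" for v
  proof -
    have "\<exists>s. h s = v" using progress_surj[OF h that] by blast
    then show ?thesis using progressD(3,4)[OF h] unfolding G_def by (auto intro: someI_ex)
  qed
  define s where "s r = G (clamp01 (t r))" for r
  have hs: "h (s r) = clamp01 (t r)" for r unfolding s_def by (rule hG) (rule clamp01_bounds)+
  have "s r \<le> s (Suc r)" if "r \<le> m" for r
  proof (cases "clamp01 (t r) = clamp01 (t (Suc r))")
    case False
    then have "h (s r) < h (s (Suc r))" using t(3)[OF that] by (auto simp: hs clamp01_def)
    then show ?thesis using progressD(5)[OF h, of "s (Suc r)" "s r"] by linarith
  qed (simp add: s_def)
  moreover have "s 0 \<le> 0" using t(1) by (simp add: s_def clamp01_def G_def)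
  moreover have "s (Suc m) \<ge> 1" using t(2) by (simp add: s_def clamp01_def G_def)
  moreover have "f (h (s r)) = f (t r)" "g (h (s r)) = g (t r)" for r
    unfolding hs using progress_clamp f g by auto
  ultimately show ?thesis using t(3) unfolding cell_def by (intro exI[of _ s]) auto
qed

text \<open>An empty interval is appended at the end.\<close>

lemma cell_Suc: "cell m f g \<Longrightarrow> cell (Suc m) f g"
proof -
  assume "cell m f g"
  then obtain t where t: "t 0 \<le> 0" "1 \<le> t (Suc m)"
    "\<And>r. r \<le> m \<Longrightarrow> t r \<le> t (Suc r) \<and>
      (if even r then g (t r) = g (t (Suc r)) else f (t r) = f (t (Suc r)))"
    unfolding cell_def by blast
  show ?thesis unfolding cell_def
    by (rule exI[of _ "\<lambda>r. if r = Suc (Suc m) then t (Suc m) else t r"])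
      (use t in \<open>auto simp: le_Suc_eq\<close>)
qed

text \<open>An empty interval is inserted at the start. This shifts the parity of all others and so
  exchanges the roles of the two functions.\<close>

lemma cell_Suc_swap:
  assumes "cell m f g" "f \<in> progress" "g \<in> progress"
  shows "cell (Suc m) g f"
proof -
  obtain t where t: "t 0 \<le> 0" "1 \<le> t (Suc m)"
    "\<And>r. r \<le> m \<Longrightarrow> t r \<le> t (Suc r) \<and>
      (if even r then g (t r) = g (t (Suc r)) else f (t r) = f (t (Suc r)))"
    using assms(1) unfolding cell_def by blast
  show ?thesis unfolding cell_def
  proof (rule exI[of _ "\<lambda>r. if r = 0 then t 0 else t (r - 1)"], intro conjI allI impI)
    fix r assume "r \<le> Suc m"
    then show "(if r = 0 then t 0 else t (r - 1)) \<le> (if Suc r = 0 then t 0 else t (Suc r - 1))"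
      using t(3)[of "r - 1"] by (cases r) auto
    show "if even r then f (if r = 0 then t 0 else t (r - 1)) = f (if Suc r = 0 then t 0 else t (Suc r - 1))
       else g (if r = 0 then t 0 else t (r - 1)) = g (if Suc r = 0 then t 0 else t (Suc r - 1))"
      using \<open>r \<le> Suc m\<close> t(3)[of "r - 1"] by (cases r) auto
  qed (use t in auto)
qed

text \<open>Allows a pair to be treated as ordered by a coordinate later than the one that separates
  it, in whichever order that coordinate dictates.\<close>

lemma cell_mono:
  assumes "cell m f g" "f \<in> progress" "g \<in> progress"
  shows "m \<le> m' \<Longrightarrow> cell m' f g" "m < m' \<Longrightarrow> cell m' g f"
proof -
  show *: "cell m' f g" if "m \<le> m'" for m'
    using that by (induction m' rule: dec_induct) (use assms cell_Suc in auto)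
  assume "m < m'"
  then have "cell (m' - 1) f g" by (intro *) simp
  then show "cell m' g f" using cell_Suc_swap[of "m' - 1" f g] assms \<open>m < m'\<close> by simp
qed

section \<open>The operad of little cubes with progress functions\<close>

type_synonym cube_progress = "((nat \<Rightarrow> real) \<Rightarrow> nat \<Rightarrow> real) \<times> (real \<Rightarrow> real)"

definition cp_space :: "nat \<Rightarrow> cube_progress topology" where
  "cp_space n = prod_topology (TD_space n) progress_space"

text \<open>Progress composes in the opposite order to cubes: the amount that the outer operation
  has consumed of an input is the time seen by the operation plugged in there.\<close>

definition cp_mul :: "nat \<Rightarrow> cube_progress \<Rightarrow> cube_progress \<Rightarrow> cube_progress" where
  "cp_mul n x y = (cube_compose n (fst x) (fst y), snd y \<circ> snd x)"

definition cp_unit :: "nat \<Rightarrow> cube_progress" where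
  "cp_unit n = (cube_id n, clamp01)"

definition cp_compat :: "nat \<Rightarrow> cube_progress \<Rightarrow> cube_progress \<Rightarrow> bool" where
  "cp_compat n x y \<longleftrightarrow> (\<exists>m\<in>{1..n}. cube_before n m (fst x) (fst y) \<and> cell m (snd x) (snd y) \<or>
     cube_before n m (fst y) (fst x) \<and> cell m (snd y) (snd x))"

lemma topspace_cp_space: "x \<in> topspace (cp_space n) \<longleftrightarrow> TD_map n (fst x) \<and> snd x \<in> progress"
  by (cases x) (simp add: cp_space_def topspace_TD_space)

text \<open>Plugging something into each member of a compatible pair postcomposes their progress
  functions (\<open>cell_compose_left\<close>); plugging a compatible pair into one input
  precomposes them with a common function (\<open>cell_compose_right\<close>).\<close>

lemma operadic_monoid_cp:
  assumes n: "n \<ge> 1"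
  shows "operadic_monoid (cp_space n) (cp_mul n) (cp_unit n) (cp_compat n)"
proof -
  interpret C: operadic_monoid "TD_space n" "cube_compose n" "cube_id n" "cubes_disjoint n"
    by (rule operadic_monoid_cubes[OF n])
  show ?thesis
  proof
    let ?P = "prod_topology (cp_space n) (cp_space n)"
    have 1: "continuous_map ?P (TD_space n) (\<lambda>z. cube_compose n (fst (fst z)) (fst (snd z)))"
      using continuous_map_o[OF _ C.mul_cont, of ?P "\<lambda>z. (fst (fst z), fst (snd z))"]
      unfolding cp_space_def case_prod_unfold fst_conv snd_conv
      by (elim meta_mp) (rule continuous_map_projections)+
    have 2: "continuous_map ?P progress_space (\<lambda>z. snd (snd z) \<circ> snd (fst z))"
    proof (rule continuous_map_into_progress)
      fix t
      have "continuous_map ?P progress_space (\<lambda>z. snd (snd z))" "continuous_map ?P progress_space (\<lambda>z. snd (fst z))"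
        unfolding cp_space_def by (rule continuous_map_projections)+
      then show "continuous_map ?P euclideanreal (\<lambda>z. (snd (snd z) \<circ> snd (fst z)) t)"
        unfolding o_def by (rule continuous_map_progress_eval[OF _ continuous_map_progress_at])
    qed (auto simp: topspace_cp_space cp_space_def intro: progress_compose)
    show "continuous_map ?P (cp_space n) (\<lambda>(x, y). cp_mul n x y)"
      using continuous_map_Pair[OF 1 2] by (simp add: cp_space_def cp_mul_def case_prod_unfold)
  next
    fix x y z assume "x \<in> topspace (cp_space n)" "y \<in> topspace (cp_space n)" "z \<in> topspace (cp_space n)"
    then show "cp_mul n (cp_mul n x y) z = cp_mul n x (cp_mul n y z)"
      using C.mul_assoc by (simp add: cp_mul_def topspace_cp_space topspace_TD_space o_assoc)
  next
    show "cp_unit n \<in> topspace (cp_space n)"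
      by (simp add: topspace_cp_space cp_unit_def TD_cube_id clamp01_progress)
  next
    fix x assume x: "x \<in> topspace (cp_space n)"
    have "snd x \<circ> clamp01 = snd x" "clamp01 \<circ> snd x = snd x"
      using x progress_clamp[of "snd x"] progress_bounds[of "snd x"] clamp01_id by (auto simp: topspace_cp_space fun_eq_iff)
    then show "cp_mul n (cp_unit n) x = x" "cp_mul n x (cp_unit n) = x"
      using x cube_compose_id[of n "fst x"] by (simp_all add: cp_mul_def cp_unit_def topspace_cp_space)
  next
    fix x y assume "cp_compat n x y"
    then show "cp_compat n y x" by (auto simp: cp_compat_def)
  next
    fix x y a b assume xy: "x \<in> topspace (cp_space n)" "y \<in> topspace (cp_space n)" "a \<in> topspace (cp_space n)" "b \<in> topspace (cp_space n)"
      and R: "cp_compat n x y"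
    then obtain m where m: "m \<in> {1..n}" "cube_before n m (fst x) (fst y) \<and> cell m (snd x) (snd y) \<or>
     cube_before n m (fst y) (fst x) \<and> cell m (snd y) (snd x)" unfolding cp_compat_def by blast
    then show "cp_compat n (cp_mul n x a) (cp_mul n y b)"
      using xy n cube_before_mul_right[of n m] cell_compose_left unfolding cp_compat_def cp_mul_def topspace_cp_space
      by (intro bexI[of _ m]) auto
  next
    fix x a b assume xy: "x \<in> topspace (cp_space n)" "a \<in> topspace (cp_space n)" "b \<in> topspace (cp_space n)"
      and R: "cp_compat n a b"
    then obtain m where m: "m \<in> {1..n}" "cube_before n m (fst a) (fst b) \<and> cell m (snd a) (snd b) \<or>
     cube_before n m (fst b) (fst a) \<and> cell m (snd b) (snd a)" unfolding cp_compat_def by blast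
    then show "cp_compat n (cp_mul n x a) (cp_mul n x b)"
      using xy n cube_before_mul_left[of n m] cell_compose_right unfolding cp_compat_def cp_mul_def topspace_cp_space
      by (intro bexI[of _ m]) auto
  qed
qed

section \<open>Encoding decorated cubes in the type of cubes\<close>

lemma operadic_monoid_transport:
  assumes "operadic_monoid M mul e R"
    and inv: "\<And>x. x \<in> topspace M \<Longrightarrow> d (c x) = x"
  defines "M' \<equiv> pullback_topology (c ` topspace M) d M"
  shows "operadic_monoid M' (\<lambda>x y. c (mul (d x) (d y))) (c e) (\<lambda>x y. R (d x) (d y))"
    "continuous_map M' M d" "continuous_map M M' c" "topspace M' = c ` topspace M"
proof -
  interpret operadic_monoid M mul e R by fact
  show ts: "topspace M' = c ` topspace M"
    using inv by (auto simp: M'_def topspace_pullback_topology)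
  show d: "continuous_map M' M d"
    using continuous_map_pullback[OF continuous_map_id, of "c ` topspace M" d M] by (simp add: M'_def)
  show c: "continuous_map M M' c"
    unfolding M'_def
  proof (rule continuous_map_pullback')
    show "continuous_map M M (d \<circ> c)"
      by (rule continuous_map_eq[OF continuous_map_id]) (simp add: inv)
  qed auto
  have mul: "continuous_map (prod_topology M' M') M' (\<lambda>z. c (mul (d (fst z)) (d (snd z))))"
  proof -
    have "continuous_map (prod_topology M' M') (prod_topology M M) (\<lambda>z. (d (fst z), d (snd z)))"
      by (intro continuous_map_Pair continuous_map_o[OF _ d] continuous_map_fst continuous_map_snd)
    from continuous_map_o[OF continuous_map_o[OF this mul_cont] c] show ?thesis by simp
  qed
  show "operadic_monoid M' (\<lambda>x y. c (mul (d x) (d y))) (c e) (\<lambda>x y. R (d x) (d y))"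
    by standard (use mul in \<open>auto simp: ts inv mul_in case_prod_unfold mul_assoc e_in mul_e_left mul_e_right
       intro: R_sym R_left R_right\<close>)
qed

text \<open>Both components are packed into one function of the type required by
  \<open>E_operad\<close>. A TD-map is extensional, which leaves the arguments outside the cube free
  to store the progress function, with the time in the coordinate \<open>t 0\<close> that cubes do
  not have.\<close>

definition cp_encode :: "nat \<Rightarrow> cube_progress \<Rightarrow> (nat \<Rightarrow> real) \<Rightarrow> nat \<Rightarrow> real" where
  "cp_encode n x = (\<lambda>t. if t \<in> cube_set n then fst x t else (\<lambda>_. snd x (t 0)))"

text \<open>Away from coordinate 0 the argument has the entries \<open>undefined + 1\<close>. It is
  not extensional on \<open>{1..n}\<close> and therefore outside the cube, whatever the time
  \<open>s\<close> is.\<close>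

definition cp_decode :: "nat \<Rightarrow> ((nat \<Rightarrow> real) \<Rightarrow> nat \<Rightarrow> real) \<Rightarrow> cube_progress" where
  "cp_decode n y = (restrict y (cube_set n), \<lambda>s. y (\<lambda>i. if i = 0 then s else undefined + 1) 0)"

lemma cp_decode_encode:
  assumes "x \<in> topspace (cp_space n)"
  shows "cp_decode n (cp_encode n x) = x"
proof -
  have out: "(\<lambda>i. if i = 0 then s else undefined + 1) \<notin> cube_set n" for s :: real
  proof
    assume "(\<lambda>i. if i = 0 then s else undefined + 1) \<in> cube_set n"
    then have "(\<lambda>i. if i = 0 then s else undefined + 1) (Suc n) = (undefined :: real)"
      unfolding cube_set_eq by (rule PiE_arb) simp
    then show False by simp
  qed
  have "restrict (\<lambda>t. if t \<in> cube_set n then fst x t else (\<lambda>_. snd x (t 0))) (cube_set n) = fst x"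
    using TD_extensional[of n "fst x"] assms
    by (intro extensionalityI[of _ "cube_set n"]) (auto simp: topspace_cp_space)
  then show ?thesis using out by (simp add: cp_decode_def cp_encode_def prod_eq_iff)
qed

definition cpe_space :: "nat \<Rightarrow> ((nat \<Rightarrow> real) \<Rightarrow> nat \<Rightarrow> real) topology" where
  "cpe_space n = pullback_topology (cp_encode n ` topspace (cp_space n)) (cp_decode n) (cp_space n)"

definition cpe_mul where
  "cpe_mul n x y = cp_encode n (cp_mul n (cp_decode n x) (cp_decode n y))"

definition cpe_compat where
  "cpe_compat n x y = cp_compat n (cp_decode n x) (cp_decode n y)"

lemma operadic_monoid_cpe:
  assumes "n \<ge> 1"
  shows "operadic_monoid (cpe_space n) (cpe_mul n) (cp_encode n (cp_unit n)) (cpe_compat n)"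
    "continuous_map (cpe_space n) (cp_space n) (cp_decode n)"
    "continuous_map (cp_space n) (cpe_space n) (cp_encode n)"
    "topspace (cpe_space n) = cp_encode n ` topspace (cp_space n)"
  using operadic_monoid_transport[OF operadic_monoid_cp[OF assms], of "cp_decode n" "cp_encode n"] cp_decode_encode
  unfolding cpe_space_def cpe_mul_def[abs_def] cpe_compat_def[abs_def] by auto

definition cube_progress_operad :: "nat \<Rightarrow> cube_tuple operad" where
  "cube_progress_operad n = tuple_operad (cpe_space n) (cpe_mul n) (cp_encode n (cp_unit n)) (cpe_compat n)"

lemma topological_operad_cube_progress: "n \<ge> 1 \<Longrightarrow> topological_operad (cube_progress_operad n)"
  unfolding cube_progress_operad_def
  by (rule operadic_monoid.topological_operad[OF operadic_monoid_cpe(1)])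

lemma topological_operad_little_cubes: "n \<ge> 1 \<Longrightarrow> topological_operad (little_cubes n)"
  unfolding little_cubes_eq
  by (rule operadic_monoid.topological_operad[OF operadic_monoid_cubes])

definition forget_progress :: "nat \<Rightarrow> nat \<Rightarrow> cube_tuple \<Rightarrow> cube_tuple" where
  "forget_progress n k c = (\<lambda>i\<in>{1..k}. fst (cp_decode n (c i)))"

lemma forget_progress_morphism:
  assumes n: "n \<ge> 1"
  shows "operad_morphism (cube_progress_operad n) (little_cubes n) (forget_progress n)"
  unfolding cube_progress_operad_def little_cubes_eq forget_progress_def[abs_def]
proof (rule tuple_operad_morphism[OF operadic_monoid_cpe(1)[OF n] operadic_monoid_cubes[OF n]])
  show "continuous_map (cpe_space n) (TD_space n) (\<lambda>x. fst (cp_decode n x))"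
    using operadic_monoid_cpe(2)[OF n] unfolding cp_space_def by (rule continuous_map_fst_comp)
  interpret operadic_monoid "cp_space n" "cp_mul n" "cp_unit n" "cp_compat n" by (rule operadic_monoid_cp[OF n])
  fix x y assume "x \<in> topspace (cpe_space n)" "y \<in> topspace (cpe_space n)"
  then obtain x' y' where xy: "x = cp_encode n x'" "y = cp_encode n y'" "x' \<in> topspace (cp_space n)" "y' \<in> topspace (cp_space n)"
    unfolding operadic_monoid_cpe(4)[OF n] by blast
  then show "fst (cp_decode n (cpe_mul n x y)) = cube_compose n (fst (cp_decode n x)) (fst (cp_decode n y))"
    using mul_in by (simp add: cpe_mul_def cp_decode_encode) (simp add: cp_mul_def)
  assume "cpe_compat n x y"
  then show "cubes_disjoint n (fst (cp_decode n x)) (fst (cp_decode n y))"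
    using xy n by (auto simp: cpe_compat_def cp_compat_def cp_decode_encode topspace_cp_space cubes_disjoint_iff)
next
  show "fst (cp_decode n (cp_encode n (cp_unit n))) = cube_id n"
    using cp_decode_encode[of "cp_unit n" n] by (simp add: topspace_cp_space cp_unit_def TD_cube_id clamp01_progress)
qed

section \<open>A lifting criterion for weak equivalences\<close>

abbreviation boundary :: "nat \<Rightarrow> (nat \<Rightarrow> real) set" where
  "boundary \<equiv> unit_cube_boundary"

text \<open>Vanishing of all relative homotopy groups, stated as a compression criterion with a
  strict lift on the boundary. For \<open>N = 0\<close> the boundary is empty and the criterion
  gives surjectivity on path components.\<close>

definition rel_boundary_lifting :: "'a topology \<Rightarrow> 'b topology \<Rightarrow> ('a \<Rightarrow> 'b) \<Rightarrow> bool" where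
  "rel_boundary_lifting X Y f \<longleftrightarrow> (\<forall>N g b. continuous_map (unit_cube N) Y g \<longrightarrow>
     continuous_map (subtopology (unit_cube N) (boundary N)) X b \<longrightarrow>
     (\<forall>t\<in>boundary N. f (b t) = g t) \<longrightarrow>
     (\<exists>G. continuous_map (unit_cube N) X G \<and> (\<forall>t\<in>boundary N. G t = b t) \<and>
        homotopic_with (\<lambda>u. \<forall>t\<in>boundary N. u t = g t) (unit_cube N) Y g (f \<circ> G)))"

lemma rel_boundary_liftingE:
  assumes "rel_boundary_lifting X Y f" "continuous_map (unit_cube N) Y g"
    "continuous_map (subtopology (unit_cube N) (boundary N)) X b"
    "\<And>t. t \<in> boundary N \<Longrightarrow> f (b t) = g t"
  obtains G where "continuous_map (unit_cube N) X G" "\<forall>t\<in>boundary N. G t = b t"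
    "homotopic_with (\<lambda>u. \<forall>t\<in>boundary N. u t = g t) (unit_cube N) Y g (f \<circ> G)"
proof -
  have "\<exists>G. continuous_map (unit_cube N) X G \<and> (\<forall>t\<in>boundary N. G t = b t) \<and>
        homotopic_with (\<lambda>u. \<forall>t\<in>boundary N. u t = g t) (unit_cube N) Y g (f \<circ> G)"
    by (rule assms(1)[unfolded rel_boundary_lifting_def, rule_format, OF assms(2,3)]) (rule assms(4))
  then obtain G where "continuous_map (unit_cube N) X G \<and> (\<forall>t\<in>boundary N. G t = b t) \<and>
        homotopic_with (\<lambda>u. \<forall>t\<in>boundary N. u t = g t) (unit_cube N) Y g (f \<circ> G)" ..
  then show thesis by (intro that[of G]) blast+
qed

lemma boundary_subset: "boundary N \<subseteq> cube_set N"
  by (auto simp: unit_cube_boundary_def)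

lemma homotopic_with_boundary:
  "homotopic_with (\<lambda>u. \<forall>t\<in>boundary N. u t = b t) (unit_cube N) Y p q \<longleftrightarrow>
     (\<exists>h. continuous_map (prod_topology (top_of_set {0..1::real}) (unit_cube N)) Y h \<and>
        (\<forall>x\<in>cube_set N. h (0, x) = p x) \<and> (\<forall>x\<in>cube_set N. h (1, x) = q x) \<and>
        (\<forall>s\<in>{0..1}. \<forall>t\<in>boundary N. h (s, t) = b t))"
proof (rule homotopic_with)
  fix h k :: "(nat \<Rightarrow> real) \<Rightarrow> 'a"
  assume "\<And>x. x \<in> cube_set N \<Longrightarrow> h x = k x"
  then show "(\<forall>t\<in>boundary N. h t = b t) \<longleftrightarrow> (\<forall>t\<in>boundary N. k t = b t)"
    using boundary_subset[of N] by (metis subsetD)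
qed

lemma equiv_spheroid_homotopy: "equiv (spheroids q X x) (spheroid_homotopy q X x)"
proof (rule equivI)
  show "refl_on (spheroids q X x) (spheroid_homotopy q X x)"
    by (auto simp: refl_on_def spheroid_homotopy_def spheroids_def)
  show "sym (spheroid_homotopy q X x)"
    by (auto simp: sym_def spheroid_homotopy_def dest: homotopic_with_symD)
  show "trans (spheroid_homotopy q X x)"
    by (auto simp: trans_def spheroid_homotopy_def intro: homotopic_with_trans)
  show "spheroid_homotopy q X x \<subseteq> spheroids q X x \<times> spheroids q X x"
    by (auto simp: spheroid_homotopy_def)
qed

lemma restrict_in_cube: "t \<in> cube_set (Suc q) \<Longrightarrow> restrict t {1..q} \<in> cube_set q"
  by (auto simp: cube_set_eq PiE_iff)

lemma restrict_cube_continuous: "continuous_map (unit_cube (Suc q)) (unit_cube q) (\<lambda>t. restrict t {1..q})"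
proof (rule continuous_map_into_unit_cube)
  fix i assume i: "i \<in> {1..q}"
  then have "continuous_map (unit_cube (Suc q)) euclideanreal (\<lambda>t. t i)"
    by (intro continuous_map_cube_coord[OF continuous_map_ident]) auto
  then show "continuous_map (unit_cube (Suc q)) euclideanreal (\<lambda>t. restrict t {1..q} i)" using i by simp
qed (rule restrict_in_cube)

text \<open>A homotopy between the images is a map from the cube of one dimension more. Its boundary
  is lifted strictly by \<open>G0\<close> on the bottom, \<open>G1\<close> on the top and a constant
  homotopy on the sides; a lift of the whole cube is the required homotopy.\<close>

lemma lift_homotopy:
  assumes lift: "rel_boundary_lifting X Y f"
    and G0: "continuous_map (unit_cube q) X G0" and G1: "continuous_map (unit_cube q) X G1"
    and eq: "\<And>t. t \<in> boundary q \<Longrightarrow> G1 t = G0 t"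
    and h: "homotopic_with (\<lambda>u. \<forall>t\<in>boundary q. u t = f (G0 t)) (unit_cube q) Y (f \<circ> G0) (f \<circ> G1)"
  shows "homotopic_with (\<lambda>u. \<forall>t\<in>boundary q. u t = G0 t) (unit_cube q) X G0 G1"
proof -
  obtain h where h: "continuous_map (prod_topology (top_of_set {0..1::real}) (unit_cube q)) Y h"
    "\<And>x. x \<in> cube_set q \<Longrightarrow> h (0, x) = f (G0 x)" "\<And>x. x \<in> cube_set q \<Longrightarrow> h (1, x) = f (G1 x)"
    "\<And>s t. s \<in> {0..1} \<Longrightarrow> t \<in> boundary q \<Longrightarrow> h (s, t) = f (G0 t)"
    using h unfolding homotopic_with_boundary by auto
  let ?r = "\<lambda>t::nat \<Rightarrow> real. restrict t {1..q}" and ?Q = "Suc q"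
  define g where "g t = h (t ?Q, ?r t)" for t :: "nat \<Rightarrow> real"
  \<comment> \<open>The last coordinate is the homotopy parameter. On the sides \<open>G0\<close>
    and \<open>G1\<close> agree, so the switch at 1/2 is continuous there.\<close>
  define b where "b t = (if t ?Q \<le> 1/2 then G0 (?r t) else G1 (?r t))" for t :: "nat \<Rightarrow> real"
  have last: "continuous_map (unit_cube ?Q) (top_of_set {0..1::real}) (\<lambda>t. t ?Q)"
    unfolding unit_cube_def by (rule continuous_map_product_projection) simp
  have lastR: "continuous_map (unit_cube ?Q) euclideanreal (\<lambda>t. t ?Q)"
    using last by (rule continuous_map_into_fulltopology)
  have g: "continuous_map (unit_cube ?Q) Y g"
    unfolding g_def by (rule continuous_map_o[OF continuous_map_Pair[OF last restrict_cube_continuous] h(1)])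
  have side: "?r t \<in> boundary q" if tb: "t \<in> boundary ?Q" "t ?Q \<noteq> 0" "t ?Q \<noteq> 1" for t
  proof -
    obtain i where i: "i \<in> {1..?Q}" "t i = 0 \<or> t i = 1" using tb by (auto simp: unit_cube_boundary_def)
    then have "i \<noteq> ?Q" using tb by auto
    then have "i \<in> {1..q}" using i by auto
    then show ?thesis using i tb restrict_in_cube by (auto simp: unit_cube_boundary_def intro!: bexI[of _ i])
  qed
  let ?B = "subtopology (unit_cube ?Q) (boundary ?Q)"
  have tB: "topspace ?B = boundary ?Q" using boundary_subset[of ?Q] by auto
  have b: "continuous_map ?B X b"
    unfolding b_def
  proof (rule continuous_map_cases_le)
    show "continuous_map ?B euclideanreal (\<lambda>t. t ?Q)" by (rule continuous_map_from_subtopology[OF lastR])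
    show "continuous_map (subtopology ?B {x \<in> topspace ?B. x ?Q \<le> 1/2}) X (\<lambda>t. G0 (?r t))"
      by (intro continuous_map_from_subtopology continuous_map_o[OF restrict_cube_continuous G0])
    show "continuous_map (subtopology ?B {x \<in> topspace ?B. 1/2 \<le> x ?Q}) X (\<lambda>t. G1 (?r t))"
      by (intro continuous_map_from_subtopology continuous_map_o[OF restrict_cube_continuous G1])
    fix t assume "t \<in> topspace ?B" "t ?Q = 1/2"
    then show "G0 (?r t) = G1 (?r t)" using side[of t] eq unfolding tB by simp
  qed simp
  have fb: "f (b t) = g t" if t: "t \<in> boundary ?Q" for t
  proof -
    have tc: "t \<in> cube_set ?Q" "?r t \<in> cube_set q" using t boundary_subset restrict_in_cube by blast+
    have t01: "t ?Q \<in> {0..1}" using tc(1) by (auto simp: cube_set_eq PiE_iff)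
    consider "t ?Q = 0" | "t ?Q = 1" | "?r t \<in> boundary q" using side[OF t] by blast
    then show ?thesis
    proof cases
      case 3 then show ?thesis using h(4)[OF t01 3] eq[OF 3] by (simp add: b_def g_def)
    qed (use h(2,3) tc in \<open>simp_all add: b_def g_def\<close>)
  qed
  obtain G where G: "continuous_map (unit_cube ?Q) X G" "\<forall>t\<in>boundary ?Q. G t = b t"
    by (rule rel_boundary_liftingE[OF lift g b fb])
  define e where "e = (\<lambda>z::real \<times> (nat \<Rightarrow> real). \<lambda>i\<in>{1..?Q}. if i = ?Q then fst z else snd z i)"
  have e_in: "e z \<in> cube_set ?Q" if "fst z \<in> {0..1}" "snd z \<in> cube_set q" for z
  proof -
    have "e z i \<in> {0..1}" if "i \<in> {1..?Q}" for i
    proof (cases "i = ?Q")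
      case False
      then have "i \<in> {1..q}" using that by auto
      then have "snd z i \<in> {0..1}" using \<open>snd z \<in> cube_set q\<close> unfolding cube_set_eq by (rule PiE_mem[rotated])
      then show ?thesis using that False by (simp add: e_def)
    qed (use that \<open>fst z \<in> {0..1}\<close> in \<open>simp add: e_def\<close>)
    then show ?thesis unfolding cube_set_eq by (simp add: e_def PiE_iff)
  qed
  let ?P = "prod_topology (top_of_set {0..1::real}) (unit_cube q)"
  have ec: "continuous_map ?P (unit_cube ?Q) e"
  proof (rule continuous_map_into_unit_cube)
    fix i assume i: "i \<in> {1..?Q}"
    show "continuous_map ?P euclideanreal (\<lambda>z. e z i)"
    proof (cases "i = ?Q")
      case True
      then show ?thesis using i continuous_map_into_fulltopology[OF continuous_map_fst] by (simp add: e_def)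
    next
      case False
      then have "i \<in> {1..q}" using i by auto
      then show ?thesis using i False continuous_map_cube_coord[OF continuous_map_snd] by (simp add: e_def)
    qed
  qed (use e_in in auto)
  have re: "?r (e z) = snd z" if "snd z \<in> cube_set q" for z
    using that by (intro extensionalityI[of _ "{1..q}"]) (auto simp: e_def cube_set_eq PiE_iff)
  have eQ: "e z ?Q = fst z" for z by (simp add: e_def)
  have e_bd: "e z \<in> boundary ?Q" if zb: "fst z \<in> {0..1}" "snd z \<in> cube_set q" "fst z = 0 \<or> fst z = 1 \<or> snd z \<in> boundary q" for z
  proof -
    have "\<exists>i\<in>{1..?Q}. e z i = 0 \<or> e z i = 1"
    proof (cases "fst z = 0 \<or> fst z = 1")
      case True then show ?thesis using eQ[of z] by (intro bexI[of _ ?Q]) auto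
    next
      case False
      then obtain i where "i \<in> {1..q}" "snd z i = 0 \<or> snd z i = 1" using zb by (auto simp: unit_cube_boundary_def)
      then show ?thesis by (intro bexI[of _ i]) (auto simp: e_def)
    qed
    then show ?thesis using e_in[OF zb(1,2)] by (simp add: unit_cube_boundary_def)
  qed
  show ?thesis
    unfolding homotopic_with_boundary
  proof (intro exI[of _ "\<lambda>z. G (e z)"] conjI ballI)
    show "continuous_map ?P X (\<lambda>z. G (e z))" by (rule continuous_map_o[OF ec G(1)])
    show "G (e (0, x)) = G0 x" if "x \<in> cube_set q" for x
      using G(2)[rule_format, OF e_bd[of "(0, x)"]] that re[of "(0,x)"] eQ[of "(0,x)"] by (simp add: b_def)
    show "G (e (1, x)) = G1 x" if "x \<in> cube_set q" for x
      using G(2)[rule_format, OF e_bd[of "(1, x)"]] that re[of "(1,x)"] eQ[of "(1,x)"] by (simp add: b_def)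
    show "G (e (s, t)) = G0 t" if "s \<in> {0..1}" "t \<in> boundary q" for s t
    proof -
      have tc: "t \<in> cube_set q" using that boundary_subset by blast
      then show ?thesis using G(2)[rule_format, OF e_bd[of "(s, t)"]] that re[of "(s,t)"] eq[OF that(2)] by (simp add: b_def)
    qed
  qed
qed

lemma lifting_components:
  assumes cont: "continuous_map X Y f" and lift: "rel_boundary_lifting X Y f"
  shows "bij_betw (\<lambda>C. \<Union>x\<in>C. path_component_of_set Y (f x)) (path_components_of X) (path_components_of Y)"
proof -
  let ?F = "\<lambda>C. \<Union>x\<in>C. path_component_of_set Y (f x)"
  have F: "?F (path_component_of_set X x) = path_component_of_set Y (f x)" if x: "x \<in> topspace X" for x
  proof (intro equalityI subsetI)
    fix y assume "y \<in> ?F (path_component_of_set X x)"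
    then obtain x' where x': "path_component_of X x x'" "path_component_of Y (f x') y" by auto
    then show "y \<in> path_component_of_set Y (f x)"
      using path_component_of_trans[OF path_component_of_continuous_image[OF cont x'(1)] x'(2)] by simp
  next
    fix y assume "y \<in> path_component_of_set Y (f x)"
    moreover have "x \<in> path_component_of_set X x" using x by (simp add: path_component_of_refl)
    ultimately show "y \<in> ?F (path_component_of_set X x)" by blast
  qed
  \<comment> \<open>The 0-cube consists of this one point and has empty boundary. A path is a
    homotopy between maps from it, so injectivity on path components is \<open>lift_homotopy\<close>
    for \<open>q = 0\<close>.\<close>
  let ?pt = "\<lambda>i::nat. undefined::real"
  have pt: "cube_set 0 = {?pt}" by (simp add: cube_set_eq)
  have bd0: "boundary 0 = {}" by (auto simp: unit_cube_boundary_def)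
  have inj: "path_component_of X x0 x1"
    if x: "x0 \<in> topspace X" "x1 \<in> topspace X" and p: "path_component_of Y (f x0) (f x1)" for x0 x1
  proof -
    obtain \<gamma> where \<gamma>: "continuous_map (top_of_set {0..1::real}) Y \<gamma>" "\<gamma> 0 = f x0" "\<gamma> 1 = f x1"
      using p unfolding path_component_of_def pathin_def by blast
    have "homotopic_with (\<lambda>u. \<forall>t\<in>boundary 0. u t = f x0) (unit_cube 0) Y (f \<circ> (\<lambda>_. x0)) (f \<circ> (\<lambda>_. x1))"
      unfolding homotopic_with_boundary
      by (rule exI[of _ "\<lambda>z. \<gamma> (fst z)"])
        (use \<gamma> continuous_map_o[OF continuous_map_fst \<gamma>(1)] in \<open>simp add: bd0\<close>)
    then have "homotopic_with (\<lambda>u. \<forall>t\<in>boundary 0. u t = x0) (unit_cube 0) X (\<lambda>_. x0) (\<lambda>_. x1)"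
      by (intro lift_homotopy[OF lift]) (use x bd0 in simp_all)
    then obtain h where h: "continuous_map (prod_topology (top_of_set {0..1::real}) (unit_cube 0)) X h"
      "h (0, ?pt) = x0" "h (1, ?pt) = x1"
      unfolding homotopic_with_boundary using pt by auto
    have "continuous_map (top_of_set {0..1::real}) (prod_topology (top_of_set {0..1::real}) (unit_cube 0)) (\<lambda>s. (s, ?pt))"
      using pt by (intro continuous_map_Pair) (simp_all add: continuous_map_ident)
    from continuous_map_o[OF this h(1)] show ?thesis
      unfolding path_component_of_def pathin_def using h by blast
  qed
  have surj: "\<exists>x\<in>topspace X. path_component_of Y (f x) y" if y: "y \<in> topspace Y" for y
  proof -
    have 1: "continuous_map (subtopology (unit_cube 0) (boundary 0)) X (\<lambda>_. undefined)"
      using bd0 by (simp add: continuous_map_def)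
    have 2: "continuous_map (unit_cube 0) Y (\<lambda>_. y)" using y by simp
    have 3: "\<And>t. t \<in> boundary 0 \<Longrightarrow> f undefined = y" using bd0 by simp
    obtain G where G: "continuous_map (unit_cube 0) X G" "\<forall>t\<in>boundary 0. G t = undefined"
      "homotopic_with (\<lambda>u. \<forall>t\<in>boundary 0. u t = y) (unit_cube 0) Y (\<lambda>_. y) (f \<circ> G)"
      by (rule rel_boundary_liftingE[OF lift 2 1 3])
    obtain h where h: "continuous_map (prod_topology (top_of_set {0..1::real}) (unit_cube 0)) Y h"
      "h (0, ?pt) = y" "h (1, ?pt) = f (G ?pt)"
      using G(3) unfolding homotopic_with_boundary using pt by auto
    have "continuous_map (top_of_set {0..1::real}) (prod_topology (top_of_set {0..1::real}) (unit_cube 0)) (\<lambda>s. (s, ?pt))"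
      using pt by (intro continuous_map_Pair) (simp_all add: continuous_map_ident)
    from continuous_map_o[OF this h(1)] have "path_component_of Y y (f (G ?pt))"
      unfolding path_component_of_def pathin_def using h by blast
    moreover have "G ?pt \<in> topspace X" using G(1) pt by (auto simp: continuous_map_def)
    ultimately show ?thesis by (intro bexI[of _ "G ?pt"]) (rule path_component_of_sym)
  qed
  have fin: "f x \<in> topspace Y" if "x \<in> topspace X" for x using cont that by (auto simp: continuous_map_def)
  show ?thesis
    unfolding bij_betw_def
  proof (intro conjI inj_onI)
    fix C D assume C: "C \<in> path_components_of X" and D: "D \<in> path_components_of X" and eq: "?F C = ?F D"
    obtain x0 where x0: "x0 \<in> topspace X" "C = path_component_of_set X x0" using C by (auto simp: path_components_of_def)
    obtain x1 where x1: "x1 \<in> topspace X" "D = path_component_of_set X x1" using D by (auto simp: path_components_of_def)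
    have "path_component_of_set Y (f x0) = path_component_of_set Y (f x1)"
      using eq F[OF x0(1)] F[OF x1(1)] unfolding x0(2) x1(2) by simp
    moreover have "f x1 \<in> path_component_of_set Y (f x1)" using fin[OF x1(1)] by (simp add: path_component_of_refl)
    ultimately have "path_component_of Y (f x0) (f x1)" by blast
    then have "path_component_of X x0 x1" by (rule inj[OF x0(1) x1(1)])
    then show "C = D" unfolding x0(2) x1(2) by (simp add: path_component_of_equiv)
  next
    show "?F ` path_components_of X = path_components_of Y"
    proof (intro equalityI subsetI)
      fix D assume "D \<in> ?F ` path_components_of X"
      then show "D \<in> path_components_of Y" using F fin by (auto simp: path_components_of_def)
    next
      fix D assume "D \<in> path_components_of Y"
      then obtain y where y: "y \<in> topspace Y" "D = path_component_of_set Y y" by (auto simp: path_components_of_def)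
      obtain x where x: "x \<in> topspace X" "path_component_of Y (f x) y" using surj[OF y(1)] by blast
      then have "D = ?F (path_component_of_set X x)" using F y by (simp add: path_component_of_equiv)
      then show "D \<in> ?F ` path_components_of X" using x(1) by (auto simp: path_components_of_def)
    qed
  qed
qed

text \<open>Injectivity is \<open>lift_homotopy\<close>; surjectivity lifts a spheroid, starting
  from the constant lift on the boundary.\<close>

lemma lifting_homotopy_groups:
  assumes cont: "continuous_map X Y f" and lift: "rel_boundary_lifting X Y f" and x: "x \<in> topspace X"
  shows "bij_betw (homotopy_group_map q Y (f x) f) (homotopy_group q X x) (homotopy_group q Y (f x))"
proof -
  let ?SX = "spheroids q X x" and ?SY = "spheroids q Y (f x)"
  let ?RX = "spheroid_homotopy q X x" and ?RY = "spheroid_homotopy q Y (f x)"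
  let ?F = "homotopy_group_map q Y (f x) f"
  note eX = equiv_spheroid_homotopy[of q X x] and eY = equiv_spheroid_homotopy[of q Y "f x"]
  have post: "f \<circ> G \<in> ?SY" if "G \<in> ?SX" for G
    using that continuous_map_compose[OF _ cont] by (auto simp: spheroids_def)
  have resp: "(f \<circ> G, f \<circ> G') \<in> ?RY" if "(G, G') \<in> ?RX" for G G'
    using that post homotopic_with_compose_continuous_map_left[OF _ cont]
    by (fastforce simp: spheroid_homotopy_def)
  have F: "?F (?RX `` {G}) = ?RY `` {f \<circ> G}" if G: "G \<in> ?SX" for G
  proof (intro equalityI subsetI)
    fix u assume "u \<in> ?F (?RX `` {G})"
    then obtain G' where G': "(G, G') \<in> ?RX" "(f \<circ> G', u) \<in> ?RY" by (auto simp: homotopy_group_map_def)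
    then show "u \<in> ?RY `` {f \<circ> G}" using resp[OF G'(1)] eY unfolding equiv_def trans_def by blast
  next
    fix u assume "u \<in> ?RY `` {f \<circ> G}"
    moreover have "(G, G) \<in> ?RX" using eX G unfolding equiv_def refl_on_def by blast
    ultimately show "u \<in> ?F (?RX `` {G})" by (auto simp: homotopy_group_map_def)
  qed
  show ?thesis
    unfolding bij_betw_def homotopy_group_def
  proof (intro conjI inj_onI)
    fix C D assume C: "C \<in> ?SX // ?RX" and D: "D \<in> ?SX // ?RX" and eq: "?F C = ?F D"
    obtain G0 where G0: "G0 \<in> ?SX" "C = ?RX `` {G0}" using C by (rule quotientE)
    obtain G1 where G1: "G1 \<in> ?SX" "D = ?RX `` {G1}" using D by (rule quotientE)
    have "(f \<circ> G0, f \<circ> G1) \<in> ?RY"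
      using eq eq_equiv_class[OF _ eY post[OF G1(1)]] unfolding G0(2) G1(2) F[OF G0(1)] F[OF G1(1)] by blast
    then have "homotopic_with (\<lambda>u. \<forall>t\<in>boundary q. u t = f x) (unit_cube q) Y (f \<circ> G0) (f \<circ> G1)"
      by (simp add: spheroid_homotopy_def)
    then have "homotopic_with (\<lambda>u. \<forall>t\<in>boundary q. u t = f (G0 t)) (unit_cube q) Y (f \<circ> G0) (f \<circ> G1)"
      using G0 by (simp add: spheroids_def cong: ball_cong)
    then have "homotopic_with (\<lambda>u. \<forall>t\<in>boundary q. u t = G0 t) (unit_cube q) X G0 G1"
      by (intro lift_homotopy[OF lift]) (use G0 G1 in \<open>auto simp: spheroids_def\<close>)
    then have "homotopic_with (\<lambda>u. \<forall>t\<in>boundary q. u t = x) (unit_cube q) X G0 G1"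
      using G0 by (simp add: spheroids_def cong: ball_cong)
    then have "(G0, G1) \<in> ?RX" using G0 G1 by (simp add: spheroid_homotopy_def)
    then show "C = D" unfolding G0(2) G1(2) using equiv_class_eq[OF eX] by blast
  next
    show "?F ` (?SX // ?RX) = ?SY // ?RY"
    proof (intro equalityI subsetI)
      fix D assume "D \<in> ?F ` (?SX // ?RX)"
      then show "D \<in> ?SY // ?RY" using F post by (auto elim!: quotientE intro!: quotientI)
    next
      fix D assume "D \<in> ?SY // ?RY"
      then obtain g where g: "g \<in> ?SY" "D = ?RY `` {g}" by (rule quotientE)
      have 1: "continuous_map (subtopology (unit_cube q) (boundary q)) X (\<lambda>_. x)" using x by simp
      have 2: "continuous_map (unit_cube q) Y g" and 3: "\<And>t. t \<in> boundary q \<Longrightarrow> f x = g t"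
        using g by (auto simp: spheroids_def)
      obtain G where G: "continuous_map (unit_cube q) X G" "\<forall>t\<in>boundary q. G t = x"
        "homotopic_with (\<lambda>u. \<forall>t\<in>boundary q. u t = g t) (unit_cube q) Y g (f \<circ> G)"
        by (rule rel_boundary_liftingE[OF lift 2 1 3])
      have GS: "G \<in> ?SX" using G by (simp add: spheroids_def)
      have "homotopic_with (\<lambda>u. \<forall>t\<in>boundary q. u t = f x) (unit_cube q) Y g (f \<circ> G)"
        using G(3) g by (simp add: spheroids_def cong: ball_cong)
      then have "(g, f \<circ> G) \<in> ?RY" using g post[OF GS] by (simp add: spheroid_homotopy_def)
      then have "D = ?F (?RX `` {G})" unfolding g(2) F[OF GS] using equiv_class_eq[OF eY] by blast
      then show "D \<in> ?F ` (?SX // ?RX)" using GS by (auto intro!: quotientI)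
    qed
  qed
qed

lemma weak_homotopy_equivalence_if_lifting:
  assumes "continuous_map X Y f" "rel_boundary_lifting X Y f"
  shows "weak_homotopy_equivalence X Y f"
  unfolding weak_homotopy_equivalence_def
  using assms lifting_components[OF assms] lifting_homotopy_groups[OF assms] by blast

section \<open>Contracting progress functions\<close>

text \<open>The prefix: in the first half of the time the labels are processed one after the other, in
  the order given by their places \<open>s\<close>, up to total amount \<open>k * \<mu>\<close>; then \<open>p\<close> takes over, skipping
  what has been done already.\<close>

definition prefix :: "nat \<Rightarrow> real \<Rightarrow> real \<Rightarrow> real \<Rightarrow> (real \<Rightarrow> real) \<Rightarrow> real \<Rightarrow> real" where
  "prefix k \<theta> \<mu> s p t = max (clamp01 (real k * min \<mu> (2 * t) - s)) (p ((1 + \<theta>) * t - \<theta>))"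

text \<open>Waits for the fraction \<open>\<theta> / (1 + \<theta>)\<close> of the time and then
  runs uniformly to the end. It is what remains of \<open>prefix\<close> when \<mu> = 0.\<close>

definition delay :: "real \<Rightarrow> real \<Rightarrow> real" where
  "delay \<theta> t = clamp01 ((1 + \<theta>) * t - \<theta>)"

lemma clamp01_mono: "x \<le> y \<Longrightarrow> clamp01 x \<le> clamp01 y"
  by (auto simp: clamp01_def)

lemma clamp01_eq_0: "x \<le> 0 \<Longrightarrow> clamp01 x = 0"
  by (auto simp: clamp01_def)

lemma clamp01_eq_1: "x \<ge> 1 \<Longrightarrow> clamp01 x = 1"
  by (auto simp: clamp01_def)

lemma affine_time:
  fixes t \<theta> :: real
  assumes "0 \<le> \<theta>"
  shows "t \<le> 0 \<Longrightarrow> (1 + \<theta>) * t - \<theta> \<le> 0" "t \<ge> 1 \<Longrightarrow> (1 + \<theta>) * t - \<theta> \<ge> 1"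
proof -
  have eq: "(1 + \<theta>) * t - \<theta> = t + \<theta> * (t - 1)" by (simp add: algebra_simps)
  show "t \<le> 0 \<Longrightarrow> (1 + \<theta>) * t - \<theta> \<le> 0"
    unfolding eq using assms mult_nonneg_nonpos[of \<theta> "t - 1"] by linarith
  show "t \<ge> 1 \<Longrightarrow> (1 + \<theta>) * t - \<theta> \<ge> 1"
    unfolding eq using assms mult_nonneg_nonneg[of \<theta> "t - 1"] by linarith
qed

lemma delay_progress:
  assumes "0 \<le> \<theta>"
  shows "delay \<theta> \<in> progress"
proof -
  have "mono (delay \<theta>)"
    unfolding mono_def delay_def using assms by (auto intro!: clamp01_mono mult_left_mono)
  moreover have "continuous_on UNIV (delay \<theta>)"
    unfolding delay_def clamp01_def by (intro continuous_intros)
  ultimately show ?thesis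
    using affine_time[OF assms] by (auto simp: progress_def delay_def clamp01_eq_0 clamp01_eq_1)
qed

lemma prefix_progress:
  assumes p: "p \<in> progress" and nn: "0 \<le> \<theta>" "0 \<le> \<mu>" "0 \<le> s"
  shows "prefix k \<theta> \<mu> s p \<in> progress"
proof -
  have "mono (prefix k \<theta> \<mu> s p)"
    unfolding mono_def prefix_def
  proof (intro allI impI max.mono)
    fix x y :: real assume "x \<le> y"
    then have "min \<mu> (2 * x) \<le> min \<mu> (2 * y)" by auto
    then show "clamp01 (real k * min \<mu> (2 * x) - s) \<le> clamp01 (real k * min \<mu> (2 * y) - s)"
      by (intro clamp01_mono diff_right_mono mult_left_mono) auto
    show "p ((1 + \<theta>) * x - \<theta>) \<le> p ((1 + \<theta>) * y - \<theta>)"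
      using \<open>x \<le> y\<close> nn by (intro progressD(5)[OF p] diff_right_mono mult_left_mono) auto
  qed
  moreover have "continuous_on UNIV (prefix k \<theta> \<mu> s p)"
  proof -
    have "continuous_on UNIV (\<lambda>t. p ((1 + \<theta>) * t - \<theta>))"
      by (rule continuous_on_compose2[OF progressD(2)[OF p]]) (auto intro!: continuous_intros)
    then show ?thesis unfolding prefix_def[abs_def] clamp01_def by (intro continuous_intros)
  qed
  moreover have "prefix k \<theta> \<mu> s p t = 0" if "t \<le> 0" for t
  proof -
    have "real k * min \<mu> (2 * t) \<le> 0" using that by (simp add: mult_nonneg_nonpos)
    then have "clamp01 (real k * min \<mu> (2 * t) - s) = 0" using nn by (intro clamp01_eq_0) linarith
    then show ?thesis
      using affine_time(1)[OF nn(1) that] progressD(3)[OF p] by (simp add: prefix_def)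
  qed
  moreover have "prefix k \<theta> \<mu> s p t = 1" if "t \<ge> 1" for t
    using affine_time(2)[OF nn(1) that] progressD(4)[OF p] clamp01_bounds by (simp add: prefix_def)
  ultimately show ?thesis by (auto simp: progress_def)
qed

lemma prefix_0:
  assumes "p \<in> progress" "0 \<le> s"
  shows "prefix k \<theta> 0 s p = p \<circ> delay \<theta>"
proof
  fix t
  have "real k * min 0 (2 * t) \<le> 0" by (simp add: mult_nonneg_nonpos)
  then show "prefix k \<theta> 0 s p t = (p \<circ> delay \<theta>) t"
    using assms progress_bounds[OF assms(1)] progress_clamp[OF assms(1)]
    by (simp add: prefix_def delay_def clamp01_eq_0)
qed

text \<open>For \<theta> = \<mu> = 1 the prefix finishes the label within the first half of the
  time, while the delayed function is still 0. The original function leaves no trace, and this is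
  the source of the contraction.\<close>

lemma prefix_1:
  assumes "p \<in> progress" "q \<in> progress" "0 \<le> s" "s + 1 \<le> real k"
  shows "prefix k 1 1 s p = prefix k 1 1 s q"
proof
  fix t
  show "prefix k 1 1 s p t = prefix k 1 1 s q t"
  proof (cases "2 * t \<le> 1")
    case True
    then show ?thesis using progressD(3)[OF assms(1)] progressD(3)[OF assms(2)] by (simp add: prefix_def)
  next
    case False
    then show ?thesis
      using assms progress_bounds[OF assms(1)] progress_bounds[OF assms(2)] by (simp add: prefix_def clamp01_eq_1)
  qed
qed

text \<open>If the budget \<open>k * \<mu>\<close> suffices for the first label, that label is
  finished before the second one starts, so a single change is enough.\<close>

lemma cell_prefix_early:
  assumes p: "p \<in> progress" and q: "q \<in> progress" and \<mu>: "0 \<le> \<mu>" "\<mu> \<le> 1" and s: "0 \<le> s" "s + 1 \<le> s'"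
    and k: "s + 1 \<le> real k * \<mu>"
  shows "cell 1 (prefix k 1 \<mu> s p) (prefix k 1 \<mu> s' q)"
proof -
  let ?f = "prefix k 1 \<mu> s p" and ?g = "prefix k 1 \<mu> s' q"
  have f: "?f \<in> progress" and g: "?g \<in> progress" using assms by (auto intro!: prefix_progress)
  have k0: "real k > 0" using k s by (cases "k = 0") auto
  \<comment> \<open>The time at which the first label is just finished: the total amount processed
    is then \<open>2 * k * u = s + 1 \<le> s'\<close>.\<close>
  define u where "u = (s + 1) / (2 * real k)"
  have u2: "2 * u = (s + 1) / real k" using k0 by (simp add: u_def field_simps)
  have u\<mu>: "2 * u \<le> \<mu>" unfolding u2 using k k0 by (simp add: divide_le_eq mult.commute)
  have u0: "0 \<le> u" using s k0 by (simp add: u_def)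
  have ku: "real k * (2 * u) = s + 1" unfolding u2 using k0 by simp
  have g0: "?g u = ?g 0"
  proof -
    have "?g u = 0" using u\<mu> ku s \<mu> progressD(3)[OF q] by (simp add: prefix_def clamp01_eq_0)
    then show ?thesis using progressD(3)[OF g] by simp
  qed
  have f1: "?f u = ?f 1"
  proof -
    have "?f u \<ge> clamp01 (real k * min \<mu> (2 * u) - s)" by (simp add: prefix_def)
    moreover have "clamp01 (real k * min \<mu> (2 * u) - s) = 1" using u\<mu> ku by (simp add: clamp01_def)
    ultimately have "?f u = 1" using progress_bounds(2)[OF f, of u] by simp
    then show ?thesis using progressD(4)[OF f] by simp
  qed
  show ?thesis
    unfolding cell_def
  proof (rule exI[of _ "\<lambda>r. if r = 0 then 0 else if r = 1 then u else 1"], intro conjI allI impI)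
    fix r :: nat assume "r \<le> 1"
    then have "r = 0 \<or> r = 1" by auto
    then show "(if r = 0 then 0 else if r = 1 then u else 1) \<le> (if Suc r = 0 then 0 else if Suc r = 1 then u else 1)"
      using u0 u\<mu> \<mu> by auto
    show "if even r
        then ?g (if r = 0 then 0 else if r = 1 then u else 1) = ?g (if Suc r = 0 then 0 else if Suc r = 1 then u else 1)
        else ?f (if r = 0 then 0 else if r = 1 then u else 1) = ?f (if Suc r = 0 then 0 else if Suc r = 1 then u else 1)"
      using \<open>r = 0 \<or> r = 1\<close> g0 f1 by auto
  qed auto
qed

text \<open>If the budget does not finish the first label, it does not reach the second one, whose
  place is at least \<open>s + 1\<close>. Then the second function is only delayed and the first is,
  from time 1/2 on, a maximum with a constant, so the old cuts can be transported.\<close>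

lemma cell_prefix:
  assumes c: "cell m p q" and m: "1 \<le> m" and p: "p \<in> progress" and q: "q \<in> progress"
    and \<mu>: "0 \<le> \<mu>" "\<mu> \<le> 1" and s: "0 \<le> s" "s + 1 \<le> s'"
  shows "cell m (prefix k 1 \<mu> s p) (prefix k 1 \<mu> s' q)"
proof (cases "s + 1 \<le> real k * \<mu>")
  case True
  have "prefix k 1 \<mu> s p \<in> progress" "prefix k 1 \<mu> s' q \<in> progress"
    using assms by (auto intro!: prefix_progress)
  then show ?thesis using cell_mono(1)[OF cell_prefix_early[OF p q \<mu> s True]] m by blast
next
  case False
  obtain t where t: "t 0 \<le> 0" "1 \<le> t (Suc m)"
    "\<And>r. r \<le> m \<Longrightarrow> t r \<le> t (Suc r) \<and>
      (if even r then q (t r) = q (t (Suc r)) else p (t r) = p (t (Suc r)))"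
    using c unfolding cell_def by blast
  \<comment> \<open>All cuts move to the second half of the time except the first, which is put at
    0. The first interval thus absorbs the prefix, and only the second function has to be constant
    on it.\<close>
  define T where "T r = (if r = 0 then 0 else (clamp01 (t r) + 1) / 2)" for r
  have Q: "prefix k 1 \<mu> s' q (T r) = q (t r)" for r
  proof -
    have "real k * min \<mu> (2 * T r) \<le> real k * \<mu>" by (intro mult_left_mono) auto
    then have "real k * min \<mu> (2 * T r) - s' \<le> 0" using False s by linarith
    then have "prefix k 1 \<mu> s' q (T r) = q (2 * T r - 1)"
      using progress_bounds[OF q] by (simp add: prefix_def clamp01_eq_0)
    moreover have "2 * T r - 1 = clamp01 (t r)" if "r \<noteq> 0" using that by (simp add: T_def field_simps)
    ultimately show ?thesis using t(1) progress_clamp[OF q, of "t r"] progressD(3)[OF q]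
      by (cases "r = 0") (simp_all add: T_def)
  qed
  have P: "prefix k 1 \<mu> s p (T r) = max (clamp01 (real k * \<mu> - s)) (p (t r))" if "r \<noteq> 0" for r
  proof -
    have "min \<mu> (2 * T r) = \<mu>" using that \<mu> clamp01_bounds(1)[of "t r"] by (simp add: T_def)
    moreover have "2 * T r - 1 = clamp01 (t r)" using that by (simp add: T_def field_simps)
    ultimately show ?thesis using progress_clamp[OF p, of "t r"] by (simp add: prefix_def)
  qed
  show ?thesis
    unfolding cell_def
  proof (rule exI[of _ T], intro conjI allI impI)
    show "T 0 \<le> 0" by (simp add: T_def)
    show "1 \<le> T (Suc m)" using t(2) by (simp add: T_def clamp01_eq_1)
    fix r assume r: "r \<le> m"
    show "T r \<le> T (Suc r)"
      using t(3)[OF r] clamp01_mono[of "t r" "t (Suc r)"] clamp01_bounds(1)[of "t (Suc r)"] by (auto simp: T_def)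
    show "if even r then prefix k 1 \<mu> s' q (T r) = prefix k 1 \<mu> s' q (T (Suc r))
        else prefix k 1 \<mu> s p (T r) = prefix k 1 \<mu> s p (T (Suc r))"
    proof (cases "even r")
      case True then show ?thesis using t(3)[OF r] by (simp add: Q)
    next
      case False
      then have "r \<noteq> 0" by (cases r) auto
      then show ?thesis using t(3)[OF r] False by (simp add: P)
    qed
  qed
qed

section \<open>Scales\<close>

text \<open>At a scale \<open>a\<close> that is free, i.e. when no coordinate difference lies between \<open>lo a\<close> and \<open>hi a\<close>,
  being close is transitive in every coordinate. Then the points are linearly ordered by comparing
  the last coordinate in which they are not close. Among more scales than there are differences
  one is free.\<close>

locale scales =
  fixes n k :: nat and \<delta> :: real
  assumes \<delta>: "\<delta> > 0"
begin

text \<open>Since \<open>2 * lo a = hi a\<close>, two close differences add up to less than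
  \<open>hi a\<close>, and at a free scale the sum is then close again. The base 8 leaves room for a
  margin of \<delta> on both sides of the gap from \<open>lo a\<close> to \<open>hi a\<close>
  without overlap between successive scales.\<close>

definition lo :: "nat \<Rightarrow> real" where "lo a = 2 * 8 ^ a * \<delta>"
definition hi :: "nat \<Rightarrow> real" where "hi a = 4 * 8 ^ a * \<delta>"

definition before :: "nat \<Rightarrow> (nat \<Rightarrow> nat \<Rightarrow> real) \<Rightarrow> nat \<Rightarrow> nat \<Rightarrow> nat \<Rightarrow> bool" where
  "before a x i j m \<longleftrightarrow> m \<in> {1..n} \<and> hi a < x j m - x i m \<and>
     (\<forall>m'\<in>{1..n}. m < m' \<longrightarrow> \<bar>x j m' - x i m'\<bar> < lo a)"

definition free :: "nat \<Rightarrow> (nat \<Rightarrow> nat \<Rightarrow> real) \<Rightarrow> bool" where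
  "free a x \<longleftrightarrow> (\<forall>i\<in>{1..k}. \<forall>j\<in>{1..k}. \<forall>m\<in>{1..n}.
     \<bar>x j m - x i m\<bar> < lo a \<or> hi a < \<bar>x j m - x i m\<bar>)"

definition total_at :: "nat \<Rightarrow> (nat \<Rightarrow> nat \<Rightarrow> real) \<Rightarrow> bool" where
  "total_at a x \<longleftrightarrow> (\<forall>i\<in>{1..k}. \<forall>j\<in>{1..k}. i \<noteq> j \<longrightarrow> (\<exists>m. before a x i j m \<or> before a x j i m))"

definition place :: "nat \<Rightarrow> (nat \<Rightarrow> nat \<Rightarrow> real) \<Rightarrow> nat \<Rightarrow> nat" where
  "place a x i = card {j \<in> {1..k}. \<exists>m. before a x j i m}"

definition compatible_at :: "nat \<Rightarrow> (nat \<Rightarrow> nat \<Rightarrow> real) \<Rightarrow> (nat \<Rightarrow> real \<Rightarrow> real) \<Rightarrow> bool" where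
  "compatible_at a x p \<longleftrightarrow> (\<forall>i\<in>{1..k}. \<forall>j\<in>{1..k}. \<forall>m. before a x i j m \<longrightarrow> cell m (p i) (p j))"

text \<open>The form that compatibility takes for shrunken cubes: if their edges are at most
  \<delta>, it suffices that the centres are \<delta> apart in the direction whose cell condition
  holds.\<close>

definition separated :: "(nat \<Rightarrow> nat \<Rightarrow> real) \<Rightarrow> (nat \<Rightarrow> real \<Rightarrow> real) \<Rightarrow> bool" where
  "separated x p \<longleftrightarrow> (\<forall>i\<in>{1..k}. \<forall>j\<in>{1..k}. i \<noteq> j \<longrightarrow> (\<exists>m\<in>{1..n}.
     \<delta> \<le> x j m - x i m \<and> cell m (p i) (p j) \<or> \<delta> \<le> x i m - x j m \<and> cell m (p j) (p i)))"

text \<open>A continuous cutoff. It vanishes unless the scale is free, and it is 1 as soon as every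
  difference keeps the distance \<delta> from the gap between \<open>lo a\<close> and
  \<open>hi a\<close>.\<close>

definition weight :: "nat \<Rightarrow> (nat \<Rightarrow> nat \<Rightarrow> real) \<Rightarrow> real" where
  "weight a x = (\<Prod>z\<in>{1..k} \<times> {1..k} \<times> {1..n}.
     clamp01 (max (lo a - \<bar>x (fst (snd z)) (snd (snd z)) - x (fst z) (snd (snd z))\<bar>)
                  (\<bar>x (fst (snd z)) (snd (snd z)) - x (fst z) (snd (snd z))\<bar> - hi a) / \<delta>))"

lemma lo_hi: "0 < lo a" "0 < hi a" "2 * lo a = hi a" "\<delta> \<le> hi a" "\<delta> < lo a"
proof -
  have "(1::real) \<le> 8 ^ a" by simp
  then have "\<delta> \<le> 8 ^ a * \<delta>" using \<delta> mult_right_mono[of 1 "8 ^ a" \<delta>] by simp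
  moreover have "lo a = 2 * (8 ^ a * \<delta>)" "hi a = 4 * (8 ^ a * \<delta>)" by (simp_all add: lo_def hi_def)
  ultimately show "0 < lo a" "0 < hi a" "2 * lo a = hi a" "\<delta> \<le> hi a" "\<delta> < lo a"
    using \<delta> by linarith+
qed

lemma freeD:
  "\<lbrakk>free a x; i \<in> {1..k}; j \<in> {1..k}; m \<in> {1..n}\<rbrakk> \<Longrightarrow> \<bar>x j m - x i m\<bar> < lo a \<or> hi a < \<bar>x j m - x i m\<bar>"
  unfolding free_def by blast

lemma hi_mono: "a \<le> b \<Longrightarrow> hi a \<le> hi b" "a \<le> b \<Longrightarrow> lo a \<le> lo b"
  using \<delta> by (simp_all add: lo_def hi_def)

text \<open>Beyond both deciding coordinates closeness is transitive at a free scale. At the larger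
  of the two the total difference exceeds \<open>hi a - lo a = lo a\<close>, and freeness raises
  this to \<open>hi a\<close>.\<close>

lemma before_trans:
  assumes f: "free a x" and i: "i \<in> {1..k}" "j \<in> {1..k}" "l \<in> {1..k}"
    and ij: "before a x i j m" and jl: "before a x j l m'"
  shows "\<exists>m. before a x i l m"
proof -
  have close: "\<bar>x l r - x i r\<bar> < lo a" if "r \<in> {1..n}" "m < r" "m' < r" for r
  proof -
    have "\<bar>x j r - x i r\<bar> < lo a" "\<bar>x l r - x j r\<bar> < lo a" using ij jl that by (auto simp: before_def)
    then have "\<bar>x l r - x i r\<bar> < hi a" using lo_hi(3)[of a] by linarith
    then show ?thesis using freeD[OF f i(1,3) that(1)] by linarith
  qed
  have far: "hi a < x l r - x i r" if "r \<in> {1..n}" "lo a < x l r - x i r" for r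
    using freeD[OF f i(1,3) that(1)] that(2) lo_hi(1)[of a] by linarith
  consider "m = m'" | "m < m'" | "m' < m" by linarith
  then show ?thesis
  proof cases
    case 1
    then have "hi a < x l m - x i m" using ij jl lo_hi[of a] by (auto simp: before_def)
    then show ?thesis using close ij 1 by (intro exI[of _ m]) (auto simp: before_def)
  next
    case 2
    then have "m' \<in> {1..n}" "\<bar>x j m' - x i m'\<bar> < lo a" "hi a < x l m' - x j m'" using ij jl by (auto simp: before_def)
    then have "hi a < x l m' - x i m'" using far[of m'] lo_hi(3)[of a] by linarith
    then show ?thesis using close jl 2 by (intro exI[of _ m']) (auto simp: before_def)
  next
    case 3
    then have "m \<in> {1..n}" "\<bar>x l m - x j m\<bar> < lo a" "hi a < x j m - x i m" using ij jl by (auto simp: before_def)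
    then have "hi a < x l m - x i m" using far[of m] lo_hi(3)[of a] by linarith
    then show ?thesis using close ij 3 by (intro exI[of _ m]) (auto simp: before_def)
  qed
qed

lemma not_before_self: "\<not> before a x i i m"
  using lo_hi(2)[of a] by (auto simp: before_def)

text \<open>By transitivity every predecessor of \<open>i\<close> precedes \<open>j\<close>, and
  \<open>i\<close> is one more.\<close>

lemma place_less:
  assumes f: "free a x" and i: "i \<in> {1..k}" "j \<in> {1..k}" and b: "before a x i j m"
  shows "place a x i < place a x j"
  unfolding place_def
proof (rule psubset_card_mono)
  show "{l \<in> {1..k}. \<exists>m. before a x l i m} \<subset> {l \<in> {1..k}. \<exists>m. before a x l j m}"
  proof
    show "{l \<in> {1..k}. \<exists>m. before a x l i m} \<subseteq> {l \<in> {1..k}. \<exists>m. before a x l j m}"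
      using before_trans[OF f _ i _ b] by blast
    have "i \<in> {l \<in> {1..k}. \<exists>m. before a x l j m}" "i \<notin> {l \<in> {1..k}. \<exists>m. before a x l i m}"
      using i b not_before_self by blast+
    then show "{l \<in> {1..k}. \<exists>m. before a x l i m} \<noteq> {l \<in> {1..k}. \<exists>m. before a x l j m}" by blast
  qed
qed simp

lemma place_bound:
  assumes "i \<in> {1..k}"
  shows "place a x i + 1 \<le> k"
proof -
  have "{j \<in> {1..k}. \<exists>m. before a x j i m} \<subset> {1..k}" using assms not_before_self by blast
  then have "place a x i < card {1..k}" unfolding place_def by (intro psubset_card_mono) auto
  then show ?thesis by simp
qed

lemma weight_bounds: "0 \<le> weight a x" "weight a x \<le> 1"
  unfolding weight_def by (auto intro!: prod_nonneg prod_le_1 simp: clamp01_bounds)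

lemma weight_free:
  assumes "weight a x \<noteq> 0"
  shows "free a x"
  unfolding free_def
proof (intro ballI)
  fix i j m assume ijm: "i \<in> {1..k}" "j \<in> {1..k}" "m \<in> {1..n}"
  have "clamp01 (max (lo a - \<bar>x j m - x i m\<bar>) (\<bar>x j m - x i m\<bar> - hi a) / \<delta>) \<noteq> 0"
  proof
    assume z: "clamp01 (max (lo a - \<bar>x j m - x i m\<bar>) (\<bar>x j m - x i m\<bar> - hi a) / \<delta>) = 0"
    have "weight a x = 0"
      unfolding weight_def
      by (intro prod_zero bexI[of _ "(i, j, m)"]) (use z ijm in simp_all)
    then show False using assms by simp
  qed
  then have "\<not> max (lo a - \<bar>x j m - x i m\<bar>) (\<bar>x j m - x i m\<bar> - hi a) / \<delta> \<le> 0" using clamp01_eq_0 by blast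
  then have "\<not> max (lo a - \<bar>x j m - x i m\<bar>) (\<bar>x j m - x i m\<bar> - hi a) \<le> 0" using \<delta> by (simp add: divide_le_0_iff)
  then show "\<bar>x j m - x i m\<bar> < lo a \<or> hi a < \<bar>x j m - x i m\<bar>" by auto
qed

text \<open>Pigeonhole. A scale of weight below 1 has a difference strictly between
  \<open>8 ^ a * \<delta>\<close> and \<open>8 ^ Suc a * \<delta>\<close>. These windows are
  disjoint, and there is one scale more than the \<open>k * k * n\<close> differences.\<close>

lemma exists_weight_1: "\<exists>a\<le>k * k * n. weight a x = 1"
proof (rule ccontr)
  assume no: "\<not> ?thesis"
  let ?I = "{1..k} \<times> {1..k} \<times> {1..n}"
  define gap where "gap z = \<bar>x (fst (snd z)) (snd (snd z)) - x (fst z) (snd (snd z))\<bar>" for z :: "nat \<times> nat \<times> nat"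
  have "\<exists>z\<in>?I. 8 ^ a * \<delta> < gap z \<and> gap z < 8 ^ Suc a * \<delta>" if "a \<in> {..k * k * n}" for a
  proof -
    have "weight a x \<noteq> 1" using no that by auto
    obtain z where z: "z \<in> ?I" "clamp01 (max (lo a - gap z) (gap z - hi a) / \<delta>) \<noteq> 1"
    proof -
      have "weight a x = (\<Prod>z\<in>?I. clamp01 (max (lo a - gap z) (gap z - hi a) / \<delta>))"
        by (simp only: weight_def gap_def)
      then have "\<exists>z\<in>?I. clamp01 (max (lo a - gap z) (gap z - hi a) / \<delta>) \<noteq> 1"
        using \<open>weight a x \<noteq> 1\<close> prod.neutral[of ?I "\<lambda>z. clamp01 (max (lo a - gap z) (gap z - hi a) / \<delta>)"]
        by (intro ccontr[of "\<exists>z\<in>?I. clamp01 (max (lo a - gap z) (gap z - hi a) / \<delta>) \<noteq> 1"]) simp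
      then show thesis using that by (elim bexE)
    qed
    then have "max (lo a - gap z) (gap z - hi a) / \<delta> < 1" using clamp01_eq_1 by (meson not_le)
    then have "lo a - gap z < \<delta>" "gap z - hi a < \<delta>" using \<delta> by (auto simp: divide_less_eq)
    moreover have "\<delta> \<le> 8 ^ a * \<delta>" using \<delta> mult_right_mono[of 1 "8 ^ a" \<delta>] by simp
    ultimately have "8 ^ a * \<delta> < gap z" "gap z < 8 ^ Suc a * \<delta>" by (simp_all add: lo_def hi_def)
    then show ?thesis using z(1) by blast
  qed
  then obtain F where F: "\<And>a. a \<in> {..k * k * n} \<Longrightarrow> F a \<in> ?I \<and> 8 ^ a * \<delta> < gap (F a) \<and> gap (F a) < 8 ^ Suc a * \<delta>"
    by metis
  have "F a \<noteq> F b" if "a \<in> {..k * k * n}" "b \<in> {..k * k * n}" "a < b" for a b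
  proof
    assume eq: "F a = F b"
    have "(8::real) ^ Suc a \<le> 8 ^ b" using that by (intro power_increasing) auto
    then have "8 ^ Suc a * \<delta> \<le> 8 ^ b * \<delta>" using \<delta> by (simp add: mult_right_mono)
    then show False using F[OF that(1)] F[OF that(2)] eq by simp
  qed
  then have "inj_on F {..k * k * n}" unfolding inj_on_def by (metis linorder_neqE_nat)
  moreover have "F ` {..k * k * n} \<subseteq> ?I" using F by blast
  ultimately have "card {..k * k * n} \<le> card ?I" by (rule card_inj_on_le) simp
  then show False by (simp add: card_cartesian_product mult.assoc)
qed

text \<open>A difference that is far at scale \<open>b\<close> is also far at the smaller scale
  \<open>a\<close>, so the coordinate deciding at \<open>b\<close> is at most the one deciding at
  \<open>a\<close>. If they coincide, the order of the pair is the same; otherwise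
  \<open>cell_mono\<close> applies, whichever order holds at \<open>b\<close>.\<close>

lemma compatible_at_coarser:
  assumes ab: "a \<le> b" and tot: "total_at b x" and r: "compatible_at b x p"
    and p: "\<And>i. i \<in> {1..k} \<Longrightarrow> p i \<in> progress"
  shows "compatible_at a x p"
  unfolding compatible_at_def
proof (intro ballI allI impI)
  fix i j m assume i: "i \<in> {1..k}" and j: "j \<in> {1..k}" and bf: "before a x i j m"
  have "i \<noteq> j" using bf not_before_self by blast
  then obtain m' where m': "before b x i j m' \<or> before b x j i m'" using tot i j unfolding total_at_def by blast
  then have far: "hi b < \<bar>x j m' - x i m'\<bar>" "m' \<in> {1..n}" by (auto simp: before_def)
  have le: "m' \<le> m"
  proof (rule ccontr)
    assume "\<not> m' \<le> m"
    then have "\<bar>x j m' - x i m'\<bar> < lo a" using bf far by (auto simp: before_def)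
    then show False using far hi_mono[OF ab] lo_hi[of a] by linarith
  qed
  show "cell m (p i) (p j)"
  proof (cases "m' = m")
    case True
    have "hi a < x j m - x i m" using bf by (simp add: before_def)
    then have "before b x i j m" using m' True lo_hi(2)[of a] lo_hi(2)[of b] by (auto simp: before_def)
    then show ?thesis using r i j by (auto simp: compatible_at_def)
  next
    case False
    then have "m' < m" using le by simp
    have "cell m' (p i) (p j) \<or> cell m' (p j) (p i)" using m' r i j by (auto simp: compatible_at_def)
    then show ?thesis using cell_mono[OF _ p[OF i] p[OF j], of m' m] cell_mono[OF _ p[OF j] p[OF i], of m' m] \<open>m' < m\<close>
      by (meson less_imp_le)
  qed
qed

lemma compatible_at_separated:
  assumes tot: "total_at a x" and r: "compatible_at a x p"
  shows "separated x p"
  unfolding separated_def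
proof (intro ballI impI)
  fix i j assume i: "i \<in> {1..k}" and j: "j \<in> {1..k}" and ne: "i \<noteq> j"
  obtain m where m: "before a x i j m \<or> before a x j i m" using tot i j ne unfolding total_at_def by blast
  then have "m \<in> {1..n}" by (auto simp: before_def)
  moreover have "\<delta> \<le> x j m - x i m \<and> cell m (p i) (p j) \<or> \<delta> \<le> x i m - x j m \<and> cell m (p j) (p i)"
    using m r i j lo_hi(4)[of a] by (fastforce simp: before_def compatible_at_def)
  ultimately show "\<exists>m\<in>{1..n}. \<delta> \<le> x j m - x i m \<and> cell m (p i) (p j) \<or> \<delta> \<le> x i m - x j m \<and> cell m (p j) (p i)" by blast
qed

text \<open>A prefix keeps compatibility that is already there. For \<mu> = 1 it creates it, because
  each label is then finished before the next place starts.\<close>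

lemma compatible_at_prefix:
  assumes f: "free a x" and p: "\<And>i. i \<in> {1..k} \<Longrightarrow> p i \<in> progress"
    and \<mu>: "0 \<le> \<mu>" "\<mu> \<le> 1" and h: "compatible_at a x p \<or> \<mu> = 1"
  shows "compatible_at a x (\<lambda>i. prefix k 1 \<mu> (real (place a x i)) (p i))"
  unfolding compatible_at_def
proof (intro ballI allI impI)
  fix i j m assume i: "i \<in> {1..k}" and j: "j \<in> {1..k}" and bf: "before a x i j m"
  have s: "real (place a x i) + 1 \<le> real (place a x j)" using place_less[OF f i j bf] by simp
  have m: "1 \<le> m" using bf by (simp add: before_def)
  show "cell m (prefix k 1 \<mu> (real (place a x i)) (p i)) (prefix k 1 \<mu> (real (place a x j)) (p j))"
  proof (cases "\<mu> = 1")
    case True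
    have "real (place a x i) + 1 \<le> real k" using place_bound[OF i, of a x] by linarith
    then have "cell 1 (prefix k 1 \<mu> (real (place a x i)) (p i)) (prefix k 1 \<mu> (real (place a x j)) (p j))"
      using True by (intro cell_prefix_early p i j s) auto
    then show ?thesis using m p[OF i] p[OF j] \<mu> by (elim cell_mono(1)) (auto intro!: prefix_progress)
  next
    case False
    then have "cell m (p i) (p j)" using h i j bf by (auto simp: compatible_at_def)
    then show ?thesis using m by (intro cell_prefix p i j \<mu> s) auto
  qed
qed

text \<open>Prefixes for the scales from \<open>a\<close> up to \<open>a + L - 1\<close>, the
  smallest scale being outermost and hence first in time. The order matters: compatibility gained at
  a scale passes on to the smaller ones by \<open>compatible_at_coarser\<close>, and those are added
  afterwards.\<close>

primrec nest :: "nat \<Rightarrow> real \<Rightarrow> (nat \<Rightarrow> real) \<Rightarrow> (nat \<Rightarrow> nat \<Rightarrow> real) \<Rightarrow> nat \<Rightarrow> (nat \<Rightarrow> real \<Rightarrow> real) \<Rightarrow> nat \<Rightarrow> real \<Rightarrow> real" where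
  "nest 0 \<theta> \<mu> s a p i = p i"
| "nest (Suc L) \<theta> \<mu> s a p i = prefix k \<theta> (\<mu> a) (s a i) (nest L \<theta> \<mu> s (Suc a) p i)"

lemma nest_progress:
  assumes "p i \<in> progress" "0 \<le> \<theta>" "\<And>a. 0 \<le> \<mu> a" "\<And>a i. 0 \<le> s a i"
  shows "nest L \<theta> \<mu> s a p i \<in> progress"
  by (induction L arbitrary: a) (use assms in \<open>auto intro!: prefix_progress\<close>)

text \<open>Only a change of time remains. It is common to all labels, which is what preserves
  cells.\<close>

lemma nest_0:
  assumes "\<And>i. i \<in> {1..k} \<Longrightarrow> p i \<in> progress" "0 \<le> \<theta>" "\<And>a i. 0 \<le> s a i"
  shows "\<exists>d\<in>progress. \<forall>i\<in>{1..k}. nest L \<theta> (\<lambda>_. 0) s a p i = p i \<circ> d"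
proof (induction L arbitrary: a)
  case 0
  have "p i \<circ> clamp01 = p i" if "i \<in> {1..k}" for i
    using progress_clamp[OF assms(1)[OF that]] by (simp add: fun_eq_iff)
  then show ?case by (intro bexI[of _ clamp01]) (auto simp: clamp01_progress)
next
  case (Suc L)
  obtain d where d: "d \<in> progress" "\<forall>i\<in>{1..k}. nest L \<theta> (\<lambda>_. 0) s (Suc a) p i = p i \<circ> d" using Suc by blast
  have "nest (Suc L) \<theta> (\<lambda>_. 0) s a p i = p i \<circ> (d \<circ> delay \<theta>)" if i: "i \<in> {1..k}" for i
  proof -
    have "p i \<circ> d \<in> progress" using progress_compose d(1) assms(1)[OF i] by blast
    then show ?thesis using d(2) i assms(3) by (simp add: prefix_0 o_assoc)
  qed
  then show ?case using progress_compose[OF delay_progress[OF assms(2)] d(1)] by blast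
qed

lemma nest_0_0:
  assumes "p i \<in> progress" "\<And>a i. 0 \<le> s a i"
  shows "nest L 0 (\<lambda>_. 0) s a p i = p i"
proof (induction L arbitrary: a)
  case (Suc L)
  have "nest (Suc L) 0 (\<lambda>_. 0) s a p i = p i \<circ> delay 0" using Suc assms by (simp add: prefix_0)
  then show ?case using progress_clamp[OF assms(1)] by (simp add: delay_def fun_eq_iff)
qed simp

text \<open>One prefix of full weight at any scale erases the innermost function. This is what
  allows two different starting functions to be glued.\<close>

lemma nest_1:
  assumes "\<And>a. 0 \<le> \<mu> a" "\<And>a i. 0 \<le> s a i" "\<And>a. s a i + 1 \<le> real k"
    and "p i \<in> progress" "q i \<in> progress" and "\<exists>A\<in>{a..<a + L}. \<mu> A = 1"
  shows "nest L 1 \<mu> s a p i = nest L 1 \<mu> s a q i"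
  using assms(6)
proof (induction L arbitrary: a)
  case (Suc L)
  show ?case
  proof (cases "\<mu> a = 1")
    case True
    then show ?thesis using assms by (auto intro!: prefix_1 nest_progress)
  next
    case False
    then have "\<exists>A\<in>{Suc a..<Suc a + L}. \<mu> A = 1" using Suc.prems by (metis Suc_leI atLeastLessThan_iff add_Suc_shift le_neq_implies_less)
    then show ?thesis using Suc.IH by simp
  qed
qed simp

text \<open>Induction from the innermost scale outwards. The prefix of a free scale establishes or
  keeps compatibility there, which then holds at all smaller scales. A scale that is not free has
  weight 0 and contributes only a common delay.\<close>

lemma nest_compatible_at:
  assumes tot: "\<And>b. free b x \<Longrightarrow> b < B \<Longrightarrow> total_at b x" and \<mu>: "\<And>a. 0 \<le> \<mu> a" "\<And>a. \<mu> a \<le> 1"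
    and fr: "\<And>a. \<mu> a \<noteq> 0 \<Longrightarrow> free a x"
    and p: "\<And>i. i \<in> {1..k} \<Longrightarrow> p i \<in> progress"
    and h: "(separated x p \<and> (\<forall>b<B. free b x \<longrightarrow> compatible_at b x p)) \<or> (\<exists>A\<in>{a..<a + L}. \<mu> A = 1)"
    and B: "a + L \<le> B"
  defines "s \<equiv> \<lambda>a i. real (place a x i)"
  shows "separated x (nest L 1 \<mu> s a p) \<and> (\<forall>b\<le>a. b < B \<longrightarrow> free b x \<longrightarrow> compatible_at b x (nest L 1 \<mu> s a p))"
  using h B
proof (induction L arbitrary: a)
  case 0
  then show ?case by simp
next
  case (Suc L)
  let ?q = "nest L 1 \<mu> s (Suc a) p"
  have s0: "0 \<le> s a i" for a i by (simp add: s_def)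
  have q: "?q i \<in> progress" if "i \<in> {1..k}" for i using p that \<mu> s0 by (auto intro!: nest_progress)
  have q': "nest (Suc L) 1 \<mu> s a p i \<in> progress" if "i \<in> {1..k}" for i using p that \<mu> s0 by (intro nest_progress) auto
  have eq: "nest (Suc L) 1 \<mu> s a p = (\<lambda>i. prefix k 1 (\<mu> a) (real (place a x i)) (?q i))"
    by (simp add: fun_eq_iff s_def)
  have IH: "separated x ?q \<and> (\<forall>b\<le>Suc a. b < B \<longrightarrow> free b x \<longrightarrow> compatible_at b x ?q)" if "\<mu> a \<noteq> 1"
  proof (rule Suc.IH)
    show "(separated x p \<and> (\<forall>b<B. free b x \<longrightarrow> compatible_at b x p)) \<or> (\<exists>A\<in>{Suc a..<Suc a + L}. \<mu> A = 1)"
      using Suc.prems(1) that by (metis Suc_leI atLeastLessThan_iff add_Suc_shift le_neq_implies_less)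
  qed (use Suc.prems in simp)
  show ?case
  proof (cases "free a x")
    case True
    have aB: "a < B" using Suc.prems by simp
    have "compatible_at a x ?q \<or> \<mu> a = 1" using IH True aB by auto
    then have r: "compatible_at a x (nest (Suc L) 1 \<mu> s a p)"
      unfolding eq by (intro compatible_at_prefix True q \<mu>)
    have "separated x (nest (Suc L) 1 \<mu> s a p)" by (rule compatible_at_separated[OF tot[OF True aB] r])
    moreover have "compatible_at b x (nest (Suc L) 1 \<mu> s a p)" if "b \<le> a" for b
      by (rule compatible_at_coarser[OF that tot[OF True aB] r q'])
    ultimately show ?thesis by blast
  next
    case False
    then have l0: "\<mu> a = 0" using fr by blast
    have eq0: "nest (Suc L) 1 \<mu> s a p i = ?q i \<circ> delay 1" if "i \<in> {1..k}" for i
      using l0 q[OF that] s0 by (simp add: prefix_0)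
    have cell: "cell m (?q i \<circ> delay 1) (?q j \<circ> delay 1)" if "cell m (?q i) (?q j)" "i \<in> {1..k}" "j \<in> {1..k}" for i j m
      by (rule cell_compose_right[OF that(1) q[OF that(2)] q[OF that(3)] delay_progress]) simp
    have I: "separated x ?q" "\<And>b. b \<le> Suc a \<Longrightarrow> b < B \<Longrightarrow> free b x \<Longrightarrow> compatible_at b x ?q" using IH l0 by auto
    have "separated x (nest (Suc L) 1 \<mu> s a p)"
      unfolding separated_def
    proof (intro ballI impI)
      fix i j assume ij: "i \<in> {1..k}" "j \<in> {1..k}" "i \<noteq> j"
      then obtain m where "m \<in> {1..n}" "\<delta> \<le> x j m - x i m \<and> cell m (?q i) (?q j) \<or> \<delta> \<le> x i m - x j m \<and> cell m (?q j) (?q i)"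
        using I(1) unfolding separated_def by blast
      then show "\<exists>m\<in>{1..n}. \<delta> \<le> x j m - x i m \<and> cell m (nest (Suc L) 1 \<mu> s a p i) (nest (Suc L) 1 \<mu> s a p j) \<or>
          \<delta> \<le> x i m - x j m \<and> cell m (nest (Suc L) 1 \<mu> s a p j) (nest (Suc L) 1 \<mu> s a p i)"
        unfolding eq0[OF ij(1)] eq0[OF ij(2)] using cell ij by blast
    qed
    moreover have "compatible_at b x (nest (Suc L) 1 \<mu> s a p)" if "b \<le> a" "b < B" "free b x" for b
      unfolding compatible_at_def
    proof (intro ballI allI impI)
      fix i j m assume ij: "i \<in> {1..k}" "j \<in> {1..k}" and "before b x i j m"
      then have "cell m (?q i) (?q j)" using I(2)[of b] that unfolding compatible_at_def by simp
      then show "cell m (nest (Suc L) 1 \<mu> s a p i) (nest (Suc L) 1 \<mu> s a p j)"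
        unfolding eq0[OF ij(1)] eq0[OF ij(2)] using cell ij by blast
    qed
    ultimately show ?thesis by blast
  qed
qed

section \<open>Continuity of the nested prefixes\<close>

lemma before_locally_constant:
  assumes x: "\<And>i m. i \<in> {1..k} \<Longrightarrow> m \<in> {1..n} \<Longrightarrow> continuous_map Z euclideanreal (\<lambda>z. x z i m)"
    and z: "z \<in> topspace Z" and f: "free a (x z)"
  shows "\<exists>W. openin Z W \<and> z \<in> W \<and> (\<forall>w\<in>W. \<forall>i\<in>{1..k}. place a (x w) i = place a (x z) i)"
proof -
  let ?I = "{1..k} \<times> {1..k} \<times> {1..n}"
  define d where "d q w = x w (fst (snd q)) (snd (snd q)) - x w (fst q) (snd (snd q))" for q w
  \<comment> \<open>At a free scale each difference lies in one of three open regions, and the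
    region alone determines \<open>before\<close>.\<close>
  define S where "S q = (if \<bar>d q z\<bar> < lo a then {-lo a<..<lo a} else if d q z > 0 then {hi a<..} else {..<-hi a})" for q
  define W where "W = (\<Inter>q\<in>?I. {w \<in> topspace Z. d q w \<in> S q}) \<inter> topspace Z"
  have "openin Z W"
    unfolding W_def
  proof (rule openin_INT)
    fix q assume "q \<in> ?I"
    then have "continuous_map Z euclideanreal (d q)"
      unfolding d_def[abs_def] by (intro continuous_map_diff x) auto
    then show "openin Z {w \<in> topspace Z. d q w \<in> S q}"
      by (rule openin_continuous_map_preimage) (simp add: S_def)
  qed simp
  moreover have "z \<in> W"
  proof -
    have "d q z \<in> S q" if "q \<in> ?I" for q
    proof -
      have "\<bar>d q z\<bar> < lo a \<or> hi a < \<bar>d q z\<bar>" using freeD[OF f, of "fst q" "fst (snd q)" "snd (snd q)"] that unfolding d_def by auto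
      then show ?thesis by (auto simp: S_def)
    qed
    then show ?thesis using z by (simp add: W_def)
  qed
  moreover have "place a (x w) i = place a (x z) i" if w: "w \<in> W" and i: "i \<in> {1..k}" for w i
  proof -
    have eq: "(hi a < x w i m - x w j m \<longleftrightarrow> hi a < x z i m - x z j m) \<and>
      (\<bar>x w i m - x w j m\<bar> < lo a \<longleftrightarrow> \<bar>x z i m - x z j m\<bar> < lo a)" if "j \<in> {1..k}" "m \<in> {1..n}" for j m
    proof -
      have q: "(j, i, m) \<in> ?I" using that i by simp
      then have 1: "d (j, i, m) w \<in> S (j, i, m)" using w unfolding W_def by blast
      have 2: "\<bar>d (j, i, m) z\<bar> < lo a \<or> hi a < \<bar>d (j, i, m) z\<bar>" using freeD[OF f that(1) i that(2)] unfolding d_def by simp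
      have e: "x w i m - x w j m = d (j, i, m) w" "x z i m - x z j m = d (j, i, m) z" by (simp_all add: d_def)
      show ?thesis unfolding e using 1 2 lo_hi[of a]
        by (cases "\<bar>d (j, i, m) z\<bar> < lo a"; cases "d (j, i, m) z > 0") (auto simp: S_def)
    qed
    have "before a (x w) j i m \<longleftrightarrow> before a (x z) j i m" if "j \<in> {1..k}" for j m
      unfolding before_def using eq[OF that] by blast
    then have "{j \<in> {1..k}. \<exists>m. before a (x w) j i m} = {j \<in> {1..k}. \<exists>m. before a (x z) j i m}" by blast
    then show ?thesis unfolding place_def by simp
  qed
  ultimately show ?thesis by blast
qed

text \<open>The place \<open>s\<close> may jump, but only where \<mu> vanishes, and near such points
  the first term of the maximum is squeezed between 0 and \<open>k * \<mu>\<close>. Elsewhere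
  \<open>s\<close> is locally constant.\<close>

lemma prefix_continuous:
  assumes F: "continuous_map Z progress_space F" and \<mu>: "continuous_map Z euclideanreal \<mu>" and \<theta>: "continuous_map Z euclideanreal \<theta>"
    and nn: "\<And>z. z \<in> topspace Z \<Longrightarrow> 0 \<le> \<mu> z" "\<And>z. z \<in> topspace Z \<Longrightarrow> 0 \<le> \<theta> z" "\<And>z. 0 \<le> s z"
    and loc: "\<And>z. z \<in> topspace Z \<Longrightarrow> \<mu> z \<noteq> 0 \<Longrightarrow> \<exists>W. openin Z W \<and> z \<in> W \<and> (\<forall>w\<in>W. s w = s z)"
  shows "continuous_map Z progress_space (\<lambda>z. prefix k (\<theta> z) (\<mu> z) (s z) (F z))"
proof (rule continuous_map_into_progress)
  show "prefix k (\<theta> z) (\<mu> z) (s z) (F z) \<in> progress" if "z \<in> topspace Z" for z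
    using that F nn by (intro prefix_progress) (auto simp: continuous_map_def)
  fix t :: real
  let ?\<phi> = "\<lambda>z. clamp01 (real k * min (\<mu> z) (2 * t) - s z)"
  have "continuous_map Z euclideanreal ?\<phi>"
    unfolding continuous_map_def
  proof (intro conjI allI impI)
    fix U :: "real set" assume "openin euclideanreal U"
    then have U: "open U" by simp
    show "openin Z {z \<in> topspace Z. ?\<phi> z \<in> U}"
    proof (subst openin_subopen, intro ballI)
      fix z assume z: "z \<in> {z \<in> topspace Z. ?\<phi> z \<in> U}"
      show "\<exists>T. openin Z T \<and> z \<in> T \<and> T \<subseteq> {z \<in> topspace Z. ?\<phi> z \<in> U}"
      proof (cases "\<mu> z = 0")
        case True
        have "real k * min (\<mu> z) (2 * t) \<le> 0" using True by (simp add: mult_nonneg_nonpos)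
        then have "?\<phi> z = 0" using nn(3)[of z] by (intro clamp01_eq_0) linarith
        then have "0 \<in> U" using z by simp
        then obtain e where e: "e > 0" "ball 0 e \<subseteq> U" using U open_contains_ball by blast
        let ?T = "{w \<in> topspace Z. real k * \<mu> w \<in> {..<e}}"
        have "openin Z ?T"
          by (rule openin_continuous_map_preimage[of Z euclideanreal]) (auto intro!: continuous_map_real_mult_left \<mu>)
        moreover have "z \<in> ?T" using z True e by simp
        moreover have "?T \<subseteq> {z \<in> topspace Z. ?\<phi> z \<in> U}"
        proof
          fix w assume w: "w \<in> ?T"
          have "real k * min (\<mu> w) (2 * t) \<le> real k * \<mu> w" by (intro mult_left_mono) auto
          then have "?\<phi> w \<le> clamp01 (real k * \<mu> w)" using nn(3)[of w] by (intro clamp01_mono) linarith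
          also have "\<dots> \<le> real k * \<mu> w" using nn(1)[of w] w by (auto simp: clamp01_def)
          finally have "?\<phi> w \<in> ball 0 e" using w clamp01_bounds(1) by (simp add: dist_real_def)
          then show "w \<in> {z \<in> topspace Z. ?\<phi> z \<in> U}" using e w by blast
        qed
        ultimately show ?thesis by blast
      next
        case False
        then obtain W where W: "openin Z W" "z \<in> W" "\<forall>w\<in>W. s w = s z" using loc z by blast
        have "continuous_map Z euclideanreal (\<lambda>w. clamp01 (real k * min (\<mu> w) (2 * t) - s z))"
          unfolding clamp01_def by (intro continuous_map_real_max continuous_map_real_min continuous_map_diff
              continuous_map_real_mult_left \<mu>) auto
        then have "openin Z {w \<in> topspace Z. clamp01 (real k * min (\<mu> w) (2 * t) - s z) \<in> U}"
          by (rule openin_continuous_map_preimage) (simp add: U)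
        then have "openin Z (W \<inter> {w \<in> topspace Z. clamp01 (real k * min (\<mu> w) (2 * t) - s z) \<in> U})"
          by (rule openin_Int[OF W(1)])
        moreover have "W \<inter> {w \<in> topspace Z. clamp01 (real k * min (\<mu> w) (2 * t) - s z) \<in> U} \<subseteq> {z \<in> topspace Z. ?\<phi> z \<in> U}"
          using W(3) by auto
        moreover have "z \<in> W \<inter> {w \<in> topspace Z. clamp01 (real k * min (\<mu> w) (2 * t) - s z) \<in> U}" using W(2) z by simp
        ultimately show ?thesis by blast
      qed
    qed
  qed simp
  moreover have "continuous_map Z euclideanreal (\<lambda>z. F z ((1 + \<theta> z) * t - \<theta> z))"
    by (rule continuous_map_progress_eval[OF F])
      (intro continuous_map_diff continuous_map_real_mult_right continuous_map_add \<theta> continuous_map_const[THEN iffD2], simp)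
  ultimately show "continuous_map Z euclideanreal (\<lambda>z. prefix k (\<theta> z) (\<mu> z) (s z) (F z) t)"
    unfolding prefix_def by (rule continuous_map_real_max)
qed

lemma nest_continuous:
  assumes p: "\<And>i. i \<in> {1..k} \<Longrightarrow> continuous_map Z progress_space (\<lambda>z. p z i)"
    and \<mu>: "\<And>a. continuous_map Z euclideanreal (\<lambda>z. \<mu> z a)" and \<theta>: "continuous_map Z euclideanreal \<theta>"
    and nn: "\<And>z a. z \<in> topspace Z \<Longrightarrow> 0 \<le> \<mu> z a" "\<And>z. z \<in> topspace Z \<Longrightarrow> 0 \<le> \<theta> z"
    and x: "\<And>i m. i \<in> {1..k} \<Longrightarrow> m \<in> {1..n} \<Longrightarrow> continuous_map Z euclideanreal (\<lambda>z. x z i m)"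
    and fr: "\<And>z a. z \<in> topspace Z \<Longrightarrow> \<mu> z a \<noteq> 0 \<Longrightarrow> free a (x z)"
    and i: "i \<in> {1..k}"
  shows "continuous_map Z progress_space (\<lambda>z. nest L (\<theta> z) (\<mu> z) (\<lambda>a i. real (place a (x z) i)) a (p z) i)"
proof (induction L arbitrary: a)
  case 0
  then show ?case using p[OF i] by simp
next
  case (Suc L)
  show ?case
    unfolding nest.simps
  proof (rule prefix_continuous[OF Suc \<mu> \<theta>])
    fix z assume z: "z \<in> topspace Z" and nz: "\<mu> z a \<noteq> 0"
    have "\<exists>W. openin Z W \<and> z \<in> W \<and> (\<forall>w\<in>W. \<forall>i\<in>{1..k}. place a (x w) i = place a (x z) i)"
      by (rule before_locally_constant[of Z x z a]) (auto intro: x z fr[OF z nz])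
    then obtain W where W: "openin Z W" "z \<in> W" "\<forall>w\<in>W. \<forall>i\<in>{1..k}. place a (x w) i = place a (x z) i"
      by (elim exE conjE)
    have "real (place a (x w) i) = real (place a (x z) i)" if "w \<in> W" for w using W(3) that i by simp
    with W(1,2) show "\<exists>W. openin Z W \<and> z \<in> W \<and> (\<forall>w\<in>W. real (place a (x w) i) = real (place a (x z) i))"
      by (intro exI[of _ W] conjI ballI)
  qed (use nn in auto)
qed

end

section \<open>Forgetting progress functions is a weak equivalence\<close>

context operadic_monoid
begin

lemma continuous_map_into_space:
  assumes "\<And>z. z \<in> topspace Z \<Longrightarrow> F z \<in> topspace (opd_space Opd k)"
    and "\<And>i. i \<in> {1..k} \<Longrightarrow> continuous_map Z M (\<lambda>z. F z i)"
  shows "continuous_map Z (opd_space Opd k) F"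
proof -
  have "continuous_map Z (product_topology (\<lambda>_. M) {1..k}) F"
    by (subst continuous_map_componentwise) (use assms in \<open>auto dest: space_extensional\<close>)
  then show ?thesis using assms(1)
    by (subst tuple_operad_def, simp add: continuous_map_in_subtopology Pi_iff) (auto simp: in_space)
qed

lemma continuous_map_space_at:
  assumes "continuous_map Z (opd_space Opd k) F" "i \<in> {1..k}"
  shows "continuous_map Z M (\<lambda>z. F z i)"
proof -
  have "continuous_map Z (product_topology (\<lambda>_. M) {1..k}) F"
    using assms(1) by (subst (asm) tuple_operad_def, simp) (erule continuous_map_into_fulltopology)
  then show ?thesis using assms(2) by (auto simp: continuous_map_componentwise)
qed

end

text \<open>Precomposition with this concentric cube shrinks a cube about its own centre, so the
  coordinate differences of the centres do not change.\<close>

definition shrink :: "nat \<Rightarrow> real \<Rightarrow> (nat \<Rightarrow> real) \<Rightarrow> nat \<Rightarrow> real" where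
  "shrink n s = affine_cube n (\<lambda>_. (1 - s) / 2) s"

lemma affine_cube_extensional: "affine_cube n a b \<in> extensional (cube_set n)"
  unfolding affine_cube_def by (rule restrict_extensional)

lemma TD_shrink: "0 < s \<Longrightarrow> s \<le> 1 \<Longrightarrow> TD_map n (shrink n s)"
  unfolding shrink_def by (rule TD_map_affine_cube) (simp_all add: field_simps)

lemma shrink_1: "shrink n 1 = cube_id n"
  by (rule extensionalityI[of _ "cube_set n"])
    (auto simp: shrink_def affine_cube_def cube_id_def cube_set_eq PiE_iff extensional_def restrict_def fun_eq_iff)

lemma shrink_continuous:
  assumes s: "continuous_map Z euclideanreal s" and b: "\<And>z. z \<in> topspace Z \<Longrightarrow> 0 < s z \<and> s z \<le> 1"
  shows "continuous_map Z (TD_space n) (\<lambda>z. shrink n (s z))"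
proof -
  have "continuous_map (prod_topology Z (unit_cube n)) (unit_cube n) (\<lambda>(z, t). shrink n (s z) t)"
  proof (rule continuous_map_into_unit_cube)
    fix p assume "p \<in> topspace (prod_topology Z (unit_cube n))"
    then have "fst p \<in> topspace Z" "snd p \<in> cube_set n" by auto
    then show "(case p of (z, t) \<Rightarrow> shrink n (s z) t) \<in> cube_set n"
      using TD_in_cube[OF TD_shrink] b by (auto simp: case_prod_unfold)
  next
    fix i assume i: "i \<in> {1..n}"
    have s': "continuous_map (prod_topology Z (unit_cube n)) euclideanreal (\<lambda>p. s (fst p))"
      by (rule continuous_map_o[OF continuous_map_fst s])
    have t': "continuous_map (prod_topology Z (unit_cube n)) euclideanreal (\<lambda>p. snd p i)"
      by (rule continuous_map_cube_coord[OF continuous_map_snd i])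
    have "continuous_map (prod_topology Z (unit_cube n)) euclideanreal (\<lambda>p. (1 - s (fst p)) / 2 + s (fst p) * snd p i)"
      by (intro continuous_map_add continuous_map_real_mult continuous_map_real_divide continuous_map_diff s' t') auto
    then show "continuous_map (prod_topology Z (unit_cube n)) euclideanreal (\<lambda>p. (case p of (z, t) \<Rightarrow> shrink n (s z) t) i)"
      by (rule continuous_map_eq) (use i in \<open>auto simp: shrink_def affine_cube_def\<close>)
  qed
  then have "continuous_map Z (compact_open (unit_cube n) (unit_cube n)) (\<lambda>z. shrink n (s z))"
    by (rule continuous_map_into_compact_open) (simp add: shrink_def affine_cube_extensional)
  then show ?thesis
    unfolding TD_space_def continuous_map_in_subtopology using TD_shrink b by auto
qed

section \<open>The radial retraction of a cube\<close>

primrec rad :: "nat \<Rightarrow> (nat \<Rightarrow> real) \<Rightarrow> real" where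
  "rad 0 z = 0"
| "rad (Suc N) z = max (rad N z) \<bar>z (Suc N) - 1/2\<bar>"

text \<open>Radial projection to the boundary where the sup-distance \<open>rad\<close> from the
  centre is at least 1/4, and dilation by 2 on the inner cube. It fixes the boundary.\<close>

definition retr :: "nat \<Rightarrow> (nat \<Rightarrow> real) \<Rightarrow> nat \<Rightarrow> real" where
  "retr N z = (\<lambda>i\<in>{1..N}. 1/2 + (z i - 1/2) / (2 * max (rad N z) (1/4)))"

lemma rad_ge: "i \<in> {1..N} \<Longrightarrow> \<bar>z i - 1/2\<bar> \<le> rad N z"
  by (induction N) (auto simp: le_Suc_eq)

lemma rad_attained: "rad N z > 0 \<Longrightarrow> \<exists>i\<in>{1..N}. rad N z = \<bar>z i - 1/2\<bar>"
proof (induction N)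
  case (Suc N)
  show ?case
  proof (cases "rad N z \<le> \<bar>z (Suc N) - 1/2\<bar>")
    case True then show ?thesis by (intro bexI[of _ "Suc N"]) auto
  next
    case False
    then have "rad N z > 0" by linarith
    then obtain i where "i \<in> {1..N}" "rad N z = \<bar>z i - 1/2\<bar>" using Suc by blast
    then show ?thesis using False by (intro bexI[of _ i]) auto
  qed
qed simp

lemma rad_le_half:
  assumes "\<And>i. i \<in> {1..N} \<Longrightarrow> z i \<in> {0..1}"
  shows "rad N z \<le> 1/2"
  using assms
proof (induction N)
  case (Suc N)
  have "z (Suc N) \<in> {0..1}" by (rule Suc.prems) simp
  then have "0 \<le> z (Suc N)" "z (Suc N) \<le> 1" by auto
  then have "\<bar>z (Suc N) - 1/2\<bar> \<le> 1/2" by linarith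
  moreover have "rad N z \<le> 1/2" by (rule Suc.IH) (use Suc.prems in auto)
  ultimately show ?case unfolding rad.simps by (intro max.boundedI)
qed simp

lemma rad_continuous:
  assumes "M \<le> N"
  shows "continuous_map (unit_cube N) euclideanreal (rad M)"
  using assms
proof (induction M)
  case 0
  have "rad 0 = (\<lambda>_. 0)" by (simp add: fun_eq_iff)
  then show ?case by simp
next
  case (Suc M)
  have "continuous_map (unit_cube N) euclideanreal (\<lambda>z. z (Suc M))"
    using Suc.prems by (intro continuous_map_cube_coord[OF continuous_map_ident]) simp
  then have "continuous_map (unit_cube N) euclideanreal (\<lambda>z. max (rad M z) \<bar>z (Suc M) - 1/2\<bar>)"
    using Suc by (intro continuous_map_real_max continuous_map_real_abs continuous_map_diff) auto
  moreover have "rad (Suc M) = (\<lambda>z. max (rad M z) \<bar>z (Suc M) - 1/2\<bar>)" by (simp add: fun_eq_iff)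
  ultimately show ?case by simp
qed

lemma cube_rad: "z \<in> cube_set N \<Longrightarrow> rad N z \<le> 1/2"
  by (rule rad_le_half) (auto simp: cube_set_eq PiE_iff)

lemma retr_in_cube: "retr N z \<in> cube_set N"
proof -
  have "retr N z i \<in> {0..1}" if i: "i \<in> {1..N}" for i
  proof -
    let ?d = "max (rad N z) (1/4)"
    have d: "?d > 0" by simp
    have "\<bar>z i - 1/2\<bar> \<le> ?d" using rad_ge[OF i, of z] by linarith
    then have "\<bar>(z i - 1/2) / (2 * ?d)\<bar> \<le> 1/2" using d by (simp add: abs_divide divide_le_eq)
    moreover have "retr N z i = 1/2 + (z i - 1/2) / (2 * ?d)" unfolding retr_def using i by (rule restrict_apply')
    ultimately show ?thesis unfolding atLeastAtMost_iff by linarith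
  qed
  then show ?thesis by (simp add: cube_set_eq PiE_iff retr_def)
qed

lemma retr_continuous: "continuous_map (unit_cube N) (unit_cube N) (retr N)"
proof (rule continuous_map_into_unit_cube[OF retr_in_cube])
  fix i assume i: "i \<in> {1..N}"
  have z: "continuous_map (unit_cube N) euclideanreal (\<lambda>z. z i)"
    by (rule continuous_map_cube_coord[OF continuous_map_ident i])
  have "continuous_map (unit_cube N) euclideanreal (\<lambda>z. 1/2 + (z i - 1/2) / (2 * max (rad N z) (1/4)))"
    by (intro continuous_map_add continuous_map_real_divide continuous_map_diff continuous_map_real_mult_left
        continuous_map_real_max z rad_continuous) auto
  then show "continuous_map (unit_cube N) euclideanreal (\<lambda>z. retr N z i)" using i by (simp add: retr_def)
qed

lemma retr_boundary:
  assumes "1/4 \<le> rad N z"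
  shows "retr N z \<in> boundary N"
proof -
  have r: "rad N z > 0" using assms by linarith
  obtain i where i: "i \<in> {1..N}" "rad N z = \<bar>z i - 1/2\<bar>" using rad_attained[OF r] by blast
  have m: "max (rad N z) (1/4) = rad N z" using assms by simp
  have "(z i - 1/2) / (2 * rad N z) = 1/2 \<or> (z i - 1/2) / (2 * rad N z) = - (1/2)"
    using i(2) r by (cases "z i \<ge> 1/2") (auto simp: field_simps)
  moreover have "retr N z i = 1/2 + (z i - 1/2) / (2 * rad N z)"
    unfolding retr_def restrict_apply'[OF i(1)] m ..
  ultimately have "retr N z i = 0 \<or> retr N z i = 1" by linarith
  then show ?thesis using i(1) retr_in_cube by (auto simp: unit_cube_boundary_def)
qed

lemma rad_on_boundary:
  assumes "z \<in> boundary N"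
  shows "rad N z = 1/2" "retr N z = z"
proof -
  obtain i where i: "i \<in> {1..N}" "z i = 0 \<or> z i = 1" and z: "z \<in> cube_set N"
    using assms by (auto simp: unit_cube_boundary_def)
  have "1/2 \<le> rad N z" using rad_ge[OF i(1), of z] i(2) by auto
  then show r: "rad N z = 1/2" using cube_rad[OF z] by simp
  show "retr N z = z"
  proof (rule extensionalityI[of _ "{1..N}"])
    show "retr N z i = z i" if "i \<in> {1..N}" for i unfolding retr_def r restrict_apply'[OF that] by simp
  qed (use z in \<open>auto simp: retr_def cube_set_eq PiE_iff\<close>)
qed

text \<open>The edges are at most 1 before and at most \<open>s\<close> after shrinking, so two half
  edges fit between centres that are \<open>s\<close> apart.\<close>

lemma cell_shrunk_cubes:
  assumes n: "n \<ge> 1" and h: "TD_map n h" and h': "TD_map n h'" and s: "0 < s" "s \<le> 1" and m: "m \<in> {1..n}"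
    and d: "s \<le> (corner n h' m + side n h' / 2) - (corner n h m + side n h / 2)"
  shows "cube_before n m (cube_compose n h (shrink n s)) (cube_compose n h' (shrink n s))"
proof -
  have sh: "corner n (shrink n s) m = (1 - s) / 2" "side n (shrink n s) = s"
    using n m by (simp_all add: shrink_def corner_affine side_affine)
  note A = TD_map_affine[OF n h] and B = TD_map_affine[OF n h']
  have "side n h \<le> 1" "side n h' \<le> 1" using A(3)[OF m] B(3)[OF m] by linarith+
  then have "s * (side n h + side n h') \<le> s * 2" using s by (intro mult_left_mono) auto
  then have "side n h * s + side n h' * s \<le> 2 * s" by (simp add: algebra_simps)
  then have "corner n h m + side n h * ((1 - s) / 2) + side n h * s \<le> corner n h' m + side n h' * ((1 - s) / 2)"
    using d by (simp add: field_simps)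
  then show ?thesis
    using cube_compose_TD[OF n h TD_shrink[OF s]] cube_compose_TD[OF n h' TD_shrink[OF s]] m
    by (simp add: cube_before_def sh)
qed

text \<open>By compactness of the parameter cube. The 1 in the minimum also covers
  \<open>k = 0\<close>.\<close>

lemma side_lower_bound:
  fixes k :: nat
  assumes n: "n \<ge> 1" and g: "\<And>i. i \<in> {1..k} \<Longrightarrow> continuous_map (unit_cube N) (TD_space n) (\<lambda>z. g z i)"
  obtains \<beta> where "\<beta> > 0" "\<beta> \<le> 1" "\<And>z i. z \<in> cube_set N \<Longrightarrow> i \<in> {1..k} \<Longrightarrow> \<beta> \<le> side n (g z i)"
proof -
  have "\<exists>\<beta>>0. \<forall>z\<in>cube_set N. \<beta> \<le> side n (g z i)" if i: "i \<in> {1..k}" for i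
  proof -
    have c: "continuous_map (unit_cube N) euclideanreal (\<lambda>z. side n (g z i))"
      by (rule continuous_map_side[OF g[OF i] n])
    have "compactin euclideanreal ((\<lambda>z. side n (g z i)) ` cube_set N)"
      by (rule image_compactin[OF _ c]) (use compact_Hausdorff_unit_cube(1)[of N] in \<open>simp add: compact_space_def\<close>)
    then have cp: "compact ((\<lambda>z. side n (g z i)) ` cube_set N)" by simp
    have "(\<lambda>z. side n (g z i)) ` cube_set N \<noteq> {}" using corners_in_cube[of N] by blast
    then obtain v where v: "v \<in> (\<lambda>z. side n (g z i)) ` cube_set N" "\<forall>w\<in>(\<lambda>z. side n (g z i)) ` cube_set N. v \<le> w"
      using compact_attains_inf[OF cp] by blast
    then obtain z where z: "z \<in> cube_set N" "v = side n (g z i)" by blast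
    have "TD_map n (g z i)" using g[OF i] z topspace_TD_space[of n] by (auto simp: continuous_map_def)
    then have "v > 0" using z TD_map_affine(2)[OF n] by blast
    then show ?thesis using v(2) by (intro exI[of _ v]) auto
  qed
  then obtain B where B: "\<And>i. i \<in> {1..k} \<Longrightarrow> B i > 0 \<and> (\<forall>z\<in>cube_set N. B i \<le> side n (g z i))" by metis
  show thesis
  proof (rule that[of "Min (insert 1 (B ` {1..k}))"])
    show "Min (insert 1 (B ` {1..k})) > 0" using B by (subst Min_gr_iff) auto
    show "Min (insert 1 (B ` {1..k})) \<le> 1" by simp
    fix z i assume "z \<in> cube_set N" "i \<in> {1..k}"
    then have "B i \<le> side n (g z i)" using B by blast
    moreover have "Min (insert 1 (B ` {1..k})) \<le> B i" using \<open>i \<in> {1..k}\<close> by (intro Min_le) auto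
    ultimately show "Min (insert 1 (B ` {1..k})) \<le> side n (g z i)" by linarith
  qed
qed

text \<open>The boundary lift is extended over a collar in which the cubes are first shrunk and then
  the prefixes of the free scales are switched on. At the inner end of the collar the result no
  longer depends on the given progress functions and can be continued over the inner cube.\<close>

lemma forget_progress_lifting:
  assumes n: "n \<ge> 1"
  shows "rel_boundary_lifting (opd_space (cube_progress_operad n) k) (opd_space (little_cubes n) k) (forget_progress n k)"
  unfolding rel_boundary_lifting_def
proof (intro allI impI)
  let ?X = "opd_space (cube_progress_operad n) k" and ?Y = "opd_space (little_cubes n) k"
  fix N g b
  assume g: "continuous_map (unit_cube N) ?Y g"
    and b: "continuous_map (subtopology (unit_cube N) (boundary N)) ?X b"
    and fb: "\<forall>t\<in>boundary N. forget_progress n k (b t) = g t"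
  interpret C: operadic_monoid "TD_space n" "cube_compose n" "cube_id n" "cubes_disjoint n"
    rewrites "tuple_operad (TD_space n) (cube_compose n) (cube_id n) (cubes_disjoint n) = little_cubes n"
    by (rule operadic_monoid_cubes[OF n]) (rule little_cubes_eq[symmetric])
  interpret P: operadic_monoid "cpe_space n" "cpe_mul n" "cp_encode n (cp_unit n)" "cpe_compat n"
    rewrites "tuple_operad (cpe_space n) (cpe_mul n) (cp_encode n (cp_unit n)) (cpe_compat n) = cube_progress_operad n"
    by (rule operadic_monoid_cpe(1)[OF n]) (rule cube_progress_operad_def[symmetric])
  let ?Z = "unit_cube N" and ?B = "subtopology (unit_cube N) (boundary N)"
  have tB: "topspace ?B = boundary N" using boundary_subset[of N] by auto
  have gi: "continuous_map ?Z (TD_space n) (\<lambda>z. g z i)" if "i \<in> {1..k}" for i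
    by (rule C.continuous_map_space_at[OF g that])
  have gY: "g z \<in> topspace ?Y" if "z \<in> cube_set N" for z using g that by (auto simp: continuous_map_def)
  have TD: "TD_map n (g z i)" if "z \<in> cube_set N" "i \<in> {1..k}" for z i
    using C.space_at[OF gY[OF that(1)] that(2)] topspace_TD_space by blast
  obtain \<beta> where \<beta>: "\<beta> > 0" "\<beta> \<le> 1" "\<And>z i. z \<in> cube_set N \<Longrightarrow> i \<in> {1..k} \<Longrightarrow> \<beta> \<le> side n (g z i)"
    using side_lower_bound[of n k N g, OF n gi] by blast
  \<comment> \<open>Scales up to \<open>A\<close> suffice for \<open>exists_weight_1\<close>. The
    choice of \<delta> gives \<open>hi A = \<beta> / 2\<close>, so even the largest gap ends below
    \<beta>, the least distance of two centres in a direction that separates their cubes.\<close>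
  define A where "A = k * k * n"
  define \<delta> where "\<delta> = \<beta> / 8 ^ Suc A"
  have \<delta>: "\<delta> > 0" using \<beta> by (simp add: \<delta>_def)
  interpret S: scales n k \<delta> by standard (rule \<delta>)
  have hi: "S.hi a < \<beta>" if "a \<le> A" for a
  proof -
    have "S.hi a \<le> S.hi A" using S.hi_mono[OF that] by simp
    also have "S.hi A = \<beta> / 2" unfolding S.hi_def unfolding \<delta>_def by simp
    finally show ?thesis using \<beta> by simp
  qed
  have \<delta>\<beta>: "\<delta> < \<beta>" "\<delta> \<le> 1" using hi[of 0] S.lo_hi(4)[of 0] \<beta>(2) by simp_all
  define x where "x z i m = corner n (g z i) m + side n (g z i) / 2" for z i m
  have xc: "continuous_map ?Z euclideanreal (\<lambda>z. x z i m)" if "i \<in> {1..k}" "m \<in> {1..n}" for i m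
    unfolding x_def by (intro continuous_map_add continuous_map_real_divide continuous_map_corner[OF gi] continuous_map_side[OF gi] that n) auto
  have sep: "\<beta> \<le> x z j m - x z i m" if "z \<in> cube_set N" "i \<in> {1..k}" "j \<in> {1..k}" "cube_before n m (g z i) (g z j)" for z i j m
    using that \<beta>(3)[OF that(1,2)] \<beta>(3)[OF that(1,3)] by (simp add: x_def cube_before_def)
  \<comment> \<open>A separating direction has a difference of at least \<beta>, hence some
    coordinate is far at each of these scales. The last far one decides, since freeness makes the
    later ones close.\<close>
  have tot: "S.total_at a (x z)" if fr: "S.free a (x z)" and aA: "a < Suc A" and z: "z \<in> cube_set N" for a z
    unfolding S.total_at_def
  proof (intro ballI impI)
    fix i j assume i: "i \<in> {1..k}" and j: "j \<in> {1..k}" and ne: "i \<noteq> j"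
    have hia: "S.hi a < \<beta>" using hi aA by simp
    have "cubes_disjoint n (g z i) (g z j)" using gY[OF z] i j ne unfolding C.in_space by blast
    then obtain m0 where m0: "m0 \<in> {1..n}" "cube_before n m0 (g z i) (g z j) \<or> cube_before n m0 (g z j) (g z i)"
      unfolding cubes_disjoint_iff[OF n TD[OF z i] TD[OF z j]] by blast
    let ?M = "{m \<in> {1..n}. S.hi a < \<bar>x z j m - x z i m\<bar>}"
    have "\<beta> \<le> \<bar>x z j m0 - x z i m0\<bar>" using m0(2) sep[OF z i j] sep[OF z j i] by fastforce
    then have "m0 \<in> ?M" using m0(1) hia by simp
    then have ne': "?M \<noteq> {}" by blast
    define m where "m = Max ?M"
    have "m \<in> ?M" unfolding m_def using ne' by (intro Max_in) auto
    then have m: "m \<in> {1..n}" "S.hi a < \<bar>x z j m - x z i m\<bar>" by auto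
    have above: "\<bar>x z j m' - x z i m'\<bar> < S.lo a" if "m' \<in> {1..n}" "m < m'" for m'
    proof -
      have "m' \<notin> ?M"
      proof
        assume "m' \<in> ?M"
        then have "m' \<le> m" unfolding m_def by (intro Max_ge) auto
        then show False using that by simp
      qed
      then show ?thesis using S.freeD[OF fr i j that(1)] that(1) by blast
    qed
    then have above': "\<bar>x z i m' - x z j m'\<bar> < S.lo a" if "m' \<in> {1..n}" "m < m'" for m'
      using that by (simp add: abs_minus_commute)
    show "\<exists>m. S.before a (x z) i j m \<or> S.before a (x z) j i m"
    proof (cases "x z j m - x z i m > 0")
      case True
      then have "S.before a (x z) i j m" using m above by (simp add: S.before_def)
      then show ?thesis by blast
    next
      case False
      then have "S.before a (x z) j i m" using m above' by (simp add: S.before_def)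
      then show ?thesis by blast
    qed
  qed
  define pb where "pb z i = snd (cp_decode n (b z i))" for z i
  have bX: "b z \<in> topspace ?X" if "z \<in> boundary N" for z using b that tB by (auto simp: continuous_map_def)
  have bz: "cp_decode n (b z i) = (g z i, pb z i)" "pb z i \<in> progress" "b z i = cp_encode n (g z i, pb z i)"
    if z: "z \<in> boundary N" and i: "i \<in> {1..k}" for z i
  proof -
    have "forget_progress n k (b z) i = g z i" using fb z by simp
    then show 1: "cp_decode n (b z i) = (g z i, pb z i)" using i by (simp add: forget_progress_def pb_def prod_eq_iff)
    have "b z i \<in> topspace (cpe_space n)" using P.space_at[OF bX[OF z] i] .
    then obtain y where y: "y \<in> topspace (cp_space n)" "b z i = cp_encode n y"
      unfolding operadic_monoid_cpe(4)[OF n] by blast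
    then show "pb z i \<in> progress" using cp_decode_encode[OF y(1)] by (simp add: pb_def topspace_cp_space)
    show "b z i = cp_encode n (g z i, pb z i)" using y cp_decode_encode[OF y(1)] 1 by simp
  qed
  have compat: "cp_compat n (g z i, pb z i) (g z j, pb z j)" if z: "z \<in> boundary N" and ij: "i \<in> {1..k}" "j \<in> {1..k}" "i \<noteq> j" for z i j
  proof -
    have "cpe_compat n (b z i) (b z j)" using bX[OF z] ij unfolding P.in_space by blast
    then show ?thesis unfolding cpe_compat_def bz(1)[OF z ij(1)] bz(1)[OF z ij(2)] .
  qed
  \<comment> \<open>The direction in which two cubes are separated is far at every scale in use, so
    it is at most the deciding coordinate, and the given cell condition passes to the latter by
    \<open>cell_mono\<close>.\<close>
  have base: "S.separated (x z) (pb z) \<and> (\<forall>a<Suc A. S.free a (x z) \<longrightarrow> S.compatible_at a (x z) (pb z))"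
    if z: "z \<in> boundary N" for z
  proof (intro conjI allI impI)
    have zc: "z \<in> cube_set N" using z boundary_subset by blast
    show "S.separated (x z) (pb z)"
      unfolding S.separated_def
    proof (intro ballI impI)
      fix i j assume ij: "i \<in> {1..k}" "j \<in> {1..k}" "i \<noteq> j"
      obtain m where m: "m \<in> {1..n}" "cube_before n m (g z i) (g z j) \<and> cell m (pb z i) (pb z j) \<or>
        cube_before n m (g z j) (g z i) \<and> cell m (pb z j) (pb z i)"
        using compat[OF z ij] unfolding cp_compat_def fst_conv snd_conv by blast
      have "\<delta> \<le> x z j m - x z i m" if "cube_before n m (g z i) (g z j)" using sep[OF zc ij(1,2) that] \<delta>\<beta> by linarith
      moreover have "\<delta> \<le> x z i m - x z j m" if "cube_before n m (g z j) (g z i)" using sep[OF zc ij(2,1) that] \<delta>\<beta> by linarith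
      ultimately show "\<exists>m\<in>{1..n}. \<delta> \<le> x z j m - x z i m \<and> cell m (pb z i) (pb z j) \<or> \<delta> \<le> x z i m - x z j m \<and> cell m (pb z j) (pb z i)"
        using m by blast
    qed
    fix a assume a: "a < Suc A" and fr: "S.free a (x z)"
    have hia: "S.hi a < \<beta>" using hi a by simp
    show "S.compatible_at a (x z) (pb z)"
      unfolding S.compatible_at_def
    proof (intro ballI allI impI)
      fix i j m' assume i: "i \<in> {1..k}" and j: "j \<in> {1..k}" and bf: "S.before a (x z) i j m'"
      have ne: "i \<noteq> j" using bf S.not_before_self by blast
      obtain m where m: "m \<in> {1..n}" "cube_before n m (g z i) (g z j) \<and> cell m (pb z i) (pb z j) \<or>
        cube_before n m (g z j) (g z i) \<and> cell m (pb z j) (pb z i)"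
        using compat[OF z i j ne] unfolding cp_compat_def fst_conv snd_conv by blast
      have far: "\<beta> \<le> \<bar>x z j m - x z i m\<bar>" using m(2) sep[OF zc i j, of m] sep[OF zc j i, of m] by fastforce
      have le: "m \<le> m'"
      proof (rule ccontr)
        assume "\<not> m \<le> m'"
        then have "\<bar>x z j m - x z i m\<bar> < S.lo a" using bf m(1) by (auto simp: S.before_def)
        then show False using far hia S.lo_hi[of a] by linarith
      qed
      note pi = bz(2)[OF z i] and pj = bz(2)[OF z j]
      show "cell m' (pb z i) (pb z j)"
      proof (cases "m = m'")
        case True
        have "\<not> cube_before n m (g z j) (g z i)"
        proof
          assume "cube_before n m (g z j) (g z i)"
          then have "\<beta> \<le> x z i m - x z j m" by (rule sep[OF zc j i])
          moreover have "S.hi a < x z j m - x z i m" using bf True by (simp add: S.before_def)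
          ultimately show False using \<beta>(1) S.lo_hi(2)[of a] by linarith
        qed
        then show ?thesis using m(2) True by blast
      next
        case False
        then have "m < m'" using le by simp
        then show ?thesis using m(2) cell_mono(1)[OF _ pi pj, of m m'] cell_mono(2)[OF _ pj pi, of m m'] le by blast
      qed
    qed
  qed
  \<comment> \<open>\<rho> grows from 0 on the boundary to 1 on the inner cube
    \<open>rad N z \<le> 1/4\<close>. During its first half the shrinking factor goes from 1 to
    \<delta> and \<theta> from 0 to 1. Only then does \<tau> switch on the prefixes, when centres at
    distance \<delta> are already enough.\<close>
  define \<rho> where "\<rho> z = min 1 (2 * (1 - 2 * rad N z))" for z
  define sh where "sh z = 1 - (1 - \<delta>) * min 1 (2 * \<rho> z)" for z
  define \<theta> where "\<theta> z = min 1 (2 * \<rho> z)" for z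
  define \<tau> where "\<tau> z = max 0 (2 * \<rho> z - 1)" for z
  define \<mu> where "\<mu> z a = \<tau> z * S.weight a (x (retr N z))" for z a
  \<comment> \<open>\<open>pb\<close> is meaningful only on the boundary, which \<open>retr\<close>
    need not hit from the inner cube; there the nest is started from \<open>clamp01\<close> instead.
    On the interface \<open>rad N z = 1/4\<close> some weight is 1, so both starts give the same
    function.\<close>
  define q1 where "q1 z i = S.nest (Suc A) (\<theta> z) (\<mu> z) (\<lambda>a i. real (S.place a (x (retr N z)) i)) 0 (\<lambda>_. clamp01) i" for z i
  define q2 where "q2 z i = S.nest (Suc A) (\<theta> z) (\<mu> z) (\<lambda>a i. real (S.place a (x (retr N z)) i)) 0 (pb (retr N z)) i" for z i
  define q where "q z i = (if rad N z \<le> 1/4 then q1 z i else q2 z i)" for z i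
  define c where "c z i = cube_compose n (g (retr N z) i) (shrink n (sh z))" for z i
  have \<rho>c: "continuous_map ?Z euclideanreal \<rho>"
    unfolding \<rho>_def by (intro continuous_map_real_min continuous_map_real_mult_left continuous_map_diff rad_continuous) auto
  have \<theta>c: "continuous_map ?Z euclideanreal \<theta>"
    unfolding \<theta>_def by (intro continuous_map_real_min continuous_map_real_mult_left \<rho>c) auto
  have \<tau>c: "continuous_map ?Z euclideanreal \<tau>"
    unfolding \<tau>_def by (intro continuous_map_real_max continuous_map_diff continuous_map_real_mult_left \<rho>c) auto
  have shc: "continuous_map ?Z euclideanreal sh"
    unfolding sh_def \<theta>_def[symmetric] by (intro continuous_map_diff continuous_map_real_mult_left \<theta>c) auto
  have xr: "continuous_map ?Z euclideanreal (\<lambda>z. x (retr N z) i m)" if "i \<in> {1..k}" "m \<in> {1..n}" for i m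
    by (rule continuous_map_o[OF retr_continuous xc[OF that]])
  have \<mu>c: "continuous_map ?Z euclideanreal (\<lambda>z. \<mu> z a)" for a
    unfolding \<mu>_def S.weight_def clamp01_def
    by (intro continuous_map_real_mult \<tau>c continuous_map_prod continuous_map_real_max continuous_map_real_min
        continuous_map_real_divide continuous_map_diff continuous_map_real_abs xr) (use \<delta> in auto)
  have \<rho>0: "0 \<le> \<rho> z" "\<rho> z \<le> 1" if "z \<in> cube_set N" for z using cube_rad[OF that] by (auto simp: \<rho>_def)
  have nn: "0 \<le> \<mu> z a" "\<mu> z a \<le> 1" "0 \<le> \<theta> z" "\<tau> z \<le> 1" if "z \<in> cube_set N" for z a
  proof -
    have "0 \<le> \<tau> z" "\<tau> z \<le> 1" using \<rho>0[OF that] by (auto simp: \<tau>_def)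
    then show "0 \<le> \<mu> z a" "\<mu> z a \<le> 1" "\<tau> z \<le> 1"
      using S.weight_bounds[of a "x (retr N z)"] by (auto simp: \<mu>_def mult_le_one)
    show "0 \<le> \<theta> z" using \<rho>0[OF that] by (auto simp: \<theta>_def)
  qed
  have fr: "S.free a (x (retr N z))" if "\<mu> z a \<noteq> 0" for z a
    using that S.weight_free by (auto simp: \<mu>_def)
  have shb: "0 < sh z" "sh z \<le> 1" if "z \<in> cube_set N" for z
  proof -
    have t: "0 \<le> \<theta> z" "\<theta> z \<le> 1" using nn(3)[OF that] by (auto simp: \<theta>_def)
    have "(1 - \<delta>) * \<theta> z \<le> 1 - \<delta>" "0 \<le> (1 - \<delta>) * \<theta> z" using t \<delta>\<beta> by (auto intro: mult_left_le)
    then show "0 < sh z" "sh z \<le> 1" using \<delta> unfolding sh_def \<theta>_def[symmetric] by linarith+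
  qed
  have q1c: "continuous_map ?Z progress_space (\<lambda>z. q1 z i)" if i: "i \<in> {1..k}" for i
    unfolding q1_def
    by (rule S.nest_continuous[where p = "\<lambda>_ _. clamp01" and x = "\<lambda>z. x (retr N z)"])
      (use \<mu>c \<theta>c nn xr fr i in \<open>simp_all add: clamp01_progress\<close>)
  let ?W = "subtopology ?Z {z \<in> cube_set N. 1/4 \<le> rad N z}"
  have retrW: "continuous_map ?W ?B (retr N)"
    unfolding continuous_map_in_subtopology
    using continuous_map_from_subtopology[OF retr_continuous] retr_boundary by auto
  have pbc: "continuous_map ?W progress_space (\<lambda>z. pb (retr N z) i)" if i: "i \<in> {1..k}" for i
  proof -
    have "continuous_map ?B (cp_space n) (\<lambda>z. cp_decode n (b z i))"
      by (rule continuous_map_o[OF P.continuous_map_space_at[OF b i] operadic_monoid_cpe(2)[OF n]])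
    then have "continuous_map ?B progress_space (\<lambda>z. pb z i)"
      unfolding pb_def cp_space_def by (rule continuous_map_snd_comp)
    then show ?thesis by (rule continuous_map_o[OF retrW])
  qed
  have q2c: "continuous_map ?W progress_space (\<lambda>z. q2 z i)" if i: "i \<in> {1..k}" for i
    unfolding q2_def
    by (rule S.nest_continuous[where p = "\<lambda>z. pb (retr N z)" and x = "\<lambda>z. x (retr N z)"])
      (use \<mu>c \<theta>c nn xr fr i pbc in \<open>auto intro: continuous_map_from_subtopology\<close>)
  \<comment> \<open>Here \<tau> no longer scales the weights down, and one of them is 1 by
    \<open>exists_weight_1\<close>.\<close>
  have inner: "\<rho> z = 1" "\<theta> z = 1" "\<tau> z = 1" "\<exists>a\<in>{0..<0 + Suc A}. \<mu> z a = 1" if "rad N z \<le> 1/4" for z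
  proof -
    show r: "\<rho> z = 1" using that by (simp add: \<rho>_def)
    show "\<theta> z = 1" and t: "\<tau> z = 1" using r by (simp_all add: \<theta>_def \<tau>_def)
    obtain a where "a \<le> A" "S.weight a (x (retr N z)) = 1" using S.exists_weight_1 unfolding A_def by blast
    then show "\<exists>a\<in>{0..<0 + Suc A}. \<mu> z a = 1" using t by (intro bexI[of _ a]) (auto simp: \<mu>_def)
  qed
  have qc: "continuous_map ?Z progress_space (\<lambda>z. q z i)" if i: "i \<in> {1..k}" for i
    unfolding q_def
  proof (rule continuous_map_cases_le)
    show "continuous_map ?Z euclideanreal (rad N)" by (rule rad_continuous) simp
    show "continuous_map (subtopology ?Z {x \<in> cube_set N. rad N x \<le> 1/4}) progress_space (\<lambda>z. q1 z i)"
      by (rule continuous_map_from_subtopology[OF q1c[OF i]])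
    show "continuous_map ?W progress_space (\<lambda>z. q2 z i)" by (rule q2c[OF i])
    fix z assume z: "z \<in> cube_set N" and r: "rad N z = 1/4"
    have "real (S.place a (x (retr N z)) i) + 1 \<le> real k" for a using S.place_bound[OF i, of a "x (retr N z)"] by linarith
    moreover have "pb (retr N z) i \<in> progress" using bz(2)[OF retr_boundary i] r by simp
    ultimately show "q1 z i = q2 z i"
      unfolding q1_def q2_def using inner[of z] r nn(1)[OF z]
      by (simp only: inner(2)) (intro S.nest_1, auto simp: clamp01_progress)
  qed simp
  have cTD: "continuous_map ?Z (TD_space n) (\<lambda>z. c z i)" if i: "i \<in> {1..k}" for i
  proof -
    have "continuous_map ?Z (prod_topology (TD_space n) (TD_space n)) (\<lambda>z. (g (retr N z) i, shrink n (sh z)))"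
      by (rule continuous_map_Pair[OF continuous_map_o[OF retr_continuous gi[OF i]] shrink_continuous[OF shc]]) (use shb in blast)
    from continuous_map_o[OF this C.mul_cont] show ?thesis by (simp add: c_def)
  qed
  have cz: "TD_map n (c z i)" if "z \<in> cube_set N" "i \<in> {1..k}" for z i
    using cTD[OF that(2)] that(1) topspace_TD_space[of n] by (auto simp: continuous_map_def)
  have qz: "q z i \<in> progress" if "z \<in> cube_set N" "i \<in> {1..k}" for z i
    using qc[OF that(2)] that(1) by (auto simp: continuous_map_def)
  have cq: "(c z i, q z i) \<in> topspace (cp_space n)" if "z \<in> cube_set N" "i \<in> {1..k}" for z i
    using cz[OF that] qz[OF that] by (simp add: topspace_cp_space)
  \<comment> \<open>While \<tau> = 0, all labels have undergone a common change of time and all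
    cubes a common shrinking of an already compatible tuple. Once \<tau> is positive the shrinking
    factor is \<delta>, and \<open>separated\<close> suffices.\<close>
  have GR: "cp_compat n (c z i, q z i) (c z j, q z j)" if z: "z \<in> cube_set N" and ij: "i \<in> {1..k}" "j \<in> {1..k}" "i \<noteq> j" for z i j
  proof (cases "\<tau> z = 0")
    case True
    let ?w = "retr N z"
    have r: "\<not> rad N z \<le> 1/4" using inner(3)[of z] True by auto
    then have w: "?w \<in> boundary N" by (intro retr_boundary) simp
    have "\<mu> z = (\<lambda>_. 0)" using True by (simp add: \<mu>_def fun_eq_iff)
    moreover obtain d where d: "d \<in> progress" "\<forall>i\<in>{1..k}. S.nest (Suc A) (\<theta> z) (\<lambda>_. 0) (\<lambda>a i. real (S.place a (x ?w) i)) 0 (pb ?w) i = pb ?w i \<circ> d"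
      using S.nest_0[of "pb ?w" "\<theta> z" "\<lambda>a i. real (S.place a (x ?w) i)" "Suc A" 0] bz(2)[OF w] nn(3)[OF z] by auto
    ultimately have qd: "q z i = pb ?w i \<circ> d" if "i \<in> {1..k}" for i
      using r that unfolding q_def q2_def by simp
    have wc: "?w \<in> cube_set N" by (rule retr_in_cube)
    obtain m where m: "m \<in> {1..n}" "cube_before n m (g ?w i) (g ?w j) \<and> cell m (pb ?w i) (pb ?w j) \<or>
        cube_before n m (g ?w j) (g ?w i) \<and> cell m (pb ?w j) (pb ?w i)"
      using compat[OF w ij] unfolding cp_compat_def fst_conv snd_conv by blast
    note T = TD[OF wc ij(1)] TD[OF wc ij(2)] TD_shrink[OF shb[OF z]]
    have "cube_before n m (c z i) (c z j)" if "cube_before n m (g ?w i) (g ?w j)"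
      unfolding c_def by (rule cube_before_mul_right[OF n m(1) T(1,2,3,3) that])
    moreover have "cube_before n m (c z j) (c z i)" if "cube_before n m (g ?w j) (g ?w i)"
      unfolding c_def by (rule cube_before_mul_right[OF n m(1) T(2,1,3,3) that])
    moreover have "cell m (q z i) (q z j)" if "cell m (pb ?w i) (pb ?w j)"
      unfolding qd[OF ij(1)] qd[OF ij(2)] by (rule cell_compose_right[OF that bz(2)[OF w ij(1)] bz(2)[OF w ij(2)] d(1)])
    moreover have "cell m (q z j) (q z i)" if "cell m (pb ?w j) (pb ?w i)"
      unfolding qd[OF ij(1)] qd[OF ij(2)] by (rule cell_compose_right[OF that bz(2)[OF w ij(2)] bz(2)[OF w ij(1)] d(1)])
    ultimately show ?thesis unfolding cp_compat_def fst_conv snd_conv using m by blast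
  next
    case False
    let ?w = "retr N z"
    have wc: "?w \<in> cube_set N" by (rule retr_in_cube)
    have "2 * \<rho> z > 1" using False by (auto simp: \<tau>_def max_def split: if_splits)
    then have \<theta>1: "\<theta> z = 1" and sh1: "sh z = \<delta>" by (simp_all add: \<theta>_def sh_def)
    have "S.separated (x ?w) (q z)"
    proof (cases "rad N z \<le> 1/4")
      case True
      have "S.separated (x ?w) (q1 z)"
        unfolding q1_def[abs_def] \<theta>1 
        using S.nest_compatible_at[of "x ?w" "Suc A" "\<mu> z" "\<lambda>_. clamp01" 0 "Suc A"] tot[OF _ _ wc] nn(1,2)[OF z] fr[of z] inner(4)[OF True]
        by (simp add: clamp01_progress)
      moreover have "q z = q1 z" using True by (simp add: q_def fun_eq_iff)
      ultimately show ?thesis by simp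
    next
      case False
      then have w: "?w \<in> boundary N" by (intro retr_boundary) simp
      have "S.separated (x ?w) (q2 z)"
        unfolding q2_def[abs_def] \<theta>1 
        using S.nest_compatible_at[of "x ?w" "Suc A" "\<mu> z" "pb ?w" 0 "Suc A"] tot[OF _ _ wc] nn(1,2)[OF z] fr[of z] base[OF w] bz(2)[OF w]
        by simp
      moreover have "q z = q2 z" using False by (simp add: q_def fun_eq_iff)
      ultimately show ?thesis by simp
    qed
    then obtain m where m: "m \<in> {1..n}" "\<delta> \<le> x ?w j m - x ?w i m \<and> cell m (q z i) (q z j) \<or> \<delta> \<le> x ?w i m - x ?w j m \<and> cell m (q z j) (q z i)"
      using ij unfolding S.separated_def by blast
    have "cube_before n m (c z i) (c z j)" if "\<delta> \<le> x ?w j m - x ?w i m"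
      unfolding c_def sh1 by (rule cell_shrunk_cubes[OF n TD[OF wc ij(1)] TD[OF wc ij(2)] \<delta> \<delta>\<beta>(2) m(1)]) (use that in \<open>simp add: x_def\<close>)
    moreover have "cube_before n m (c z j) (c z i)" if "\<delta> \<le> x ?w i m - x ?w j m"
      unfolding c_def sh1 by (rule cell_shrunk_cubes[OF n TD[OF wc ij(2)] TD[OF wc ij(1)] \<delta> \<delta>\<beta>(2) m(1)]) (use that in \<open>simp add: x_def\<close>)
    ultimately show ?thesis unfolding cp_compat_def fst_conv snd_conv using m by blast
  qed
  define G where "G z = (\<lambda>i\<in>{1..k}. cp_encode n (c z i, q z i))" for z
  have Gi: "cp_decode n (G z i) = (c z i, q z i)" if "z \<in> cube_set N" "i \<in> {1..k}" for z i
    using cp_decode_encode[OF cq[OF that]] that by (simp add: G_def)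
  have GX: "G z \<in> topspace ?X" if z: "z \<in> cube_set N" for z
    unfolding P.in_space
  proof (intro conjI ballI impI)
    show "G z \<in> {1..k} \<rightarrow>\<^sub>E topspace (cpe_space n)"
      unfolding operadic_monoid_cpe(4)[OF n] using cq[OF z] by (auto simp: G_def)
    fix i j assume "i \<in> {1..k}" "j \<in> {1..k}" "i \<noteq> j"
    then show "cpe_compat n (G z i) (G z j)" using GR[OF z] Gi[OF z] by (simp add: cpe_compat_def)
  qed
  have Gc: "continuous_map ?Z ?X G"
  proof (rule P.continuous_map_into_space[OF GX])
    fix i assume i: "i \<in> {1..k}"
    have "continuous_map ?Z (cp_space n) (\<lambda>z. (c z i, q z i))"
      unfolding cp_space_def by (rule continuous_map_Pair[OF cTD[OF i] qc[OF i]])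
    from continuous_map_o[OF this operadic_monoid_cpe(3)[OF n]] i
    show "continuous_map ?Z (cpe_space n) (\<lambda>z. G z i)" by (simp add: G_def)
  qed
  have bd: "sh z = 1" "\<theta> z = 0" "\<mu> z = (\<lambda>_. 0)" "retr N z = z" "\<not> rad N z \<le> 1/4" if "z \<in> boundary N" for z
    using rad_on_boundary[OF that] by (auto simp: sh_def \<theta>_def \<mu>_def \<tau>_def \<rho>_def)
  have Gb: "G z = b z" if z: "z \<in> boundary N" for z
  proof (rule extensionalityI[of _ "{1..k}"])
    show "G z \<in> extensional {1..k}" by (simp add: G_def)
    show "b z \<in> extensional {1..k}" by (rule P.space_extensional[OF bX[OF z]])
    fix i assume i: "i \<in> {1..k}"
    have zc: "z \<in> cube_set N" using z boundary_subset by blast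
    have "c z i = g z i" unfolding c_def bd[OF z] shrink_1 by (rule cube_compose_id(2)[OF TD[OF zc i]])
    moreover have "q z i = pb z i"
      unfolding q_def q2_def using bd[OF z] S.nest_0_0[of "pb z" i] bz(2)[OF z i] by (simp del: S.nest.simps)
    ultimately show "G z i = b z i" using bz(3)[OF z i] i by (simp add: G_def)
  qed
  \<comment> \<open>The homotopy moves the parameter straight towards its retraction and shrinks the
    cubes at the same time; both movements are stationary on the boundary.\<close>
  define \<kappa> where "\<kappa> w = (\<lambda>i\<in>{1..N}. (1 - fst w) * snd w i + fst w * retr N (snd w) i)" for w :: "real \<times> (nat \<Rightarrow> real)"
  define st where "st w = 1 - fst w * (1 - sh (snd w))" for w :: "real \<times> (nat \<Rightarrow> real)"
  define H where "H w = (\<lambda>i\<in>{1..k}. cube_compose n (g (\<kappa> w) i) (shrink n (st w)))" for w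
  let ?P = "prod_topology (top_of_set {0..1::real}) ?Z"
  have \<kappa>in: "\<kappa> w \<in> cube_set N" if "w \<in> topspace ?P" for w
  proof -
    have w: "fst w \<in> {0..1}" "snd w \<in> cube_set N" using that by auto
    have "\<kappa> w i \<in> {0..1}" if i: "i \<in> {1..N}" for i
    proof -
      have "snd w i \<in> {0..1}" using w(2) i unfolding cube_set_eq by (rule PiE_mem)
      moreover have "retr N (snd w) i \<in> {0..1}" using retr_in_cube[of N "snd w"] i unfolding cube_set_eq by (rule PiE_mem)
      ultimately have "(1 - fst w) *\<^sub>R snd w i + fst w *\<^sub>R retr N (snd w) i \<in> {0..1}"
        using w(1) by (intro convexD_alt[of "{0..1::real}"]) auto
      then show ?thesis using i by (simp add: \<kappa>_def)
    qed
    then show ?thesis by (simp add: cube_set_eq PiE_iff \<kappa>_def)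
  qed
  have fstc: "continuous_map ?P euclideanreal fst" by (rule continuous_map_into_fulltopology[OF continuous_map_fst])
  have \<kappa>c: "continuous_map ?P ?Z \<kappa>"
  proof (rule continuous_map_into_unit_cube[OF \<kappa>in])
    fix i assume i: "i \<in> {1..N}"
    have "continuous_map ?P euclideanreal (\<lambda>w. (1 - fst w) * snd w i + fst w * retr N (snd w) i)"
      by (intro continuous_map_add continuous_map_real_mult continuous_map_diff fstc
          continuous_map_cube_coord[OF continuous_map_snd i]
          continuous_map_cube_coord[OF continuous_map_o[OF continuous_map_snd retr_continuous] i]) simp
    then show "continuous_map ?P euclideanreal (\<lambda>w. \<kappa> w i)" using i by (simp add: \<kappa>_def)
  qed
  have stc: "continuous_map ?P euclideanreal st"
    unfolding st_def by (intro continuous_map_diff continuous_map_real_mult fstc continuous_map_o[OF continuous_map_snd shc]) auto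
  have stb: "0 < st w \<and> st w \<le> 1" if "w \<in> topspace ?P" for w
  proof -
    have w: "0 \<le> fst w" "fst w \<le> 1" "snd w \<in> cube_set N" using that by auto
    note s = shb[OF w(3)]
    have "fst w * (1 - sh (snd w)) \<le> 1 - sh (snd w)" "0 \<le> fst w * (1 - sh (snd w))"
      using w s by (auto intro: mult_left_le_one_le)
    then show ?thesis using s unfolding st_def by linarith
  qed
  have HY: "H w \<in> topspace ?Y" if w: "w \<in> topspace ?P" for w
    unfolding C.in_space
  proof (intro conjI ballI impI)
    have sT: "TD_map n (shrink n (st w))" using TD_shrink stb[OF w] by blast
    show "H w \<in> {1..k} \<rightarrow>\<^sub>E topspace (TD_space n)"
      using cube_compose_TD(1)[OF n TD[OF \<kappa>in[OF w]] sT] by (auto simp: H_def topspace_TD_space)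
    fix i j assume ij: "i \<in> {1..k}" "j \<in> {1..k}" "i \<noteq> j"
    have "cubes_disjoint n (g (\<kappa> w) i) (g (\<kappa> w) j)" using gY[OF \<kappa>in[OF w]] ij unfolding C.in_space by blast
    then show "cubes_disjoint n (H w i) (H w j)"
      using C.R_right TD[OF \<kappa>in[OF w]] sT ij by (simp add: H_def topspace_TD_space)
  qed
  have Hc: "continuous_map ?P ?Y H"
  proof (rule C.continuous_map_into_space[OF HY])
    fix i assume i: "i \<in> {1..k}"
    have "continuous_map ?P (prod_topology (TD_space n) (TD_space n)) (\<lambda>w. (g (\<kappa> w) i, shrink n (st w)))"
      by (rule continuous_map_Pair[OF continuous_map_o[OF \<kappa>c gi[OF i]] shrink_continuous[OF stc stb]])
    from continuous_map_o[OF this C.mul_cont] i show "continuous_map ?P (TD_space n) (\<lambda>w. H w i)" by (simp add: H_def)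
  qed
  have g_ext: "g z \<in> extensional {1..k}" if "z \<in> cube_set N" for z by (rule C.space_extensional[OF gY[OF that]])
  have Hg: "H w = g z" if z: "z \<in> cube_set N" "\<kappa> w = z" "st w = 1" for w z
  proof (rule extensionalityI[of _ "{1..k}"])
    show "H w \<in> extensional {1..k}" by (simp add: H_def)
    show "g z \<in> extensional {1..k}" by (rule g_ext[OF z(1)])
    fix i assume i: "i \<in> {1..k}"
    then show "H w i = g z i" unfolding H_def z shrink_1 using cube_compose_id(2)[OF TD[OF z(1) i]] by simp
  qed
  have hom: "homotopic_with (\<lambda>u. \<forall>t\<in>boundary N. u t = g t) ?Z ?Y g (forget_progress n k \<circ> G)"
    unfolding homotopic_with_boundary
  proof (intro exI[of _ H] conjI ballI)
    show "continuous_map ?P ?Y H" by (rule Hc)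
    show "H (0, z) = g z" if z: "z \<in> cube_set N" for z
    proof (rule Hg[OF z])
      show "\<kappa> (0, z) = z" by (rule extensionalityI[of _ "{1..N}"]) (use z in \<open>auto simp: \<kappa>_def cube_set_eq PiE_iff\<close>)
      show "st (0, z) = 1" by (simp add: st_def)
    qed
    show "H (1, z) = (forget_progress n k \<circ> G) z" if z: "z \<in> cube_set N" for z
    proof (rule extensionalityI[of _ "{1..k}"])
      have "\<kappa> (1, z) = retr N z" by (rule extensionalityI[of _ "{1..N}"]) (auto simp: \<kappa>_def retr_def)
      then show "H (1, z) i = (forget_progress n k \<circ> G) z i" if "i \<in> {1..k}" for i
        using that Gi[OF z that] by (simp add: H_def forget_progress_def c_def st_def)
    qed (auto simp: H_def forget_progress_def)
    show "H (s, t) = g t" if s: "s \<in> {0..1}" and t: "t \<in> boundary N" for s t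
    proof (rule Hg)
      show tc: "t \<in> cube_set N" using t boundary_subset by blast
      show "\<kappa> (s, t) = t"
        by (rule extensionalityI[of _ "{1..N}"]) (use tc bd(4)[OF t] in \<open>auto simp: \<kappa>_def cube_set_eq PiE_iff algebra_simps\<close>)
      show "st (s, t) = 1" using bd(1)[OF t] by (simp add: st_def)
    qed
  qed
  show "\<exists>G. continuous_map ?Z ?X G \<and> (\<forall>t\<in>boundary N. G t = b t) \<and>
        homotopic_with (\<lambda>u. \<forall>t\<in>boundary N. u t = g t) ?Z ?Y g (forget_progress n k \<circ> G)"
    by (intro exI[of _ G] conjI ballI Gc hom Gb)
qed

lemma E_operad_cube_progress:
  assumes n: "n \<ge> 1"
  shows "E_operad n (cube_progress_operad n)"
proof -
  have "operad_weak_equivalence (cube_progress_operad n) (little_cubes n) (forget_progress n)"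
    unfolding operad_weak_equivalence_def
    using forget_progress_morphism[OF n] weak_homotopy_equivalence_if_lifting[OF _ forget_progress_lifting[OF n]]
    unfolding operad_morphism_def by blast
  then have "weakly_equivalent_operads (cube_progress_operad n) (little_cubes n)"
    unfolding weakly_equivalent_operads_def
    using topological_operad_cube_progress[OF n] topological_operad_little_cubes[OF n] by (intro r_into_equivclp) blast
  then show ?thesis unfolding E_operad_def using topological_operad_cube_progress[OF n] by blast
qed

section \<open>Complexity\<close>

text \<open>A sequence changes between \<open>a\<close> and \<open>b\<close> at most \<open>m\<close> times iff it can be cut into \<open>m + 1\<close>
  consecutive blocks none of which contains both letters.\<close>

definition alternates :: "nat \<Rightarrow> nat set \<Rightarrow> (nat \<Rightarrow> nat) \<Rightarrow> nat \<Rightarrow> nat \<Rightarrow> bool" where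
  "alternates m T f a b \<longleftrightarrow> (\<exists>\<beta>::nat \<Rightarrow> nat. mono_on T \<beta> \<and> (\<forall>t\<in>T. \<beta> t \<le> m) \<and>
     (\<forall>t\<in>T. \<forall>t'\<in>T. f t = a \<longrightarrow> f t' = b \<longrightarrow> \<beta> t \<noteq> \<beta> t'))"

lemma strict_sorted_nth_less:
  assumes "sorted_wrt (<) (M :: nat list)" "p < q" "q < length M"
  shows "M ! p < M ! q"
  using assms by (simp add: sorted_wrt_nth_less)

lemma exists_change_between:
  assumes "u < v" "(h :: nat \<Rightarrow> 'a) u \<noteq> h v"
  shows "\<exists>p\<ge>u. p < v \<and> h p \<noteq> h (Suc p)"
proof (rule ccontr)
  assume no: "\<not> ?thesis"
  have "h (u + d) = h u" if "u + d \<le> v" for d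
    using that
  proof (induction d)
    case (Suc d)
    have "h (u + d) = h (Suc (u + d))" using no Suc.prems by (metis add_Suc_right le_add1 Suc_le_eq)
    then show ?case using Suc by simp
  qed simp
  from this[of "v - u"] assms show False by simp
qed

text \<open>Given few changes, the block of \<open>t\<close> is the number of changes up to
  \<open>t\<close>. Conversely the block number increases strictly at each change, so the changes
  inject into \<open>{1..m}\<close>.\<close>

lemma changes_map_le_iff:
  assumes T: "finite T" and ab: "a \<noteq> b"
  shows "changes (filter (\<lambda>v. v = a \<or> v = b) (map f (sorted_list_of_set T))) \<le> m \<longleftrightarrow> alternates m T f a b"
proof -
  define M where "M = filter (\<lambda>t. f t = a \<or> f t = b) (sorted_list_of_set T)"
  have eqM: "filter (\<lambda>v. v = a \<or> v = b) (map f (sorted_list_of_set T)) = map f M"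
    by (simp add: M_def filter_map o_def)
  have sM: "sorted_wrt (<) M"
    unfolding M_def by (intro sorted_wrt_filter) (rule strict_sorted_list_of_set)
  have setM: "set M = {t \<in> T. f t = a \<or> f t = b}" using T by (auto simp: M_def)
  define C where "C = {p. Suc p < length M \<and> f (M ! p) \<noteq> f (M ! Suc p)}"
  have finC: "finite C" unfolding C_def by (rule finite_subset[of _ "{..<length M}"]) auto
  have ch: "changes (map f M) = card C"
    unfolding changes_def C_def by (rule arg_cong[where f = card]) (auto simp: Suc_lessD)
  have Mt: "M ! p \<in> T" "f (M ! p) = a \<or> f (M ! p) = b" if "p < length M" for p
    using nth_mem[OF that] unfolding setM by auto
  note lt = strict_sorted_nth_less[OF sM]
  show ?thesis
    unfolding eqM ch
  proof
    assume le: "card C \<le> m"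
    define \<beta> where "\<beta> t = card {p \<in> C. M ! Suc p \<le> t}" for t
    have mono: "\<beta> t \<le> \<beta> t'" if "t \<le> t'" for t t'
      unfolding \<beta>_def using finC that by (intro card_mono) auto
    have strict: "\<beta> t < \<beta> t'" if t: "t \<in> set M" "t' \<in> set M" "t < t'" and ne: "f t \<noteq> f t'" for t t'
    proof -
      obtain u v where u: "u < length M" "t = M ! u" and v: "v < length M" "t' = M ! v"
        using t by (metis in_set_conv_nth)
      have "u < v"
      proof (rule ccontr)
        assume "\<not> u < v"
        then have "t' \<le> t" using lt[of v u] u v by (cases "u = v") auto
        then show False using t by simp
      qed
      then obtain p where p: "u \<le> p" "p < v" "f (M ! p) \<noteq> f (M ! Suc p)"
        using exists_change_between[of u v "\<lambda>p. f (M ! p)"] ne u v by auto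
      have pC: "p \<in> C" using p v by (simp add: C_def)
      have "M ! Suc p \<le> t'" using p v lt[of "Suc p" v] by (cases "Suc p = v") auto
      moreover have "t < M ! Suc p" using p u v lt[of u "Suc p"] by simp
      ultimately have "p \<in> {q \<in> C. M ! Suc q \<le> t'}" "p \<notin> {q \<in> C. M ! Suc q \<le> t}" using pC by auto
      moreover have "{q \<in> C. M ! Suc q \<le> t} \<subseteq> {q \<in> C. M ! Suc q \<le> t'}" using t(3) by auto
      ultimately have "{q \<in> C. M ! Suc q \<le> t} \<subset> {q \<in> C. M ! Suc q \<le> t'}" by blast
      then show ?thesis unfolding \<beta>_def using finC by (intro psubset_card_mono) auto
    qed
    have "\<beta> t \<noteq> \<beta> t'" if t: "t \<in> T" "t' \<in> T" "f t = a" "f t' = b" for t t'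
    proof -
      have "t \<in> set M" "t' \<in> set M" "f t \<noteq> f t'" using t ab by (auto simp: setM)
      moreover have "t \<noteq> t'" using t ab by auto
      ultimately show ?thesis using strict[of t t'] strict[of t' t] by (cases "t < t'") auto
    qed
    moreover have "\<beta> t \<le> m" for t
      using card_mono[OF finC, of "{p \<in> C. M ! Suc p \<le> t}"] le unfolding \<beta>_def by simp
    ultimately show "alternates m T f a b"
      unfolding alternates_def using mono by (intro exI[of _ \<beta>]) (auto simp: mono_on_def)
  next
    assume "alternates m T f a b"
    then obtain \<beta> where \<beta>: "mono_on T \<beta>" "\<forall>t\<in>T. \<beta> t \<le> m"
      "\<forall>t\<in>T. \<forall>t'\<in>T. f t = a \<longrightarrow> f t' = b \<longrightarrow> \<beta> t \<noteq> \<beta> t'" unfolding alternates_def by blast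
    have le: "\<beta> (M ! p) \<le> \<beta> (M ! q)" if "p \<le> q" "q < length M" for p q
    proof (cases "p = q")
      case False
      then have "M ! p < M ! q" using that by (intro lt) auto
      then show ?thesis using \<beta>(1) Mt that by (auto simp: mono_on_def)
    qed simp
    have less: "\<beta> (M ! p) < \<beta> (M ! Suc p)" if "p \<in> C" for p
    proof -
      have p: "Suc p < length M" "f (M ! p) \<noteq> f (M ! Suc p)" using that by (auto simp: C_def)
      have "\<beta> (M ! p) \<noteq> \<beta> (M ! Suc p)"
        using \<beta>(3) Mt[of p] Mt[of "Suc p"] p by (metis Suc_lessD)
      then show ?thesis using le[of p "Suc p"] p by simp
    qed
    have "inj_on (\<lambda>p. \<beta> (M ! Suc p)) C"
    proof (rule inj_onI)
      fix p q assume pq: "p \<in> C" "q \<in> C" "\<beta> (M ! Suc p) = \<beta> (M ! Suc q)"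
      have "\<beta> (M ! Suc p) < \<beta> (M ! Suc q)" if "p < q" "q \<in> C" for p q
      proof -
        have "\<beta> (M ! Suc p) \<le> \<beta> (M ! q)" using that by (intro le) (auto simp: C_def)
        then show ?thesis using less[OF that(2)] by simp
      qed
      then show "p = q" using pq by (metis linorder_neqE_nat nat_neq_iff)
    qed
    moreover have "(\<lambda>p. \<beta> (M ! Suc p)) ` C \<subseteq> {1..m}"
    proof
      fix y assume "y \<in> (\<lambda>p. \<beta> (M ! Suc p)) ` C"
      then obtain p where p: "p \<in> C" "y = \<beta> (M ! Suc p)" by blast
      then have "Suc p < length M" by (simp add: C_def)
      then show "y \<in> {1..m}" using less[OF p(1)] \<beta>(2) Mt(1) p(2) by auto
    qed
    ultimately have "card C \<le> card {1..m}" by (rule card_inj_on_le) simp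
    then show "card C \<le> m" by simp
  qed
qed

lemma admissible_iff:
  "admissible n k T f \<longleftrightarrow> finite T \<and> f \<in> T \<rightarrow>\<^sub>E {1..k} \<and>
     (\<forall>a\<in>{1..k}. \<forall>b\<in>{1..k}. a \<noteq> b \<longrightarrow> alternates n T f a b)"
proof (cases "finite T")
  case True
  let ?c = "\<lambda>a b. changes (filter (\<lambda>v. v = a \<or> v = b) (map f (sorted_list_of_set T)))"
  let ?S = "{?c a b | a b. a \<in> {1..k} \<and> b \<in> {1..k} \<and> a \<noteq> b}"
  have "?S \<subseteq> (\<lambda>(a, b). ?c a b) ` ({1..k} \<times> {1..k})" by auto
  then have fin: "finite ?S" by (rule finite_subset) simp
  have "complexity k T f \<le> n \<longleftrightarrow> (\<forall>c\<in>?S. c \<le> n)"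
    unfolding complexity_def using fin by simp
  also have "\<dots> \<longleftrightarrow> (\<forall>a\<in>{1..k}. \<forall>b\<in>{1..k}. a \<noteq> b \<longrightarrow> alternates n T f a b)"
    using changes_map_le_iff[OF True, of _ _ f n] by blast
  finally show ?thesis using True by (simp add: admissible_def)
qed (simp add: admissible_def)

text \<open>The blocks pull back along \<psi>: repeating or omitting entries of a sequence creates
  no new changes.\<close>

lemma admissible_pullback:
  assumes f: "admissible n k T f" and T': "finite T'" and \<psi>: "\<psi> \<in> ord_hom T' T"
  shows "admissible n k T' (compose T' f \<psi>)"
  unfolding admissible_iff
proof (intro conjI ballI impI)
  have \<psi>in: "\<psi> t \<in> T" if "t \<in> T'" for t using \<psi> that by (auto simp: ord_hom_def)
  show "finite T'" by fact
  show "compose T' f \<psi> \<in> T' \<rightarrow>\<^sub>E {1..k}" using f \<psi>in by (auto simp: admissible_def compose_def)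
  fix a b assume "a \<in> {1..k}" "b \<in> {1..k}" "a \<noteq> b"
  then obtain \<beta> where \<beta>: "mono_on T \<beta>" "\<forall>t\<in>T. \<beta> t \<le> n"
      "\<forall>t\<in>T. \<forall>t'\<in>T. f t = a \<longrightarrow> f t' = b \<longrightarrow> \<beta> t \<noteq> \<beta> t'"
    using f unfolding admissible_iff alternates_def by metis
  have "mono_on T' (\<beta> \<circ> \<psi>)"
    unfolding mono_on_def
  proof (intro allI impI)
    fix r s assume rs: "r \<in> T' \<and> s \<in> T' \<and> r \<le> s"
    then have "\<psi> r \<le> \<psi> s" using \<psi> by (auto simp: ord_hom_def mono_on_def)
    then show "(\<beta> \<circ> \<psi>) r \<le> (\<beta> \<circ> \<psi>) s" using \<beta>(1) \<psi>in rs by (auto simp: mono_on_def)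
  qed
  then show "alternates n T' (compose T' f \<psi>) a b"
    unfolding alternates_def using \<beta>(2,3) \<psi>in by (intro exI[of _ "\<beta> \<circ> \<psi>"]) (auto simp: compose_def)
qed

lemma ord_hom_compose: "\<lbrakk>\<phi> \<in> ord_hom T T'; \<psi> \<in> ord_hom T' T''\<rbrakk> \<Longrightarrow> compose T \<psi> \<phi> \<in> ord_hom T T''"
proof -
  assume \<phi>: "\<phi> \<in> ord_hom T T'" and \<psi>: "\<psi> \<in> ord_hom T' T''"
  have in1: "\<phi> t \<in> T'" if "t \<in> T" for t using \<phi> that by (auto simp: ord_hom_def)
  have in2: "\<psi> t \<in> T''" if "t \<in> T'" for t using \<psi> that by (auto simp: ord_hom_def)
  have "\<psi> (\<phi> r) \<le> \<psi> (\<phi> s)" if "r \<in> T" "s \<in> T" "r \<le> s" for r s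
  proof -
    have "\<phi> r \<le> \<phi> s" using \<phi> that by (auto simp: ord_hom_def mono_on_def)
    then show ?thesis using \<psi> in1 that by (auto simp: ord_hom_def mono_on_def)
  qed
  then show ?thesis using in1 in2 by (auto simp: ord_hom_def compose_def mono_on_def)
qed

lemma ord_hom_fibre:
  assumes "\<psi> \<in> ord_hom T' T" "compose T' f \<psi> = f'"
  shows "restrict \<psi> (fibre T' f' i) \<in> ord_hom (fibre T' f' i) (fibre T f i)"
proof -
  have "f' t = f (\<psi> t)" if "t \<in> T'" for t using assms(2) that by (auto simp: compose_def)
  then show ?thesis using assms(1) by (auto simp: ord_hom_def fibre_def mono_on_def)
qed

lemma finite_fibre: "finite T \<Longrightarrow> finite (fibre T f i)"
  by (simp add: fibre_def)

section \<open>Structure maps including arity zero\<close>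

lemma block_num_mono:
  assumes "t \<le> t'" "t' \<in> {1..sum j {1..k}}"
  shows "block_num j t \<le> block_num j t'"
  unfolding block_num_def
proof (rule Least_le)
  have "t' \<le> sum j {1..LEAST i. t' \<le> sum j {1..i}}" by (rule LeastI[of _ k]) (use assms in simp)
  then show "t \<le> sum j {1..LEAST i. t' \<le> sum j {1..i}}" using assms by simp
qed

text \<open>Omitting the index of the empty block \<open>i0\<close> does not move any
  letter.\<close>

lemma sum_skip:
  fixes j :: "nat \<Rightarrow> nat"
  assumes "j i0 = 0" "1 \<le> i0" "1 \<le> m"
  defines "sh \<equiv> \<lambda>m. if m < i0 then m else m + 1"
  shows "sum (j \<circ> sh) {1..<m} = sum j {1..<sh m}"
  using assms(3)
proof (induction m rule: dec_induct)
  case base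
  show ?case using assms(1,2) by (cases "1 < i0") (auto simp: sh_def numeral_2_eq_2 One_nat_def)
next
  case (step m)
  have "{1..<Suc m} = insert m {1..<m}" using step by auto
  then have "sum (j \<circ> sh) {1..<Suc m} = j (sh m) + sum j {1..<sh m}" using step by simp
  also have "\<dots> = sum j {1..<Suc (sh m)}"
  proof -
    have "{1..<Suc (sh m)} = insert (sh m) {1..<sh m}" using step by (auto simp: sh_def)
    then show ?thesis by simp
  qed
  also have "\<dots> = sum j {1..<sh (Suc m)}"
  proof (cases "Suc m = i0")
    case True
    then have "{1..<sh (Suc m)} = insert i0 {1..<Suc (sh m)}" using assms(2) by (auto simp: sh_def)
    moreover have "i0 \<notin> {1..<Suc (sh m)}" using True by (simp add: sh_def)
    ultimately show ?thesis using assms(1) by simp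
  next
    case False
    then have "sh (Suc m) = Suc (sh m)" by (auto simp: sh_def)
    then show ?thesis by simp
  qed
  finally show ?case .
qed

locale bracketed =
  fixes n :: nat and X :: "'a cosimplicial" and B :: "'a brackets" and \<epsilon> :: 'a
  assumes cosimplicial: "augmented_cosimplicial_space X"
    and brackets_cont: "brackets_continuous n X B"
    and brackets_id: "brackets_identity n X B"
    and brackets_cons: "brackets_consistent n X B"
    and brackets_comm: "brackets_commutative n X B"
    and brackets_assoc: "brackets_associative n X B"
    and eps_in: "\<epsilon> \<in> topspace (cos_space X {})"
    and eps_unit: "\<And>k i T f' x. \<lbrakk>k \<ge> 2; i \<in> {1..k}; admissible n (k - 1) T f';
        x \<in> topspace (fibre_product X (k - 1) T f')\<rbrakk> \<Longrightarrow>
          B k T (compose T (\<lambda>m. if m < i then m else m + 1) f')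
            (\<lambda>m\<in>{1..k}. if m < i then x m else if m = i then \<epsilon> else x (m - 1)) =
          B (k - 1) T f' x"
begin

text \<open>Brackets are given for \<open>k \<ge> 1\<close> only, while the operad has nullary
  operations. Only the empty \<open>T\<close> has a function to the empty set of labels, and its
  bracket has to be the unit.\<close>

definition BB :: "'a brackets" where
  "BB k T f x = (if k = 0 then \<epsilon> else B k T f x)"

lemma BB_positive: "k \<noteq> 0 \<Longrightarrow> BB k T f x = B k T f x"
  by (simp add: BB_def)

lemma cos_map_cont:
  "\<lbrakk>finite T; finite T'; \<phi> \<in> ord_hom T T'\<rbrakk> \<Longrightarrow> continuous_map (cos_space X T) (cos_space X T') (cos_map X T T' \<phi>)"
  by (rule cosimplicial[unfolded augmented_cosimplicial_space_def, THEN conjunct1, rule_format])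

lemma cos_map_in:
  "\<lbrakk>finite T; finite T'; \<phi> \<in> ord_hom T T'; x \<in> topspace (cos_space X T)\<rbrakk> \<Longrightarrow> cos_map X T T' \<phi> x \<in> topspace (cos_space X T')"
  using cos_map_cont[of T T' \<phi>] by (auto simp: continuous_map_def)

lemma cos_map_id: "\<lbrakk>finite T; x \<in> topspace (cos_space X T)\<rbrakk> \<Longrightarrow> cos_map X T T (\<lambda>t\<in>T. t) x = x"
  by (rule cosimplicial[unfolded augmented_cosimplicial_space_def, THEN conjunct2, THEN conjunct1, rule_format])

lemma cos_map_comp:
  "\<lbrakk>finite T; finite T'; finite T''; \<phi> \<in> ord_hom T T'; \<psi> \<in> ord_hom T' T''; x \<in> topspace (cos_space X T)\<rbrakk>
    \<Longrightarrow> cos_map X T T'' (compose T \<psi> \<phi>) x = cos_map X T' T'' \<psi> (cos_map X T T' \<phi> x)"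
  by (rule cosimplicial[unfolded augmented_cosimplicial_space_def, THEN conjunct2, THEN conjunct2, rule_format])

lemma admissible_0: "admissible n 0 T f \<Longrightarrow> T = {}"
  by (auto simp: admissible_def)

lemma BB_cont:
  assumes "admissible n k T f"
  shows "continuous_map (fibre_product X k T f) (cos_space X T) (BB k T f)"
proof (cases "k = 0")
  case True
  then have "T = {}" using assms admissible_0 by blast
  then show ?thesis using eps_in True by (simp add: BB_def[abs_def])
next
  case False
  then have "BB k T f = B k T f" by (simp add: BB_def fun_eq_iff)
  then show ?thesis using brackets_cont assms False by (simp add: brackets_continuous_def)
qed

lemma BB_in:
  "\<lbrakk>admissible n k T f; x \<in> topspace (fibre_product X k T f)\<rbrakk> \<Longrightarrow> BB k T f x \<in> topspace (cos_space X T)"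
  using BB_cont[of k T f] by (auto simp: continuous_map_def)

lemma BB_consistent:
  assumes "\<phi> \<in> ord_hom T T'" "admissible n k T f" "admissible n k T' g" "compose T g \<phi> = f"
    and "x \<in> topspace (fibre_product X k T f)"
  shows "cos_map X T T' \<phi> (BB k T f x) = BB k T' g (\<lambda>i\<in>{1..k}.
          cos_map X (fibre T f i) (fibre T' g i) (restrict \<phi> (fibre T f i)) (x i))"
proof (cases "k = 0")
  case True
  then have T: "T = {}" "T' = {}" using assms admissible_0 by blast+
  have "\<phi> = (\<lambda>t\<in>{}. t)" using assms(1) T by (auto simp: ord_hom_def)
  then show ?thesis using True T eps_in cos_map_id[of "{}" \<epsilon>] by (simp add: BB_def)
next
  case False
  then show ?thesis using brackets_cons assms unfolding brackets_consistent_def BB_def by simp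
qed

lemma BB_commutative:
  assumes "admissible n k T f" "\<sigma> permutes {1..k}" "x \<in> topspace (fibre_product X k T f)"
  shows "BB k T f x = BB k T (compose T \<sigma> f) (\<lambda>i\<in>{1..k}. x (inv \<sigma> i))"
  using brackets_comm assms unfolding brackets_commutative_def BB_def by simp

lemma BB_identity:
  assumes "admissible n 1 T f" "x \<in> topspace (fibre_product X 1 T f)"
  shows "BB 1 T f x = x 1"
  using brackets_id assms unfolding brackets_identity_def BB_def by simp

text \<open>The associativity axiom for the map given by \<open>block_num\<close>. It is surjective
  because no block is empty, and its fibres and offsets are the blocks and their starting
  positions.\<close>

lemma BB_assoc_positive:
  assumes f: "admissible n k T f" and h: "\<And>i. i \<in> {1..k} \<Longrightarrow> admissible n (j i) (fibre T f i) (h i)"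
    and j: "\<And>i. i \<in> {1..k} \<Longrightarrow> 1 \<le> j i" and k: "1 \<le> k"
    and g: "g = (\<lambda>t\<in>T. block_index j (f t) (h (f t) t))"
    and x: "x \<in> topspace (fibre_product X (sum j {1..k}) T g)"
  shows "BB k T f (\<lambda>i\<in>{1..k}. BB (j i) (fibre T f i) (h i) (\<lambda>l\<in>{1..j i}. x (block_index j i l))) =
    BB (sum j {1..k}) T g x"
proof -
  let ?J = "sum j {1..k}"
  define \<xi> where "\<xi> = restrict (block_num j) {1..?J}"
  have ft: "f t \<in> {1..k}" if "t \<in> T" for t using f that by (auto simp: admissible_def)
  have ht: "h i t \<in> {1..j i}" if "t \<in> fibre T f i" "i \<in> {1..k}" for t i
    using h[OF that(2)] that(1) unfolding admissible_def by (meson PiE_mem)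
  have ht': "h (f t) t \<in> {1..j (f t)}" if "t \<in> T" for t
    by (rule ht[OF _ ft[OF that]]) (use that in \<open>simp add: fibre_def\<close>)
  have \<xi>: "\<xi> \<in> ord_hom {1..?J} {1..k}"
    using block_num_pos_bounds(1)[of _ j k] block_num_mono[of _ _ j k]
    by (auto simp: ord_hom_def \<xi>_def mono_on_def)
  have \<xi>_index: "\<xi> (block_index j i l) = i" if "i \<in> {1..k}" "l \<in> {1..j i}" for i l
    using block_index_bounds[of i k l j] block_num_index[of i l j] that by (simp add: \<xi>_def)
  have surj: "\<xi> ` {1..?J} = {1..k}"
  proof
    show "\<xi> ` {1..?J} \<subseteq> {1..k}" using \<xi> by (auto simp: ord_hom_def)
    show "{1..k} \<subseteq> \<xi> ` {1..?J}"
    proof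
      fix i assume i: "i \<in> {1..k}"
      then have "1 \<in> {1..j i}" using j by simp
      then show "i \<in> \<xi> ` {1..?J}" using \<xi>_index[OF i] block_index_bounds[of i k 1 j] i by (metis imageI)
    qed
  qed
  have gT: "g \<in> T \<rightarrow>\<^sub>E {1..?J}"
    unfolding g using block_index_bounds[of _ k _ j] ft ht' by auto
  have comp: "compose T \<xi> g = f"
  proof (rule extensionalityI[of _ T])
    show "f \<in> extensional T" using f by (auto simp: admissible_def PiE_iff)
    show "compose T \<xi> g t = f t" if "t \<in> T" for t
      using that \<xi>_index[of "f t" "h (f t) t"] ft ht' by (simp add: compose_def g)
  qed simp
  have fib: "fibre {1..?J} \<xi> i = block_index j i ` {1..j i}" if i: "i \<in> {1..k}" for i
  proof (intro equalityI subsetI)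
    fix t assume "t \<in> fibre {1..?J} \<xi> i"
    then have t: "t \<in> {1..?J}" "block_num j t = i" by (auto simp: fibre_def \<xi>_def)
    then show "t \<in> block_index j i ` {1..j i}" using block_num_pos_bounds[OF t(1)] by (metis imageI)
  next
    fix t assume "t \<in> block_index j i ` {1..j i}"
    then obtain l where "l \<in> {1..j i}" "t = block_index j i l" by blast
    then show "t \<in> fibre {1..?J} \<xi> i" using \<xi>_index[OF i] block_index_bounds[of i k l j] i by (simp add: fibre_def)
  qed
  have card: "card (fibre {1..?J} \<xi> i) = j i" if "i \<in> {1..k}" for i
    unfolding fib[OF that] by (subst card_image) (auto simp: inj_on_def block_index_def)
  have off: "fibre_offset ?J \<xi> i = sum j {1..<i}" if i: "i \<in> {1..k}" for i
  proof -
    have "{m \<in> {1..?J}. \<xi> m < i} = {1..sum j {1..<i}}"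
    proof (intro equalityI subsetI)
      fix m assume "m \<in> {m \<in> {1..?J}. \<xi> m < i}"
      then have m: "m \<in> {1..?J}" "block_num j m < i" by (auto simp: \<xi>_def)
      have "m \<le> sum j {1..block_num j m}"
        unfolding block_num_def by (rule LeastI[of _ k]) (use m in simp)
      also have "\<dots> \<le> sum j {1..<i}" using m by (intro sum_mono2) auto
      finally show "m \<in> {1..sum j {1..<i}}" using m by simp
    next
      fix m assume m: "m \<in> {1..sum j {1..<i}}"
      have eq: "{1..<i} = {1..i - 1}" using i by auto
      have "sum j {1..i - 1} \<le> ?J" using i by (intro sum_mono_upto) auto
      then have mJ: "m \<in> {1..?J}" using m eq by simp
      have "block_num j m \<le> i - 1" unfolding block_num_def by (rule Least_le) (use m eq in simp)
      then have "block_num j m < i" using i by auto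
      then show "m \<in> {m \<in> {1..?J}. \<xi> m < i}" using mJ by (simp add: \<xi>_def)
    qed
    then show ?thesis by (simp add: fibre_offset_def)
  qed
  have restr: "fibre_restriction ?J \<xi> T g i = h i" if i: "i \<in> {1..k}" for i
  proof (rule extensionalityI[of _ "fibre T f i"])
    show "fibre_restriction ?J \<xi> T g i \<in> extensional (fibre T f i)" by (simp add: fibre_restriction_def comp)
    show "h i \<in> extensional (fibre T f i)" using h[OF i] by (auto simp: admissible_def PiE_iff)
    show "fibre_restriction ?J \<xi> T g i t = h i t" if "t \<in> fibre T f i" for t
      using that unfolding fibre_restriction_def comp off[OF i] by (simp add: g fibre_def block_index_def)
  qed
  have J: "1 \<le> ?J"
  proof -
    have "block_index j 1 1 \<in> {1..?J}" using k j[of 1] by (intro block_index_bounds) auto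
    then show ?thesis by auto
  qed
  have "B k T (compose T \<xi> g) (\<lambda>i\<in>{1..k}.
          B (card (fibre {1..?J} \<xi> i)) (fibre T (compose T \<xi> g) i) (fibre_restriction ?J \<xi> T g i)
            (\<lambda>l\<in>{1..card (fibre {1..?J} \<xi> i)}. x (fibre_offset ?J \<xi> i + l))) = B ?J T g x"
    using brackets_assoc[unfolded brackets_associative_def, rule_format, OF k \<xi> surj gT, of x]
    unfolding comp using f h x by (simp add: card restr)
  moreover have "(\<lambda>i\<in>{1..k}. B (card (fibre {1..?J} \<xi> i)) (fibre T (compose T \<xi> g) i) (fibre_restriction ?J \<xi> T g i)
            (\<lambda>l\<in>{1..card (fibre {1..?J} \<xi> i)}. x (fibre_offset ?J \<xi> i + l))) =
     (\<lambda>i\<in>{1..k}. BB (j i) (fibre T f i) (h i) (\<lambda>l\<in>{1..j i}. x (block_index j i l)))"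
  proof (rule restrict_ext)
    fix i assume i: "i \<in> {1..k}"
    then have "j i \<noteq> 0" using j[OF i] by simp
    then show "B (card (fibre {1..?J} \<xi> i)) (fibre T (compose T \<xi> g) i) (fibre_restriction ?J \<xi> T g i)
            (\<lambda>l\<in>{1..card (fibre {1..?J} \<xi> i)}. x (fibre_offset ?J \<xi> i + l)) =
        BB (j i) (fibre T f i) (h i) (\<lambda>l\<in>{1..j i}. x (block_index j i l))"
      unfolding comp card[OF i] restr[OF i] off[OF i] by (simp add: BB_def block_index_def)
  qed
  ultimately have "B k T f (\<lambda>i\<in>{1..k}. BB (j i) (fibre T f i) (h i) (\<lambda>l\<in>{1..j i}. x (block_index j i l))) = B ?J T g x"
    unfolding comp by simp
  moreover have "k \<noteq> 0" "?J \<noteq> 0" using k J by linarith+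
  ultimately show ?thesis by (simp only: BB_positive not_False_eq_True)
qed

text \<open>An empty block contributes the value \<epsilon> and is removed by the unit axiom.
  Induction removes all of them, until the axiom for nonempty blocks applies.\<close>

lemma BB_assoc:
  assumes f: "admissible n k T f" and h: "\<And>i. i \<in> {1..k} \<Longrightarrow> admissible n (j i) (fibre T f i) (h i)"
    and g: "g = (\<lambda>t\<in>T. block_index j (f t) (h (f t) t))"
    and x: "x \<in> topspace (fibre_product X (sum j {1..k}) T g)"
  shows "BB k T f (\<lambda>i\<in>{1..k}. BB (j i) (fibre T f i) (h i) (\<lambda>l\<in>{1..j i}. x (block_index j i l))) =
    BB (sum j {1..k}) T g x"
  using assms
proof (induction k arbitrary: j f h)
  case 0
  then show ?case by (simp add: BB_def)
next
  case (Suc k)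
  note f = Suc.prems(1) and h = Suc.prems(2) and g = Suc.prems(3) and x = Suc.prems(4)
  let ?K = "Suc k" let ?J = "sum j {1..?K}"
  have ft: "f t \<in> {1..?K}" if "t \<in> T" for t using f that unfolding admissible_def by (meson PiE_mem)
  have ht: "h i t \<in> {1..j i}" if "t \<in> fibre T f i" "i \<in> {1..?K}" for t i
    using h[OF that(2)] that(1) unfolding admissible_def by (meson PiE_mem)
  let ?y = "\<lambda>i. BB (j i) (fibre T f i) (h i) (\<lambda>l\<in>{1..j i}. x (block_index j i l))"
  show ?case
  proof (cases "\<forall>i\<in>{1..?K}. 1 \<le> j i")
    case True
    then show ?thesis by (intro BB_assoc_positive[OF f h _ _ g x]) auto
  next
    case False
    then obtain i0 where i0: "i0 \<in> {1..?K}" "j i0 = 0" by (metis One_nat_def Suc_leI neq0_conv)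
    have empty: "fibre T f i0 = {}" using ht[OF _ i0(1)] i0(2) by fastforce
    have y_in: "?y i \<in> topspace (cos_space X (fibre T f i))" if i: "i \<in> {1..?K}" for i
    proof (rule BB_in[OF h[OF i]])
      have "x (block_index j i l) \<in> topspace (cos_space X (fibre (fibre T f i) (h i) l))" if l: "l \<in> {1..j i}" for l
      proof -
        have "block_index j i l \<in> {1..?J}" using i l by (rule block_index_bounds)
        then have "x (block_index j i l) \<in> topspace (cos_space X (fibre T g (block_index j i l)))"
          using x unfolding fibre_product_def by auto
        moreover have "fibre T g (block_index j i l) = fibre (fibre T f i) (h i) l"
        proof (intro equalityI subsetI)
          fix t assume "t \<in> fibre T g (block_index j i l)"
          then have t: "t \<in> T" "block_index j (f t) (h (f t) t) = block_index j i l" by (auto simp: fibre_def g)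
          have "h (f t) t \<in> {1..j (f t)}" using ht[of t "f t"] t(1) ft[OF t(1)] by (simp add: fibre_def)
          then have "f t = i \<and> h (f t) t = l"
            using block_index_inject[of "f t" ?K "h (f t) t" j i l] ft[OF t(1)] i l t(2) by blast
          then show "t \<in> fibre (fibre T f i) (h i) l" using t by (auto simp: fibre_def)
        qed (auto simp: fibre_def g)
        ultimately show ?thesis by simp
      qed
      then show "(\<lambda>l\<in>{1..j i}. x (block_index j i l)) \<in> topspace (fibre_product X (j i) (fibre T f i) (h i))"
        by (simp add: fibre_product_def PiE_iff)
    qed
    show ?thesis
    proof (cases "k = 0")
      \<comment> \<open>The only block is empty. The unit axiom starts at arity 2, but here
        \<open>T\<close> is empty and the identity axiom for arity 1 already gives
        \<epsilon>.\<close>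
      case True
      have one: "{1..?K} = {1}" using True by auto
      then have "i0 = 1" using i0 by simp
      then have J0: "?J = 0" unfolding one using i0 by simp
      have "T = {}" using ft empty unfolding one \<open>i0 = 1\<close> by (auto simp: fibre_def)
      have K1: "?K = 1" using True by simp
      have "BB 1 T f (\<lambda>i\<in>{1}. ?y i) = (\<lambda>i\<in>{1}. ?y i) 1"
        by (rule BB_identity) (use f y_in[of 1] one K1 in \<open>auto simp: fibre_product_def\<close>)
      also have "\<dots> = ?y 1" by (rule restrict_apply') simp
      also have "\<dots> = \<epsilon>" using i0 \<open>i0 = 1\<close> by (simp add: BB_def)
      finally have "BB 1 T f (\<lambda>i\<in>{1}. ?y i) = \<epsilon>" .
      moreover have "BB ?K T f (\<lambda>i\<in>{1..?K}. ?y i) = BB 1 T f (\<lambda>i\<in>{1}. ?y i)"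
        unfolding one unfolding K1 by (rule refl)
      moreover have "BB ?J T g x = \<epsilon>" unfolding J0 by (simp add: BB_def)
      ultimately show ?thesis by (simp only:)
    next
      case False
      \<comment> \<open>Lists the labels other than \<open>i0\<close>, a label that \<open>f\<close>
        never takes since its block is empty.\<close>
      define sh where "sh m = (if m < i0 then m else m + 1)" for m
      define f' where "f' = (\<lambda>t\<in>T. if f t < i0 then f t else f t - 1)"
      have fne: "f t \<noteq> i0" if "t \<in> T" for t using empty that by (auto simp: fibre_def)
      have shf: "sh (f' t) = f t" "f' t \<in> {1..k}" if "t \<in> T" for t
        using ft[OF that] fne[OF that] i0(1) that by (auto simp: sh_def f'_def)
      have sh_in: "sh m \<in> {1..?K}" if "m \<in> {1..k}" for m using that by (auto simp: sh_def)
      have sh_inj: "sh m = sh m' \<Longrightarrow> m = m'" for m m' by (auto simp: sh_def split: if_splits)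
      have f_iff: "f' t = m \<longleftrightarrow> f t = sh m" if "t \<in> T" for t m
        using shf(1)[OF that] sh_inj by metis
      have fib: "fibre T f' m = fibre T f (sh m)" for m using f_iff by (auto simp: fibre_def)
      have comp: "compose T sh f' = f"
        by (rule extensionalityI[of _ T]) (use f shf in \<open>auto simp: compose_def admissible_def PiE_iff\<close>)
      have adm: "admissible n k T f'"
        unfolding admissible_iff
      proof (intro conjI ballI impI)
        show "finite T" using f by (simp add: admissible_def)
        show "f' \<in> T \<rightarrow>\<^sub>E {1..k}" using shf(2) by (auto simp: f'_def)
        fix a b assume ab: "a \<in> {1..k}" "b \<in> {1..k}" "a \<noteq> b"
        then have "alternates n T f (sh a) (sh b)"
          using f sh_in sh_inj unfolding admissible_iff by metis
        then show "alternates n T f' a b" unfolding alternates_def using f_iff by simp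
      qed
      have bi: "block_index (j \<circ> sh) m l = block_index j (sh m) l" if "1 \<le> m" for m l
        using sum_skip[of j i0 m] i0 that unfolding block_index_def sh_def by simp
      have sJ: "sum (j \<circ> sh) {1..k} = ?J"
      proof -
        have sh: "(\<lambda>m. if m < i0 then m else m + 1) = sh" by (simp add: sh_def fun_eq_iff)
        have i1: "1 \<le> i0" "1 \<le> Suc k" using i0(1) by auto
        have "sum (j \<circ> sh) {1..<Suc k} = sum j {1..<sh (Suc k)}"
          using sum_skip[of j i0 "Suc k", OF i0(2) i1] unfolding sh by (simp only: sh_def)
        moreover have "sh (Suc k) = Suc ?K" using i0(1) by (auto simp: sh_def)
        ultimately show ?thesis by (simp only: atLeastLessThanSuc_atLeastAtMost)
      qed
      have g': "g = (\<lambda>t\<in>T. block_index (j \<circ> sh) (f' t) ((h \<circ> sh) (f' t) t))"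
        unfolding g using bi shf by (intro restrict_ext) simp
      have IH: "BB k T f' (\<lambda>i\<in>{1..k}. BB ((j \<circ> sh) i) (fibre T f' i) ((h \<circ> sh) i) (\<lambda>l\<in>{1..(j \<circ> sh) i}. x (block_index (j \<circ> sh) i l))) =
          BB (sum (j \<circ> sh) {1..k}) T g x"
      proof (rule Suc.IH[where j = "j \<circ> sh" and f = f' and h = "h \<circ> sh"])
        show "admissible n k T f'" by (rule adm)
        show "g = (\<lambda>t\<in>T. block_index (j \<circ> sh) (f' t) ((h \<circ> sh) (f' t) t))" by (rule g')
        show "admissible n ((j \<circ> sh) i) (fibre T f' i) ((h \<circ> sh) i)" if "i \<in> {1..k}" for i
          using h[OF sh_in[OF that]] by (simp add: fib)
        show "x \<in> topspace (fibre_product X (sum (j \<circ> sh) {1..k}) T g)" unfolding sJ by (rule x)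
      qed
      define y' where "y' = (\<lambda>i\<in>{1..k}. ?y (sh i))"
      have y'_eq: "(\<lambda>i\<in>{1..k}. BB ((j \<circ> sh) i) (fibre T f' i) ((h \<circ> sh) i) (\<lambda>l\<in>{1..(j \<circ> sh) i}. x (block_index (j \<circ> sh) i l))) = y'"
        unfolding y'_def by (intro restrict_ext) (simp add: fib bi)
      have y'_in: "y' \<in> topspace (fibre_product X k T f')"
        unfolding fibre_product_def using y_in sh_in by (auto simp: y'_def fib)
      have "B ?K T (compose T (\<lambda>m. if m < i0 then m else m + 1) f')
            (\<lambda>m\<in>{1..?K}. if m < i0 then y' m else if m = i0 then \<epsilon> else y' (m - 1)) = B (?K - 1) T f' y'"
        by (rule eps_unit) (use False i0 adm y'_in in auto)
      moreover have "(\<lambda>m\<in>{1..?K}. if m < i0 then y' m else if m = i0 then \<epsilon> else y' (m - 1)) = (\<lambda>i\<in>{1..?K}. ?y i)"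
      proof (rule restrict_ext)
        fix m assume m: "m \<in> {1..?K}"
        consider "m < i0" | "m = i0" | "m > i0" by linarith
        then show "(if m < i0 then y' m else if m = i0 then \<epsilon> else y' (m - 1)) = ?y m"
        proof cases
          case 1
          then have "m \<in> {1..k}" "sh m = m" using i0(1) m by (auto simp: sh_def)
          then show ?thesis using 1 by (simp add: y'_def)
        next
          case 2 then show ?thesis using i0 by (simp add: BB_def)
        next
          case 3
          then have "m - 1 \<in> {1..k}" "sh (m - 1) = m" using i0(1) m by (auto simp: sh_def)
          then show ?thesis using 3 by (simp add: y'_def)
        qed
      qed
      moreover have "compose T (\<lambda>m. if m < i0 then m else m + 1) f' = f" using comp unfolding sh_def .
      ultimately have "BB ?K T f (\<lambda>i\<in>{1..?K}. ?y i) = BB k T f' y'" using False by (simp add: BB_def)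
      also have "\<dots> = BB ?J T g x" using IH unfolding y'_eq sJ .
      finally show ?thesis .
    qed
  qed
qed

end

section \<open>Simplices\<close>

lemma topspace_simplex_on:
  "topspace (simplex_on T) = {u. (\<forall>t. 0 \<le> u t) \<and> (\<forall>t. t \<notin> T \<longrightarrow> u t = 0) \<and> sum u T = 1}"
  by (simp add: simplex_on_def)

lemma closedin_Collect_conj:
  "\<lbrakk>closedin Z {x \<in> topspace Z. P x}; closedin Z {x \<in> topspace Z. Q x}\<rbrakk> \<Longrightarrow> closedin Z {x \<in> topspace Z. P x \<and> Q x}"
  using closedin_Int[of Z "{x \<in> topspace Z. P x}" "{x \<in> topspace Z. Q x}"]
  by (simp add: Collect_conj_eq[symmetric] Int_def conj_ac cong: conj_cong)

lemma closedin_Collect_ball: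
  assumes "\<And>r. r \<in> T \<Longrightarrow> closedin Z {x \<in> topspace Z. P r x}"
  shows "closedin Z {x \<in> topspace Z. \<forall>r\<in>T. P r x}"
proof (cases "T = {}")
  case False
  then have "{x \<in> topspace Z. \<forall>r\<in>T. P r x} = (\<Inter>r\<in>T. {x \<in> topspace Z. P r x})" by auto
  then show ?thesis using False assms by (simp add: closedin_INT)
qed simp

lemma closedin_Collect_le:
  assumes "continuous_map Z euclideanreal F" "continuous_map Z euclideanreal G"
  shows "closedin Z {x \<in> topspace Z. F x \<le> G x}"
proof -
  have "closedin Z {x \<in> topspace Z. F x - G x \<in> {..0}}"
    by (rule closedin_continuous_map_preimage[of Z euclideanreal]) (auto intro: continuous_map_diff assms)
  then show ?thesis by simp
qed

lemma closedin_Collect_eq: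
  assumes "continuous_map Z euclideanreal F" "continuous_map Z euclideanreal G"
  shows "closedin Z {x \<in> topspace Z. F x = G x}"
  using closedin_Collect_conj[OF closedin_Collect_le[OF assms] closedin_Collect_le[OF assms(2,1)]]
  by (simp add: eq_iff)

text \<open>A closed subset of a product of compact intervals.\<close>

lemma compact_Hausdorff_simplex:
  assumes "finite T"
  shows "compact_space (simplex_on T)" "Hausdorff_space (simplex_on T)"
proof -
  let ?P = "powertop_real (UNIV :: nat set)"
  have HP: "Hausdorff_space ?P" by (simp add: Hausdorff_space_product_topology)
  show "Hausdorff_space (simplex_on T)" unfolding simplex_on_def by (rule Hausdorff_space_subtopology[OF HP])
  let ?S = "{u. (\<forall>t. 0 \<le> u t) \<and> (\<forall>t. t \<notin> T \<longrightarrow> u t = 0) \<and> sum u T = (1::real)}"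
  have proj: "continuous_map ?P euclideanreal (\<lambda>u. u t)" for t by (rule continuous_map_product_projection) simp
  have "closedin ?P {u \<in> topspace ?P. (\<forall>t\<in>UNIV. 0 \<le> u t) \<and> (\<forall>t\<in>-T. u t = 0) \<and> sum u T = 1}"
    by (intro closedin_Collect_conj closedin_Collect_ball closedin_Collect_le closedin_Collect_eq proj continuous_map_sum)
      (use assms in auto)
  then have cl: "closedin ?P ?S" by (simp add: Ball_def)
  have cp: "compactin ?P (UNIV \<rightarrow>\<^sub>E {0..1})" by (simp add: compactin_PiE)
  have sub: "?S \<subseteq> UNIV \<rightarrow>\<^sub>E {0..1}"
  proof
    fix u assume u: "u \<in> ?S"
    have "u t \<le> 1" for t
    proof (cases "t \<in> T")
      case True
      then have "u t \<le> sum u T" using u assms by (intro member_le_sum) auto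
      then show ?thesis using u by simp
    qed (use u in simp)
    then show "u \<in> UNIV \<rightarrow>\<^sub>E {0..1}" using u by (auto simp: PiE_def)
  qed
  have "compactin ?P ?S" by (rule closed_compactin[OF cp sub cl])
  then show "compact_space (simplex_on T)" unfolding simplex_on_def by (rule compact_space_subtopology)
qed

lemma continuous_map_into_simplex:
  assumes "\<And>z. z \<in> topspace Z \<Longrightarrow> F z \<in> topspace (simplex_on T)"
    and "\<And>t. continuous_map Z euclideanreal (\<lambda>z. F z t)"
  shows "continuous_map Z (simplex_on T) F"
  using assms unfolding simplex_on_def continuous_map_in_subtopology by (auto simp: continuous_map_componentwise_UNIV)

lemma continuous_map_simplex_at:
  assumes "continuous_map Z (simplex_on T) F"
  shows "continuous_map Z euclideanreal (\<lambda>z. F z t)"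
  using assms unfolding simplex_on_def continuous_map_in_subtopology by (auto simp: continuous_map_componentwise_UNIV)

lemma simplex_sum_mono:
  fixes u :: "nat \<Rightarrow> real"
  assumes "\<And>t. 0 \<le> u t" "A \<subseteq> B" "finite B"
  shows "sum u A \<le> sum u B"
  using assms by (intro sum_mono2) auto

lemma simplex_push_in:
  assumes u: "u \<in> topspace (simplex_on T)" and T: "finite T" "finite T'" and \<phi>: "\<phi> \<in> ord_hom T T'"
  shows "simplex_push T \<phi> u \<in> topspace (simplex_on T')"
proof -
  have 1: "0 \<le> simplex_push T \<phi> u s" for s
    using u by (auto simp: simplex_push_def topspace_simplex_on intro!: sum_nonneg)
  have 2: "simplex_push T \<phi> u s = 0" if "s \<notin> T'" for s
  proof -
    have "{t \<in> T. \<phi> t = s} = {}" using \<phi> that by (auto simp: ord_hom_def)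
    then show ?thesis unfolding simplex_push_def by (simp only: sum.empty)
  qed
  have "\<phi> ` T \<subseteq> T'" using \<phi> by (auto simp: ord_hom_def)
  then have "(\<Sum>s\<in>T'. simplex_push T \<phi> u s) = sum u T"
    unfolding simplex_push_def using sum.group[OF T(1,2), of \<phi> u] by simp
  then show ?thesis using 1 2 u by (simp add: topspace_simplex_on)
qed

section \<open>Increments of progress functions\<close>

text \<open>The projection of the line to the interval from \<open>a\<close> to \<open>b\<close>.
  The increment of \<open>F \<circ> clip a b\<close> between \<open>x\<close> and \<open>y\<close>
  is the growth of \<open>F\<close> on the part of that range inside the interval.\<close>

definition clip :: "real \<Rightarrow> real \<Rightarrow> real \<Rightarrow> real" where
  "clip a b x = max a (min b x)"

text \<open>Induction on the last interval. The range is cut at the left end \<open>a m\<close> of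
  that interval: the earlier intervals see only the left part, the last one only the right
  part.\<close>

lemma clip_increments_le:
  fixes a b :: "nat \<Rightarrow> real"
  assumes "finite T" and F: "F \<in> progress" and "\<And>r. r \<in> T \<Longrightarrow> a r \<le> b r"
    and "\<And>r r'. \<lbrakk>r \<in> T; r' \<in> T; r < r'\<rbrakk> \<Longrightarrow> b r \<le> a r'" and "x \<le> y"
  shows "(\<Sum>r\<in>T. F (clip (a r) (b r) y) - F (clip (a r) (b r) x)) \<le> F y - F x"
  using assms(1,3-5)
proof (induction T arbitrary: x y rule: finite_linorder_max_induct)
  case empty
  then show ?case using progressD(5)[OF F] by simp
next
  case (insert m T)
  note Fm = progressD(5)[OF F]
  have ab: "a r \<le> b r" "b r \<le> a m" if "r \<in> T" for r using insert that by auto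
  have abm: "a m \<le> b m" using insert by simp
  let ?x1 = "min x (a m)" and ?y1 = "min y (a m)" and ?x2 = "max x (a m)" and ?y2 = "max y (a m)"
  have "(\<Sum>r\<in>T. F (clip (a r) (b r) y) - F (clip (a r) (b r) x)) =
      (\<Sum>r\<in>T. F (clip (a r) (b r) ?y1) - F (clip (a r) (b r) ?x1))"
  proof (rule sum.cong[OF refl])
    fix r assume "r \<in> T"
    then have "min (b r) y = min (b r) ?y1" "min (b r) x = min (b r) ?x1" using ab[of r] by auto
    then show "F (clip (a r) (b r) y) - F (clip (a r) (b r) x) = F (clip (a r) (b r) ?y1) - F (clip (a r) (b r) ?x1)"
      unfolding clip_def by simp
  qed
  also have "\<dots> \<le> F ?y1 - F ?x1" using insert by (intro insert.IH) auto
  finally have 1: "(\<Sum>r\<in>T. F (clip (a r) (b r) y) - F (clip (a r) (b r) x)) \<le> F ?y1 - F ?x1" .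
  have clips: "clip (a m) (b m) x = min (b m) ?x2" "clip (a m) (b m) y = min (b m) ?y2"
    unfolding clip_def using abm by auto
  have le2: "?x2 \<le> ?y2" using insert by auto
  have 2: "F (clip (a m) (b m) y) - F (clip (a m) (b m) x) \<le> F ?y2 - F ?x2"
    unfolding clips
  proof (cases "?x2 \<le> b m")
    case True
    then have "min (b m) ?x2 = ?x2" by simp
    moreover have "F (min (b m) ?y2) \<le> F ?y2" by (rule Fm) simp
    ultimately show "F (min (b m) ?y2) - F (min (b m) ?x2) \<le> F ?y2 - F ?x2" by simp
  next
    case False
    then have "min (b m) ?x2 = b m" "min (b m) ?y2 = b m" using le2 by linarith+
    then show "F (min (b m) ?y2) - F (min (b m) ?x2) \<le> F ?y2 - F ?x2" using Fm[OF le2] by simp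
  qed
  have 3: "F ?y1 + F ?y2 = F y + F (a m)" "F ?x1 + F ?x2 = F x + F (a m)"
    by (cases "y \<le> a m"; simp add: min_def max_def)+
  have "m \<notin> T" using insert by auto
  then show ?case using 1 2 3 insert.hyps(1) by simp
qed

text \<open>The intervals carry the whole growth 1 of \<open>F\<close>. So the inequalities of
  \<open>clip_increments_le\<close> for the ranges before \<open>x\<close>, from \<open>x\<close> to
  \<open>y\<close> and after \<open>y\<close> add up to an equality, and each of them is
  one.\<close>

lemma increment_spread:
  fixes a b :: "nat \<Rightarrow> real"
  assumes T: "finite T" and F: "F \<in> progress" and ab: "\<And>r. r \<in> T \<Longrightarrow> 0 \<le> a r \<and> a r \<le> b r \<and> b r \<le> 1"
    and ord: "\<And>r r'. \<lbrakk>r \<in> T; r' \<in> T; r < r'\<rbrakk> \<Longrightarrow> b r \<le> a r'"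
    and tot: "(\<Sum>r\<in>T. F (b r) - F (a r)) = 1" and xy: "0 \<le> x" "x \<le> y" "y \<le> 1"
  shows "(\<Sum>r\<in>T. F (clip (a r) (b r) y) - F (clip (a r) (b r) x)) = F y - F x"
proof -
  define S where "S x y = (\<Sum>r\<in>T. F (clip (a r) (b r) y) - F (clip (a r) (b r) x))" for x y
  have le: "S x y \<le> F y - F x" if "x \<le> y" for x y
    unfolding S_def by (rule clip_increments_le[OF T F]) (use ab ord that in auto)
  have "S 0 x + S x y + S y 1 = (\<Sum>r\<in>T. F (clip (a r) (b r) 1) - F (clip (a r) (b r) 0))"
    unfolding S_def sum.distrib[symmetric] by (rule sum.cong) auto
  also have "\<dots> = (\<Sum>r\<in>T. F (b r) - F (a r))"
  proof (rule sum.cong[OF refl])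
    fix r assume "r \<in> T"
    then have "clip (a r) (b r) 1 = b r" "clip (a r) (b r) 0 = a r" using ab[of r] unfolding clip_def by linarith+
    then show "F (clip (a r) (b r) 1) - F (clip (a r) (b r) 0) = F (b r) - F (a r)" by simp
  qed
  finally have "S 0 x + S x y + S y 1 = 1" using tot by simp
  moreover have "F 0 = 0" "F 1 = 1" using progressD(3,4)[OF F] by auto
  ultimately have "S x y \<ge> F y - F x" using le[OF xy(1)] le[OF xy(3)] by linarith
  then show ?thesis using le[OF xy(2)] unfolding S_def by linarith
qed

text \<open>A clipped increment is the growth on the overlap, and it vanishes if there is
  none.\<close>

lemma increment_overlaps:
  fixes a b :: "nat \<Rightarrow> real"
  assumes T: "finite T" and F: "F \<in> progress" and ab: "\<And>r. r \<in> T \<Longrightarrow> 0 \<le> a r \<and> a r \<le> b r \<and> b r \<le> 1"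
    and ord: "\<And>r r'. \<lbrakk>r \<in> T; r' \<in> T; r < r'\<rbrakk> \<Longrightarrow> b r \<le> a r'"
    and tot: "(\<Sum>r\<in>T. F (b r) - F (a r)) = 1" and xy: "0 \<le> x" "x \<le> y" "y \<le> 1"
  shows "(\<Sum>r\<in>{r \<in> T. max x (a r) < min y (b r)}. F (min y (b r)) - F (max x (a r))) = F y - F x"
proof -
  have "(\<Sum>r\<in>T. F (clip (a r) (b r) y) - F (clip (a r) (b r) x)) =
    (\<Sum>r\<in>T. if max x (a r) < min y (b r) then F (min y (b r)) - F (max x (a r)) else 0)"
  proof (rule sum.cong[OF refl])
    fix r assume r: "r \<in> T"
    show "F (clip (a r) (b r) y) - F (clip (a r) (b r) x) =
      (if max x (a r) < min y (b r) then F (min y (b r)) - F (max x (a r)) else 0)"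
    proof (cases "max x (a r) < min y (b r)")
      case True
      then have "clip (a r) (b r) y = min y (b r)" "clip (a r) (b r) x = max x (a r)" unfolding clip_def by auto
      then show ?thesis using True by simp
    next
      case False
      have "clip (a r) (b r) y = clip (a r) (b r) x"
        using False ab[OF r] xy unfolding clip_def by linarith
      then show ?thesis using False by (simp only: if_False diff_self)
    qed
  qed
  also have "\<dots> = (\<Sum>r\<in>{r \<in> T. max x (a r) < min y (b r)}. F (min y (b r)) - F (max x (a r)))"
    using T by (rule sum.inter_filter[symmetric])
  finally show ?thesis using increment_spread[OF assms] by simp
qed

section \<open>Presentations\<close>

text \<open>A presentation cuts time into successive intervals, indexed by \<open>T\<close>, in each of which only one
  label \<open>f r\<close> progresses and which lies inside the interval of one vertex \<open>\<phi> r\<close> of the simplex;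
  here the simplex point \<open>u\<close> is read as a partition of the unit interval.\<close>

definition presents ::
  "nat \<Rightarrow> nat \<Rightarrow> nat set \<Rightarrow> (nat \<Rightarrow> real \<Rightarrow> real) \<Rightarrow> (nat \<Rightarrow> real) \<Rightarrow> nat set \<Rightarrow> (nat \<Rightarrow> nat) \<Rightarrow>
    (nat \<Rightarrow> nat) \<Rightarrow> (nat \<Rightarrow> real) \<Rightarrow> (nat \<Rightarrow> real) \<Rightarrow> bool" where
  "presents n k S p u T f \<phi> a b \<longleftrightarrow> admissible n k T f \<and> \<phi> \<in> ord_hom T S \<and>
     (\<forall>r\<in>T. 0 \<le> a r \<and> a r \<le> b r \<and> b r \<le> 1 \<and> sum u {..<\<phi> r} \<le> a r \<and> b r \<le> sum u {..\<phi> r}) \<and>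
     (\<forall>r\<in>T. \<forall>r'\<in>T. r < r' \<longrightarrow> b r \<le> a r') \<and>
     (\<forall>i\<in>{1..k}. (\<Sum>r\<in>fibre T f i. p i (b r) - p i (a r)) = 1)"

text \<open>Barycentric coordinates of the point at which the \<open>i\<close>-th argument is
  evaluated: the amounts of label \<open>i\<close> consumed in its successive intervals.\<close>

definition increments ::
  "nat set \<Rightarrow> (nat \<Rightarrow> nat) \<Rightarrow> (nat \<Rightarrow> real) \<Rightarrow> (nat \<Rightarrow> real) \<Rightarrow> (nat \<Rightarrow> real \<Rightarrow> real) \<Rightarrow> nat \<Rightarrow> nat \<Rightarrow> real" where
  "increments T f a b p i = (\<lambda>r. if r \<in> fibre T f i then p i (b r) - p i (a r) else 0)"

lemma presentsD:
  assumes "presents n k S p u T f \<phi> a b"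
  shows "admissible n k T f" "\<phi> \<in> ord_hom T S" "finite T"
    "\<And>r. r \<in> T \<Longrightarrow> 0 \<le> a r \<and> a r \<le> b r \<and> b r \<le> 1"
    "\<And>r. r \<in> T \<Longrightarrow> sum u {..<\<phi> r} \<le> a r" "\<And>r. r \<in> T \<Longrightarrow> b r \<le> sum u {..\<phi> r}"
    "\<And>r r'. \<lbrakk>r \<in> T; r' \<in> T; r < r'\<rbrakk> \<Longrightarrow> b r \<le> a r'"
    "\<And>i. i \<in> {1..k} \<Longrightarrow> (\<Sum>r\<in>fibre T f i. p i (b r) - p i (a r)) = 1"
  using assms unfolding presents_def admissible_def by auto

lemma increments_in_simplex:
  assumes P: "presents n k S p u T f \<phi> a b" and p: "p i \<in> progress" and i: "i \<in> {1..k}"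
  shows "increments T f a b p i \<in> topspace (simplex_on (fibre T f i))"
proof -
  have "0 \<le> increments T f a b p i r" for r
    using presentsD(4)[OF P, of r] progressD(5)[OF p] by (auto simp: increments_def fibre_def)
  moreover have "sum (increments T f a b p i) (fibre T f i) = 1"
    using presentsD(8)[OF P i] by (simp add: increments_def)
  ultimately show ?thesis by (auto simp: topspace_simplex_on increments_def)
qed

text \<open>The refinement consists of the nondegenerate intersections of intervals with equal
  labels. By \<open>increment_overlaps\<close> the growth of \<open>p i\<close> on an old interval
  is the sum of its growths on the new ones, so the new increments push forward to the old ones on
  both sides.\<close>

lemma common_refinement:
  assumes P: "presents n k S p u T f \<phi> a b" and P': "presents n k S p u T' f' \<phi>' a' b'"
    and p: "\<And>i. i \<in> {1..k} \<Longrightarrow> p i \<in> progress" and u: "\<And>t. 0 \<le> u t"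
  obtains Q g \<omega> c d \<psi> \<psi>' where "presents n k S p u Q g \<omega> c d"
    "\<psi> \<in> ord_hom Q T" "compose Q f \<psi> = g" "compose Q \<phi> \<psi> = \<omega>"
    "\<forall>i\<in>{1..k}. simplex_push (fibre Q g i) (restrict \<psi> (fibre Q g i)) (increments Q g c d p i) = increments T f a b p i"
    "\<psi>' \<in> ord_hom Q T'" "compose Q f' \<psi>' = g" "compose Q \<phi>' \<psi>' = \<omega>"
    "\<forall>i\<in>{1..k}. simplex_push (fibre Q g i) (restrict \<psi>' (fibre Q g i)) (increments Q g c d p i) = increments T' f' a' b' p i"
proof -
  note D = presentsD[OF P] and D' = presentsD[OF P']
  \<comment> \<open>\<open>N\<close> exceeds all elements of \<open>T'\<close>, so
    \<open>r * N + r'\<close> codes pairs in lexicographic order.\<close>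
  define N where "N = Suc (Max (insert 0 T'))"
  have N: "r' < N" if "r' \<in> T'" for r' unfolding N_def using that D'(3) by (simp add: less_Suc_eq_le)
  define lo hi where "lo q = max (a (q div N)) (a' (q mod N))" and "hi q = min (b (q div N)) (b' (q mod N))" for q
  define Q where "Q = {q. q div N \<in> T \<and> q mod N \<in> T' \<and> f (q div N) = f' (q mod N) \<and> lo q < hi q}"
  define \<psi> where "\<psi> = (\<lambda>q\<in>Q. q div N)"
  define \<psi>' where "\<psi>' = (\<lambda>q\<in>Q. q mod N)"
  define g where "g = compose Q f \<psi>"
  define \<omega> where "\<omega> = compose Q \<phi> \<psi>"
  have N0: "0 < N" by (simp add: N_def)
  have code: "(r * N + r') div N = r" "(r * N + r') mod N = r'" if "r' \<in> T'" for r r' using N[OF that] N0 by auto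
  have decode: "q = (q div N) * N + q mod N" for q by simp
  have Qsub: "Q \<subseteq> (\<lambda>(r, r'). r * N + r') ` (T \<times> T')"
    unfolding Q_def using decode by (auto simp: image_iff) (metis decode)
  then have finQ: "finite Q" using D(3) D'(3) by (meson finite_SigmaI finite_imageI finite_subset)
  \<comment> \<open>Overlaps whose first index increases cannot have a decreasing second index, as
    the intervals of both presentations are ordered in time.\<close>
  have mono': "q mod N \<le> q2 mod N" if q: "q \<in> Q" "q2 \<in> Q" "q \<le> q2" for q q2
  proof (cases "q div N = q2 div N")
    case True
    then show ?thesis using q(3) decode[of q] decode[of q2] by (metis add_le_cancel_left)
  next
    case False
    then have "q div N < q2 div N" using div_le_mono[OF q(3), of N] by simp
    then have 1: "b (q div N) \<le> a (q2 div N)" using q by (intro D(7)) (auto simp: Q_def)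
    show ?thesis
    proof (rule ccontr)
      assume "\<not> ?thesis"
      then have "b' (q2 mod N) \<le> a' (q mod N)" using q by (intro D'(7)) (auto simp: Q_def)
      moreover have "a' (q mod N) < b (q div N)" "a (q2 div N) < b' (q2 mod N)" using q by (auto simp: Q_def lo_def hi_def)
      ultimately show False using 1 by linarith
    qed
  qed
  have \<psi>: "\<psi> \<in> ord_hom Q T" unfolding \<psi>_def ord_hom_def by (auto simp: Q_def mono_on_def intro: div_le_mono)
  have \<psi>': "\<psi>' \<in> ord_hom Q T'" unfolding \<psi>'_def ord_hom_def using mono' by (auto simp: mono_on_def) (auto simp: Q_def)
  have gq: "g q = f (q div N)" "g q = f' (q mod N)" if "q \<in> Q" for q
    using that by (auto simp: g_def \<psi>_def compose_def Q_def)
  have g': "compose Q f' \<psi>' = g"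
    by (rule extensionalityI[of _ Q]) (use gq in \<open>auto simp: compose_def \<psi>'_def g_def\<close>)
  have sums: "sum u A \<le> sum u B" if "A \<subseteq> B" "finite B" for A B by (rule simplex_sum_mono[OF u that])
  \<comment> \<open>A nondegenerate interval cannot lie in the time slots of two different
    vertices.\<close>
  have \<phi>eq: "\<phi> (q div N) = \<phi>' (q mod N)" if "q \<in> Q" for q
  proof -
    have q: "q div N \<in> T" "q mod N \<in> T'" "lo q < hi q" using that by (auto simp: Q_def)
    have "\<not> \<phi> (q div N) < \<phi>' (q mod N)"
    proof
      assume "\<phi> (q div N) < \<phi>' (q mod N)"
      then have "sum u {..\<phi> (q div N)} \<le> sum u {..<\<phi>' (q mod N)}" by (intro sums) auto
      then show False using D(6)[OF q(1)] D'(5)[OF q(2)] q(3) by (simp add: lo_def hi_def)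
    qed
    moreover have "\<not> \<phi>' (q mod N) < \<phi> (q div N)"
    proof
      assume "\<phi>' (q mod N) < \<phi> (q div N)"
      then have "sum u {..\<phi>' (q mod N)} \<le> sum u {..<\<phi> (q div N)}" by (intro sums) auto
      then show False using D'(6)[OF q(2)] D(5)[OF q(1)] q(3) by (simp add: lo_def hi_def)
    qed
    ultimately show ?thesis by simp
  qed
  have \<omega>q: "\<omega> q = \<phi> (q div N)" if "q \<in> Q" for q using that by (simp add: \<omega>_def \<psi>_def compose_def)
  have \<omega>': "compose Q \<phi>' \<psi>' = \<omega>"
    by (rule extensionalityI[of _ Q]) (use \<phi>eq \<omega>q in \<open>auto simp: compose_def \<psi>'_def \<omega>_def\<close>)
  have fib_fin: "finite (fibre T f i)" "finite (fibre T' f' i)" for i using D(3) D'(3) finite_fibre by auto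
  have push: "simplex_push (fibre Q g i) (restrict \<psi> (fibre Q g i)) (increments Q g lo hi p i) = increments T f a b p i" if i: "i \<in> {1..k}" for i
  proof
    fix r
    let ?A = "{q \<in> fibre Q g i. restrict \<psi> (fibre Q g i) q = r}"
    have A: "?A = {q \<in> Q. q div N = r \<and> f r = i}" using gq by (auto simp: fibre_def \<psi>_def)
    have incr: "increments Q g lo hi p i q = p i (hi q) - p i (lo q)" if "q \<in> ?A" for q
      using that by (simp add: increments_def)
    show "simplex_push (fibre Q g i) (restrict \<psi> (fibre Q g i)) (increments Q g lo hi p i) r = increments T f a b p i r"
    proof (cases "r \<in> fibre T f i")
      case False
      then have "?A = {}" unfolding A by (auto simp: Q_def fibre_def)
      then show ?thesis using False unfolding simplex_push_def by (simp only: sum.empty) (simp add: increments_def)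
    next
      case True
      then have rT: "r \<in> T" "f r = i" by (auto simp: fibre_def)
      let ?R = "{r' \<in> fibre T' f' i. max (a r) (a' r') < min (b r) (b' r')}"
      have "(\<Sum>q\<in>?A. increments Q g lo hi p i q) = (\<Sum>q\<in>?A. p i (hi q) - p i (lo q))"
        by (rule sum.cong[OF refl]) (rule incr)
      also have "\<dots> = (\<Sum>r'\<in>?R. p i (min (b r) (b' r')) - p i (max (a r) (a' r')))"
      proof (rule sum.reindex_bij_witness[of _ "\<lambda>r'. r * N + r'" "\<lambda>q. q mod N"])
        fix q assume q: "q \<in> ?A"
        then have q': "q \<in> Q" "q div N = r" unfolding A by auto
        show "r * N + q mod N = q" using q'(2) decode[of q] by simp
        show "q mod N \<in> ?R" using q' rT by (auto simp: Q_def fibre_def lo_def hi_def)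
        show "p i (min (b r) (b' (q mod N))) - p i (max (a r) (a' (q mod N))) = p i (hi q) - p i (lo q)"
          using q' by (simp add: lo_def hi_def)
      next
        fix r' assume r': "r' \<in> ?R"
        then have r'T: "r' \<in> T'" "f' r' = i" by (auto simp: fibre_def)
        show "(r * N + r') mod N = r'" using code[OF r'T(1)] by simp
        have "r * N + r' \<in> Q" unfolding Q_def using code[OF r'T(1)] r' r'T rT by (simp add: lo_def hi_def)
        then show "r * N + r' \<in> ?A" unfolding A using code[OF r'T(1)] rT by simp
      qed
      also have "\<dots> = p i (b r) - p i (a r)"
        by (rule increment_overlaps[OF fib_fin(2) p[OF i]]) (use D'(4,7,8) D(4)[OF rT(1)] i in \<open>auto simp: fibre_def\<close>)
      finally show ?thesis using True by (simp add: simplex_push_def increments_def)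
    qed
  qed
  have push': "simplex_push (fibre Q g i) (restrict \<psi>' (fibre Q g i)) (increments Q g lo hi p i) = increments T' f' a' b' p i" if i: "i \<in> {1..k}" for i
  proof
    fix r'
    let ?A = "{q \<in> fibre Q g i. restrict \<psi>' (fibre Q g i) q = r'}"
    have A: "?A = {q \<in> Q. q mod N = r' \<and> f' r' = i}" using gq(2) by (auto simp: fibre_def \<psi>'_def)
    have incr: "increments Q g lo hi p i q = p i (hi q) - p i (lo q)" if "q \<in> ?A" for q
      using that by (simp add: increments_def)
    show "simplex_push (fibre Q g i) (restrict \<psi>' (fibre Q g i)) (increments Q g lo hi p i) r' = increments T' f' a' b' p i r'"
    proof (cases "r' \<in> fibre T' f' i")
      case False
      then have "?A = {}" unfolding A by (auto simp: Q_def fibre_def)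
      then show ?thesis using False unfolding simplex_push_def by (simp only: sum.empty) (simp add: increments_def)
    next
      case True
      then have rT: "r' \<in> T'" "f' r' = i" by (auto simp: fibre_def)
      let ?R = "{r \<in> fibre T f i. max (a' r') (a r) < min (b' r') (b r)}"
      have "(\<Sum>q\<in>?A. increments Q g lo hi p i q) = (\<Sum>q\<in>?A. p i (hi q) - p i (lo q))"
        by (rule sum.cong[OF refl]) (rule incr)
      also have "\<dots> = (\<Sum>r\<in>?R. p i (min (b' r') (b r)) - p i (max (a' r') (a r)))"
      proof (rule sum.reindex_bij_witness[of _ "\<lambda>r. r * N + r'" "\<lambda>q. q div N"])
        fix q assume q: "q \<in> ?A"
        then have q': "q \<in> Q" "q mod N = r'" unfolding A by auto
        show "q div N * N + r' = q" using q'(2) decode[of q] by simp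
        show "q div N \<in> ?R" using q' rT by (auto simp: Q_def fibre_def lo_def hi_def)
        show "p i (min (b' r') (b (q div N))) - p i (max (a' r') (a (q div N))) = p i (hi q) - p i (lo q)"
          using q' by (simp add: lo_def hi_def min.commute max.commute)
      next
        fix r assume r: "r \<in> ?R"
        then have rT': "r \<in> T" "f r = i" by (auto simp: fibre_def)
        show "(r * N + r') div N = r" using code[OF rT(1)] by simp
        have "r * N + r' \<in> Q" unfolding Q_def using code[OF rT(1)] r rT' rT by (simp add: lo_def hi_def)
        then show "r * N + r' \<in> ?A" unfolding A using code[OF rT(1)] rT by simp
      qed
      also have "\<dots> = p i (b' r') - p i (a' r')"
        by (rule increment_overlaps[OF fib_fin(1) p[OF i]]) (use D(4,7,8) D'(4)[OF rT(1)] i in \<open>auto simp: fibre_def\<close>)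
      finally show ?thesis using True by (simp add: simplex_push_def increments_def)
    qed
  qed
  have "presents n k S p u Q g \<omega> lo hi"
    unfolding presents_def
  proof (intro conjI ballI impI)
    show "admissible n k Q g" unfolding g_def by (rule admissible_pullback[OF D(1) finQ \<psi>])
    show "\<omega> \<in> ord_hom Q S" unfolding \<omega>_def by (rule ord_hom_compose[OF \<psi> D(2)])
    fix q assume q: "q \<in> Q"
    then have qT: "q div N \<in> T" "q mod N \<in> T'" "lo q < hi q" by (auto simp: Q_def)
    show "0 \<le> lo q" "hi q \<le> 1" using D(4)[OF qT(1)] by (auto simp: lo_def hi_def)
    show "lo q \<le> hi q" using qT by simp
    show "sum u {..<\<omega> q} \<le> lo q" "hi q \<le> sum u {..\<omega> q}"
      using D(5)[OF qT(1)] D(6)[OF qT(1)] unfolding \<omega>q[OF q] by (auto simp: lo_def hi_def)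
    fix q2 assume q2: "q2 \<in> Q" and less: "q < q2"
    then have q2T: "q2 div N \<in> T" "q2 mod N \<in> T'" by (auto simp: Q_def)
    show "hi q \<le> lo q2"
    proof (cases "q div N = q2 div N")
      case True
      then have "q mod N < q2 mod N" using less decode[of q] decode[of q2] by (metis nat_add_left_cancel_less)
      then show ?thesis using D'(7)[OF qT(2) q2T(2)] by (auto simp: lo_def hi_def)
    next
      case False
      then have "q div N < q2 div N" using div_le_mono[of q q2 N] less by simp
      then show ?thesis using D(7)[OF qT(1) q2T(1)] by (auto simp: lo_def hi_def)
    qed
  next
    fix i assume i: "i \<in> {1..k}"
    have "(\<Sum>q\<in>fibre Q g i. p i (hi q) - p i (lo q)) = sum (increments Q g lo hi p i) (fibre Q g i)"
      by (simp add: increments_def)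
    also have "\<dots> = (\<Sum>r\<in>fibre T f i. simplex_push (fibre Q g i) (restrict \<psi> (fibre Q g i)) (increments Q g lo hi p i) r)"
    proof -
      have "restrict \<psi> (fibre Q g i) \<in> ord_hom (fibre Q g i) (fibre T f i)"
        by (rule ord_hom_fibre[OF \<psi>]) (simp add: g_def)
      then have "restrict \<psi> (fibre Q g i) ` fibre Q g i \<subseteq> fibre T f i" by (auto simp: ord_hom_def)
      from sum.group[OF finite_fibre[OF finQ] fib_fin(1) this] show ?thesis unfolding simplex_push_def by (rule sym)
    qed
    also have "\<dots> = 1" unfolding push[OF i] using D(8)[OF i] by (simp add: increments_def)
    finally show "(\<Sum>q\<in>fibre Q g i. p i (hi q) - p i (lo q)) = 1" .
  qed
  then show thesis
    by (rule that[OF _ \<psi> g_def[symmetric] \<omega>_def[symmetric] _ \<psi>' g' \<omega>']) (use push push' in blast)+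
qed

text \<open>Time is cut at the partial sums of \<open>u\<close> and at the cut points of all cells;
  between consecutive cuts at most one label progresses. The bound on \<open>T\<close> depends only
  on \<open>n\<close>, \<open>k\<close> and \<open>card S\<close>, so that finitely many shapes
  serve all parameters in \<open>evaluate_continuous\<close>.\<close>

lemma exists_presentation:
  assumes p: "\<And>i. i \<in> {1..k} \<Longrightarrow> p i \<in> progress"
    and pc: "\<And>i j. \<lbrakk>i \<in> {1..k}; j \<in> {1..k}; i \<noteq> j\<rbrakk> \<Longrightarrow> cell n (p i) (p j) \<or> cell n (p j) (p i)"
    and S: "finite S" and u: "u \<in> topspace (simplex_on S)"
  shows "\<exists>T f \<phi> a b. presents n k S p u T f \<phi> a b \<and> T \<subseteq> {..<2 + card S + k * (k * Suc (Suc n))}"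
proof -
  have u0: "0 \<le> u t" and uS: "t \<notin> S \<Longrightarrow> u t = 0" and u1: "sum u S = 1" for t using u by (auto simp: topspace_simplex_on)
  define W where "W i j t \<longleftrightarrow> t 0 \<le> 0 \<and> 1 \<le> t (Suc n) \<and> (\<forall>r\<le>n. t r \<le> t (Suc r) \<and>
     (if even r then p j (t r) = p j (t (Suc r)) else p i (t r) = p i (t (Suc r))))" for i j and t :: "nat \<Rightarrow> real"
  define tm where "tm i j = (SOME t. W i j t)" for i j
  have tm: "W i j (tm i j)" if "cell n (p i) (p j)" for i j
  proof -
    have "\<exists>t. W i j t" using that unfolding cell_def W_def .
    then show ?thesis unfolding tm_def by (rule someI_ex)
  qed
  define Q where "Q = {0, 1} \<union> (\<lambda>s. sum u {..s}) ` S \<union> (\<lambda>(i, j, r). clamp01 (tm i j r)) ` ({1..k} \<times> {1..k} \<times> {..Suc n})"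
  have finQ: "finite Q" unfolding Q_def using S by simp
  have cardQ: "card Q \<le> 2 + card S + k * (k * Suc (Suc n))"
  proof -
    have "card ((\<lambda>(i, j, r). clamp01 (tm i j r)) ` ({1..k} \<times> {1..k} \<times> {..Suc n})) \<le> card ({1..k} \<times> {1..k} \<times> {..Suc n})"
      by (rule card_image_le) simp
    also have "\<dots> = k * (k * Suc (Suc n))" by (simp add: card_cartesian_product)
    finally have 1: "card ((\<lambda>(i, j, r). clamp01 (tm i j r)) ` ({1..k} \<times> {1..k} \<times> {..Suc n})) \<le> k * (k * Suc (Suc n))" .
    have 2: "card ((\<lambda>s. sum u {..s}) ` S) \<le> card S" using S by (rule card_image_le)
    have 3: "card ({0, 1::real} \<union> (\<lambda>s. sum u {..s}) ` S) \<le> 2 + card S"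
      using card_Un_le[of "{0, 1::real}" "(\<lambda>s. sum u {..s}) ` S"] 2 by simp
    show ?thesis
      unfolding Q_def using card_Un_le[of "{0, 1::real} \<union> (\<lambda>s. sum u {..s}) ` S" "(\<lambda>(i, j, r). clamp01 (tm i j r)) ` ({1..k} \<times> {1..k} \<times> {..Suc n})"] 1 3
      by linarith
  qed
  have sum_S: "sum u A = sum u (A \<inter> S)" if "finite A" for A
    by (rule sum.mono_neutral_right[OF that]) (use uS in auto)
  have sum01: "sum u {..s} \<le> 1" "0 \<le> sum u {..s}" for s
  proof -
    have "sum u {..s} = sum u ({..s} \<inter> S)" by (rule sum_S) simp
    also have "\<dots> \<le> sum u S" using S u0 by (intro simplex_sum_mono) auto
    finally show "sum u {..s} \<le> 1" using u1 by simp
    show "0 \<le> sum u {..s}" using u0 by (simp add: sum_nonneg)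
  qed
  have Q01: "0 \<le> v" "v \<le> 1" if "v \<in> Q" for v using that sum01 clamp01_bounds by (auto simp: Q_def)
  define xs where "xs = sorted_list_of_set Q"
  have setxs: "set xs = Q" and sorted: "sorted_wrt (<) xs" using finQ by (simp_all add: xs_def)
  have len: "length xs = card Q" by (simp add: xs_def)
  have xsQ: "xs ! r \<in> Q" if "r < length xs" for r using nth_mem[OF that] setxs by simp
  have lt: "xs ! r < xs ! r'" if "r < r'" "r' < length xs" for r r' using sorted_wrt_nth_less[OF sorted that] .
  have le: "xs ! r \<le> xs ! r'" if "r \<le> r'" "r' < length xs" for r r' using lt[of r r'] that by (cases "r = r'") auto
  have gap: "v \<le> xs ! r \<or> xs ! Suc r \<le> v" if "v \<in> Q" "Suc r < length xs" for v r
  proof -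
    obtain q where q: "q < length xs" "v = xs ! q" using \<open>v \<in> Q\<close> setxs by (metis in_set_conv_nth)
    show ?thesis using le[of q r] le[of "Suc r" q] q that(2) by (cases "q \<le> r") auto
  qed
  have first: "xs ! 0 = 0" and len0: "0 < length xs" and last: "xs ! (length xs - 1) = 1"
  proof -
    have "0 \<in> set xs" "1 \<in> set xs" by (simp_all add: setxs Q_def)
    then obtain q q' where q: "q < length xs" "xs ! q = 0" and q': "q' < length xs" "xs ! q' = 1" by (metis in_set_conv_nth)
    show len0: "0 < length xs" using q by linarith
    show "xs ! 0 = 0" using le[of 0 q] q Q01(1)[OF xsQ[OF len0]] by simp
    show "xs ! (length xs - 1) = 1" using le[of q' "length xs - 1"] q' len0 Q01(2)[OF xsQ, of "length xs - 1"] by simp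
  qed
  \<comment> \<open>The number of the cell interval containing the gap after \<open>xs ! r\<close>.
    Its parity tells which of the two functions is constant there.\<close>
  have block: "\<exists>\<beta>. mono \<beta> \<and> (\<forall>r. Suc r < length xs \<longrightarrow> \<beta> r \<le> n \<and>
      (if even (\<beta> r) then p j (xs ! r) = p j (xs ! Suc r) else p i (xs ! r) = p i (xs ! Suc r)))"
    if c: "cell n (p i) (p j)" and i: "i \<in> {1..k}" and j: "j \<in> {1..k}" for i j
  proof -
    define t where "t = tm i j"
    have Wt: "W i j t" unfolding t_def by (rule tm[OF c])
    have tQ: "clamp01 (t q) \<in> Q" if "q \<le> Suc n" for q
      unfolding Q_def t_def using i j that by (intro UnI2 image_eqI[of _ _ "(i, j, q)"]) auto
    \<comment> \<open>The maximum over the first \<open>Suc r\<close> entries is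
      \<open>xs ! r\<close> inside the list; written in this way it stays monotone for indices
      beyond the list as well.\<close>
    define \<beta> where "\<beta> r = Max (insert 0 {q. q \<le> n \<and> clamp01 (t q) \<le> Max (insert 0 (set (take (Suc r) xs)))})" for r
    have fin: "finite (insert 0 {q. q \<le> n \<and> clamp01 (t q) \<le> v})" for v by simp
    have "mono \<beta>"
      unfolding mono_def \<beta>_def
    proof (intro allI impI)
      fix r r' :: nat assume "r \<le> r'"
      then have "set (take (Suc r) xs) \<subseteq> set (take (Suc r') xs)" by (intro set_take_subset_set_take) simp
      then have le': "Max (insert 0 (set (take (Suc r) xs))) \<le> Max (insert 0 (set (take (Suc r') xs)))" by (intro Max_mono) auto
      have "insert 0 {q. q \<le> n \<and> clamp01 (t q) \<le> Max (insert 0 (set (take (Suc r) xs)))} \<subseteq>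
          insert 0 {q. q \<le> n \<and> clamp01 (t q) \<le> Max (insert 0 (set (take (Suc r') xs)))}"
        by (intro insert_mono Collect_mono impI conjI) (use order_trans[OF _ le'] in blast)+
      then show "Max (insert 0 {q. q \<le> n \<and> clamp01 (t q) \<le> Max (insert 0 (set (take (Suc r) xs)))}) \<le>
          Max (insert 0 {q. q \<le> n \<and> clamp01 (t q) \<le> Max (insert 0 (set (take (Suc r') xs)))})"
        by (rule Max_mono) auto
    qed
    moreover have "\<beta> r \<le> n \<and> (if even (\<beta> r) then p j (xs ! r) = p j (xs ! Suc r) else p i (xs ! r) = p i (xs ! Suc r))"
      if r: "Suc r < length xs" for r
    proof -
      have "Max (insert 0 (set (take (Suc r) xs))) = xs ! r"
      proof (rule Max_eqI)
        fix y assume "y \<in> insert 0 (set (take (Suc r) xs))"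
        then show "y \<le> xs ! r"
          using le[of _ r] r Q01(1)[OF xsQ, of r] by (auto simp: in_set_conv_nth)
      next
        have "take (Suc r) xs ! r \<in> set (take (Suc r) xs)" using r by (intro nth_mem) simp
        then show "xs ! r \<in> insert 0 (set (take (Suc r) xs))" by simp
      qed simp
      then have \<beta>r: "\<beta> r = Max (insert 0 {q. q \<le> n \<and> clamp01 (t q) \<le> xs ! r})" by (simp add: \<beta>_def)
      have t0: "clamp01 (t 0) = 0" using Wt by (simp add: W_def clamp01_eq_0)
      have "\<beta> r \<in> insert 0 {q. q \<le> n \<and> clamp01 (t q) \<le> xs ! r}" unfolding \<beta>r by (rule Max_in) auto
      then have b: "\<beta> r \<le> n" "clamp01 (t (\<beta> r)) \<le> xs ! r" using t0 Q01(1)[OF xsQ, of r] r by auto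
      \<comment> \<open>By maximality of \<open>\<beta> r\<close> the next cut of the cell lies to
        the right of \<open>xs ! r\<close>, and being itself a member of \<open>Q\<close> it cannot
        lie inside the gap. For \<open>\<beta> r = n\<close> it is the final cut.\<close>
      have up: "xs ! Suc r \<le> clamp01 (t (Suc (\<beta> r)))"
      proof (cases "\<beta> r = n")
        case True
        then have "clamp01 (t (Suc (\<beta> r))) = 1" using Wt by (simp add: W_def clamp01_eq_1)
        then show ?thesis using Q01(2)[OF xsQ[OF r]] by simp
      next
        case False
        have "\<not> clamp01 (t (Suc (\<beta> r))) \<le> xs ! r"
        proof
          assume "clamp01 (t (Suc (\<beta> r))) \<le> xs ! r"
          then have "Suc (\<beta> r) \<in> insert 0 {q. q \<le> n \<and> clamp01 (t q) \<le> xs ! r}" using False b by simp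
          then have "Suc (\<beta> r) \<le> \<beta> r" unfolding \<beta>r by (intro Max_ge) auto
          then show False by simp
        qed
        then show ?thesis using gap[OF tQ r, of "Suc (\<beta> r)"] b(1) by auto
      qed
      have const: "h (xs ! r) = h (xs ! Suc r)" if h: "h \<in> progress" and e: "h (t (\<beta> r)) = h (t (Suc (\<beta> r)))" for h
      proof -
        have "h (t (\<beta> r)) \<le> h (xs ! r)" using progressD(5)[OF h b(2)] progress_clamp[OF h] by simp
        moreover have "h (xs ! r) \<le> h (xs ! Suc r)" using lt[of r "Suc r"] r by (intro progressD(5)[OF h]) simp
        moreover have "h (xs ! Suc r) \<le> h (t (Suc (\<beta> r)))" using progressD(5)[OF h up] progress_clamp[OF h] by simp
        ultimately show ?thesis using e by linarith
      qed
      show ?thesis using b(1) const[OF p[OF i]] const[OF p[OF j]] Wt unfolding W_def by auto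
    qed
    ultimately show ?thesis by blast
  qed
  define move where "move i r \<longleftrightarrow> p i (xs ! r) \<noteq> p i (xs ! Suc r)" for i r
  have uniq: "i = j" if ij: "i \<in> {1..k}" "j \<in> {1..k}" "Suc r < length xs" "move i r" "move j r" for i j r
  proof (rule ccontr)
    assume "i \<noteq> j"
    then consider "cell n (p i) (p j)" | "cell n (p j) (p i)" using pc ij by blast
    then show False
    proof cases
      case 1 from block[OF this ij(1,2)] ij show False unfolding move_def by metis
    next
      case 2 from block[OF this ij(2,1)] ij show False unfolding move_def by metis
    qed
  qed
  \<comment> \<open>Gaps in which nothing moves have no label; leaving them out costs no
    growth.\<close>
  define T where "T = {r. Suc r < length xs \<and> (\<exists>i\<in>{1..k}. move i r)}"
  define f where "f = (\<lambda>r\<in>T. SOME i. i \<in> {1..k} \<and> move i r)"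
  have fr: "f r \<in> {1..k}" "move (f r) r" if "r \<in> T" for r
  proof -
    have "\<exists>i. i \<in> {1..k} \<and> move i r" using that by (auto simp: T_def)
    from someI_ex[OF this] show "f r \<in> {1..k}" "move (f r) r" using that by (simp_all add: f_def)
  qed
  have f_iff: "r \<in> fibre T f i \<longleftrightarrow> Suc r < length xs \<and> move i r" if i: "i \<in> {1..k}" for i r
  proof
    assume "r \<in> fibre T f i"
    then show "Suc r < length xs \<and> move i r" using fr by (auto simp: fibre_def T_def)
  next
    assume r: "Suc r < length xs \<and> move i r"
    then have "r \<in> T" using i by (auto simp: T_def)
    then show "r \<in> fibre T f i" using uniq[OF fr(1) i _ fr(2)] r by (auto simp: fibre_def)
  qed
  have Tlt: "T \<subseteq> {..<length xs}" by (auto simp: T_def)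
  \<comment> \<open>The vertex whose slot contains the gap. All partial sums of \<open>u\<close>
    over vertices are cuts, so no slot boundary lies inside a gap.\<close>
  define \<phi> where "\<phi> = (\<lambda>r\<in>T. LEAST s. s \<in> S \<and> xs ! Suc r \<le> sum u {..s})"
  have S_ne: "S \<noteq> {}" using u1 by auto
  have top1: "sum u {..Max S} = 1"
  proof -
    have "{..Max S} \<inter> S = S" using S by auto
    then show ?thesis using sum_S[of "{..Max S}"] u1 by simp
  qed
  have ex: "\<exists>s. s \<in> S \<and> xs ! Suc r \<le> sum u {..s}" if "r \<in> T" for r
    using Max_in[OF S S_ne] top1 Q01(2)[OF xsQ, of "Suc r"] that by (intro exI[of _ "Max S"]) (auto simp: T_def)
  have \<phi>r: "\<phi> r \<in> S" "xs ! Suc r \<le> sum u {..\<phi> r}" if "r \<in> T" for r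
    using LeastI_ex[OF ex[OF that]] that by (simp_all add: \<phi>_def)
  have \<phi>low: "sum u {..<\<phi> r} \<le> xs ! r" if r: "r \<in> T" for r
  proof -
    have rl: "Suc r < length xs" using r by (simp add: T_def)
    let ?B = "S \<inter> {..<\<phi> r}"
    show ?thesis
    proof (cases "?B = {}")
      case True
      then have "sum u {..<\<phi> r} = 0" using sum_S[of "{..<\<phi> r}"] by (simp add: Int_commute)
      then show ?thesis using Q01(1)[OF xsQ, of r] rl by simp
    next
      case False
      define s where "s = Max ?B"
      have s: "s \<in> S" "s < \<phi> r" using Max_in[OF _ False] S unfolding s_def by auto
      have "{..<\<phi> r} \<inter> S = {..s} \<inter> S"
      proof (intro equalityI subsetI)
        fix t assume "t \<in> {..<\<phi> r} \<inter> S"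
        then have "t \<le> s" unfolding s_def using S by (intro Max_ge) auto
        then show "t \<in> {..s} \<inter> S" using \<open>t \<in> {..<\<phi> r} \<inter> S\<close> by simp
      qed (use s in auto)
      then have eq: "sum u {..<\<phi> r} = sum u {..s}" using sum_S[of "{..<\<phi> r}"] sum_S[of "{..s}"] by simp
      have "\<not> (s \<in> S \<and> xs ! Suc r \<le> sum u {..s})" using s(2) r unfolding \<phi>_def by (auto dest: not_less_Least)
      then have "\<not> xs ! Suc r \<le> sum u {..s}" using s by blast
      moreover have "sum u {..s} \<in> Q" using s by (auto simp: Q_def)
      ultimately show ?thesis using gap[OF _ rl] eq by auto
    qed
  qed
  have \<phi>mono: "\<phi> \<in> ord_hom T S"
  proof -
    have "\<phi> r \<le> \<phi> r'" if r: "r \<in> T" "r' \<in> T" "r \<le> r'" for r r'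
    proof -
      have "xs ! Suc r \<le> xs ! Suc r'" using r by (intro le) (auto simp: T_def)
      then have "xs ! Suc r \<le> sum u {..\<phi> r'}" using \<phi>r(2)[OF r(2)] by simp
      then have "(LEAST s. s \<in> S \<and> xs ! Suc r \<le> sum u {..s}) \<le> \<phi> r'" using \<phi>r(1)[OF r(2)] by (intro Least_le) simp
      then show ?thesis using r(1) by (simp add: \<phi>_def)
    qed
    then show ?thesis using \<phi>r(1) by (auto simp: ord_hom_def mono_on_def \<phi>_def)
  qed
  have finT: "finite T" using Tlt finite_subset by blast
  have adm: "admissible n k T f"
    unfolding admissible_iff
  proof (intro conjI ballI impI)
    show "f \<in> T \<rightarrow>\<^sub>E {1..k}" using fr(1) by (auto simp: f_def)
    fix i j assume ij: "i \<in> {1..k}" "j \<in> {1..k}" "i \<noteq> j"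
    have alt: "\<exists>\<beta>::nat \<Rightarrow> nat. mono_on T \<beta> \<and> (\<forall>t\<in>T. \<beta> t \<le> n) \<and> (\<forall>t\<in>T. \<forall>t'\<in>T. f t = i \<longrightarrow> f t' = j \<longrightarrow> \<beta> t \<noteq> \<beta> t')"
      if c: "cell n (p i) (p j)" and i: "i \<in> {1..k}" and j: "j \<in> {1..k}" for i j
    proof -
      obtain \<beta> where \<beta>: "mono \<beta>" "\<And>r. Suc r < length xs \<Longrightarrow> \<beta> r \<le> n \<and>
        (if even (\<beta> r) then p j (xs ! r) = p j (xs ! Suc r) else p i (xs ! r) = p i (xs ! Suc r))"
        using block[OF c i j] by blast
      have "\<beta> t \<noteq> \<beta> t'" if "t \<in> T" "t' \<in> T" "f t = i" "f t' = j" for t t'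
      proof -
        have "even (\<beta> t)" using \<beta>(2)[of t] fr(2)[OF that(1)] that by (auto simp: T_def move_def split: if_splits)
        moreover have "odd (\<beta> t')" using \<beta>(2)[of t'] fr(2)[OF that(2)] that by (auto simp: T_def move_def split: if_splits)
        ultimately show ?thesis by auto
      qed
      moreover have "mono_on T \<beta>" using \<beta>(1) by (auto simp: mono_on_def mono_def)
      moreover have "\<beta> t \<le> n" if "t \<in> T" for t using \<beta>(2)[of t] that by (simp add: T_def)
      ultimately show ?thesis by blast
    qed
    consider "cell n (p i) (p j)" | "cell n (p j) (p i)" using pc[OF ij] by blast
    then show "alternates n T f i j"
    proof cases
      case 1 from alt[OF this ij(1,2)] show ?thesis unfolding alternates_def .
    next
      case 2 from alt[OF this ij(2,1)] show ?thesis unfolding alternates_def by metis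
    qed
  qed (rule finT)
  have "presents n k S p u T f \<phi> (\<lambda>r. xs ! r) (\<lambda>r. xs ! Suc r)"
    unfolding presents_def
  proof (intro conjI ballI impI adm \<phi>mono)
    fix r assume r: "r \<in> T"
    then have rl: "Suc r < length xs" by (simp add: T_def)
    show "0 \<le> xs ! r" "xs ! Suc r \<le> 1" using Q01 xsQ rl by auto
    show "xs ! r \<le> xs ! Suc r" using lt[of r "Suc r"] rl by simp
    show "sum u {..<\<phi> r} \<le> xs ! r" by (rule \<phi>low[OF r])
    show "xs ! Suc r \<le> sum u {..\<phi> r}" by (rule \<phi>r(2)[OF r])
    fix r' assume "r' \<in> T" "r < r'"
    then show "xs ! Suc r \<le> xs ! r'" by (intro le) (auto simp: T_def)
  next
    fix i assume i: "i \<in> {1..k}"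
    have "(\<Sum>r\<in>fibre T f i. p i (xs ! Suc r) - p i (xs ! r)) = (\<Sum>r<length xs - 1. p i (xs ! Suc r) - p i (xs ! r))"
    proof (rule sum.mono_neutral_left)
      show "fibre T f i \<subseteq> {..<length xs - 1}"
      proof
        fix r assume "r \<in> fibre T f i"
        then have "Suc r < length xs" using f_iff[OF i, of r] by simp
        then show "r \<in> {..<length xs - 1}" by auto
      qed
      show "\<forall>r\<in>{..<length xs - 1} - fibre T f i. p i (xs ! Suc r) - p i (xs ! r) = 0"
      proof
        fix r assume r: "r \<in> {..<length xs - 1} - fibre T f i"
        then have "Suc r < length xs" by auto
        then have "\<not> move i r" using f_iff[OF i, of r] r by simp
        then show "p i (xs ! Suc r) - p i (xs ! r) = 0" by (simp add: move_def)
      qed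
    qed simp
    also have "\<dots> = p i (xs ! (length xs - 1)) - p i (xs ! 0)"
      by (rule sum_lessThan_telescope)
    also have "\<dots> = 1" unfolding first last using progressD(3,4)[OF p[OF i]] by simp
    finally show "(\<Sum>r\<in>fibre T f i. p i (xs ! Suc r) - p i (xs ! r)) = 1" .
  qed
  moreover have "T \<subseteq> {..<2 + card S + k * (k * Suc (Suc n))}" using Tlt len cardQ by auto
  ultimately show ?thesis by blast
qed

section \<open>The action on the totalization\<close>

text \<open>What the action retains of an operation: the directions are forgotten and only the
  common bound \<open>n\<close> on alternation remains.\<close>

definition progress_tuple :: "nat \<Rightarrow> nat \<Rightarrow> (nat \<Rightarrow> real \<Rightarrow> real) \<Rightarrow> bool" where
  "progress_tuple n k p \<longleftrightarrow> (\<forall>i\<in>{1..k}. p i \<in> progress) \<and>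
     (\<forall>i\<in>{1..k}. \<forall>j\<in>{1..k}. i \<noteq> j \<longrightarrow> cell n (p i) (p j) \<or> cell n (p j) (p i))"

lemma TotD:
  assumes "\<alpha> \<in> topspace (Tot X)" "finite T"
  shows "continuous_map (simplex_on T) (cos_space X T) (\<alpha> T)"
    "\<alpha> T \<in> topspace (compact_open (simplex_on T) (cos_space X T))"
    "u \<in> topspace (simplex_on T) \<Longrightarrow> \<alpha> T u \<in> topspace (cos_space X T)"
    "\<lbrakk>finite T'; \<phi> \<in> ord_hom T T'; u \<in> topspace (simplex_on T)\<rbrakk> \<Longrightarrow> \<alpha> T' (simplex_push T \<phi> u) = cos_map X T T' \<phi> (\<alpha> T u)"
proof -
  have "\<alpha> \<in> topspace (product_topology (\<lambda>T. compact_open (simplex_on T) (cos_space X T)) {T. finite T})"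
    using assms(1) unfolding Tot_def by simp
  then show 1: "\<alpha> T \<in> topspace (compact_open (simplex_on T) (cos_space X T))"
    using assms(2) by (auto simp: PiE_iff)
  then show c: "continuous_map (simplex_on T) (cos_space X T) (\<alpha> T)" by (simp add: topspace_compact_open)
  then show "u \<in> topspace (simplex_on T) \<Longrightarrow> \<alpha> T u \<in> topspace (cos_space X T)" by (auto simp: continuous_map_def)
  show "\<lbrakk>finite T'; \<phi> \<in> ord_hom T T'; u \<in> topspace (simplex_on T)\<rbrakk> \<Longrightarrow> \<alpha> T' (simplex_push T \<phi> u) = cos_map X T T' \<phi> (\<alpha> T u)"
    using assms unfolding Tot_def by simp
qed

lemma continuous_map_Tot_at:
  assumes "continuous_map Z (Tot X) F" "finite T"
  shows "continuous_map Z (compact_open (simplex_on T) (cos_space X T)) (\<lambda>z. F z T)"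
proof -
  have "continuous_map Z (product_topology (\<lambda>T. compact_open (simplex_on T) (cos_space X T)) {T. finite T}) F"
    using assms(1) unfolding Tot_def by (rule continuous_map_into_fulltopology)
  then show ?thesis using assms(2) unfolding continuous_map_componentwise by simp
qed

context bracketed
begin

definition present_val ::
  "nat \<Rightarrow> nat set \<Rightarrow> (nat \<Rightarrow> real \<Rightarrow> real) \<Rightarrow> (nat \<Rightarrow> nat set \<Rightarrow> (nat \<Rightarrow> real) \<Rightarrow> 'a) \<Rightarrow>
    nat set \<Rightarrow> (nat \<Rightarrow> nat) \<Rightarrow> (nat \<Rightarrow> nat) \<Rightarrow> (nat \<Rightarrow> real) \<Rightarrow> (nat \<Rightarrow> real) \<Rightarrow> 'a" where
  "present_val k S p y T f \<phi> a b =
     cos_map X T S \<phi> (BB k T f (\<lambda>i\<in>{1..k}. y i (fibre T f i) (increments T f a b p i)))"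

text \<open>Independent of the presentation that \<open>SOME\<close> picks, by
  \<open>present_val_unique\<close>.\<close>

definition evaluate ::
  "nat \<Rightarrow> nat set \<Rightarrow> (nat \<Rightarrow> real \<Rightarrow> real) \<Rightarrow> (nat \<Rightarrow> nat set \<Rightarrow> (nat \<Rightarrow> real) \<Rightarrow> 'a) \<Rightarrow> (nat \<Rightarrow> real) \<Rightarrow> 'a" where
  "evaluate k S p y u = (SOME v. \<exists>T f \<phi> a b. presents n k S p u T f \<phi> a b \<and> v = present_val k S p y T f \<phi> a b)"

definition act ::
  "nat \<Rightarrow> (nat \<Rightarrow> real \<Rightarrow> real) \<Rightarrow> (nat \<Rightarrow> nat set \<Rightarrow> (nat \<Rightarrow> real) \<Rightarrow> 'a) \<Rightarrow> nat set \<Rightarrow> (nat \<Rightarrow> real) \<Rightarrow> 'a" where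
  "act k p y = (\<lambda>S\<in>{S. finite S}. \<lambda>u\<in>topspace (simplex_on S). evaluate k S p y u)"

lemma args_in:
  assumes P: "presents n k S p u T f \<phi> a b" and p: "\<And>i. i \<in> {1..k} \<Longrightarrow> p i \<in> progress"
    and y: "\<And>i. i \<in> {1..k} \<Longrightarrow> y i \<in> topspace (Tot X)"
  shows "(\<lambda>i\<in>{1..k}. y i (fibre T f i) (increments T f a b p i)) \<in> topspace (fibre_product X k T f)"
  unfolding fibre_product_def
  using TotD(3)[OF y finite_fibre[OF presentsD(3)[OF P]] increments_in_simplex[OF P p]] by auto

text \<open>Consistency moves \<psi> through the bracket, and naturality of each \<open>y i\<close>
  turns the induced maps on the fibres into pushforwards of simplex points.\<close>

lemma present_val_morphism:
  assumes P: "presents n k S p u T f \<phi> a b" and Q: "presents n k S p u Q g \<omega> c d"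
    and p: "\<And>i. i \<in> {1..k} \<Longrightarrow> p i \<in> progress" and y: "\<And>i. i \<in> {1..k} \<Longrightarrow> y i \<in> topspace (Tot X)" and S: "finite S"
    and \<psi>: "\<psi> \<in> ord_hom Q T" and g: "compose Q f \<psi> = g" and \<omega>: "compose Q \<phi> \<psi> = \<omega>"
    and push: "\<And>i. i \<in> {1..k} \<Longrightarrow> simplex_push (fibre Q g i) (restrict \<psi> (fibre Q g i)) (increments Q g c d p i) = increments T f a b p i"
  shows "present_val k S p y Q g \<omega> c d = present_val k S p y T f \<phi> a b"
proof -
  note D = presentsD[OF P] and E = presentsD[OF Q]
  let ?x = "\<lambda>i\<in>{1..k}. y i (fibre Q g i) (increments Q g c d p i)"
  have x: "?x \<in> topspace (fibre_product X k Q g)" by (rule args_in[OF Q p y])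
  have "present_val k S p y Q g \<omega> c d = cos_map X T S \<phi> (cos_map X Q T \<psi> (BB k Q g ?x))"
    unfolding present_val_def \<omega>[symmetric] by (rule cos_map_comp[OF E(3) D(3) S \<psi> D(2) BB_in[OF E(1) x]])
  also have "cos_map X Q T \<psi> (BB k Q g ?x) = BB k T f (\<lambda>i\<in>{1..k}.
          cos_map X (fibre Q g i) (fibre T f i) (restrict \<psi> (fibre Q g i)) (?x i))"
    by (rule BB_consistent[OF \<psi> E(1) D(1) g x])
  also have "(\<lambda>i\<in>{1..k}. cos_map X (fibre Q g i) (fibre T f i) (restrict \<psi> (fibre Q g i)) (?x i)) =
      (\<lambda>i\<in>{1..k}. y i (fibre T f i) (increments T f a b p i))"
  proof (rule restrict_ext)
    fix i assume i: "i \<in> {1..k}"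
    show "cos_map X (fibre Q g i) (fibre T f i) (restrict \<psi> (fibre Q g i)) (?x i) = y i (fibre T f i) (increments T f a b p i)"
      using TotD(4)[OF y[OF i] finite_fibre[OF E(3)] finite_fibre[OF D(3)] ord_hom_fibre[OF \<psi> g] increments_in_simplex[OF Q p[OF i] i]] i
      unfolding push[OF i] by simp
  qed
  finally show ?thesis unfolding present_val_def .
qed

lemma present_val_unique:
  assumes P: "presents n k S p u T f \<phi> a b" and P': "presents n k S p u T' f' \<phi>' a' b'"
    and p: "\<And>i. i \<in> {1..k} \<Longrightarrow> p i \<in> progress" and y: "\<And>i. i \<in> {1..k} \<Longrightarrow> y i \<in> topspace (Tot X)" and S: "finite S"
    and u: "\<And>t. 0 \<le> u t"
  shows "present_val k S p y T f \<phi> a b = present_val k S p y T' f' \<phi>' a' b'"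
proof -
  obtain Q g \<omega> c d \<psi> \<psi>' where R: "presents n k S p u Q g \<omega> c d"
    "\<psi> \<in> ord_hom Q T" "compose Q f \<psi> = g" "compose Q \<phi> \<psi> = \<omega>"
    "\<forall>i\<in>{1..k}. simplex_push (fibre Q g i) (restrict \<psi> (fibre Q g i)) (increments Q g c d p i) = increments T f a b p i"
    "\<psi>' \<in> ord_hom Q T'" "compose Q f' \<psi>' = g" "compose Q \<phi>' \<psi>' = \<omega>"
    "\<forall>i\<in>{1..k}. simplex_push (fibre Q g i) (restrict \<psi>' (fibre Q g i)) (increments Q g c d p i) = increments T' f' a' b' p i"
    by (rule common_refinement[OF P P' p u])
  show ?thesis
    using present_val_morphism[OF P R(1) p y S R(2-4) R(5)[rule_format]]
      present_val_morphism[OF P' R(1) p y S R(6-8) R(9)[rule_format]] by simp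
qed

lemma evaluate_eq:
  assumes P: "presents n k S p u T f \<phi> a b"
    and p: "\<And>i. i \<in> {1..k} \<Longrightarrow> p i \<in> progress" and y: "\<And>i. i \<in> {1..k} \<Longrightarrow> y i \<in> topspace (Tot X)" and S: "finite S"
    and u: "u \<in> topspace (simplex_on S)"
  shows "evaluate k S p y u = present_val k S p y T f \<phi> a b"
  unfolding evaluate_def
proof (rule some_equality)
  show "\<exists>T' f' \<phi>' a' b'. presents n k S p u T' f' \<phi>' a' b' \<and> present_val k S p y T f \<phi> a b = present_val k S p y T' f' \<phi>' a' b'"
    using P by blast
  have u0: "0 \<le> u t" for t using u by (simp add: topspace_simplex_on)
  fix v assume "\<exists>T f \<phi> a b. presents n k S p u T f \<phi> a b \<and> v = present_val k S p y T f \<phi> a b"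
  then obtain T' f' \<phi>' a' b' where P': "presents n k S p u T' f' \<phi>' a' b'" and v: "v = present_val k S p y T' f' \<phi>' a' b'" by blast
  show "v = present_val k S p y T f \<phi> a b" unfolding v by (rule present_val_unique[OF P' P p y S u0])
qed

lemma present_val_in:
  assumes P: "presents n k S p u T f \<phi> a b" and p: "\<And>i. i \<in> {1..k} \<Longrightarrow> p i \<in> progress"
    and y: "\<And>i. i \<in> {1..k} \<Longrightarrow> y i \<in> topspace (Tot X)" and S: "finite S"
  shows "present_val k S p y T f \<phi> a b \<in> topspace (cos_space X S)"
  unfolding present_val_def
  by (rule cos_map_in[OF presentsD(3)[OF P] S presentsD(2)[OF P] BB_in[OF presentsD(1)[OF P] args_in[OF P p y]]])

text \<open>For a fixed shape \<open>(T, f, \<phi>)\<close> the parameters together with the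
  endpoints form a closed subset of \<open>Z\<close> times a compact cube, and the value is
  continuous on it. Projecting the cube away is a closed map.\<close>

lemma present_val_closed:
  assumes p: "\<And>i. i \<in> {1..k} \<Longrightarrow> continuous_map Z progress_space (\<lambda>z. p z i)"
    and y: "\<And>i. i \<in> {1..k} \<Longrightarrow> continuous_map Z (Tot X) (\<lambda>z. y z i)"
    and u: "continuous_map Z (simplex_on S) u" and S: "finite S"
    and C: "closedin (cos_space X S) C" and T: "T \<subseteq> {..<L}"
  shows "closedin Z {z \<in> topspace Z. \<exists>a b. presents n k S (p z) (u z) T f \<phi> a b \<and> present_val k S (p z) (y z) T f \<phi> a b \<in> C}"
proof (cases "admissible n k T f \<and> \<phi> \<in> ord_hom T S")
  case False
  then have "{z \<in> topspace Z. \<exists>a b. presents n k S (p z) (u z) T f \<phi> a b \<and> present_val k S (p z) (y z) T f \<phi> a b \<in> C} = {}"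
    by (auto simp: presents_def)
  then show ?thesis by (simp only: closedin_empty)
next
  case True
  then have adm: "admissible n k T f" and \<phi>: "\<phi> \<in> ord_hom T S" by auto
  have finT: "finite T" using adm by (simp add: admissible_def)
  let ?K = "unit_cube (2 * L)"
  let ?ZZ = "prod_topology Z ?K"
  \<comment> \<open>The endpoints of interval \<open>r\<close> are kept in the coordinates
    \<open>2 * r + 1\<close> and \<open>2 * r + 2\<close>, as cube coordinates start at 1.\<close>
  define a b where "a w r = snd w (2 * r + 1)" and "b w r = snd w (2 * r + 2)" for w :: "'b \<times> (nat \<Rightarrow> real)" and r :: nat
  define E where "E = {w \<in> topspace ?ZZ. presents n k S (p (fst w)) (u (fst w)) T f \<phi> (a w) (b w)}"
  have pr: "p z i \<in> progress" if "z \<in> topspace Z" "i \<in> {1..k}" for z i using p[OF that(2)] that(1) by (auto simp: continuous_map_def)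
  have yT: "y z i \<in> topspace (Tot X)" if "z \<in> topspace Z" "i \<in> {1..k}" for z i using y[OF that(2)] that(1) by (auto simp: continuous_map_def)
  have ac: "continuous_map ?ZZ euclideanreal (\<lambda>w. a w r)" "continuous_map ?ZZ euclideanreal (\<lambda>w. b w r)" if "r \<in> T" for r
    unfolding a_def b_def using T that by (intro continuous_map_cube_coord[OF continuous_map_snd]; auto)+
  have uc: "continuous_map ?ZZ euclideanreal (\<lambda>w. sum (u (fst w)) A)" if "finite A" for A
    by (intro continuous_map_sum that continuous_map_simplex_at[OF continuous_map_o[OF continuous_map_fst u]])
  have pc: "continuous_map ?ZZ progress_space (\<lambda>w. p (fst w) i)" if "i \<in> {1..k}" for i
    by (rule continuous_map_o[OF continuous_map_fst p[OF that]])
  have incr: "continuous_map ?ZZ euclideanreal (\<lambda>w. p (fst w) i (b w r) - p (fst w) i (a w r))" if "i \<in> {1..k}" "r \<in> T" for i r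
    by (intro continuous_map_diff continuous_map_progress_eval[OF pc] ac that)
  have clE: "closedin ?ZZ E"
  proof -
    have "closedin ?ZZ {w \<in> topspace ?ZZ.
       (\<forall>r\<in>T. 0 \<le> a w r \<and> a w r \<le> b w r \<and> b w r \<le> 1 \<and> sum (u (fst w)) {..<\<phi> r} \<le> a w r \<and> b w r \<le> sum (u (fst w)) {..\<phi> r}) \<and>
       (\<forall>r\<in>T. \<forall>r'\<in>{r' \<in> T. r < r'}. b w r \<le> a w r') \<and>
       (\<forall>i\<in>{1..k}. (\<Sum>r\<in>fibre T f i. p (fst w) i (b w r) - p (fst w) i (a w r)) = 1)}"
      by (intro closedin_Collect_conj closedin_Collect_ball closedin_Collect_le closedin_Collect_eq ac uc continuous_map_sum incr
          finite_fibre finT) (auto simp: fibre_def)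
    moreover have "E = {w \<in> topspace ?ZZ.
       (\<forall>r\<in>T. 0 \<le> a w r \<and> a w r \<le> b w r \<and> b w r \<le> 1 \<and> sum (u (fst w)) {..<\<phi> r} \<le> a w r \<and> b w r \<le> sum (u (fst w)) {..\<phi> r}) \<and>
       (\<forall>r\<in>T. \<forall>r'\<in>{r' \<in> T. r < r'}. b w r \<le> a w r') \<and>
       (\<forall>i\<in>{1..k}. (\<Sum>r\<in>fibre T f i. p (fst w) i (b w r) - p (fst w) i (a w r)) = 1)}"
      unfolding E_def presents_def using adm \<phi> by auto
    ultimately show ?thesis by simp
  qed
  let ?E = "subtopology ?ZZ E"
  have tE: "topspace ?E = E" by (auto simp: E_def)
  have wE: "fst w \<in> topspace Z" "presents n k S (p (fst w)) (u (fst w)) T f \<phi> (a w) (b w)" if "w \<in> E" for w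
    using that by (auto simp: E_def)
  have val: "continuous_map ?E (cos_space X S) (\<lambda>w. present_val k S (p (fst w)) (y (fst w)) T f \<phi> (a w) (b w))"
  proof -
    have "continuous_map ?E (cos_space X (fibre T f i)) (\<lambda>w. y (fst w) i (fibre T f i) (increments T f (a w) (b w) (p (fst w)) i))"
      if i: "i \<in> {1..k}" for i
    proof (rule continuous_map_evaluation_compose[OF compact_Hausdorff_simplex[OF finite_fibre[OF finT]]])
      show "continuous_map ?E (compact_open (simplex_on (fibre T f i)) (cos_space X (fibre T f i))) (\<lambda>w. y (fst w) i (fibre T f i))"
        by (rule continuous_map_Tot_at[OF continuous_map_from_subtopology[OF continuous_map_o[OF continuous_map_fst y[OF i]]] finite_fibre[OF finT]])
      show "continuous_map ?E (simplex_on (fibre T f i)) (\<lambda>w. increments T f (a w) (b w) (p (fst w)) i)"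
      proof (rule continuous_map_into_simplex)
        fix w assume "w \<in> topspace ?E"
        then have "w \<in> E" using tE by blast
        then show "increments T f (a w) (b w) (p (fst w)) i \<in> topspace (simplex_on (fibre T f i))"
          using increments_in_simplex[OF wE(2) pr[OF wE(1) i] i] by blast
      next
        fix r
        show "continuous_map ?E euclideanreal (\<lambda>w. increments T f (a w) (b w) (p (fst w)) i r)"
        proof (cases "r \<in> fibre T f i")
          case True
          then show ?thesis using continuous_map_from_subtopology[OF incr[OF i, of r], of E] by (simp add: increments_def fibre_def)
        qed (simp add: increments_def)
      qed
    qed
    then have "continuous_map ?E (fibre_product X k T f) (\<lambda>w. \<lambda>i\<in>{1..k}. y (fst w) i (fibre T f i) (increments T f (a w) (b w) (p (fst w)) i))"
      unfolding fibre_product_def by (subst continuous_map_componentwise) auto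
    from continuous_map_o[OF continuous_map_o[OF this BB_cont[OF adm]] cos_map_cont[OF finT S \<phi>]]
    show ?thesis unfolding present_val_def .
  qed
  have "closedin ?E {w \<in> topspace ?E. present_val k S (p (fst w)) (y (fst w)) T f \<phi> (a w) (b w) \<in> C}"
    by (rule closedin_continuous_map_preimage[OF val C])
  then have "closedin ?ZZ {w \<in> topspace ?E. present_val k S (p (fst w)) (y (fst w)) T f \<phi> (a w) (b w) \<in> C}"
    by (rule closedin_trans_full[OF _ clE])
  then have cl: "closedin Z (fst ` {w \<in> E. present_val k S (p (fst w)) (y (fst w)) T f \<phi> (a w) (b w) \<in> C})"
    using Abstract_Topological_Spaces.closed_map_fst[OF compact_Hausdorff_unit_cube(1)] unfolding closed_map_def tE by blast
  have "{z \<in> topspace Z. \<exists>a b. presents n k S (p z) (u z) T f \<phi> a b \<and> present_val k S (p z) (y z) T f \<phi> a b \<in> C} =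
    fst ` {w \<in> E. present_val k S (p (fst w)) (y (fst w)) T f \<phi> (a w) (b w) \<in> C}"
  proof (intro equalityI subsetI)
    fix z assume "z \<in> {z \<in> topspace Z. \<exists>a b. presents n k S (p z) (u z) T f \<phi> a b \<and> present_val k S (p z) (y z) T f \<phi> a b \<in> C}"
    then obtain a' b' where z: "z \<in> topspace Z" and P: "presents n k S (p z) (u z) T f \<phi> a' b'"
      and V: "present_val k S (p z) (y z) T f \<phi> a' b' \<in> C" by blast
    \<comment> \<open>Coordinates that belong to no interval are set to 0, which keeps the point in
      the cube.\<close>
    define w where "w = (z, \<lambda>m\<in>{1..2 * L}. if odd m then if (m - 1) div 2 \<in> T then a' ((m - 1) div 2) else 0
       else if (m - 2) div 2 \<in> T then b' ((m - 2) div 2) else 0)"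
    have ab: "a w r = a' r" "b w r = b' r" if "r \<in> T" for r
    proof -
      have "r < L" using T that by auto
      then have "2 * r + 1 \<in> {1..2 * L}" "2 * r + 2 \<in> {1..2 * L}" by auto
      then show "a w r = a' r" "b w r = b' r" using that by (simp_all add: a_def b_def w_def)
    qed
    have inc: "increments T f (a w) (b w) (p z) i = increments T f a' b' (p z) i" for i
      unfolding increments_def using ab by (auto simp: fibre_def fun_eq_iff)
    have "snd w \<in> cube_set (2 * L)"
      unfolding cube_set_eq w_def using presentsD(4)[OF P] by fastforce
    moreover have "presents n k S (p z) (u z) T f \<phi> (a w) (b w)"
      using P unfolding presents_def
    proof (elim conjE, intro conjI)
      show "\<forall>i\<in>{1..k}. (\<Sum>r\<in>fibre T f i. p z i (b w r) - p z i (a w r)) = 1"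
      proof
        fix i assume i: "i \<in> {1..k}"
        have "(\<Sum>r\<in>fibre T f i. p z i (b w r) - p z i (a w r)) = (\<Sum>r\<in>fibre T f i. p z i (b' r) - p z i (a' r))"
          using ab by (intro sum.cong) (auto simp: fibre_def)
        then show "(\<Sum>r\<in>fibre T f i. p z i (b w r) - p z i (a w r)) = 1" using presentsD(8)[OF P i] by simp
      qed
    qed (simp_all add: ab)
    moreover have "fst w = z" by (simp add: w_def)
    moreover have "present_val k S (p z) (y z) T f \<phi> (a w) (b w) \<in> C" using V unfolding present_val_def inc .
    ultimately have "w \<in> {w \<in> E. present_val k S (p (fst w)) (y (fst w)) T f \<phi> (a w) (b w) \<in> C}"
      using z by (simp add: E_def mem_Times_iff)
    then show "z \<in> fst ` {w \<in> E. present_val k S (p (fst w)) (y (fst w)) T f \<phi> (a w) (b w) \<in> C}"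
      unfolding \<open>fst w = z\<close>[symmetric] by (rule imageI)
  next
    fix z assume "z \<in> fst ` {w \<in> E. present_val k S (p (fst w)) (y (fst w)) T f \<phi> (a w) (b w) \<in> C}"
    then obtain w where w: "w \<in> E" "present_val k S (p (fst w)) (y (fst w)) T f \<phi> (a w) (b w) \<in> C" "z = fst w" by blast
    show "z \<in> {z \<in> topspace Z. \<exists>a b. presents n k S (p z) (u z) T f \<phi> a b \<and> present_val k S (p z) (y z) T f \<phi> a b \<in> C}"
      using wE[OF w(1)] w(2,3) by blast
  qed
  with cl show ?thesis by simp
qed

text \<open>The preimage of a closed set is the union, over all shapes, of the closed sets of
  \<open>present_val_closed\<close>; by the bound in \<open>exists_presentation\<close> finitely
  many shapes suffice.\<close>

lemma evaluate_continuous: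
  assumes p: "\<And>i. i \<in> {1..k} \<Longrightarrow> continuous_map Z progress_space (\<lambda>z. p z i)"
    and pt: "\<And>z. z \<in> topspace Z \<Longrightarrow> progress_tuple n k (p z)"
    and y: "\<And>i. i \<in> {1..k} \<Longrightarrow> continuous_map Z (Tot X) (\<lambda>z. y z i)"
    and u: "continuous_map Z (simplex_on S) u" and S: "finite S"
  shows "continuous_map Z (cos_space X S) (\<lambda>z. evaluate k S (p z) (y z) (u z))"
proof -
  define L where "L = 2 + card S + k * (k * Suc (Suc n))"
  have pr: "p z i \<in> progress" if "z \<in> topspace Z" "i \<in> {1..k}" for z i using p[OF that(2)] that(1) by (auto simp: continuous_map_def)
  have yT: "y z i \<in> topspace (Tot X)" if "z \<in> topspace Z" "i \<in> {1..k}" for z i using y[OF that(2)] that(1) by (auto simp: continuous_map_def)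
  have uS: "u z \<in> topspace (simplex_on S)" if "z \<in> topspace Z" for z using u that by (auto simp: continuous_map_def)
  have ex: "\<exists>T f \<phi> a b. presents n k S (p z) (u z) T f \<phi> a b \<and> T \<subseteq> {..<L}" if z: "z \<in> topspace Z" for z
    unfolding L_def using pt[OF z] by (intro exists_presentation S uS[OF z]) (auto simp: progress_tuple_def)
  have eval: "evaluate k S (p z) (y z) (u z) = present_val k S (p z) (y z) T f \<phi> a b"
    if "presents n k S (p z) (u z) T f \<phi> a b" "z \<in> topspace Z" for z T f \<phi> a b
    by (rule evaluate_eq[OF that(1) pr[OF that(2)] yT[OF that(2)] S uS[OF that(2)]])
  show ?thesis
    unfolding continuous_map_closedin
  proof (intro conjI ballI allI impI)
    show "(\<lambda>z. evaluate k S (p z) (y z) (u z)) \<in> topspace Z \<rightarrow> topspace (cos_space X S)"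
    proof
      fix z assume z: "z \<in> topspace Z"
      obtain T f \<phi> a b where P: "presents n k S (p z) (u z) T f \<phi> a b" using ex[OF z] by blast
      show "evaluate k S (p z) (y z) (u z) \<in> topspace (cos_space X S)"
        unfolding eval[OF P z] by (rule present_val_in[OF P pr[OF z] yT[OF z] S])
    qed
  next
    fix C assume C: "closedin (cos_space X S) C"
    let ?I = "SIGMA T:Pow {..<L}. (T \<rightarrow>\<^sub>E {1..k}) \<times> (T \<rightarrow>\<^sub>E S)"
    let ?F = "\<lambda>(T, f, \<phi>). {z \<in> topspace Z. \<exists>a b. presents n k S (p z) (u z) T f \<phi> a b \<and> present_val k S (p z) (y z) T f \<phi> a b \<in> C}"
    have fin: "finite ?I"
    proof (rule finite_SigmaI)
      fix T assume "T \<in> Pow {..<L}"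
      then have "finite T" using finite_subset by blast
      then show "finite ((T \<rightarrow>\<^sub>E {1..k}) \<times> (T \<rightarrow>\<^sub>E S))" using S by (intro finite_cartesian_product finite_PiE) auto
    qed simp
    have "closedin Z (?F t)" if tI: "t \<in> ?I" for t
    proof -
      obtain T f \<phi> where t: "t = (T, f, \<phi>)" "T \<subseteq> {..<L}" using tI by (cases t) auto
      show ?thesis unfolding t(1) prod.case by (rule present_val_closed[OF p y u S C t(2)])
    qed
    then have cl: "closedin Z (\<Union>t\<in>?I. ?F t)" using fin by (intro closedin_Union) auto
    have "{z \<in> topspace Z. evaluate k S (p z) (y z) (u z) \<in> C} = (\<Union>t\<in>?I. ?F t)"
    proof (intro equalityI subsetI)
      fix z assume "z \<in> {z \<in> topspace Z. evaluate k S (p z) (y z) (u z) \<in> C}"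
      then have z: "z \<in> topspace Z" "evaluate k S (p z) (y z) (u z) \<in> C" by auto
      obtain T f \<phi> a b where P: "presents n k S (p z) (u z) T f \<phi> a b" "T \<subseteq> {..<L}" using ex[OF z(1)] by blast
      have "f \<in> T \<rightarrow>\<^sub>E {1..k}" "\<phi> \<in> T \<rightarrow>\<^sub>E S" using presentsD(1,2)[OF P(1)] by (auto simp: admissible_def ord_hom_def)
      then have "(T, f, \<phi>) \<in> ?I" using P(2) by simp
      moreover have "z \<in> ?F (T, f, \<phi>)" using z P(1) eval[OF P(1) z(1)] by auto
      ultimately show "z \<in> (\<Union>t\<in>?I. ?F t)" by (rule UN_I)
    next
      fix z assume "z \<in> (\<Union>t\<in>?I. ?F t)"
      then obtain T f \<phi> where "z \<in> ?F (T, f, \<phi>)" by blast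
      then obtain a b where z: "z \<in> topspace Z" "presents n k S (p z) (u z) T f \<phi> a b" "present_val k S (p z) (y z) T f \<phi> a b \<in> C" by auto
      show "z \<in> {z \<in> topspace Z. evaluate k S (p z) (y z) (u z) \<in> C}" using z eval[OF z(2) z(1)] by simp
    qed
    with cl show "closedin Z {z \<in> topspace Z. evaluate k S (p z) (y z) (u z) \<in> C}" by simp
  qed
qed

text \<open>The same intervals still work: as \<psi> is monotone, the slot of a vertex
  \<open>s\<close> in the old partition lies in the slot of \<open>\<psi> s\<close> in the new
  one.\<close>

lemma presents_push:
  assumes P: "presents n k S p u T f \<phi> a b" and u: "u \<in> topspace (simplex_on S)" and S: "finite S" and \<psi>: "\<psi> \<in> ord_hom S S'"
  shows "presents n k S' p (simplex_push S \<psi> u) T f (compose T \<psi> \<phi>) a b"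
proof -
  note D = presentsD[OF P]
  have u0: "0 \<le> u t" and uS: "t \<notin> S \<Longrightarrow> u t = 0" for t using u by (auto simp: topspace_simplex_on)
  have sum_push: "sum (simplex_push S \<psi> u) A = sum u {t \<in> S. \<psi> t \<in> A}" if A: "finite A" for A
  proof -
    have "sum (simplex_push S \<psi> u) A = (\<Sum>s\<in>A. sum u {t \<in> {t \<in> S. \<psi> t \<in> A}. \<psi> t = s})"
      unfolding simplex_push_def by (intro sum.cong refl arg_cong2[where f = sum]) auto
    also have "\<dots> = sum u {t \<in> S. \<psi> t \<in> A}" using S A by (intro sum.group) auto
    finally show ?thesis .
  qed
  have sum_S: "sum u A = sum u (A \<inter> S)" if "finite A" for A
    by (rule sum.mono_neutral_right[OF that]) (use uS in auto)
  have mono: "\<psi> s \<le> \<psi> s'" if "s \<in> S" "s' \<in> S" "s \<le> s'" for s s' using \<psi> that by (auto simp: ord_hom_def mono_on_def)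
  have \<phi>S: "\<phi> r \<in> S" if "r \<in> T" for r using D(2) that by (auto simp: ord_hom_def)
  have low: "sum (simplex_push S \<psi> u) {..<\<psi> s} \<le> sum u {..<s}" if s: "s \<in> S" for s
  proof -
    have "{t \<in> S. \<psi> t \<in> {..<\<psi> s}} \<subseteq> {..<s}" using mono[OF s] by fastforce
    then show ?thesis unfolding sum_push[OF finite_lessThan] by (rule simplex_sum_mono[OF u0]) simp
  qed
  have high: "sum u {..s} \<le> sum (simplex_push S \<psi> u) {..\<psi> s}" if s: "s \<in> S" for s
  proof -
    have "{..s} \<inter> S \<subseteq> {t \<in> S. \<psi> t \<in> {..\<psi> s}}" using mono[OF _ s] by auto
    then have "sum u ({..s} \<inter> S) \<le> sum u {t \<in> S. \<psi> t \<in> {..\<psi> s}}" by (rule simplex_sum_mono[OF u0]) (use S in simp)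
    then show ?thesis unfolding sum_push[OF finite_atMost] sum_S[of "{..s}", simplified] .
  qed
  show ?thesis
    unfolding presents_def
  proof (intro conjI ballI impI D(1) ord_hom_compose[OF D(2) \<psi>])
    fix r assume r: "r \<in> T"
    show "0 \<le> a r" "a r \<le> b r" "b r \<le> 1" using D(4)[OF r] by auto
    show "sum (simplex_push S \<psi> u) {..<compose T \<psi> \<phi> r} \<le> a r"
      using low[OF \<phi>S[OF r]] D(5)[OF r] r by (simp add: compose_def)
    show "b r \<le> sum (simplex_push S \<psi> u) {..compose T \<psi> \<phi> r}"
      using high[OF \<phi>S[OF r]] D(6)[OF r] r by (simp add: compose_def)
    show "b r \<le> a r'" if "r' \<in> T" "r < r'" for r' using D(7)[OF r that] .
  qed (rule D(8))
qed

lemma evaluate_natural: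
  assumes pt: "progress_tuple n k p" and y: "\<And>i. i \<in> {1..k} \<Longrightarrow> y i \<in> topspace (Tot X)"
    and S: "finite S" "finite S'" and \<psi>: "\<psi> \<in> ord_hom S S'" and u: "u \<in> topspace (simplex_on S)"
  shows "evaluate k S' p y (simplex_push S \<psi> u) = cos_map X S S' \<psi> (evaluate k S p y u)"
proof -
  have p: "p i \<in> progress" if "i \<in> {1..k}" for i using pt that by (auto simp: progress_tuple_def)
  obtain T f \<phi> a b where P: "presents n k S p u T f \<phi> a b"
    using exists_presentation[of k p n S u] pt S u by (auto simp: progress_tuple_def)
  note D = presentsD[OF P]
  note E = presents_push[OF P u S(1) \<psi>]
  have "evaluate k S' p y (simplex_push S \<psi> u) = present_val k S' p y T f (compose T \<psi> \<phi>) a b"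
    by (rule evaluate_eq[OF E p y S(2) simplex_push_in[OF u S \<psi>]])
  also have "\<dots> = cos_map X S S' \<psi> (present_val k S p y T f \<phi> a b)"
    unfolding present_val_def by (rule cos_map_comp[OF D(3) S D(2) \<psi> BB_in[OF D(1) args_in[OF P p y]]])
  also have "present_val k S p y T f \<phi> a b = evaluate k S p y u"
    by (rule evaluate_eq[OF P p y S(1) u, symmetric])
  finally show ?thesis .
qed

lemma act_continuous:
  assumes p: "\<And>i. i \<in> {1..k} \<Longrightarrow> continuous_map Z progress_space (\<lambda>z. p z i)"
    and pt: "\<And>z. z \<in> topspace Z \<Longrightarrow> progress_tuple n k (p z)"
    and y: "\<And>i. i \<in> {1..k} \<Longrightarrow> continuous_map Z (Tot X) (\<lambda>z. y z i)"
  shows "continuous_map Z (Tot X) (\<lambda>z. act k (p z) (y z))"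
proof -
  have yT: "y z i \<in> topspace (Tot X)" if "z \<in> topspace Z" "i \<in> {1..k}" for z i using y[OF that(2)] that(1) by (auto simp: continuous_map_def)
  have comp: "continuous_map Z (compact_open (simplex_on S) (cos_space X S)) (\<lambda>z. act k (p z) (y z) S)" if S: "finite S" for S
  proof (rule continuous_map_into_compact_open)
    let ?P = "prod_topology Z (simplex_on S)"
    have "continuous_map ?P (cos_space X S) (\<lambda>w. evaluate k S (p (fst w)) (y (fst w)) (snd w))"
      by (rule evaluate_continuous[OF _ _ _ continuous_map_snd S])
        (auto intro!: continuous_map_o[OF continuous_map_fst p] continuous_map_o[OF continuous_map_fst y] pt)
    then show "continuous_map ?P (cos_space X S) (\<lambda>(z, x). act k (p z) (y z) S x)"
      by (rule continuous_map_eq) (use S in \<open>auto simp: act_def\<close>)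
    show "act k (p z) (y z) S \<in> extensional (topspace (simplex_on S))" for z using S by (simp add: act_def)
  qed
  have "continuous_map Z (product_topology (\<lambda>T. compact_open (simplex_on T) (cos_space X T)) {T. finite T}) (\<lambda>z. act k (p z) (y z))"
    by (subst continuous_map_componentwise) (use comp in \<open>auto simp: act_def\<close>)
  moreover have "act k (p z) (y z) S' (simplex_push S \<psi> u) = cos_map X S S' \<psi> (act k (p z) (y z) S u)"
    if z: "z \<in> topspace Z" and S: "finite S" "finite S'" and \<psi>: "\<psi> \<in> ord_hom S S'" and u: "u \<in> topspace (simplex_on S)" for z S S' \<psi> u
    using evaluate_natural[OF pt[OF z] yT[OF z] S \<psi> u] S u simplex_push_in[OF u S \<psi>] by (simp add: act_def)
  ultimately show ?thesis unfolding Tot_def continuous_map_in_subtopology by auto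
qed

lemma act_in:
  assumes "progress_tuple n k p" "\<And>i. i \<in> {1..k} \<Longrightarrow> y i \<in> topspace (Tot X)"
  shows "act k p y \<in> topspace (Tot X)"
proof -
  \<comment> \<open>A one-point parameter space makes membership a case of continuity.\<close>
  have "continuous_map (top_of_set {0::real}) (Tot X) (\<lambda>_. act k p y)"
    by (rule act_continuous) (use assms in \<open>auto simp: progress_tuple_def\<close>)
  then have "(\<lambda>_. act k p y) \<in> topspace (top_of_set {0::real}) \<rightarrow> topspace (Tot X)"
    unfolding continuous_map_def by (rule conjunct1)
  then have "(\<lambda>_. act k p y) (0::real) \<in> topspace (Tot X)" by (rule funcset_mem) simp
  then show ?thesis .
qed

text \<open>For one label with \<open>clamp01\<close>, the partition given by \<open>u\<close> is
  itself a presentation, and its increments are \<open>u\<close>.\<close>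

lemma act_unit:
  assumes y: "y 1 \<in> topspace (Tot X)"
  shows "act 1 (\<lambda>_. clamp01) y = y 1"
proof -
  have yext: "y 1 \<in> extensional {S. finite S}" using y unfolding Tot_def by (auto simp: PiE_iff)
  have eval: "evaluate 1 S (\<lambda>_. clamp01) y u = y 1 S u" if S: "finite S" and u: "u \<in> topspace (simplex_on S)" for S u
  proof -
    let ?f = "\<lambda>s\<in>S. 1::nat" and ?\<phi> = "\<lambda>s\<in>S. s" and ?a = "\<lambda>s. sum u {..<s}" and ?b = "\<lambda>s. sum u {..s}"
    have u0: "0 \<le> u t" and uS: "t \<notin> S \<Longrightarrow> u t = 0" and u1: "sum u S = 1" for t using u by (auto simp: topspace_simplex_on)
    have le1: "sum u A \<le> 1" "0 \<le> sum u A" if "finite A" for A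
    proof -
      have "sum u A = sum u (A \<inter> S)" by (rule sum.mono_neutral_right[OF that]) (use uS in auto)
      also have "\<dots> \<le> sum u S" by (rule simplex_sum_mono[OF u0]) (use S in auto)
      finally show "sum u A \<le> 1" using u1 by simp
      show "0 \<le> sum u A" by (rule sum_nonneg) (rule u0)
    qed
    have fib: "fibre S ?f 1 = S" by (auto simp: fibre_def)
    have diff: "clamp01 (?b s) - clamp01 (?a s) = u s" for s
    proof -
      have "{..s} = insert s {..<s}" by auto
      then have "?b s = u s + ?a s" by simp
      moreover have "clamp01 (?b s) = ?b s" "clamp01 (?a s) = ?a s" using le1 by (auto intro!: clamp01_id)
      ultimately show ?thesis by simp
    qed
    have one: "{1..1::nat} = {1}" by auto
    have P: "presents n 1 S (\<lambda>_. clamp01) u S ?f ?\<phi> ?a ?b"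
      unfolding presents_def admissible_iff
    proof (intro conjI ballI impI)
      fix r r' assume "r \<in> S" "r' \<in> S" "r < r'"
      then have "{..r} \<subseteq> {..<r'}" by auto
      then show "?b r \<le> ?a r'" by (rule simplex_sum_mono[OF u0]) simp
    next
      fix r assume r: "r \<in> S"
      have "{..<r} \<subseteq> {..r}" by auto
      then show "?a r \<le> ?b r" by (rule simplex_sum_mono[OF u0]) simp
    next
      fix i assume "i \<in> {1..1::nat}"
      then have "i = 1" by simp
      then show "(\<Sum>r\<in>fibre S ?f i. clamp01 (?b r) - clamp01 (?a r)) = 1" unfolding diff by (simp only: fib u1)
    qed (use S le1 in \<open>auto simp: ord_hom_def mono_on_def\<close>)
    have inc: "increments S ?f ?a ?b (\<lambda>_. clamp01) 1 = u"
      unfolding increments_def fib diff using uS by (auto simp: fun_eq_iff)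
    have x: "(\<lambda>i\<in>{1..1}. y i (fibre S ?f i) (increments S ?f ?a ?b (\<lambda>_. clamp01) i)) \<in> topspace (fibre_product X 1 S ?f)"
      by (rule args_in[OF P]) (use y clamp01_progress one in auto)
    have "evaluate 1 S (\<lambda>_. clamp01) y u = present_val 1 S (\<lambda>_. clamp01) y S ?f ?\<phi> ?a ?b"
      by (rule evaluate_eq[OF P _ _ S u]) (use y clamp01_progress one in auto)
    also have "\<dots> = cos_map X S S ?\<phi> (y 1 S u)"
      unfolding present_val_def BB_identity[OF presentsD(1)[OF P] x] using fib inc by simp
    also have "\<dots> = y 1 S u" by (rule cos_map_id[OF S TotD(3)[OF y S u]])
    finally show ?thesis .
  qed
  show ?thesis
  proof (rule extensionalityI[of _ "{S. finite S}"])
    fix S assume "S \<in> {S::nat set. finite S}"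
    then have S: "finite S" by simp
    have "y 1 S \<in> extensional (topspace (simplex_on S))" using TotD(2)[OF y S] by (simp add: topspace_compact_open)
    then show "act 1 (\<lambda>_. clamp01) y S = y 1 S"
      by (intro extensionalityI[of _ "topspace (simplex_on S)"]) (use S eval[OF S] in \<open>auto simp: act_def\<close>)
  qed (use yext in \<open>auto simp: act_def\<close>)
qed

lemma act_cong:
  assumes "\<And>i. i \<in> {1..k} \<Longrightarrow> p i = p' i" "\<And>i. i \<in> {1..k} \<Longrightarrow> y i = y' i"
  shows "act k p y = act k p' y'"
proof -
  have "presents n k S p u T f \<phi> a b = presents n k S p' u T f \<phi> a b" for S u T f \<phi> a b
    unfolding presents_def using assms(1) by simp
  moreover have "present_val k S p y T f \<phi> a b = present_val k S p' y' T f \<phi> a b" for S T f \<phi> a b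
  proof -
    have "(\<lambda>i\<in>{1..k}. y i (fibre T f i) (increments T f a b p i)) = (\<lambda>i\<in>{1..k}. y' i (fibre T f i) (increments T f a b p' i))"
    proof (rule restrict_ext)
      fix i assume i: "i \<in> {1..k}"
      show "y i (fibre T f i) (increments T f a b p i) = y' i (fibre T f i) (increments T f a b p' i)"
        unfolding increments_def assms(1)[OF i] assms(2)[OF i] ..
    qed
    then show ?thesis unfolding present_val_def by simp
  qed
  ultimately show ?thesis unfolding act_def evaluate_def by simp
qed

text \<open>Relabelling by \<open>inv \<sigma>\<close> turns a presentation for \<open>p\<close>
  into one for the permuted tuple with the same intervals, and commutativity identifies the two
  brackets.\<close>

lemma act_permute:
  assumes pt: "progress_tuple n k p" and y: "\<And>i. i \<in> {1..k} \<Longrightarrow> y i \<in> topspace (Tot X)" and \<sigma>: "\<sigma> permutes {1..k}"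
  shows "act k (\<lambda>i. p (\<sigma> i)) y = act k p (\<lambda>i. y (inv \<sigma> i))"
proof -
  have p: "p i \<in> progress" if "i \<in> {1..k}" for i using pt that by (auto simp: progress_tuple_def)
  have \<sigma>in: "\<sigma> i \<in> {1..k}" "inv \<sigma> i \<in> {1..k}" if "i \<in> {1..k}" for i
    using permutes_in_image[OF \<sigma>] permutes_in_image[OF permutes_inv[OF \<sigma>]] that by blast+
  note inv = permutes_inverses[OF \<sigma>]
  have "evaluate k S (\<lambda>i. p (\<sigma> i)) y u = evaluate k S p (\<lambda>i. y (inv \<sigma> i)) u" if S: "finite S" and u: "u \<in> topspace (simplex_on S)" for S u
  proof -
    obtain T f \<phi> a b where P: "presents n k S p u T f \<phi> a b"
      using exists_presentation[of k p n S u] pt S u by (auto simp: progress_tuple_def)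
    note D = presentsD[OF P]
    define f' where "f' = compose T (inv \<sigma>) f"
    have fT: "f r \<in> {1..k}" if "r \<in> T" for r using D(1) that by (auto simp: admissible_def)
    have f_iff: "f' r = i \<longleftrightarrow> f r = \<sigma> i" if "r \<in> T" for r i
      using that inv by (auto simp: f'_def compose_def)
    have fib: "fibre T f' i = fibre T f (\<sigma> i)" for i using f_iff by (auto simp: fibre_def)
    have adm: "admissible n k T f'"
      unfolding admissible_iff
    proof (intro conjI ballI impI)
      show "f' \<in> T \<rightarrow>\<^sub>E {1..k}" using fT \<sigma>in by (auto simp: f'_def compose_def)
      fix i j assume ij: "i \<in> {1..k}" "j \<in> {1..k}" "i \<noteq> j"
      then have "\<sigma> i \<noteq> \<sigma> j" using inv by metis
      then have "alternates n T f (\<sigma> i) (\<sigma> j)" using D(1) \<sigma>in ij unfolding admissible_iff by blast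
      then show "alternates n T f' i j" unfolding alternates_def using f_iff by simp
    qed (rule D(3))
    have P': "presents n k S (\<lambda>i. p (\<sigma> i)) u T f' \<phi> a b"
      using P adm \<sigma>in unfolding presents_def fib by blast
    have inc: "increments T f' a b (\<lambda>i. p (\<sigma> i)) i = increments T f a b p (\<sigma> i)" for i
      unfolding increments_def fib by simp
    let ?x = "\<lambda>i\<in>{1..k}. y (inv \<sigma> i) (fibre T f i) (increments T f a b p i)"
    have x: "?x \<in> topspace (fibre_product X k T f)" by (rule args_in[OF P p]) (use y \<sigma>in in auto)
    have "BB k T f ?x = BB k T f' (\<lambda>i\<in>{1..k}. ?x (inv (inv \<sigma>) i))"
      unfolding f'_def by (rule BB_commutative[OF D(1) permutes_inv[OF \<sigma>] x])
    also have "(\<lambda>i\<in>{1..k}. ?x (inv (inv \<sigma>) i)) = (\<lambda>i\<in>{1..k}. y i (fibre T f' i) (increments T f' a b (\<lambda>i. p (\<sigma> i)) i))"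
      by (rule restrict_ext) (use \<sigma>in inv in \<open>simp add: permutes_inv_inv[OF \<sigma>] fib inc\<close>)
    finally have BB: "BB k T f ?x = BB k T f' (\<lambda>i\<in>{1..k}. y i (fibre T f' i) (increments T f' a b (\<lambda>i. p (\<sigma> i)) i))" .
    have "evaluate k S (\<lambda>i. p (\<sigma> i)) y u = present_val k S (\<lambda>i. p (\<sigma> i)) y T f' \<phi> a b"
      by (rule evaluate_eq[OF P' _ y S u]) (use p \<sigma>in in auto)
    also have "\<dots> = present_val k S p (\<lambda>i. y (inv \<sigma> i)) T f \<phi> a b" unfolding present_val_def BB ..
    also have "\<dots> = evaluate k S p (\<lambda>i. y (inv \<sigma> i)) u"
      by (rule evaluate_eq[OF P p _ S u, symmetric]) (use y \<sigma>in in auto)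
    finally show ?thesis .
  qed
  then show ?thesis unfolding act_def by (intro restrict_ext) auto
qed

end

text \<open>Elements outside \<open>U\<close> carry neither letter; they receive the number of the
  last block that has begun before them.\<close>

lemma alternates_extend:
  assumes U: "alternates m U f a b" and sub: "U \<subseteq> T" and T: "finite T"
    and all: "\<And>t. \<lbrakk>t \<in> T; f t = a \<or> f t = b\<rbrakk> \<Longrightarrow> t \<in> U"
  shows "alternates m T f a b"
proof -
  obtain \<beta> where \<beta>: "mono_on U \<beta>" "\<forall>t\<in>U. \<beta> t \<le> m" "\<forall>t\<in>U. \<forall>t'\<in>U. f t = a \<longrightarrow> f t' = b \<longrightarrow> \<beta> t \<noteq> \<beta> t'"
    using U unfolding alternates_def by blast
  have finU: "finite U" using T sub finite_subset by blast
  define \<gamma> where "\<gamma> t = Max (insert 0 (\<beta> ` {s \<in> U. s \<le> t}))" for t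
  have fin: "finite (insert 0 (\<beta> ` {s \<in> U. s \<le> t}))" for t using finU by simp
  have eq: "\<gamma> t = \<beta> t" if "t \<in> U" for t
    unfolding \<gamma>_def
  proof (rule Max_eqI[OF fin])
    show "\<beta> t \<in> insert 0 (\<beta> ` {s \<in> U. s \<le> t})" using that by auto
    fix v assume "v \<in> insert 0 (\<beta> ` {s \<in> U. s \<le> t})"
    then show "v \<le> \<beta> t" using \<beta>(1) that by (auto simp: mono_on_def)
  qed
  have "mono_on T \<gamma>"
    unfolding mono_on_def \<gamma>_def using fin by (intro allI impI Max_mono) auto
  moreover have "\<gamma> t \<le> m" for t
    unfolding \<gamma>_def using fin[of t] \<beta>(2) by auto
  moreover have "\<gamma> t \<noteq> \<gamma> t'" if "t \<in> T" "t' \<in> T" "f t = a" "f t' = b" for t t'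
    using \<beta>(3) all[OF that(1)] all[OF that(2)] that(3,4) eq by metis
  ultimately show ?thesis unfolding alternates_def by blast
qed

text \<open>All growth of \<open>p i\<close> takes place in the intervals labelled \<open>i\<close>,
  so its value at an endpoint is the sum of the earlier increments. Hence the slots of the inner
  simplex point are the images under \<open>p i\<close> of the outer intervals.\<close>

lemma increments_cumulative:
  assumes P: "presents n k S p u T f \<phi> a b" and p: "p i \<in> progress" and i: "i \<in> {1..k}" and r: "r \<in> fibre T f i"
  shows "sum (increments T f a b p i) {..<r} = p i (a r)" "sum (increments T f a b p i) {..r} = p i (b r)"
proof -
  note D = presentsD[OF P]
  let ?U = "fibre T f i" and ?F = "p i"
  have UT: "?U \<subseteq> T" by (auto simp: fibre_def)
  have rT: "r \<in> T" using r UT by blast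
  have fin: "finite ?U" by (rule finite_fibre[OF D(3)])
  have ab: "0 \<le> a s \<and> a s \<le> b s \<and> b s \<le> 1" if "s \<in> ?U" for s using D(4) UT that by blast
  have ord: "b s \<le> a s'" if "s \<in> ?U" "s' \<in> ?U" "s < s'" for s s' using D(7) UT that by blast
  have "(\<Sum>s\<in>?U. ?F (clip (a s) (b s) (a r)) - ?F (clip (a s) (b s) 0)) = ?F (a r) - ?F 0"
    by (rule increment_spread[OF fin p ab ord D(8)[OF i]]) (use ab[OF r] in auto)
  moreover have "?F (clip (a s) (b s) (a r)) - ?F (clip (a s) (b s) 0) = (if s < r then ?F (b s) - ?F (a s) else 0)" if s: "s \<in> ?U" for s
  proof -
    have 0: "clip (a s) (b s) 0 = a s" using ab[OF s] unfolding clip_def by linarith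
    consider "s < r" | "s = r" | "r < s" by linarith
    then show ?thesis
    proof cases
      case 1
      then have "clip (a s) (b s) (a r) = b s" using ord[OF s r 1] ab[OF s] unfolding clip_def by linarith
      then show ?thesis using 0 1 by simp
    next
      case 2
      then have "clip (a s) (b s) (a r) = a s" using ab[OF s] by (simp add: clip_def)
      then show ?thesis using 0 2 by simp
    next
      case 3
      then have "clip (a s) (b s) (a r) = a s" using ord[OF r s 3] ab[OF s] ab[OF r] unfolding clip_def by linarith
      then show ?thesis using 0 3 by simp
    qed
  qed
  ultimately have "(\<Sum>s\<in>?U. if s < r then ?F (b s) - ?F (a s) else 0) = ?F (a r)"
    using progressD(3)[OF p, of 0] by (simp cong: sum.cong)
  moreover have "(\<Sum>s\<in>?U. if s < r then ?F (b s) - ?F (a s) else 0) = sum (increments T f a b p i) {..<r}"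
  proof -
    have "sum (increments T f a b p i) {..<r} = (\<Sum>s\<in>{s \<in> ?U. s < r}. ?F (b s) - ?F (a s))"
      by (rule sum.mono_neutral_cong_right) (auto simp: increments_def)
    also have "\<dots> = (\<Sum>s\<in>?U. if s < r then ?F (b s) - ?F (a s) else 0)" using fin by (rule sum.inter_filter)
    finally show ?thesis by simp
  qed
  ultimately show 1: "sum (increments T f a b p i) {..<r} = p i (a r)" by simp
  have "{..r} = insert r {..<r}" by auto
  then have "sum (increments T f a b p i) {..r} = increments T f a b p i r + sum (increments T f a b p i) {..<r}" by simp
  then show "sum (increments T f a b p i) {..r} = p i (b r)" using 1 r by (simp add: increments_def)
qed

section \<open>Compatibility with operadic composition\<close>

context bracketed
begin

text \<open>An outer presentation produces a simplex point for each input \<open>i\<close>, and this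
  point has an inner presentation by \<open>q i\<close>. Its intervals lie in slots of that point,
  so they can be pulled back along \<open>p i\<close> into the outer intervals; all pieces together
  present the composite.\<close>

lemma evaluate_compose:
  assumes p: "progress_tuple n k p" and q: "\<And>i. i \<in> {1..k} \<Longrightarrow> progress_tuple n (j i) (q i)"
    and pq: "\<And>i l. \<lbrakk>i \<in> {1..k}; l \<in> {1..j i}\<rbrakk> \<Longrightarrow> P (block_index j i l) = q i l \<circ> p i"
    and y: "\<And>t. t \<in> {1..sum j {1..k}} \<Longrightarrow> y t \<in> topspace (Tot X)" and S: "finite S" and u: "u \<in> topspace (simplex_on S)"
  shows "evaluate (sum j {1..k}) S P y u =
    evaluate k S p (\<lambda>i. act (j i) (q i) (\<lambda>l. y (block_index j i l))) u"
proof -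
  let ?J = "sum j {1..k}"
  have pp: "p i \<in> progress" if "i \<in> {1..k}" for i using p that by (auto simp: progress_tuple_def)
  have qp: "q i l \<in> progress" if "i \<in> {1..k}" "l \<in> {1..j i}" for i l using q[OF that(1)] that(2) by (auto simp: progress_tuple_def)
  have yb: "y (block_index j i l) \<in> topspace (Tot X)" if "i \<in> {1..k}" "l \<in> {1..j i}" for i l
    by (rule y[OF block_index_bounds[of i k l j]]) (use that in auto)
  obtain T f \<phi> a b where Pp: "presents n k S p u T f \<phi> a b"
    using exists_presentation[of k p n S u] p S u by (auto simp: progress_tuple_def)
  note D = presentsD[OF Pp]
  have fT: "f r \<in> {1..k}" if "r \<in> T" for r using D(1) that by (auto simp: admissible_def)
  define w where "w i = increments T f a b p i" for i
  have wS: "w i \<in> topspace (simplex_on (fibre T f i))" if "i \<in> {1..k}" for i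
    unfolding w_def by (rule increments_in_simplex[OF Pp pp[OF that] that])
  have finf: "finite (fibre T f i)" for i by (rule finite_fibre[OF D(3)])
  have "\<exists>R g \<rho> \<alpha> \<beta>. presents n (j i) (fibre T f i) (q i) (w i) R g \<rho> \<alpha> \<beta>" if i: "i \<in> {1..k}" for i
    using exists_presentation[of "j i" "q i" n "fibre T f i" "w i"] q[OF i] finf wS[OF i] unfolding progress_tuple_def by blast
  then obtain R g \<rho> \<alpha> \<beta> where Pq: "\<And>i. i \<in> {1..k} \<Longrightarrow> presents n (j i) (fibre T f i) (q i) (w i) (R i) (g i) (\<rho> i) (\<alpha> i) (\<beta> i)"
    by metis
  note E = presentsD[OF Pq]
  have \<rho>in: "\<rho> i \<tau> \<in> fibre T f i" if "i \<in> {1..k}" "\<tau> \<in> R i" for i \<tau> using E(2)[OF that(1)] that(2) by (auto simp: ord_hom_def)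
  have \<rho>mono: "\<rho> i \<tau> \<le> \<rho> i \<tau>'" if "i \<in> {1..k}" "\<tau> \<in> R i" "\<tau>' \<in> R i" "\<tau> \<le> \<tau>'" for i \<tau> \<tau>'
    using E(2)[OF that(1)] that(2-4) by (auto simp: ord_hom_def mono_on_def)
  have bounds: "p i (a (\<rho> i \<tau>)) \<le> \<alpha> i \<tau>" "\<alpha> i \<tau> \<le> \<beta> i \<tau>" "\<beta> i \<tau> \<le> p i (b (\<rho> i \<tau>))" if i: "i \<in> {1..k}" and \<tau>: "\<tau> \<in> R i" for i \<tau>
    using E(4,5,6)[OF i \<tau>] increments_cumulative[OF Pp pp[OF i] i \<rho>in[OF i \<tau>]] unfolding w_def by auto
  \<comment> \<open>A right inverse of \<open>p (f r)\<close> with values in the outer interval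
    \<open>r\<close>. It is chosen for each interval separately, since a value may be attained at
    the end of one interval and again at the start of the next one with the same label.\<close>
  define G where "G r v = (SOME t. t \<in> {a r..b r} \<and> p (f r) t = v)" for r v
  have G: "G r v \<in> {a r..b r} \<and> p (f r) (G r v) = v" if r: "r \<in> T" and v: "p (f r) (a r) \<le> v" "v \<le> p (f r) (b r)" for r v
  proof -
    have "a r \<le> b r" using D(4)[OF r] by simp
    then have "\<exists>t. t \<in> {a r..b r} \<and> p (f r) t = v" using progress_IVT[OF pp[OF fT[OF r]] _ v] by blast
    then show ?thesis unfolding G_def by (rule someI_ex)
  qed
  have Gmono: "G r v \<le> G r v'" if r: "r \<in> T" and v: "p (f r) (a r) \<le> v" "v \<le> v'" "v' \<le> p (f r) (b r)" for r v v'
  proof (cases "v = v'")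
    case False
    have "p (f r) (G r v) = v" "p (f r) (G r v') = v'" using G[OF r, of v] G[OF r, of v'] v by auto
    then have "\<not> G r v' \<le> G r v" using progressD(5)[OF pp[OF fT[OF r]], of "G r v'" "G r v"] False v by auto
    then show ?thesis by simp
  qed simp
  define N where "N = Suc (Max (insert 0 (\<Union>i\<in>{1..k}. R i)))"
  have N0: "0 < N" by (simp add: N_def)
  have NR: "\<tau> < N" if "i \<in> {1..k}" "\<tau> \<in> R i" for i \<tau>
  proof -
    have "finite (\<Union>i\<in>{1..k}. R i)" using E(3) by auto
    then have "\<tau> \<le> Max (insert 0 (\<Union>i\<in>{1..k}. R i))" using that by (intro Max_ge) auto
    then show ?thesis by (simp add: N_def)
  qed
  have code: "(r * N + \<tau>) div N = r" "(r * N + \<tau>) mod N = \<tau>" if "i \<in> {1..k}" "\<tau> \<in> R i" for i r \<tau> using NR[OF that] N0 by auto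
  have decode: "m = (m div N) * N + m mod N" for m by simp
  \<comment> \<open>Codes the pairs of an outer interval and an inner interval that \<rho> assigns
    to it, ordered first by the outer one.\<close>
  define T' where "T' = {m. m div N \<in> T \<and> m mod N \<in> R (f (m div N)) \<and> \<rho> (f (m div N)) (m mod N) = m div N}"
  define \<pi> where "\<pi> = (\<lambda>m\<in>T'. m div N)"
  define F where "F = compose T' f \<pi>"
  have T'D: "m div N \<in> T" "m mod N \<in> R (f (m div N))" "\<rho> (f (m div N)) (m mod N) = m div N" "F m = f (m div N)" "F m \<in> {1..k}" if "m \<in> T'" for m
    using that fT by (auto simp: T'_def F_def \<pi>_def compose_def)
  have T'I: "\<rho> i \<tau> * N + \<tau> \<in> T'" "F (\<rho> i \<tau> * N + \<tau>) = i" if i: "i \<in> {1..k}" and \<tau>: "\<tau> \<in> R i" for i \<tau>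
  proof -
    have "f (\<rho> i \<tau>) = i" "\<rho> i \<tau> \<in> T" using \<rho>in[OF i \<tau>] by (auto simp: fibre_def)
    then show T': "\<rho> i \<tau> * N + \<tau> \<in> T'" using code[OF i \<tau>] \<tau> by (simp add: T'_def)
    show "F (\<rho> i \<tau> * N + \<tau>) = i" using T'D(4)[OF T'] code[OF i \<tau>] \<open>f (\<rho> i \<tau>) = i\<close> by simp
  qed
  have finT': "finite T'"
  proof (rule finite_subset)
    show "T' \<subseteq> (\<lambda>(r, \<tau>). r * N + \<tau>) ` (T \<times> (\<Union>i\<in>{1..k}. R i))"
    proof
      fix m assume m: "m \<in> T'"
      then have "(m div N, m mod N) \<in> T \<times> (\<Union>i\<in>{1..k}. R i)" using T'D[OF m] by auto
      moreover have "m = (\<lambda>(r, \<tau>). r * N + \<tau>) (m div N, m mod N)" by simp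
      ultimately show "m \<in> (\<lambda>(r, \<tau>). r * N + \<tau>) ` (T \<times> (\<Union>i\<in>{1..k}. R i))" by blast
    qed
    show "finite ((\<lambda>(r, \<tau>). r * N + \<tau>) ` (T \<times> (\<Union>i\<in>{1..k}. R i)))" using D(3) E(3) by auto
  qed
  have \<pi>: "\<pi> \<in> ord_hom T' T" unfolding \<pi>_def ord_hom_def using T'D(1) by (auto simp: mono_on_def intro: div_le_mono)
  have admF: "admissible n k T' F" unfolding F_def by (rule admissible_pullback[OF D(1) finT' \<pi>])
  \<comment> \<open>Returns a piece to its inner interval. On the fibre over \<open>i\<close>, the
    projection \<pi> to outer intervals factors as \<rho> after \<iota>, which later splits the
    cosimplicial map.\<close>
  define \<iota> where "\<iota> i = (\<lambda>m\<in>fibre T' F i. m mod N)" for i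
  define h where "h i = compose (fibre T' F i) (g i) (\<iota> i)" for i
  have fibD: "m \<in> T'" "f (m div N) = i" "m mod N \<in> R i" "\<rho> i (m mod N) = m div N" if "m \<in> fibre T' F i" for m i
    using that T'D[of m] by (auto simp: fibre_def)
  have \<iota>: "\<iota> i \<in> ord_hom (fibre T' F i) (R i)" if i: "i \<in> {1..k}" for i
  proof -
    have "m mod N \<le> m' mod N" if m: "m \<in> fibre T' F i" "m' \<in> fibre T' F i" "m \<le> m'" for m m'
    proof (rule ccontr)
      assume c: "\<not> m mod N \<le> m' mod N"
      then have "\<rho> i (m' mod N) \<le> \<rho> i (m mod N)" using fibD(3)[OF m(1)] fibD(3)[OF m(2)] by (intro \<rho>mono[OF i]) auto
      then have "m' div N \<le> m div N" using fibD(4)[OF m(1)] fibD(4)[OF m(2)] by simp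
      then have "m' div N = m div N" using div_le_mono[OF m(3), of N] by simp
      then show False using c m(3) decode[of m] decode[of m'] by (metis add_le_cancel_left)
    qed
    then show ?thesis using fibD(3) by (auto simp: \<iota>_def ord_hom_def mono_on_def)
  qed
  have hm: "h i m = g i (m mod N)" if "m \<in> fibre T' F i" for i m using that by (simp add: h_def \<iota>_def compose_def)
  have admh: "admissible n (j i) (fibre T' F i) (h i)" if i: "i \<in> {1..k}" for i
    unfolding h_def by (rule admissible_pullback[OF E(1)[OF i] finite_fibre[OF finT'] \<iota>[OF i]])
  have gR: "g i \<tau> \<in> {1..j i}" if "i \<in> {1..k}" "\<tau> \<in> R i" for i \<tau> using E(1)[OF that(1)] that(2) unfolding admissible_def by (meson PiE_mem)
  define gg where "gg = (\<lambda>m\<in>T'. block_index j (F m) (h (F m) m))"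
  have ggm: "gg m = block_index j (F m) (g (F m) (m mod N))" "g (F m) (m mod N) \<in> {1..j (F m)}" if m: "m \<in> T'" for m
  proof -
    have "m \<in> fibre T' F (F m)" using m by (simp add: fibre_def)
    then show "gg m = block_index j (F m) (g (F m) (m mod N))" using m hm by (simp add: gg_def)
    show "g (F m) (m mod N) \<in> {1..j (F m)}" by (rule gR) (use T'D[OF m] in auto)
  qed
  have gg_iff: "gg m = block_index j i l \<longleftrightarrow> F m = i \<and> g i (m mod N) = l" if m: "m \<in> T'" and il: "i \<in> {1..k}" "l \<in> {1..j i}" for m i l
    using block_index_inject[of "F m" k "g (F m) (m mod N)" j i l] ggm[OF m] T'D(5)[OF m] il by auto
  have fib_gg: "fibre T' gg (block_index j i l) = fibre (fibre T' F i) (h i) l" if il: "i \<in> {1..k}" "l \<in> {1..j i}" for i l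
    using gg_iff[OF _ il] hm by (auto simp: fibre_def)
  \<comment> \<open>Labels from different blocks alternate as their blocks do in the outer sequence.
    Labels from one block alternate as in the inner sequence, by
    \<open>alternates_extend\<close>.\<close>
  have admgg: "admissible n ?J T' gg"
    unfolding admissible_iff
  proof (intro conjI ballI impI finT')
    show "gg \<in> T' \<rightarrow>\<^sub>E {1..?J}"
      using ggm T'D(5) block_index_bounds[of _ k _ j] by (auto simp: gg_def)
    fix t t' assume t: "t \<in> {1..?J}" and t': "t' \<in> {1..?J}" and ne: "t \<noteq> t'"
    obtain i l where il: "i \<in> {1..k}" "l \<in> {1..j i}" "t = block_index j i l" using block_cases[OF t] .
    obtain i' l' where il': "i' \<in> {1..k}" "l' \<in> {1..j i'}" "t' = block_index j i' l'" using block_cases[OF t'] .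
    show "alternates n T' gg t t'"
    proof (cases "i = i'")
      case False
      then have "alternates n T' F i i'" using admF il(1) il'(1) unfolding admissible_iff by blast
      then show ?thesis unfolding alternates_def il(3) il'(3) using gg_iff[OF _ il(1,2)] gg_iff[OF _ il'(1,2)] by metis
    next
      case True
      then have "l \<noteq> l'" using ne il il' by auto
      then have "alternates n (fibre T' F i) (h i) l l'" using admh[OF il(1)] il il' True unfolding admissible_iff by blast
      moreover have "gg m = t \<longleftrightarrow> h i m = l" "gg m = t' \<longleftrightarrow> h i m = l'" if "m \<in> fibre T' F i" for m
        using gg_iff[OF _ il(1,2), of m] gg_iff[OF _ il'(1,2), of m] that hm[OF that] True il(3) il'(3) by (auto simp: fibre_def)
      ultimately have "alternates n (fibre T' F i) gg t t'" unfolding alternates_def by metis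
      then show ?thesis
      proof (rule alternates_extend[OF _ _ finT'])
        show "fibre T' F i \<subseteq> T'" by (auto simp: fibre_def)
        show "m \<in> fibre T' F i" if "m \<in> T'" "gg m = t \<or> gg m = t'" for m
          using that gg_iff[OF that(1) il(1,2)] gg_iff[OF that(1) il'(1,2)] il il' True by (auto simp: fibre_def)
      qed
    qed
  qed
  define a' b' where "a' m = G (m div N) (\<alpha> (f (m div N)) (m mod N))" and "b' m = G (m div N) (\<beta> (f (m div N)) (m mod N))" for m
  have vb: "p (f (m div N)) (a (m div N)) \<le> \<alpha> (f (m div N)) (m mod N)" "\<alpha> (f (m div N)) (m mod N) \<le> \<beta> (f (m div N)) (m mod N)"
      "\<beta> (f (m div N)) (m mod N) \<le> p (f (m div N)) (b (m div N))" if m: "m \<in> T'" for m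
    using bounds[of "f (m div N)" "m mod N"] T'D[OF m] by auto
  have a'm: "a' m \<in> {a (m div N)..b (m div N)}" "p (f (m div N)) (a' m) = \<alpha> (f (m div N)) (m mod N)"
    and b'm: "b' m \<in> {a (m div N)..b (m div N)}" "p (f (m div N)) (b' m) = \<beta> (f (m div N)) (m mod N)"
    and ab'm: "a' m \<le> b' m" if m: "m \<in> T'" for m
    using G[OF T'D(1)[OF m], of "\<alpha> (f (m div N)) (m mod N)"] G[OF T'D(1)[OF m], of "\<beta> (f (m div N)) (m mod N)"]
      Gmono[OF T'D(1)[OF m]] vb[OF m] unfolding a'_def b'_def by (auto intro: order_trans)
  have Pinc: "P (block_index j i l) (b' m) - P (block_index j i l) (a' m) = q i l (\<beta> i (m mod N)) - q i l (\<alpha> i (m mod N))"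
    if il: "i \<in> {1..k}" "l \<in> {1..j i}" and m: "m \<in> fibre T' F i" for i l m
    using a'm(2)[OF fibD(1)[OF m]] b'm(2)[OF fibD(1)[OF m]] fibD(2)[OF m] pq[OF il] by simp
  have reindex: "(\<Sum>m\<in>fibre (fibre T' F i) (h i) l. H (m mod N)) = (\<Sum>\<tau>\<in>fibre (R i) (g i) l. H \<tau>)" if i: "i \<in> {1..k}" for i l and H :: "nat \<Rightarrow> real"
  proof (rule sum.reindex_bij_witness[of _ "\<lambda>\<tau>. \<rho> i \<tau> * N + \<tau>" "\<lambda>m. m mod N"])
    fix m assume m: "m \<in> fibre (fibre T' F i) (h i) l"
    then have m': "m \<in> fibre T' F i" "h i m = l" by (auto simp: fibre_def)
    show "\<rho> i (m mod N) * N + m mod N = m" using fibD(4)[OF m'(1)] decode[of m] by simp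
    show "m mod N \<in> fibre (R i) (g i) l" using fibD(3)[OF m'(1)] hm[OF m'(1)] m'(2) by (simp add: fibre_def)
  next
    fix \<tau> assume "\<tau> \<in> fibre (R i) (g i) l"
    then have \<tau>: "\<tau> \<in> R i" "g i \<tau> = l" by (auto simp: fibre_def)
    have m: "\<rho> i \<tau> * N + \<tau> \<in> fibre T' F i" using T'I[OF i \<tau>(1)] by (simp add: fibre_def)
    show "(\<rho> i \<tau> * N + \<tau>) mod N = \<tau>" by (rule code(2)[OF i \<tau>(1)])
    show "\<rho> i \<tau> * N + \<tau> \<in> fibre (fibre T' F i) (h i) l" using m hm[OF m] code(2)[OF i \<tau>(1)] \<tau>(2) by (simp add: fibre_def)
  qed simp
  have PP: "presents n ?J S P u T' gg (compose T' \<phi> \<pi>) a' b'"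
    unfolding presents_def
  proof (intro conjI ballI impI admgg ord_hom_compose[OF \<pi> D(2)])
    fix m assume m: "m \<in> T'"
    note r = T'D(1)[OF m]
    have \<phi>m: "compose T' \<phi> \<pi> m = \<phi> (m div N)" using m by (simp add: compose_def \<pi>_def)
    show "0 \<le> a' m" "b' m \<le> 1" using a'm(1)[OF m] b'm(1)[OF m] D(4)[OF r] by auto
    show "a' m \<le> b' m" by (rule ab'm[OF m])
    show "sum u {..<compose T' \<phi> \<pi> m} \<le> a' m" unfolding \<phi>m using D(5)[OF r] a'm(1)[OF m] by auto
    show "b' m \<le> sum u {..compose T' \<phi> \<pi> m}" unfolding \<phi>m using D(6)[OF r] b'm(1)[OF m] by auto
    fix m2 assume m2: "m2 \<in> T'" and less: "m < m2"
    note r2 = T'D(1)[OF m2]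
    show "b' m \<le> a' m2"
    proof (cases "m div N = m2 div N")
      case True
      then have "m mod N < m2 mod N" using less decode[of m] decode[of m2] by (metis nat_add_left_cancel_less)
      then have "\<beta> (f (m div N)) (m mod N) \<le> \<alpha> (f (m div N)) (m2 mod N)"
        using E(7)[OF fT[OF r]] T'D(2)[OF m] T'D(2)[OF m2] True by auto
      moreover have "p (f (m div N)) (a (m div N)) \<le> \<beta> (f (m div N)) (m mod N)" using vb[OF m] by linarith
      moreover have "\<alpha> (f (m div N)) (m2 mod N) \<le> p (f (m div N)) (b (m div N))" using vb[OF m2] unfolding True[symmetric] by linarith
      ultimately show ?thesis unfolding a'_def b'_def True[symmetric] by (intro Gmono[OF r])
    next
      case False
      then have "m div N < m2 div N" using div_le_mono[of m m2 N] less by simp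
      then have "b (m div N) \<le> a (m2 div N)" by (rule D(7)[OF r r2])
      then show ?thesis using b'm(1)[OF m] a'm(1)[OF m2] by auto
    qed
  next
    fix t assume "t \<in> {1..?J}"
    then obtain i l where il: "i \<in> {1..k}" "l \<in> {1..j i}" "t = block_index j i l" by (rule block_cases)
    have "(\<Sum>m\<in>fibre T' gg t. P t (b' m) - P t (a' m)) =
        (\<Sum>m\<in>fibre (fibre T' F i) (h i) l. q i l (\<beta> i (m mod N)) - q i l (\<alpha> i (m mod N)))"
      unfolding il(3) fib_gg[OF il(1,2)] by (rule sum.cong[OF refl]) (rule Pinc[OF il(1,2)], auto simp: fibre_def)
    also have "\<dots> = 1" unfolding reindex[OF il(1), of "\<lambda>\<tau>. q i l (\<beta> i \<tau>) - q i l (\<alpha> i \<tau>)" l] by (rule E(8)[OF il(1,2)])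
    finally show "(\<Sum>m\<in>fibre T' gg t. P t (b' m) - P t (a' m)) = 1" .
  qed
  have Pprog: "P t \<in> progress" if t: "t \<in> {1..?J}" for t
  proof -
    obtain i l where il: "i \<in> {1..k}" "l \<in> {1..j i}" "t = block_index j i l" using block_cases[OF t] .
    then show ?thesis using pq[OF il(1,2)] progress_compose[OF pp[OF il(1)] qp[OF il(1,2)]] by simp
  qed
  let ?x = "\<lambda>t\<in>{1..?J}. y t (fibre T' gg t) (increments T' gg a' b' P t)"
  have xin: "?x \<in> topspace (fibre_product X ?J T' gg)" by (rule args_in[OF PP Pprog y])
  let ?xi = "\<lambda>i. \<lambda>l\<in>{1..j i}. ?x (block_index j i l)"
  let ?X = "\<lambda>i. BB (j i) (fibre T' F i) (h i) (?xi i)"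
  have xi_in: "?xi i \<in> topspace (fibre_product X (j i) (fibre T' F i) (h i))" if i: "i \<in> {1..k}" for i
  proof -
    have "?x (block_index j i l) \<in> topspace (cos_space X (fibre (fibre T' F i) (h i) l))" if l: "l \<in> {1..j i}" for l
    proof -
      have "?x \<in> (\<Pi>\<^sub>E t\<in>{1..?J}. topspace (cos_space X (fibre T' gg t)))"
        using xin unfolding fibre_product_def topspace_product_topology by (simp only: o_def)
      from PiE_mem[OF this block_index_bounds[of i k l j, OF i l]] show ?thesis unfolding fib_gg[OF i l] .
    qed
    then show ?thesis by (simp add: fibre_product_def)
  qed
  have Xin: "(\<lambda>i\<in>{1..k}. ?X i) \<in> topspace (fibre_product X k T' F)"
    unfolding fibre_product_def using BB_in[OF admh xi_in] by auto
  \<comment> \<open>Associativity splits the bracket of the composite. Consistency along \<pi> then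
    moves the outer bracket to the outer intervals, and consistency along \<iota> each inner bracket
    to the inner ones.\<close>
  have one: "BB ?J T' gg ?x = BB k T' F (\<lambda>i\<in>{1..k}. ?X i)"
    by (rule BB_assoc[OF admF admh gg_def xin, symmetric])
  have two: "cos_map X T' T \<pi> (BB k T' F (\<lambda>i\<in>{1..k}. ?X i)) = BB k T f (\<lambda>i\<in>{1..k}.
      cos_map X (fibre T' F i) (fibre T f i) (restrict \<pi> (fibre T' F i)) ((\<lambda>i\<in>{1..k}. ?X i) i))"
    by (rule BB_consistent[OF \<pi> admF D(1) F_def[symmetric] Xin])
  have three: "cos_map X (fibre T' F i) (fibre T f i) (restrict \<pi> (fibre T' F i)) (?X i) =
      act (j i) (q i) (\<lambda>l. y (block_index j i l)) (fibre T f i) (w i)" if i: "i \<in> {1..k}" for i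
  proof -
    note e = presentsD[OF Pq[OF i]]
    let ?Fi = "fibre T' F i"
    have finFi: "finite ?Fi" by (rule finite_fibre[OF finT'])
    have "restrict \<pi> ?Fi = compose ?Fi (\<rho> i) (\<iota> i)"
    proof (rule restrict_ext[of ?Fi \<pi> "\<lambda>m. \<rho> i (\<iota> i m)", folded compose_def])
      fix m assume m: "m \<in> ?Fi"
      show "\<pi> m = \<rho> i (\<iota> i m)" using fibD[OF m] m by (simp add: \<pi>_def \<iota>_def)
    qed
    then have "cos_map X ?Fi (fibre T f i) (restrict \<pi> ?Fi) (?X i) =
        cos_map X (R i) (fibre T f i) (\<rho> i) (cos_map X ?Fi (R i) (\<iota> i) (?X i))"
      using cos_map_comp[OF finFi e(3) finf \<iota>[OF i] e(2) BB_in[OF admh[OF i] xi_in[OF i]]] by simp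
    also have "cos_map X ?Fi (R i) (\<iota> i) (?X i) = BB (j i) (R i) (g i) (\<lambda>l\<in>{1..j i}.
        cos_map X (fibre ?Fi (h i) l) (fibre (R i) (g i) l) (restrict (\<iota> i) (fibre ?Fi (h i) l)) (?xi i l))"
      by (rule BB_consistent[OF \<iota>[OF i] admh[OF i] e(1) h_def[symmetric] xi_in[OF i]])
    also have "(\<lambda>l\<in>{1..j i}. cos_map X (fibre ?Fi (h i) l) (fibre (R i) (g i) l) (restrict (\<iota> i) (fibre ?Fi (h i) l)) (?xi i l)) =
        (\<lambda>l\<in>{1..j i}. y (block_index j i l) (fibre (R i) (g i) l) (increments (R i) (g i) (\<alpha> i) (\<beta> i) (q i) l))"
    proof (rule restrict_ext)
      fix l assume l: "l \<in> {1..j i}"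
      let ?t = "block_index j i l" and ?A = "fibre ?Fi (h i) l"
      have t: "?t \<in> {1..?J}" using i l by (rule block_index_bounds)
      have xt: "?xi i l = y ?t ?A (increments T' gg a' b' P ?t)" using l t by (simp add: fib_gg[OF i l])
      have inS: "increments T' gg a' b' P ?t \<in> topspace (simplex_on ?A)"
        using increments_in_simplex[OF PP Pprog[OF t] t] unfolding fib_gg[OF i l] .
      have hom: "restrict (\<iota> i) ?A \<in> ord_hom ?A (fibre (R i) (g i) l)"
        by (rule ord_hom_fibre[OF \<iota>[OF i]]) (simp add: h_def)
      have push: "simplex_push ?A (restrict (\<iota> i) ?A) (increments T' gg a' b' P ?t) = increments (R i) (g i) (\<alpha> i) (\<beta> i) (q i) l"
      proof
        fix \<tau>
        let ?M = "{m \<in> ?A. restrict (\<iota> i) ?A m = \<tau>}"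
        have AF: "m \<in> ?Fi" if "m \<in> ?A" for m using that by (auto simp: fibre_def)
        have \<iota>A: "restrict (\<iota> i) ?A m = m mod N" if "m \<in> ?A" for m using that AF[OF that] by (simp add: \<iota>_def)
        show "simplex_push ?A (restrict (\<iota> i) ?A) (increments T' gg a' b' P ?t) \<tau> = increments (R i) (g i) (\<alpha> i) (\<beta> i) (q i) l \<tau>"
        proof (cases "\<tau> \<in> fibre (R i) (g i) l")
          case False
          have "restrict (\<iota> i) ?A m \<in> fibre (R i) (g i) l" if "m \<in> ?A" for m
            using hom that unfolding ord_hom_def by (auto dest: PiE_mem)
          then have "?M = {}" using False by blast
          then show ?thesis using False unfolding simplex_push_def by (simp only: sum.empty) (simp add: increments_def)
        next
          case True
          then have \<tau>: "\<tau> \<in> R i" "g i \<tau> = l" by (auto simp: fibre_def)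
          let ?m = "\<rho> i \<tau> * N + \<tau>"
          have mF: "?m \<in> ?Fi" using T'I[OF i \<tau>(1)] by (simp add: fibre_def)
          have mA: "?m \<in> ?A" using mF hm[OF mF] code(2)[OF i \<tau>(1)] \<tau>(2) by (simp add: fibre_def)
          have "?M = {?m}"
          proof (intro equalityI subsetI)
            fix m assume "m \<in> ?M"
            then have m: "m \<in> ?A" "m mod N = \<tau>" using \<iota>A by auto
            then have "m = ?m" using fibD(4)[OF AF[OF m(1)]] decode[of m] by simp
            then show "m \<in> {?m}" by simp
          qed (use mA \<iota>A[OF mA] code(2)[OF i \<tau>(1)] in simp)
          then have "simplex_push ?A (restrict (\<iota> i) ?A) (increments T' gg a' b' P ?t) \<tau> = increments T' gg a' b' P ?t ?m"
            unfolding simplex_push_def by simp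
          also have "\<dots> = P ?t (b' ?m) - P ?t (a' ?m)" using mA unfolding increments_def fib_gg[OF i l] by simp
          also have "\<dots> = q i l (\<beta> i \<tau>) - q i l (\<alpha> i \<tau>)" using Pinc[OF i l mF] code(2)[OF i \<tau>(1)] by simp
          finally show ?thesis using True by (simp add: increments_def)
        qed
      qed
      show "cos_map X ?A (fibre (R i) (g i) l) (restrict (\<iota> i) ?A) (?xi i l) =
          y ?t (fibre (R i) (g i) l) (increments (R i) (g i) (\<alpha> i) (\<beta> i) (q i) l)"
        unfolding xt using TotD(4)[OF y[OF t] finite_fibre[OF finFi] finite_fibre[OF e(3)] hom inS] unfolding push by simp
    qed
    also have "cos_map X (R i) (fibre T f i) (\<rho> i) (BB (j i) (R i) (g i)
        (\<lambda>l\<in>{1..j i}. y (block_index j i l) (fibre (R i) (g i) l) (increments (R i) (g i) (\<alpha> i) (\<beta> i) (q i) l))) =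
        evaluate (j i) (fibre T f i) (q i) (\<lambda>l. y (block_index j i l)) (w i)"
      using evaluate_eq[OF Pq[OF i] qp[OF i] yb[OF i] finf wS[OF i]] unfolding present_val_def by simp
    also have "\<dots> = act (j i) (q i) (\<lambda>l. y (block_index j i l)) (fibre T f i) (w i)"
      using finf[of i] wS[OF i] by (simp add: act_def)
    finally show ?thesis .
  qed
  have actT: "act (j i) (q i) (\<lambda>l. y (block_index j i l)) \<in> topspace (Tot X)" if "i \<in> {1..k}" for i
    by (rule act_in[OF q[OF that] yb[OF that]])
  have "evaluate ?J S P y u = present_val ?J S P y T' gg (compose T' \<phi> \<pi>) a' b'"
    by (rule evaluate_eq[OF PP Pprog y S u])
  also have "\<dots> = cos_map X T S \<phi> (cos_map X T' T \<pi> (BB ?J T' gg ?x))"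
    unfolding present_val_def by (rule cos_map_comp[OF finT' D(3) S \<pi> D(2) BB_in[OF admgg xin]])
  also have "cos_map X T' T \<pi> (BB ?J T' gg ?x) = BB k T f (\<lambda>i\<in>{1..k}. act (j i) (q i) (\<lambda>l. y (block_index j i l)) (fibre T f i) (w i))"
    unfolding one two by (rule arg_cong[where f = "BB k T f"], rule restrict_ext) (simp only: restrict_apply' three)
  also have "cos_map X T S \<phi> \<dots> = present_val k S p (\<lambda>i. act (j i) (q i) (\<lambda>l. y (block_index j i l))) T f \<phi> a b"
    unfolding present_val_def w_def ..
  also have "\<dots> = evaluate k S p (\<lambda>i. act (j i) (q i) (\<lambda>l. y (block_index j i l))) u"
    by (rule evaluate_eq[OF Pp pp actT S u, symmetric])
  finally show ?thesis .
qed

lemma act_compose: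
  assumes "progress_tuple n k p" "\<And>i. i \<in> {1..k} \<Longrightarrow> progress_tuple n (j i) (q i)"
    and "\<And>i l. \<lbrakk>i \<in> {1..k}; l \<in> {1..j i}\<rbrakk> \<Longrightarrow> P (block_index j i l) = q i l \<circ> p i"
    and "\<And>t. t \<in> {1..sum j {1..k}} \<Longrightarrow> y t \<in> topspace (Tot X)"
  shows "act (sum j {1..k}) P y = act k p (\<lambda>i. act (j i) (q i) (\<lambda>l. y (block_index j i l)))"
  unfolding act_def[of "sum j {1..k}"] act_def[of k]
  by (intro restrict_ext) (use evaluate_compose[OF assms] in auto)

definition operad_act :: "nat \<Rightarrow> cube_tuple \<Rightarrow> (nat \<Rightarrow> nat set \<Rightarrow> (nat \<Rightarrow> real) \<Rightarrow> 'a) \<Rightarrow> nat set \<Rightarrow> (nat \<Rightarrow> real) \<Rightarrow> 'a" where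
  "operad_act k c y = act k (\<lambda>i. snd (cp_decode n (c i))) y"

lemma operad_action_Tot:
  assumes n: "n \<ge> 1"
  shows "operad_action (cube_progress_operad n) (Tot X) operad_act"
proof -
  interpret P: operadic_monoid "cpe_space n" "cpe_mul n" "cp_encode n (cp_unit n)" "cpe_compat n"
    rewrites "tuple_operad (cpe_space n) (cpe_mul n) (cp_encode n (cp_unit n)) (cpe_compat n) = cube_progress_operad n"
    by (rule operadic_monoid_cpe(1)[OF n]) (rule cube_progress_operad_def[symmetric])
  interpret M: operadic_monoid "cp_space n" "cp_mul n" "cp_unit n" "cp_compat n" by (rule operadic_monoid_cp[OF n])
  let ?O = "cube_progress_operad n"
  have dec_in: "cp_decode n x \<in> topspace (cp_space n)" if "x \<in> topspace (cpe_space n)" for x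
    using operadic_monoid_cpe(2)[OF n] that by (auto simp: continuous_map_def)
  have prog: "snd (cp_decode n x) \<in> progress" if "x \<in> topspace (cpe_space n)" for x
    using dec_in[OF that] by (simp add: topspace_cp_space)
  have tuple: "progress_tuple n k (\<lambda>i. snd (cp_decode n (c i)))" if c: "c \<in> topspace (opd_space ?O k)" for k c
    unfolding progress_tuple_def
  proof (intro conjI ballI impI)
    show pr: "snd (cp_decode n (c i)) \<in> progress" if "i \<in> {1..k}" for i by (rule prog[OF P.space_at[OF c that]])
    fix i i' assume i: "i \<in> {1..k}" and i': "i' \<in> {1..k}" and ne: "i \<noteq> i'"
    have "cpe_compat n (c i) (c i')" using c i i' ne unfolding P.in_space by blast
    then obtain m where "m \<in> {1..n}" "cell m (snd (cp_decode n (c i))) (snd (cp_decode n (c i'))) \<or> cell m (snd (cp_decode n (c i'))) (snd (cp_decode n (c i)))"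
      unfolding cpe_compat_def cp_compat_def by blast
    then show "cell n (snd (cp_decode n (c i))) (snd (cp_decode n (c i'))) \<or> cell n (snd (cp_decode n (c i'))) (snd (cp_decode n (c i)))"
      using cell_mono(1)[OF _ pr[OF i] pr[OF i'], of m n] cell_mono(1)[OF _ pr[OF i'] pr[OF i], of m n] by auto
  qed
  have mul: "snd (cp_decode n (cpe_mul n x x')) = snd (cp_decode n x') \<circ> snd (cp_decode n x)"
    if "x \<in> topspace (cpe_space n)" "x' \<in> topspace (cpe_space n)" for x x'
    unfolding cpe_mul_def cp_decode_encode[OF M.mul_in[OF dec_in[OF that(1)] dec_in[OF that(2)]]] by (simp add: cp_mul_def)
  have cont: "continuous_map (prod_topology (opd_space ?O k) (product_topology (\<lambda>_. Tot X) {1..k})) (Tot X) (\<lambda>(c, y). operad_act k c y)" for k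
    unfolding operad_act_def case_prod_unfold
  proof (rule act_continuous)
    let ?Z = "prod_topology (opd_space ?O k) (product_topology (\<lambda>_. Tot X) {1..k})"
    show "continuous_map ?Z progress_space (\<lambda>z. snd (cp_decode n (fst z i)))" if i: "i \<in> {1..k}" for i
      using continuous_map_o[OF P.continuous_map_space_at[OF continuous_map_fst i] operadic_monoid_cpe(2)[OF n]]
      unfolding cp_space_def by (rule continuous_map_snd_comp)
    show "continuous_map ?Z (Tot X) (\<lambda>z. snd z i)" if "i \<in> {1..k}" for i
      by (rule continuous_map_o[OF continuous_map_snd continuous_map_product_projection[OF that]])
    show "progress_tuple n k (\<lambda>i. snd (cp_decode n (fst z i)))" if "z \<in> topspace ?Z" for z
      using that by (intro tuple) auto
  qed
  have comp: "operad_act (sum j {1..k}) (opd_comp ?O k j c d) y =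
          operad_act k c (\<lambda>i\<in>{1..k}. operad_act (j i) (d i) (\<lambda>l\<in>{1..j i}. y (block_index j i l)))"
    if c: "c \<in> topspace (opd_space ?O k)" and d: "d \<in> topspace (opd_inputs ?O k j)"
      and y: "y \<in> topspace (product_topology (\<lambda>_. Tot X) {1..sum j {1..k}})" for k j c d y
  proof -
    have di: "d i \<in> topspace (opd_space ?O (j i))" if "i \<in> {1..k}" for i using d that unfolding P.in_inputs by blast
    have yt: "y t \<in> topspace (Tot X)" if "t \<in> {1..sum j {1..k}}" for t using y that by auto
    have "operad_act (sum j {1..k}) (opd_comp ?O k j c d) y =
        act k (\<lambda>i. snd (cp_decode n (c i))) (\<lambda>i. act (j i) (\<lambda>l. snd (cp_decode n (d i l))) (\<lambda>l. y (block_index j i l)))"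
      unfolding operad_act_def
    proof (rule act_compose[OF tuple[OF c] tuple[OF di] _ yt])
      fix i l assume il: "i \<in> {1..k}" "l \<in> {1..j i}"
      show "snd (cp_decode n (opd_comp ?O k j c d (block_index j i l))) = snd (cp_decode n (d i l)) \<circ> snd (cp_decode n (c i))"
        unfolding P.comp_at[of i k l j c d, OF il] by (rule mul[OF P.space_at[OF c il(1)] P.space_at[OF di[OF il(1)] il(2)]])
    qed
    also have "\<dots> = operad_act k c (\<lambda>i\<in>{1..k}. operad_act (j i) (d i) (\<lambda>l\<in>{1..j i}. y (block_index j i l)))"
      unfolding operad_act_def by (rule act_cong) (auto intro: act_cong)
    finally show ?thesis .
  qed
  have unit: "operad_act 1 (opd_unit ?O) (\<lambda>i\<in>{1}. y) = y" if y: "y \<in> topspace (Tot X)" for y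
  proof -
    have "cp_decode n (cp_encode n (cp_unit n)) = cp_unit n" by (rule cp_decode_encode[OF M.e_in])
    then have 1: "snd (cp_decode n (opd_unit ?O i)) = clamp01" if "i \<in> {1..1}" for i
      using that by (simp add: cube_progress_operad_def tuple_operad_def cp_unit_def)
    have "operad_act 1 (opd_unit ?O) (\<lambda>i\<in>{1}. y) = act 1 (\<lambda>_. clamp01) (\<lambda>i\<in>{1}. y)"
      unfolding operad_act_def by (rule act_cong) (use 1 in auto)
    also have "\<dots> = (\<lambda>i\<in>{1::nat}. y) 1" by (rule act_unit) (use y in simp)
    finally show ?thesis by simp
  qed
  have perm: "operad_act k (opd_act ?O k c \<sigma>) y = operad_act k c (\<lambda>i\<in>{1..k}. y (inv \<sigma> i))"
    if \<sigma>: "\<sigma> permutes {1..k}" and c: "c \<in> topspace (opd_space ?O k)" and y: "y \<in> topspace (product_topology (\<lambda>_. Tot X) {1..k})" for k \<sigma> c y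
  proof -
    have yi: "y i \<in> topspace (Tot X)" if "i \<in> {1..k}" for i using y that by auto
    have "operad_act k (opd_act ?O k c \<sigma>) y = act k (\<lambda>i. snd (cp_decode n (c (\<sigma> i)))) y"
      unfolding operad_act_def by (rule act_cong) (simp_all add: P.act_at)
    also have "\<dots> = act k (\<lambda>i. snd (cp_decode n (c i))) (\<lambda>i. y (inv \<sigma> i))" by (rule act_permute[OF tuple[OF c] yi \<sigma>])
    also have "\<dots> = operad_act k c (\<lambda>i\<in>{1..k}. y (inv \<sigma> i))" unfolding operad_act_def by (rule act_cong) simp_all
    finally show ?thesis .
  qed
  show ?thesis unfolding operad_action_def
    by (intro conjI allI ballI impI; (rule cont comp unit perm; assumption))
qed

end

theorem theorem10p6:
  fixes n :: nat and X :: "'a cosimplicial" and B :: "'a brackets"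
  assumes "n \<ge> 1"
    and "augmented_cosimplicial_space X"
    and "brackets_continuous n X B"
    and "brackets_identity n X B"
    and "brackets_consistent n X B"
    and "brackets_commutative n X B"
    and "brackets_associative n X B"
    and "brackets_unital n X B"
  shows "E_space n (Tot X)"
proof -
  obtain \<epsilon> where \<epsilon>: "\<epsilon> \<in> topspace (cos_space X {})"
    "\<forall>k\<ge>2. \<forall>i\<in>{1..k}. \<forall>T f'. admissible n (k - 1) T f' \<longrightarrow>
       (\<forall>x\<in>topspace (fibre_product X (k - 1) T f').
          B k T (compose T (\<lambda>m. if m < i then m else m + 1) f')
            (\<lambda>m\<in>{1..k}. if m < i then x m else if m = i then \<epsilon> else x (m - 1)) =
          B (k - 1) T f' x)"
    using assms(8) unfolding brackets_unital_def by (elim bexE)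
  interpret bracketed n X B \<epsilon>
    by (unfold_locales; (rule assms(2-7) \<epsilon>(1) \<epsilon>(2)[rule_format]; assumption))
  show ?thesis
    unfolding E_space_def using E_operad_cube_progress[OF assms(1)] operad_action_Tot[OF assms(1)] by blast
qed

end
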